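(* Let $H\le\mathrm{GL}(d,\mathbb{R})$ be integrably admissible with essential frequency support $\mathcal{O}\subseteq\widehat{\mathbb{R}}^d$, and let $G=\mathbb{R}^d\rtimes H$. Let $\mathcal{Q}=(h_i^{-T}Q)_{i\in I}$ be any cover of $\mathcal{O}$ induced by $H$ admitting a BAPU $\Phi=(\varphi_i)_{i\in I}$ subordinate to $\mathcal{Q}$. Let $p,q\in[1,\infty]$. Suppose that $\mathbb{R}^d\rtimes H\ni(x,h)\mapsto v(h)\in(0,\infty)$ is an admissible weight, let $u:\mathcal{O}\to(0,\infty)$ be a pull-back of $h\mapsto|\det h|^{\frac12-\frac1q}v(h)$, and denote also by $u=(u_i)_{i\in I}$ a discretization of it. Then $$\|\cdot\|_{\mathrm{Co}(L^{p,q}_v(G))}\asymp\|\cdot\|_{\mathcal{D}(\mathcal{Q},L^p,\ell^q_u)},$$ where elements of the reservoirs $\overline{\mathcal{S}}_{\mathcal{O}}'(\mathbb{R}^d)$ and $Z'(\mathcal{O})$ are identified via the map $\Gamma$, $\Gamma(f)(\phi)=\langle f,\overline\phi\rangle$. In particular, the spaces $\mathrm{Co}(L^{p,q}_v(G))$ and $\mathcal{D}(\mathcal{Q},L^p,\ell^q_u)$ are isomorphic as Banach spaces.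
   Context: Group and representation: for a closed subgroup $H\le\mathrm{GL}(d,\mathbb{R})$ with left Haar measure $\mu_H$ (also written $dh$), $G=\mathbb{R}^d\rtimes H$ has product $(x,h)(y,k)=(x+hy,hk)$. The quasi-regular representation on $L^2(\mathbb{R}^d)$ is $\pi(x,h)f=|\det h|^{-1/2}f(h^{-1}(\cdot-x))$; the left Haar measure of $G$ is $|\det h|^{-1}dx\,dh$. Fourier transform: $\hat f(\xi)=\int f(x)e^{-2\pi i x\cdot\xi}dx$. Write $h^{-T}=(h^{-1})^T$. $H$ is integrably admissible with essential frequency support $\mathcal{O}$ if $\mathcal{O}\subset\widehat{\mathbb{R}}^d\cong\mathbb{R}^d$ is open and: (a) $\mathcal{O}$ is co-null and $H^T$-invariant; (b) for every compact $K\subset\mathcal{O}$ the set $\{(h,\xi)\in H\times\mathcal{O}:(h^T\xi,\xi)\in K\times K\}$ is compact; (c) $\mathcal{O}=H^TC$ for some compact $C\subset\mathcal{O}$. Fix such a $C$. Coorbit space. A vector $\psi\in L^2(\mathbb{R}^d)$ is admissible if $f\mapsto W_\psi f$, $W_\psi f(g)=\langle f,\pi(g)\psi\rangle$, is an isometry $L^2(\mathbb{R}^d)\to L^2(G)$. $\mathcal{S}_{\mathcal{O}}(\mathbb{R}^d):=\mathcal{F}^{-1}(C_c^\infty(\mathcal{O}))$ carries the topology making $\mathcal{F}^{-1}:C_c^\infty(\mathcal{O})\to\mathcal{S}_{\mathcal{O}}(\mathbb{R}^d)$ a homeomorphism; $\overline{\mathcal{S}}_{\mathcal{O}}'(\mathbb{R}^d)$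 is its anti-dual (continuous conjugate-linear functionals), with pairing $\langle f,\phi\rangle=f(\phi)$, and $W_\psi f(g):=\langle f,\pi(g)\psi\rangle$ for $f\in\overline{\mathcal{S}}_{\mathcal{O}}'(\mathbb{R}^d)$, $\psi\in\mathcal{S}_{\mathcal{O}}(\mathbb{R}^d)$. A weight $v:G\to(0,\infty)$ is admissible if it is continuous, satisfies $v(g_1g_2)\le C_vv(g_1)v(g_2)$ for some $C_v>0$ and all $g_1,g_2$, and $v(x,h)\le(1+|x|)^sv_0(h)$ for some $s\ge0$ and a locally bounded $v_0:H\to(0,\infty)$; here $v$ depends only on $h$. $L^{p,q}_v(G)$ has norm $\|F\|_{L^{p,q}_v}=\big(\int_H\|v(\cdot,h)F(\cdot,h)\|_{L^p(\mathbb{R}^d)}^q\frac{dh}{|\det h|}\big)^{1/q}$ for $q<\infty$ and $\operatorname{ess\,sup}_{h}\|v(\cdot,h)F(\cdot,h)\|_{L^p}$ for $q=\infty$. Then $\mathrm{Co}(L^{p,q}_v(G))=\{f\in\overline{\mathcal{S}}_{\mathcal{O}}'(\mathbb{R}^d):W_\psi f\in L^{p,q}_v(G)\}$ with norm $\|W_\psi f\|_{L^{p,q}_v}$, for an admissible $\psi\in\mathcal{S}_{\mathcal{O}}(\mathbb{R}^d)$ (independent of $\psi$ up to equivalent norms). Covers. A countable discrete family $(h_i)_{i\in I}\subseteq H$ is well-spread if $\bigcup_ih_iU=H$ for some relatively compact unit neighborhood $U\subseteq H$ and the sets $h_iV$ are pairwise disjoint for some unit neighborhood $V$. A cover of $\mathcal{O}$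 induced by $H$ is a family $(Q_i)_{i\in I}$, $Q_i=h_i^{-T}Q$, with union $\mathcal{O}$, where $(h_i)$ is well-spread and $Q\subseteq\widehat{\mathbb{R}}^d$ is relatively compact with $\overline Q\subseteq\mathcal{O}$. A BAPU subordinate to $\mathcal{Q}$ is a family $(\varphi_i)_{i\in I}$ in $C_c^\infty(\mathcal{O})$ with $\sum_i\varphi_i=1$ on $\mathcal{O}$, $\varphi_i=0$ on $\mathcal{O}\setminus Q_i$, and $\sup_i\|\mathcal{F}^{-1}\varphi_i\|_{L^1}<\infty$. Weights on $\mathcal{O}$. A function $u:\mathcal{O}\to(0,\infty)$ is a pull-back of $\nu:H\to(0,\infty)$ if for each $\xi\in\mathcal{O}$ there are $h_\xi\in H$ and $\xi_0\in C$ with $\xi=h_\xi^{-T}\xi_0$ and $u(\xi)=\nu(h_\xi)$. A discretization of $u$ is a sequence $u_i=u(x_i)$ with $x_i\in Q_i$. Different choices give equivalent weights; in particular $u_i\asymp|\det h_i|^{\frac12-\frac1q}v(h_i)$. ($1/\infty:=0$.) Decomposition space. $Z(\mathcal{O}):=\mathcal{F}(C_c^\infty(\mathcal{O}))$ with the topology making $\mathcal{F}:C_c^\infty(\mathcal{O})\to Z(\mathcal{O})$ a homeomorphism, $Z'(\mathcal{O})$ its topological dual with bilinear pairing, and $\hat f:=f\circ\mathcal{F}\in\mathcal{D}'(\mathcal{O})$ for $f\in Z'(\mathcal{O})$. $\mathcal{D}(\mathcal{Q},L^p,\ell^q_u)$ is the space of $f\in Z'(\mathcal{O})$ with $\|f\|_{\mathcal{D}(\mathcal{Q},L^p,\ell^q_u)}:=\big\|\big(u_i\|\mathcal{F}^{-1}(\varphi_i\hat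 f)\|_{L^p}\big)_{i\in I}\big\|_{\ell^q}<\infty$. $\Gamma:\overline{\mathcal{S}}_{\mathcal{O}}'(\mathbb{R}^d)\to Z'(\mathcal{O})$, $\Gamma(f)(\phi)=\langle f,\overline\phi\rangle$, is a linear homeomorphism. $f\asymp g$ denotes two-sided estimates with positive constants independent of the element. *)

theory Defs
  imports "HOL-Analysis.Analysis" "HOL-Probability.Essential_Supremum"
begin

section \<open>Lebesgue norms with exponents in \<open>[1,\<infinity>]\<close>\<close>

definition ennreal_powr :: "ennreal \<Rightarrow> real \<Rightarrow> ennreal" where
  "ennreal_powr x a = (if x = \<infinity> then \<infinity> else ennreal (enn2real x powr a))"

definition Lp_norm :: "'a measure \<Rightarrow> ennreal \<Rightarrow> ('a \<Rightarrow> ennreal) \<Rightarrow> ennreal" where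
  "Lp_norm M p g =
     (if p = \<infinity> then esssup M g
      else ennreal_powr (\<integral>\<^sup>+x. ennreal_powr (g x) (enn2real p) \<partial>M) (1 / enn2real p))"

definition Lp_space :: "'a measure \<Rightarrow> ennreal \<Rightarrow> ('a \<Rightarrow> complex) set" where
  "Lp_space M p =
     {f \<in> borel_measurable M. Lp_norm M p (\<lambda>x. ennreal (cmod (f x))) < \<infinity>}"

section \<open>Fourier transform, test functions and Schwartz functions\<close>

definition fourier :: "(real^'d \<Rightarrow> complex) \<Rightarrow> real^'d \<Rightarrow> complex" where
  "fourier f \<xi> = (LINT x|lborel. f x * exp (- 2 * of_real pi * \<i> * of_real (x \<bullet> \<xi>)))"

definition inv_fourier :: "(real^'d \<Rightarrow> complex) \<Rightarrow> real^'d \<Rightarrow> complex" where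
  "inv_fourier g x = (LINT \<xi>|lborel. g \<xi> * exp (2 * of_real pi * \<i> * of_real (x \<bullet> \<xi>)))"

text \<open>Iterated partial derivatives, indexed by the list of coordinate directions.\<close>

fun partials :: "'d list \<Rightarrow> (real^'d \<Rightarrow> complex) \<Rightarrow> real^'d \<Rightarrow> complex" where
  "partials [] f = f"
| "partials (j # js) f = (\<lambda>x. frechet_derivative (partials js f) (at x) (axis j 1))"

definition smooth_fun :: "(real^'d \<Rightarrow> complex) \<Rightarrow> bool" where
  "smooth_fun f \<longleftrightarrow> (\<forall>js. partials js f differentiable_on UNIV)"

definition fun_supp :: "(real^'d \<Rightarrow> complex) \<Rightarrow> (real^'d) set" where
  "fun_supp f = closure {x. f x \<noteq> 0}"

text \<open>\<open>C\<^sub>c\<^sup>\<infinity>(\<Omega>)\<close>; its elements are extended by zero to the whole space.\<close>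

definition test_funs :: "(real^'d) set \<Rightarrow> (real^'d \<Rightarrow> complex) set" where
  "test_funs \<Omega> = {f. smooth_fun f \<and> compact (fun_supp f) \<and> fun_supp f \<subseteq> \<Omega>}"

definition schwartz_funs :: "(real^'d \<Rightarrow> complex) set" where
  "schwartz_funs = {f. smooth_fun f \<and>
     (\<forall>js (n::nat). bounded (range (\<lambda>x. of_real ((1 + norm x) ^ n) * partials js f x)))}"

text \<open>
  The usual locally convex inductive limit topology on \<open>C\<^sub>c\<^sup>\<infinity>(\<Omega>)\<close>: a basis of neighbourhoods
  of zero is given by the absolutely convex sets whose intersection with each Frechet space
  of test functions supported in a fixed compact set is a neighbourhood of zero there.
\<close>

definition test_nbhd0 :: "(real^'d) set \<Rightarrow> (real^'d \<Rightarrow> complex) set \<Rightarrow> bool" where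
  "test_nbhd0 \<Omega> V \<longleftrightarrow> V \<subseteq> test_funs \<Omega> \<and>
     (\<forall>f\<in>V. \<forall>g\<in>V. \<forall>a b. cmod a + cmod b \<le> 1 \<longrightarrow> (\<lambda>x. a * f x + b * g x) \<in> V) \<and>
     (\<forall>K. compact K \<and> K \<subseteq> \<Omega> \<longrightarrow>
       (\<exists>n::nat. \<exists>\<epsilon>>0. {f \<in> test_funs \<Omega>. fun_supp f \<subseteq> K \<and>
          (\<forall>js. length js \<le> n \<longrightarrow> (\<forall>x. cmod (partials js f x) < \<epsilon>))} \<subseteq> V))"

definition test_topology :: "(real^'d) set \<Rightarrow> (real^'d \<Rightarrow> complex) topology" where
  "test_topology \<Omega> = topology (\<lambda>U. U \<subseteq> test_funs \<Omega> \<and>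
     (\<forall>f\<in>U. \<exists>V. test_nbhd0 \<Omega> V \<and> (\<lambda>g x. f x + g x) ` V \<subseteq> U))"

lemma partials_linear:
  assumes "smooth_fun f" "smooth_fun g"
  shows "partials js (\<lambda>x. a * f x + b * g x) = (\<lambda>x. a * partials js f x + b * partials js g x)"
proof (induction js)
  case Nil
  show ?case by simp
next
  case (Cons j js)
  show ?case
  proof
    fix x
    have 1: "(partials js f has_derivative frechet_derivative (partials js f) (at x)) (at x)"
      and 2: "(partials js g has_derivative frechet_derivative (partials js g) (at x)) (at x)"
      using assms unfolding smooth_fun_def differentiable_on_def
      by (auto simp: frechet_derivative_works[symmetric])
    have "((\<lambda>x. a * partials js f x + b * partials js g x) has_derivative
        (\<lambda>t. a * frechet_derivative (partials js f) (at x) t +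
             b * frechet_derivative (partials js g) (at x) t)) (at x)"
      by (intro has_derivative_add has_derivative_mult_right 1 2)
    from frechet_derivative_at[OF this]
    show "partials (j # js) (\<lambda>x. a * f x + b * g x) x =
        a * partials (j # js) f x + b * partials (j # js) g x"
      by (simp add: Cons.IH fun_eq_iff)
  qed
qed

lemma test_funs_linear:
  assumes f: "f \<in> test_funs \<Omega>" and g: "g \<in> test_funs \<Omega>"
  shows "(\<lambda>x. a * f x + b * g x) \<in> test_funs \<Omega>"
proof -
  have sm: "smooth_fun f" "smooth_fun g"
    using f g by (simp_all add: test_funs_def)
  have "partials js (\<lambda>x. a * f x + b * g x) differentiable_on UNIV" for js
    unfolding partials_linear[OF sm]
    using sm unfolding smooth_fun_def differentiable_on_def
    by (auto intro!: differentiable_add differentiable_mult)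
  then have 1: "smooth_fun (\<lambda>x. a * f x + b * g x)"
    by (simp add: smooth_fun_def)
  have "{x. a * f x + b * g x \<noteq> 0} \<subseteq> {x. f x \<noteq> 0} \<union> {x. g x \<noteq> 0}"
    by auto
  then have 2: "fun_supp (\<lambda>x. a * f x + b * g x) \<subseteq> fun_supp f \<union> fun_supp g"
    unfolding fun_supp_def closure_Un[symmetric] by (rule closure_mono)
  have 3: "compact (fun_supp f \<union> fun_supp g)" "fun_supp f \<union> fun_supp g \<subseteq> \<Omega>"
    using f g by (auto simp: test_funs_def intro: compact_Un)
  have "compact ((fun_supp f \<union> fun_supp g) \<inter> fun_supp (\<lambda>x. a * f x + b * g x))"
    using 3(1) by (rule compact_Int_closed) (simp add: fun_supp_def)
  then have "compact (fun_supp (\<lambda>x. a * f x + b * g x))"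
    using 2 by (simp add: Int_absorb1)
  moreover have "fun_supp (\<lambda>x. a * f x + b * g x) \<subseteq> \<Omega>"
    using 2 3(2) by (rule subset_trans)
  ultimately show ?thesis
    using 1 by (simp add: test_funs_def)
qed

lemma test_nbhd0_test_funs: "test_nbhd0 \<Omega> (test_funs \<Omega>)"
  unfolding test_nbhd0_def
proof (intro conjI allI impI ballI)
  fix K assume "compact K \<and> K \<subseteq> \<Omega>"
  show "\<exists>n. \<exists>\<epsilon>>0. {f \<in> test_funs \<Omega>. fun_supp f \<subseteq> K \<and>
          (\<forall>js. length js \<le> n \<longrightarrow> (\<forall>x. cmod (partials js f x) < \<epsilon>))} \<subseteq> test_funs \<Omega>"
    by (rule exI[of _ 0], rule exI[of _ 1]) simp
qed (simp_all add: test_funs_linear)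

lemma test_nbhd0_Int:
  assumes "test_nbhd0 \<Omega> V" "test_nbhd0 \<Omega> W"
  shows "test_nbhd0 \<Omega> (V \<inter> W)"
  unfolding test_nbhd0_def
proof (intro conjI allI impI ballI)
  show "V \<inter> W \<subseteq> test_funs \<Omega>"
    using assms(1) unfolding test_nbhd0_def by blast
next
  fix f g a b
  assume *: "f \<in> V \<inter> W" "g \<in> V \<inter> W" "cmod a + cmod b \<le> 1"
  have "(\<lambda>x. a * f x + b * g x) \<in> V"
    using assms(1) * unfolding test_nbhd0_def by (elim conjE) simp
  moreover have "(\<lambda>x. a * f x + b * g x) \<in> W"
    using assms(2) * unfolding test_nbhd0_def by (elim conjE) simp
  ultimately show "(\<lambda>x. a * f x + b * g x) \<in> V \<inter> W" by simp
next
  fix K assume K: "compact K \<and> K \<subseteq> \<Omega>"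
  let ?B = "\<lambda>n \<epsilon>. {f \<in> test_funs \<Omega>. fun_supp f \<subseteq> K \<and>
          (\<forall>js. length js \<le> n \<longrightarrow> (\<forall>x. cmod (partials js f x) < \<epsilon>))}"
  have "\<exists>n. \<exists>\<epsilon>>0. ?B n \<epsilon> \<subseteq> V" "\<exists>n. \<exists>\<epsilon>>0. ?B n \<epsilon> \<subseteq> W"
    using assms K unfolding test_nbhd0_def by (elim conjE, simp)+
  then obtain n \<epsilon> m \<delta> where 1: "\<epsilon> > 0" "?B n \<epsilon> \<subseteq> V" and 2: "\<delta> > 0" "?B m \<delta> \<subseteq> W"
    by (elim exE conjE) (rule that)
  have "?B (max n m) (min \<epsilon> \<delta>) \<subseteq> ?B n \<epsilon>" "?B (max n m) (min \<epsilon> \<delta>) \<subseteq> ?B m \<delta>"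
    by auto
  then have "?B (max n m) (min \<epsilon> \<delta>) \<subseteq> V \<inter> W"
    using 1(2) 2(2) by (meson Int_greatest subset_trans)
  moreover have "min \<epsilon> \<delta> > 0" using 1 2 by simp
  ultimately show "\<exists>n. \<exists>\<epsilon>>0. ?B n \<epsilon> \<subseteq> V \<inter> W" by (intro exI conjI)
qed

lemma openin_test_topology:
  "openin (test_topology \<Omega>) U \<longleftrightarrow> U \<subseteq> test_funs \<Omega> \<and>
     (\<forall>f\<in>U. \<exists>V. test_nbhd0 \<Omega> V \<and> (\<lambda>g x. f x + g x) ` V \<subseteq> U)"
proof -
  have "istopology (\<lambda>U. U \<subseteq> test_funs \<Omega> \<and>
     (\<forall>f\<in>U. \<exists>V. test_nbhd0 \<Omega> V \<and> (\<lambda>g x. f x + g x) ` V \<subseteq> U))" (is "istopology ?P")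
    unfolding istopology_def
  proof (intro conjI allI impI)
    fix S T assume S: "?P S" and T: "?P T"
    show "S \<inter> T \<subseteq> test_funs \<Omega>" using S by blast
    show "\<forall>f\<in>S \<inter> T. \<exists>V. test_nbhd0 \<Omega> V \<and> (\<lambda>g x. f x + g x) ` V \<subseteq> S \<inter> T"
    proof
      fix f assume "f \<in> S \<inter> T"
      then obtain V W where "test_nbhd0 \<Omega> V" "(\<lambda>g x. f x + g x) ` V \<subseteq> S"
        "test_nbhd0 \<Omega> W" "(\<lambda>g x. f x + g x) ` W \<subseteq> T"
        using S T by blast
      then show "\<exists>V. test_nbhd0 \<Omega> V \<and> (\<lambda>g x. f x + g x) ` V \<subseteq> S \<inter> T"
        by (intro exI[of _ "V \<inter> W"]) (auto intro: test_nbhd0_Int)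
    qed
  next
    fix \<K> assume *: "\<forall>U\<in>\<K>. ?P U"
    then show "\<Union>\<K> \<subseteq> test_funs \<Omega>" by blast
    show "\<forall>f\<in>\<Union>\<K>. \<exists>V. test_nbhd0 \<Omega> V \<and> (\<lambda>g x. f x + g x) ` V \<subseteq> \<Union>\<K>"
      using * by (meson UnionE Union_upper subset_trans)
  qed
  then show ?thesis
    unfolding test_topology_def by (simp add: topology_inverse')
qed

lemma topspace_test_topology: "topspace (test_topology \<Omega>) = test_funs \<Omega>"
proof -
  have "(\<lambda>g x. f x + g x) ` test_funs \<Omega> \<subseteq> test_funs \<Omega>" if "f \<in> test_funs \<Omega>" for f
    using test_funs_linear[OF that, of _ 1 1] by auto
  then have "openin (test_topology \<Omega>) (test_funs \<Omega>)"
    unfolding openin_test_topology using test_nbhd0_test_funs by blast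
  moreover have "topspace (test_topology \<Omega>) \<subseteq> test_funs \<Omega>"
    using openin_topspace[of "test_topology \<Omega>"] unfolding openin_test_topology by blast
  ultimately show ?thesis
    using openin_subset by blast
qed

text \<open>
  The final topology on \<open>f ` topspace X\<close>; for injective \<open>f\<close> it is the topology
  that makes \<open>f\<close> a homeomorphism.
\<close>

definition transport_topology :: "('a \<Rightarrow> 'b) \<Rightarrow> 'a topology \<Rightarrow> 'b topology" where
  "transport_topology f X =
     topology (\<lambda>U. U \<subseteq> f ` topspace X \<and> openin X {x \<in> topspace X. f x \<in> U})"

lemma openin_transport_topology:
  "openin (transport_topology f X) U \<longleftrightarrow>
     U \<subseteq> f ` topspace X \<and> openin X {x \<in> topspace X. f x \<in> U}"
proof -
  have "istopology (\<lambda>U. U \<subseteq> f ` topspace X \<and> openin X {x \<in> topspace X. f x \<in> U})"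
    unfolding istopology_def
  proof (intro conjI allI impI)
    fix S T
    assume "S \<subseteq> f ` topspace X \<and> openin X {x \<in> topspace X. f x \<in> S}"
      and "T \<subseteq> f ` topspace X \<and> openin X {x \<in> topspace X. f x \<in> T}"
    moreover have "{x \<in> topspace X. f x \<in> S \<inter> T} =
        {x \<in> topspace X. f x \<in> S} \<inter> {x \<in> topspace X. f x \<in> T}" by auto
    ultimately show "S \<inter> T \<subseteq> f ` topspace X" "openin X {x \<in> topspace X. f x \<in> S \<inter> T}"
      by auto
  next
    fix \<K> assume *: "\<forall>U\<in>\<K>. U \<subseteq> f ` topspace X \<and> openin X {x \<in> topspace X. f x \<in> U}"
    then show "\<Union>\<K> \<subseteq> f ` topspace X" by blast
    have "{x \<in> topspace X. f x \<in> \<Union>\<K>} = (\<Union>U\<in>\<K>. {x \<in> topspace X. f x \<in> U})" by auto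
    then show "openin X {x \<in> topspace X. f x \<in> \<Union>\<K>}" using * by auto
  qed
  then show ?thesis
    unfolding transport_topology_def by (simp add: topology_inverse')
qed

lemma topspace_transport_topology: "topspace (transport_topology f X) = f ` topspace X"
proof
  show "topspace (transport_topology f X) \<subseteq> f ` topspace X"
    using openin_topspace[of "transport_topology f X"] unfolding openin_transport_topology by simp
  have "{x \<in> topspace X. f x \<in> f ` topspace X} = topspace X" by auto
  then have "openin (transport_topology f X) (f ` topspace X)"
    unfolding openin_transport_topology by simp
  then show "f ` topspace X \<subseteq> topspace (transport_topology f X)"
    by (rule openin_subset)
qed

lemma homeomorphic_map_transport_topology:
  assumes inj: "inj_on f (topspace X)"
  shows "homeomorphic_map X (transport_topology f X) f"
proof (rule bijective_open_imp_homeomorphic_map)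
  show "continuous_map X (transport_topology f X) f"
    by (auto simp: continuous_map_def topspace_transport_topology openin_transport_topology)
  show "open_map X (transport_topology f X) f"
    unfolding open_map_def openin_transport_topology
  proof (intro allI impI conjI)
    fix U assume U: "openin X U"
    have "U \<subseteq> topspace X" using U by (rule openin_subset)
    then have "{x \<in> topspace X. f x \<in> f ` U} = U"
      using inj by (auto dest: inj_onD)
    then show "openin X {x \<in> topspace X. f x \<in> f ` U}" using U by simp
    show "f ` U \<subseteq> f ` topspace X" using \<open>U \<subseteq> topspace X\<close> by blast
  qed
  show "f ` topspace X = topspace (transport_topology f X)"
    by (simp add: topspace_transport_topology)
qed (fact inj)

section \<open>The reservoirs\<close>

text \<open>
  Functionals are total functions in HOL; they are normalised to vanish outside of the space
  on which they are defined, so that equality and the vector space operations are pointwise.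
\<close>

definition S_space :: "(real^'d) set \<Rightarrow> (real^'d \<Rightarrow> complex) set" where
  "S_space \<Omega> = inv_fourier ` test_funs \<Omega>"

definition S_topology :: "(real^'d) set \<Rightarrow> (real^'d \<Rightarrow> complex) topology" where
  "S_topology \<Omega> = transport_topology inv_fourier (test_topology \<Omega>)"

definition S_antidual :: "(real^'d) set \<Rightarrow> ((real^'d \<Rightarrow> complex) \<Rightarrow> complex) set" where
  "S_antidual \<Omega> = {f. continuous_map (S_topology \<Omega>) euclidean f \<and>
     (\<forall>\<phi>\<in>S_space \<Omega>. \<forall>\<theta>\<in>S_space \<Omega>. \<forall>a b.
        f (\<lambda>x. a * \<phi> x + b * \<theta> x) = cnj a * f \<phi> + cnj b * f \<theta>) \<and>
     (\<forall>\<phi>. \<phi> \<notin> S_space \<Omega> \<longrightarrow> f \<phi> = 0)}"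

definition Z_space :: "(real^'d) set \<Rightarrow> (real^'d \<Rightarrow> complex) set" where
  "Z_space \<Omega> = fourier ` test_funs \<Omega>"

definition Z_topology :: "(real^'d) set \<Rightarrow> (real^'d \<Rightarrow> complex) topology" where
  "Z_topology \<Omega> = transport_topology fourier (test_topology \<Omega>)"

definition Z_dual :: "(real^'d) set \<Rightarrow> ((real^'d \<Rightarrow> complex) \<Rightarrow> complex) set" where
  "Z_dual \<Omega> = {f. continuous_map (Z_topology \<Omega>) euclidean f \<and>
     (\<forall>\<phi>\<in>Z_space \<Omega>. \<forall>\<theta>\<in>Z_space \<Omega>. \<forall>a b.
        f (\<lambda>x. a * \<phi> x + b * \<theta> x) = a * f \<phi> + b * f \<theta>) \<and>
     (\<forall>\<phi>. \<phi> \<notin> Z_space \<Omega> \<longrightarrow> f \<phi> = 0)}"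

definition Gamma_map ::
  "(real^'d) set \<Rightarrow> ((real^'d \<Rightarrow> complex) \<Rightarrow> complex) \<Rightarrow> (real^'d \<Rightarrow> complex) \<Rightarrow> complex" where
  "Gamma_map \<Omega> f \<phi> = (if \<phi> \<in> Z_space \<Omega> then f (\<lambda>x. cnj (\<phi> x)) else 0)"

section \<open>The group, its Haar measure and the quasi-regular representation\<close>

definition closed_subgroup_GL :: "(real^'d^'d) set \<Rightarrow> bool" where
  "closed_subgroup_GL H \<longleftrightarrow>
     closedin (top_of_set {A. invertible A}) H \<and> mat 1 \<in> H \<and>
     (\<forall>h\<in>H. \<forall>k\<in>H. h ** k \<in> H) \<and> (\<forall>h\<in>H. matrix_inv h \<in> H)"

text \<open>Regularity is automatic, since \<open>H\<close> is locally compact and second countable.\<close>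

definition left_haar_measure :: "(real^'d^'d) set \<Rightarrow> (real^'d^'d) measure \<Rightarrow> bool" where
  "left_haar_measure H \<mu> \<longleftrightarrow>
     sets \<mu> = sets (restrict_space borel H) \<and>
     (\<forall>h\<in>H. \<forall>A\<in>sets \<mu>. emeasure \<mu> ((\<lambda>k. h ** k) ` A) = emeasure \<mu> A) \<and>
     (\<forall>K. compact K \<and> K \<subseteq> H \<longrightarrow> emeasure \<mu> K < \<infinity>) \<and>
     (\<forall>U. openin (top_of_set H) U \<and> U \<noteq> {} \<longrightarrow> 0 < emeasure \<mu> U)"

definition semidirect_mult ::
  "(real^'d) \<times> (real^'d^'d) \<Rightarrow> (real^'d) \<times> (real^'d^'d) \<Rightarrow> (real^'d) \<times> (real^'d^'d)" where
  "semidirect_mult = (\<lambda>(x, h) (y, k). (x + h *v y, h ** k))"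

definition haar_G :: "(real^'d^'d) measure \<Rightarrow> ((real^'d) \<times> (real^'d^'d)) measure" where
  "haar_G \<mu> = density (lborel \<Otimes>\<^sub>M \<mu>) (\<lambda>(x, h). ennreal (1 / \<bar>det h\<bar>))"

definition quasi_regular ::
  "(real^'d) \<times> (real^'d^'d) \<Rightarrow> (real^'d \<Rightarrow> complex) \<Rightarrow> real^'d \<Rightarrow> complex" where
  "quasi_regular = (\<lambda>(x, h) f y.
     of_real (\<bar>det h\<bar> powr (- 1 / 2)) * f (matrix_inv h *v (y - x)))"

definition wavelet_L2 ::
  "(real^'d \<Rightarrow> complex) \<Rightarrow> (real^'d \<Rightarrow> complex) \<Rightarrow> (real^'d) \<times> (real^'d^'d) \<Rightarrow> complex" where
  "wavelet_L2 \<psi> f g = (LINT y|lborel. f y * cnj (quasi_regular g \<psi> y))"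

definition admissible_vector :: "(real^'d^'d) measure \<Rightarrow> (real^'d \<Rightarrow> complex) \<Rightarrow> bool" where
  "admissible_vector \<mu> \<psi> \<longleftrightarrow> \<psi> \<in> Lp_space lborel 2 \<and>
     (\<forall>f\<in>Lp_space lborel 2. wavelet_L2 \<psi> f \<in> Lp_space (haar_G \<mu>) 2 \<and>
        Lp_norm (haar_G \<mu>) 2 (\<lambda>g. ennreal (cmod (wavelet_L2 \<psi> f g))) =
        Lp_norm lborel 2 (\<lambda>x. ennreal (cmod (f x))))"

text \<open>\<open>\<Omega> = H\<^sup>T C\<close> with \<open>C \<subseteq> \<Omega>\<close> compact.\<close>

definition compact_generator ::
  "(real^'d^'d) set \<Rightarrow> (real^'d) set \<Rightarrow> (real^'d) set \<Rightarrow> bool" where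
  "compact_generator H \<Omega> C \<longleftrightarrow> compact C \<and> C \<subseteq> \<Omega> \<and>
     \<Omega> = {transpose h *v \<xi> | h \<xi>. h \<in> H \<and> \<xi> \<in> C}"

definition integrably_admissible :: "(real^'d^'d) set \<Rightarrow> (real^'d) set \<Rightarrow> bool" where
  "integrably_admissible H \<Omega> \<longleftrightarrow> open \<Omega> \<and>
     - \<Omega> \<in> null_sets lborel \<and>
     (\<forall>h\<in>H. \<forall>\<xi>\<in>\<Omega>. transpose h *v \<xi> \<in> \<Omega>) \<and>
     (\<forall>K. compact K \<and> K \<subseteq> \<Omega> \<longrightarrow>
        compact {(h, \<xi>). h \<in> H \<and> \<xi> \<in> \<Omega> \<and> (transpose h *v \<xi>, \<xi>) \<in> K \<times> K}) \<and>
     (\<exists>C. compact_generator H \<Omega> C)"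

section \<open>Weights and coorbit spaces\<close>

definition admissible_weight ::
  "(real^'d^'d) set \<Rightarrow> ((real^'d) \<times> (real^'d^'d) \<Rightarrow> real) \<Rightarrow> bool" where
  "admissible_weight H v \<longleftrightarrow>
     (\<forall>g\<in>UNIV \<times> H. 0 < v g) \<and>
     continuous_on (UNIV \<times> H) v \<and>
     (\<exists>c>0. \<forall>g\<in>UNIV \<times> H. \<forall>g'\<in>UNIV \<times> H. v (semidirect_mult g g') \<le> c * v g * v g') \<and>
     (\<exists>s\<ge>0. \<exists>v\<^sub>0. (\<forall>h\<in>H. 0 < v\<^sub>0 h) \<and>
        (\<forall>h\<in>H. \<exists>U. openin (top_of_set H) U \<and> h \<in> U \<and> bounded (v\<^sub>0 ` U)) \<and>
        (\<forall>x. \<forall>h\<in>H. v (x, h) \<le> (1 + norm x) powr s * v\<^sub>0 h))"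

text \<open>
  For \<open>q = \<infinity>\<close> the outer norm is the essential supremum with respect to \<open>dh\<close>, which has the same
  null sets as \<open>dh / \<bar>det h\<bar>\<close>.
\<close>

definition Lpq_norm ::
  "(real^'d^'d) measure \<Rightarrow> ennreal \<Rightarrow> ennreal \<Rightarrow> ((real^'d) \<times> (real^'d^'d) \<Rightarrow> real) \<Rightarrow>
   ((real^'d) \<times> (real^'d^'d) \<Rightarrow> complex) \<Rightarrow> ennreal" where
  "Lpq_norm \<mu> p q v F =
     Lp_norm (density \<mu> (\<lambda>h. ennreal (1 / \<bar>det h\<bar>))) q
       (\<lambda>h. Lp_norm lborel p (\<lambda>x. ennreal (cmod (of_real (v (x, h)) * F (x, h)))))"

definition wavelet ::
  "(real^'d \<Rightarrow> complex) \<Rightarrow> ((real^'d \<Rightarrow> complex) \<Rightarrow> complex) \<Rightarrow>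
   (real^'d) \<times> (real^'d^'d) \<Rightarrow> complex" where
  "wavelet \<psi> f g = f (quasi_regular g \<psi>)"

definition Co_norm ::
  "(real^'d^'d) measure \<Rightarrow> (real^'d \<Rightarrow> complex) \<Rightarrow> ennreal \<Rightarrow> ennreal \<Rightarrow>
   ((real^'d) \<times> (real^'d^'d) \<Rightarrow> real) \<Rightarrow> ((real^'d \<Rightarrow> complex) \<Rightarrow> complex) \<Rightarrow> ennreal" where
  "Co_norm \<mu> \<psi> p q v f = Lpq_norm \<mu> p q v (wavelet \<psi> f)"

definition Co_space ::
  "(real^'d) set \<Rightarrow> (real^'d^'d) measure \<Rightarrow> (real^'d \<Rightarrow> complex) \<Rightarrow> ennreal \<Rightarrow> ennreal \<Rightarrow>
   ((real^'d) \<times> (real^'d^'d) \<Rightarrow> real) \<Rightarrow> ((real^'d \<Rightarrow> complex) \<Rightarrow> complex) set" where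
  "Co_space \<Omega> \<mu> \<psi> p q v =
     {f \<in> S_antidual \<Omega>. wavelet \<psi> f \<in> borel_measurable (lborel \<Otimes>\<^sub>M \<mu>) \<and>
        Co_norm \<mu> \<psi> p q v f < \<infinity>}"

section \<open>Induced covers, partitions of unity and weights on the frequency domain\<close>

definition unit_nbhd :: "(real^'d^'d) set \<Rightarrow> (real^'d^'d) set \<Rightarrow> bool" where
  "unit_nbhd H U \<longleftrightarrow> U \<subseteq> H \<and> (\<exists>W. openin (top_of_set H) W \<and> mat 1 \<in> W \<and> W \<subseteq> U)"

definition well_spread ::
  "(real^'d^'d) set \<Rightarrow> 'i set \<Rightarrow> ('i \<Rightarrow> real^'d^'d) \<Rightarrow> bool" where
  "well_spread H I h \<longleftrightarrow> countable I \<and> h ` I \<subseteq> H \<and> discrete (h ` I) \<and>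
     (\<exists>U. unit_nbhd H U \<and> compactin (top_of_set H) (top_of_set H closure_of U) \<and>
        (\<Union>i\<in>I. (\<lambda>k. h i ** k) ` U) = H) \<and>
     (\<exists>V. unit_nbhd H V \<and> disjoint_family_on (\<lambda>i. (\<lambda>k. h i ** k) ` V) I)"

definition cover_set :: "('i \<Rightarrow> real^'d^'d) \<Rightarrow> (real^'d) set \<Rightarrow> 'i \<Rightarrow> (real^'d) set" where
  "cover_set h Q i = (\<lambda>\<xi>. transpose (matrix_inv (h i)) *v \<xi>) ` Q"

definition induced_cover ::
  "(real^'d^'d) set \<Rightarrow> (real^'d) set \<Rightarrow> 'i set \<Rightarrow> ('i \<Rightarrow> real^'d^'d) \<Rightarrow> (real^'d) set \<Rightarrow> bool" where
  "induced_cover H \<Omega> I h Q \<longleftrightarrow> well_spread H I h \<and>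
     compact (closure Q) \<and> closure Q \<subseteq> \<Omega> \<and> (\<Union>i\<in>I. cover_set h Q i) = \<Omega>"

definition BAPU ::
  "(real^'d) set \<Rightarrow> 'i set \<Rightarrow> ('i \<Rightarrow> (real^'d) set) \<Rightarrow> ('i \<Rightarrow> real^'d \<Rightarrow> complex) \<Rightarrow> bool" where
  "BAPU \<Omega> I Qs \<phi> \<longleftrightarrow>
     (\<forall>i\<in>I. \<phi> i \<in> test_funs \<Omega>) \<and>
     (\<forall>\<xi>\<in>\<Omega>. ((\<lambda>i. \<phi> i \<xi>) has_sum 1) I) \<and>
     (\<forall>i\<in>I. \<forall>\<xi>\<in>\<Omega> - Qs i. \<phi> i \<xi> = 0) \<and>
     (SUP i\<in>I. Lp_norm lborel 1 (\<lambda>x. ennreal (cmod (inv_fourier (\<phi> i) x)))) < \<infinity>"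

definition pull_back ::
  "(real^'d^'d) set \<Rightarrow> (real^'d) set \<Rightarrow> (real^'d) set \<Rightarrow> (real^'d^'d \<Rightarrow> real) \<Rightarrow>
   (real^'d \<Rightarrow> real) \<Rightarrow> bool" where
  "pull_back H \<Omega> C \<nu> u \<longleftrightarrow> (\<forall>\<xi>\<in>\<Omega>. 0 < u \<xi>) \<and>
     (\<forall>\<xi>\<in>\<Omega>. \<exists>h\<in>H. \<exists>\<xi>\<^sub>0\<in>C. \<xi> = transpose (matrix_inv h) *v \<xi>\<^sub>0 \<and> u \<xi> = \<nu> h)"

definition discretization ::
  "'i set \<Rightarrow> ('i \<Rightarrow> (real^'d) set) \<Rightarrow> (real^'d \<Rightarrow> real) \<Rightarrow> ('i \<Rightarrow> real) \<Rightarrow> bool" where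
  "discretization I Qs u w \<longleftrightarrow> (\<forall>i\<in>I. \<exists>x\<in>Qs i. w i = u x)"

section \<open>Decomposition spaces\<close>

definition distr_hat ::
  "((real^'d \<Rightarrow> complex) \<Rightarrow> complex) \<Rightarrow> (real^'d \<Rightarrow> complex) \<Rightarrow> complex" where
  "distr_hat f = (\<lambda>\<theta>. f (fourier \<theta>))"

definition distr_mult ::
  "(real^'d \<Rightarrow> complex) \<Rightarrow> ((real^'d \<Rightarrow> complex) \<Rightarrow> complex) \<Rightarrow> (real^'d \<Rightarrow> complex) \<Rightarrow> complex" where
  "distr_mult \<phi> T = (\<lambda>\<theta>. T (\<lambda>\<xi>. \<phi> \<xi> * \<theta> \<xi>))"

text \<open>
  Inverse Fourier transform of a tempered distribution, by duality. For \<open>\<phi> \<in> C\<^sub>c\<^sup>\<infinity>(\<Omega>)\<close> and a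
  distribution \<open>T\<close> on \<open>\<Omega>\<close>, \<^term>\<open>distr_mult \<phi> T\<close> is defined on all Schwartz functions.
\<close>

definition distr_inv_fourier ::
  "((real^'d \<Rightarrow> complex) \<Rightarrow> complex) \<Rightarrow> (real^'d \<Rightarrow> complex) \<Rightarrow> complex" where
  "distr_inv_fourier T = (\<lambda>\<theta>. T (inv_fourier \<theta>))"

text \<open>
  The \<open>L\<^sup>p\<close> norm of a tempered distribution: the norm of the representing function, which is unique
  up to null sets, and \<open>\<infinity>\<close> (the infimum of the empty set) if there is none.
\<close>

definition distr_Lp_norm ::
  "ennreal \<Rightarrow> ((real^'d \<Rightarrow> complex) \<Rightarrow> complex) \<Rightarrow> ennreal" where
  "distr_Lp_norm p T =
     Inf {Lp_norm lborel p (\<lambda>x. ennreal (cmod (g x))) | g.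
       g \<in> borel_measurable lborel \<and>
       (\<forall>\<theta>\<in>schwartz_funs. integrable lborel (\<lambda>x. g x * \<theta> x) \<and>
          T \<theta> = (LINT x|lborel. g x * \<theta> x))}"

definition dec_norm ::
  "'i set \<Rightarrow> ('i \<Rightarrow> real^'d \<Rightarrow> complex) \<Rightarrow> ennreal \<Rightarrow> ennreal \<Rightarrow> ('i \<Rightarrow> real) \<Rightarrow>
   ((real^'d \<Rightarrow> complex) \<Rightarrow> complex) \<Rightarrow> ennreal" where
  "dec_norm I \<phi> p q w f =
     Lp_norm (count_space I) q (\<lambda>i. ennreal (w i) *
       distr_Lp_norm p (distr_inv_fourier (distr_mult (\<phi> i) (distr_hat f))))"

definition dec_space ::
  "(real^'d) set \<Rightarrow> 'i set \<Rightarrow> ('i \<Rightarrow> real^'d \<Rightarrow> complex) \<Rightarrow> ennreal \<Rightarrow> ennreal \<Rightarrow> ('i \<Rightarrow> real) \<Rightarrow>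
   ((real^'d \<Rightarrow> complex) \<Rightarrow> complex) set" where
  "dec_space \<Omega> I \<phi> p q w = {f \<in> Z_dual \<Omega>. dec_norm I \<phi> p q w f < \<infinity>}"

section \<open>Banach spaces of functionals\<close>

definition complex_banach :: "('a \<Rightarrow> complex) set \<Rightarrow> (('a \<Rightarrow> complex) \<Rightarrow> ennreal) \<Rightarrow> bool" where
  "complex_banach V N \<longleftrightarrow>
     (\<lambda>_. 0) \<in> V \<and>
     (\<forall>f\<in>V. \<forall>g\<in>V. \<forall>a b. (\<lambda>t. a * f t + b * g t) \<in> V) \<and>
     (\<forall>f\<in>V. N f < \<infinity>) \<and>
     (\<forall>f\<in>V. N f = 0 \<longleftrightarrow> f = (\<lambda>_. 0)) \<and>
     (\<forall>f\<in>V. \<forall>a. N (\<lambda>t. a * f t) = ennreal (cmod a) * N f) \<and>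
     (\<forall>f\<in>V. \<forall>g\<in>V. N (\<lambda>t. f t + g t) \<le> N f + N g) \<and>
     Metric_space.mcomplete V (\<lambda>f g. enn2real (N (\<lambda>t. f t - g t)))"

definition banach_isomorphism ::
  "(('a \<Rightarrow> complex) \<Rightarrow> 'b \<Rightarrow> complex) \<Rightarrow>
   ('a \<Rightarrow> complex) set \<Rightarrow> (('a \<Rightarrow> complex) \<Rightarrow> ennreal) \<Rightarrow>
   ('b \<Rightarrow> complex) set \<Rightarrow> (('b \<Rightarrow> complex) \<Rightarrow> ennreal) \<Rightarrow> bool" where
  "banach_isomorphism T V N W M \<longleftrightarrow>
     complex_banach V N \<and> complex_banach W M \<and> bij_betw T V W \<and>
     (\<forall>f\<in>V. \<forall>g\<in>V. \<forall>a b.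
        T (\<lambda>t. a * f t + b * g t) = (\<lambda>t. a * T f t + b * T g t)) \<and>
     (\<exists>A>0. \<exists>B>0. \<forall>f\<in>V. ennreal A * N f \<le> M (T f) \<and> M (T f) \<le> ennreal B * N f)"

end

theory Submission
  imports Defs "HOL-Probability.Characteristic_Functions" "HOL-Probability.Sinc_Integral"
begin

text \<open>
  Write \<open>\<Lambda>\<close> for the Fourier transform of \<open>f\<close>, a distribution on \<open>\<Omega>\<close>, and \<open>\<psi>\<close> as the inverse Fourier
  transform of a test function \<open>\<eta>\<close>. Up to the factor \<open>\<bar>det h\<bar>\<^sup>1\<^sup>/\<^sup>2\<close>, the wavelet transform \<open>W f(\<cdot>, h)\<close> is
  the inverse Fourier transform of \<open>\<eta>\<^sub>h \<Lambda>\<close>, where \<open>\<eta>\<^sub>h \<xi>\<close> is the conjugate of \<open>\<eta> (h\<^sup>T \<xi>)\<close>. Properness of the dual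
  action shows that \<open>\<eta>\<^sub>h\<close> meets the support of \<open>\<phi>\<^sub>i\<close> only for \<open>h\<close> in a compact set \<open>E\<^sub>i = h\<^sub>i L\<close>, and that a point lies
  in boundedly many of these sets. On \<open>E\<^sub>i\<close> the weights \<open>v h \<bar>det h\<bar>\<^sup>1\<^sup>/\<^sup>2\<close> and \<open>u\<^sub>i \<bar>det h\<bar>\<^sup>1\<^sup>/\<^sup>q\<close> are comparable. Inserting \<open>1 = \<Sum>\<^sub>i \<phi>\<^sub>i\<close> and using
  Young's inequality bounds \<open>\<parallel>W f(\<cdot>, h)\<parallel>\<^sub>p\<close> by the finitely many pieces with \<open>h \<in> E\<^sub>i\<close>. Conversely, admissibility of
  \<open>\<psi>\<close> is the Calderon condition \<open>\<integral> \<bar>\<eta>\<^sub>h\<bar>\<^sup>2 dh = 1\<close> on \<open>\<Omega>\<close>, which writes \<open>\<phi>\<^sub>i \<Lambda>\<close> as the integral of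
  \<open>\<phi>\<^sub>i \<bar>\<eta>\<^sub>h\<bar>\<^sup>2 \<Lambda>\<close> over \<open>E\<^sub>i\<close>, and Minkowski's inequality bounds the pieces by \<open>\<parallel>W f(\<cdot>, h)\<parallel>\<^sub>p\<close>. Bounded
  overlap and Jensen's inequality transfer both estimates to the outer norms. Completeness follows from
  Fatou's lemma, since the decomposition norm controls \<open>\<Lambda>\<close> as a distribution.
\<close>

text \<open>\<open>\<Lambda>\<close> is only a distribution, so an integral over \<open>h\<close>
  may be taken outside it only after an exchange theorem. For this reason test functions are handled
  in families indexed by p = (x, h), with a common compact support and derivatives of polynomial
  growth in p. Such families depend continuously on p in the topology of test functions, so that
  \<open>\<Lambda>\<close> of a member is measurable in p and \<open>\<Lambda>\<close> commutes with
  integrals of the family. For the same reason the Calderon identity is needed at every point and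
  not just almost everywhere; continuity and Fourier inversion provide this. Constants do not depend
  on \<open>h\<close>, because dilations preserve the L1 norm of the inverse transform of \<eta>.
  Both estimates hold on the whole reservoir, infinite values included, so norms stay in the
  extended nonnegative reals and membership in one space follows from membership in the other.
  Fatou's lemma is applied only to the coorbit norm: the decomposition norm is built from infima
  over representing functions, and its completeness is carried over through \<Gamma>.\<close>

lemma ennreal_powr_ennreal [simp]: "0 \<le> x \<Longrightarrow> ennreal_powr (ennreal x) a = ennreal (x powr a)"
  by (simp add: ennreal_powr_def)

lemma ennreal_powr_top [simp]: "ennreal_powr \<infinity> a = \<infinity>" "ennreal_powr top a = top"
  by (simp_all add: ennreal_powr_def)

lemma ennreal_powr_0 [simp]: "ennreal_powr 0 a = 0"
  by (simp add: ennreal_powr_def)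

lemma ennreal_powr_1 [simp]: "ennreal_powr x 1 = x" "ennreal_powr 1 a = 1"
  by (cases x) (auto simp: ennreal_powr_def)

lemma ennreal_powr_eq_0_iff [simp]: "ennreal_powr x a = 0 \<longleftrightarrow> x = 0"
  by (cases x) auto

lemma ennreal_powr_eq_top_iff [simp]: "ennreal_powr x a = top \<longleftrightarrow> x = top"
  by (cases x) auto

lemma ennreal_powr_mono: "x \<le> y \<Longrightarrow> 0 \<le> a \<Longrightarrow> ennreal_powr x a \<le> ennreal_powr y a"
  by (cases x; cases y) (auto simp: powr_mono2 top_unique ennreal_le_iff)

lemma ennreal_powr_mult: "0 < a \<Longrightarrow> ennreal_powr (x * y) a = ennreal_powr x a * ennreal_powr y a"
  by (cases x; cases y; simp add: powr_mult flip: ennreal_mult)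
     (auto simp: ennreal_top_mult ennreal_mult_top powr_mult ennreal_mult)

lemma ennreal_powr_powr: "ennreal_powr (ennreal_powr x a) b = ennreal_powr x (a * b)"
  by (cases x) (auto simp: powr_powr)

lemma ennreal_powr_measurable [measurable]:
  assumes [measurable]: "f \<in> borel_measurable M"
  shows "(\<lambda>x. ennreal_powr (f x) a) \<in> borel_measurable M"
  unfolding ennreal_powr_def by measurable

text \<open>Convexity of t^p: the graph lies above its tangent at \<tau>, and the tangent inequality
  is solved for t. The contact point \<tau> stays free and is optimised when the inequality is
  integrated.\<close>

lemma powr_tangent_ineq:
  fixes t \<tau> p :: real
  assumes "1 \<le> p" "0 < \<tau>" "0 \<le> t"
  shows "t \<le> t powr p * (\<tau> powr (1 - p) / p) + \<tau> * (1 - 1 / p)"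
proof (cases "t = 0")
  case True
  then show ?thesis using assms by simp
next
  case False
  then have t: "0 < t" using assms by simp
  have "(t powr p * \<tau> powr (1 - p)) powr (1 / p) * \<tau> powr (1 - 1 / p)
      \<le> (1 / p) * (t powr p * \<tau> powr (1 - p)) + (1 - 1 / p) * \<tau>"
    using assms t by (intro Youngs_inequality_0) auto
  moreover have "(t powr p * \<tau> powr (1 - p)) powr (1 / p) * \<tau> powr (1 - 1 / p) = t"
  proof -
    have "(t powr p * \<tau> powr (1 - p)) powr (1 / p) = t * \<tau> powr ((1 - p) / p)"
      using assms t by (simp add: powr_mult powr_powr)
    moreover have "(1 - p) / p + (1 - 1 / p) = 0" using assms by (simp add: field_simps)
    then have "\<tau> powr ((1 - p) / p) * \<tau> powr (1 - 1 / p) = 1"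
      using assms by (simp flip: powr_add)
    ultimately show ?thesis by (simp add: mult.assoc)
  qed
  ultimately show ?thesis by (simp add: field_simps)
qed

text \<open>Jensen's inequality for a finite measure that is not normalised, which explains the
  power of the total mass. It follows by integrating \<open>powr_tangent_ineq\<close> with a
  suitable contact point.\<close>

lemma nn_integral_powr_le:
  assumes [measurable]: "g \<in> borel_measurable M" and p: "1 \<le> p"
    and fin: "emeasure M (space M) < \<infinity>"
  shows "ennreal_powr (\<integral>\<^sup>+x. g x \<partial>M) p
    \<le> ennreal (measure M (space M) powr (p - 1)) * (\<integral>\<^sup>+x. ennreal_powr (g x) p \<partial>M)"
proof -
  define s where "s = measure M (space M)"
  have s: "emeasure M (space M) = ennreal s"
    using fin by (simp add: s_def emeasure_eq_ennreal_measure)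
  define A where "A = (\<integral>\<^sup>+x. ennreal_powr (g x) p \<partial>M)"
  have s0: "0 \<le> s" by (simp add: s_def)
  \<comment> \<open>The contact point has to be positive and finite, so vanishing mass and vanishing
    or infinite right-hand integrals are split off.\<close>
  consider "s = 0" | "s > 0" "A = top" | "A = 0" | a where "s > 0" "A = ennreal a" "0 < a"
  proof (cases A)
    case (real r)
    then show ?thesis using s0 that by (cases "r = 0"; cases "s = 0") force+
  next
    case top
    then show ?thesis using s0 that by (cases "s = 0") force+
  qed
  then have "ennreal_powr (\<integral>\<^sup>+x. g x \<partial>M) p \<le> ennreal (s powr (p - 1)) * A"
  proof cases
    case 1
    then have "space M \<in> null_sets M" using s by (auto intro!: null_setsI)
    then have "AE x in M. g x = 0" by (rule AE_I') auto
    then have "(\<integral>\<^sup>+x. g x \<partial>M) = 0" by (subst nn_integral_0_iff_AE) auto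
    then show ?thesis by simp
  next
    case 2
    then show ?thesis by (simp add: ennreal_mult_top)
  next
    case 3
    then have "AE x in M. ennreal_powr (g x) p = 0"
      unfolding A_def by (subst (asm) nn_integral_0_iff_AE) auto
    then have "AE x in M. g x = 0" by simp
    then have "(\<integral>\<^sup>+x. g x \<partial>M) = 0" by (subst nn_integral_0_iff_AE) auto
    then show ?thesis by simp
  next
    case 4
    \<comment> \<open>The p-mean of \<open>g\<close>. For this contact point the two integrated
      terms add up to exactly \<open>s * \<tau>\<close>, whose p-th power is the claimed
      bound.\<close>
    define \<tau> where "\<tau> = (a / s) powr (1 / p)"
    have \<tau>: "\<tau> > 0" using 4 by (simp add: \<tau>_def)
    have pt: "g x \<le> ennreal_powr (g x) p * ennreal (\<tau> powr (1 - p) / p) + ennreal (\<tau> * (1 - 1 / p))" for x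
    proof (cases "g x")
      case (real r)
      then show ?thesis
        using powr_tangent_ineq[OF p \<tau>, of r] p \<tau>
        by (simp flip: ennreal_mult ennreal_plus)
    next
      case top
      then show ?thesis using p \<tau> by (simp add: ennreal_top_mult)
    qed
    have "(\<integral>\<^sup>+x. g x \<partial>M) \<le> (\<integral>\<^sup>+x. ennreal_powr (g x) p * ennreal (\<tau> powr (1 - p) / p) + ennreal (\<tau> * (1 - 1 / p)) \<partial>M)"
      by (intro nn_integral_mono pt)
    also have "\<dots> = A * ennreal (\<tau> powr (1 - p) / p) + ennreal (\<tau> * (1 - 1 / p)) * ennreal s"
      by (simp add: nn_integral_add nn_integral_multc A_def s)
    also have "\<dots> = ennreal (a * (\<tau> powr (1 - p) / p) + \<tau> * (1 - 1 / p) * s)"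
      using 4 p \<tau> by (simp add: ennreal_plus flip: ennreal_mult)
    also have "a * (\<tau> powr (1 - p) / p) + \<tau> * (1 - 1 / p) * s = s * \<tau>"
    proof -
      have "\<tau> powr p = a / s" using 4 p by (simp add: \<tau>_def powr_powr)
      then have "a * \<tau> powr (1 - p) = s * \<tau>"
        using 4 \<tau> by (simp add: powr_diff field_simps)
      then have "a * (\<tau> powr (1 - p) / p) = s * \<tau> / p" by simp
      then show ?thesis by (simp add: algebra_simps)
    qed
    finally have "ennreal_powr (\<integral>\<^sup>+x. g x \<partial>M) p \<le> ennreal_powr (ennreal (s * \<tau>)) p"
      using p by (intro ennreal_powr_mono) auto
    also have "\<dots> = ennreal (s powr (p - 1) * a)"
      using 4 p \<tau> by (simp add: powr_mult \<tau>_def powr_powr powr_diff field_simps)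
    finally show ?thesis using 4 by (simp add: ennreal_mult)
  qed
  then show ?thesis unfolding A_def s_def .
qed

section \<open>Lebesgue norms: Minkowski, Fatou and duality bounds\<close>

lemma Lp_norm_top: "Lp_norm M \<infinity> g = esssup M g" "Lp_norm M top g = esssup M g"
  by (simp_all add: Lp_norm_def)

lemma Lp_norm_finite: "Lp_norm M (ennreal r) g = ennreal_powr (\<integral>\<^sup>+x. ennreal_powr (g x) r \<partial>M) (1 / r)" if "0 \<le> r"
  using that by (simp add: Lp_norm_def)

lemma exponent_cases:
  assumes "(1::ennreal) \<le> p"
  obtains "p = top" | r where "p = ennreal r" "1 \<le> r"
  using assms by (cases p) (auto simp flip: ennreal_1)

lemma Lp_norm_powr:
  assumes "1 \<le> r"
  shows "ennreal_powr (Lp_norm M (ennreal r) g) r = (\<integral>\<^sup>+x. ennreal_powr (g x) r \<partial>M)"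
  using assms by (simp add: Lp_norm_finite ennreal_powr_powr)

lemma Lp_norm_le_iff:
  assumes "1 \<le> r"
  shows "Lp_norm M (ennreal r) g \<le> c \<longleftrightarrow> (\<integral>\<^sup>+x. ennreal_powr (g x) r \<partial>M) \<le> ennreal_powr c r"
proof
  assume "Lp_norm M (ennreal r) g \<le> c"
  then have "ennreal_powr (Lp_norm M (ennreal r) g) r \<le> ennreal_powr c r"
    using assms by (intro ennreal_powr_mono) auto
  then show "(\<integral>\<^sup>+x. ennreal_powr (g x) r \<partial>M) \<le> ennreal_powr c r" by (simp add: Lp_norm_powr assms)
next
  assume "(\<integral>\<^sup>+x. ennreal_powr (g x) r \<partial>M) \<le> ennreal_powr c r"
  then have "ennreal_powr (\<integral>\<^sup>+x. ennreal_powr (g x) r \<partial>M) (1 / r) \<le> ennreal_powr (ennreal_powr c r) (1 / r)"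
    using assms by (intro ennreal_powr_mono) auto
  then show "Lp_norm M (ennreal r) g \<le> c" using assms by (simp add: Lp_norm_finite ennreal_powr_powr)
qed

lemma Lp_norm_one: "Lp_norm M 1 g = (\<integral>\<^sup>+x. g x \<partial>M)"
  by (simp add: Lp_norm_def)

lemma Lp_norm_mono_AE:
  assumes "1 \<le> p" "g \<in> borel_measurable M" "AE x in M. g x \<le> g' x"
  shows "Lp_norm M p g \<le> Lp_norm M p g'"
  using assms(1)
proof (cases rule: exponent_cases)
  case 1
  then show ?thesis using assms by (simp add: Lp_norm_top esssup_AE_mono)
next
  case (2 r)
  have "(\<integral>\<^sup>+x. ennreal_powr (g x) r \<partial>M) \<le> (\<integral>\<^sup>+x. ennreal_powr (g' x) r \<partial>M)"
    using assms(3) 2 by (intro nn_integral_mono_AE) (auto elim!: eventually_mono intro: ennreal_powr_mono)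
  then show ?thesis using 2 by (simp add: Lp_norm_finite ennreal_powr_mono)
qed

lemma Lp_norm_mono:
  assumes "1 \<le> p" "g \<in> borel_measurable M" "\<And>x. x \<in> space M \<Longrightarrow> g x \<le> g' x"
  shows "Lp_norm M p g \<le> Lp_norm M p g'"
  using assms by (intro Lp_norm_mono_AE) auto

lemma esssup_le_iff:
  fixes g :: "_ \<Rightarrow> ennreal"
  assumes "g \<in> borel_measurable M"
  shows "esssup M g \<le> c \<longleftrightarrow> (AE x in M. g x \<le> c)"
proof
  assume "esssup M g \<le> c"
  then show "AE x in M. g x \<le> c" using esssup_AE[of g M] by (auto elim: eventually_mono)
qed (use assms in \<open>rule esssup_I\<close>)

lemma Lp_norm_cmult:
  assumes p: "1 \<le> p" and g[measurable]: "g \<in> borel_measurable M" and c: "c < top"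
  shows "Lp_norm M p (\<lambda>x. c * g x) = c * Lp_norm M p g"
  using p
proof (cases rule: exponent_cases)
  case 1
  \<comment> \<open>One inequality is enough: used for \<open>c\<close> and for
    \<open>inverse c\<close> it gives both directions.\<close>
  have le: "esssup M (\<lambda>x. c * g x) \<le> c * esssup M g" if "g \<in> borel_measurable M" for c :: ennreal and g
    using that esssup_AE[of g M] by (intro esssup_I) (auto elim!: eventually_mono intro: mult_left_mono)
  show ?thesis
  proof (cases "c = 0")
    case True
    then show ?thesis using 1 le[of g 0] by (simp add: Lp_norm_top)
  next
    case False
    have "inverse c * c = 1" using False c
      by (metis divide_ennreal_def ennreal_divide_self less_irrefl mult.commute not_gr_zero)
    then have "g x = inverse c * (c * g x)" for x by (simp flip: mult.assoc)
    then have "esssup M g \<le> inverse c * esssup M (\<lambda>x. c * g x)"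
      using le[of "\<lambda>x. c * g x" "inverse c"] by simp
    then have "c * esssup M g \<le> c * (inverse c * esssup M (\<lambda>x. c * g x))"
      by (intro mult_left_mono) auto
    also have "\<dots> = esssup M (\<lambda>x. c * g x)"
      using \<open>inverse c * c = 1\<close> by (simp add: mult.commute flip: mult.assoc)
    finally show ?thesis using 1 le[OF g, of c] by (simp add: Lp_norm_top)
  qed
next
  case (2 r)
  then show ?thesis
    by (simp add: Lp_norm_finite ennreal_powr_mult nn_integral_cmult ennreal_powr_powr)
qed

text \<open>A sublevel set of the essential supremum consists of those y for which the slice of {c <
  G} is a null set, and the measure of a slice depends measurably on y.\<close>

lemma esssup_ennreal_measurable:
  fixes G :: "'a \<times> 'b \<Rightarrow> ennreal"
  assumes "sigma_finite_measure M" and [measurable]: "G \<in> borel_measurable (M \<Otimes>\<^sub>M N)"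
  shows "(\<lambda>y. esssup M (\<lambda>x. G (x, y))) \<in> borel_measurable N"
proof (rule borel_measurableI_le)
  interpret M: sigma_finite_measure M by fact
  fix c :: ennreal
  have "{y \<in> space N. esssup M (\<lambda>x. G (x, y)) \<le> c}
      = {y \<in> space N. emeasure M {x \<in> space M. c < G (x, y)} = 0}"
    by (auto simp: esssup_le_iff AE_iff_measurable[OF _ refl] not_le)
  also have "\<dots> \<in> sets N"
  proof -
    \<comment> \<open>The factors are swapped because \<open>measurable_emeasure_Pair\<close>
      measures slices in the second coordinate.\<close>
    have [measurable]: "{z \<in> space (N \<Otimes>\<^sub>M M). c < G (snd z, fst z)} \<in> sets (N \<Otimes>\<^sub>M M)" by measurable
    have eq: "Pair y -` {z \<in> space (N \<Otimes>\<^sub>M M). c < G (snd z, fst z)} = {x \<in> space M. c < G (x, y)}"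
      if "y \<in> space N" for y using that by (fastforce simp: space_pair_measure)
    have "(\<lambda>y. emeasure M (Pair y -` {z \<in> space (N \<Otimes>\<^sub>M M). c < G (snd z, fst z)})) \<in> borel_measurable N"
      by (rule M.measurable_emeasure_Pair) measurable
    then have "(\<lambda>y. emeasure M {x \<in> space M. c < G (x, y)}) \<in> borel_measurable N"
      by (rule measurable_cong[THEN iffD1, rotated]) (rule arg_cong[where f = "emeasure M"], rule eq)
    then show ?thesis by measurable
  qed
  finally show "{y \<in> space N. esssup M (\<lambda>x. G (x, y)) \<le> c} \<in> sets N" .
qed

lemma Lp_norm_measurable:
  assumes M: "sigma_finite_measure M" and [measurable]: "G \<in> borel_measurable (M \<Otimes>\<^sub>M N)" and "1 \<le> p"
  shows "(\<lambda>y. Lp_norm M p (\<lambda>x. G (x, y))) \<in> borel_measurable N"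
  using assms(3)
proof (cases rule: exponent_cases)
  case 1
  then show ?thesis using esssup_ennreal_measurable[OF assms(1,2)] by (simp add: Lp_norm_top)
next
  case (2 r)
  interpret M: sigma_finite_measure M by fact
  have "(\<lambda>y. \<integral>\<^sup>+x. ennreal_powr (G (x, y)) r \<partial>M) \<in> borel_measurable N"
    by (rule M.borel_measurable_nn_integral) measurable
  then show ?thesis using 2 by (simp add: Lp_norm_finite)
qed

text \<open>
  Minkowski's integral inequality, from Jensen's inequality for the measure with density
  proportional to the norms of the slices.  The summand \<open>\<epsilon> * k\<close> keeps that density positive.
\<close>

lemma Lp_norm_nn_integral_le:
  assumes M: "sigma_finite_measure M" and N: "sigma_finite_measure N"
    and G[measurable]: "G \<in> borel_measurable (M \<Otimes>\<^sub>M N)" and p: "1 \<le> p"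
  shows "Lp_norm M p (\<lambda>x. \<integral>\<^sup>+y. G (x, y) \<partial>N) \<le> (\<integral>\<^sup>+y. Lp_norm M p (\<lambda>x. G (x, y)) \<partial>N)"
proof -
  interpret M: sigma_finite_measure M by fact
  interpret N: sigma_finite_measure N by fact
  interpret MN: pair_sigma_finite M N ..
  define n where "n y = Lp_norm M p (\<lambda>x. G (x, y))" for y
  have n[measurable]: "n \<in> borel_measurable N"
    unfolding n_def by (rule Lp_norm_measurable[OF M G p])
  have "Lp_norm M p (\<lambda>x. \<integral>\<^sup>+y. G (x, y) \<partial>N) \<le> (\<integral>\<^sup>+y. n y \<partial>N)"
    using p
  proof (cases rule: exponent_cases)
    case 1
    \<comment> \<open>For p = \<infinity> the bound holds for almost every pair, so the order of the
      two quantifiers can be exchanged before integrating in y.\<close>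
    have "AE y in N. AE x in M. G (x, y) \<le> n y"
      unfolding n_def 1 Lp_norm_top by (intro AE_I2 esssup_AE)
    then have "AE x in M. AE y in N. G (x, y) \<le> n y"
      by (subst MN.AE_commute) auto
    then have "AE x in M. (\<integral>\<^sup>+y. G (x, y) \<partial>N) \<le> (\<integral>\<^sup>+y. n y \<partial>N)"
      by (rule eventually_mono) (rule nn_integral_mono_AE)
    then show ?thesis unfolding 1 Lp_norm_top by (intro esssup_I) auto
  next
    case (2 r)
    obtain k where k[measurable]: "k \<in> borel_measurable N" and kfin: "integral\<^sup>N N k \<noteq> \<infinity>"
      and kpos: "\<And>y. y \<in> space N \<Longrightarrow> 0 < k y \<and> k y < \<infinity>"
      using N.Ex_finite_integrable_function by blast
    define u where "u x = (\<integral>\<^sup>+y. G (x, y) \<partial>N)" for x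
    have main: "Lp_norm M p u \<le> (\<integral>\<^sup>+y. n y \<partial>N) + ennreal \<epsilon> * integral\<^sup>N N k" if fin: "(\<integral>\<^sup>+y. n y \<partial>N) < top" and \<epsilon>: "0 < \<epsilon>" for \<epsilon>
    proof -
      define m where "m y = n y + ennreal \<epsilon> * k y" for y
      have m[measurable]: "m \<in> borel_measurable N" unfolding m_def by measurable
      define R where "R = (\<integral>\<^sup>+y. m y \<partial>N)"
      have R: "R = (\<integral>\<^sup>+y. n y \<partial>N) + ennreal \<epsilon> * integral\<^sup>N N k"
        unfolding R_def m_def by (simp add: nn_integral_add nn_integral_cmult)
      have Rfin: "R < top" unfolding R using fin kfin by (auto simp: ennreal_mult_less_top less_top)
      have mfin: "AE y in N. m y \<noteq> \<infinity>"
        using Rfin unfolding R_def by (intro nn_integral_PInf_AE) auto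
      have mpos: "0 < m y" if "y \<in> space N" for y
        using kpos[OF that] \<epsilon> by (simp add: m_def add_pos_pos ennreal_zero_less_mult_iff add_nonneg_pos)
      define K where "K = density N m"
      have K: "emeasure K (space K) = R"
        by (simp add: K_def emeasure_density R_def cong: nn_integral_cong)
      have ueq: "u x = (\<integral>\<^sup>+y. G (x, y) / m y \<partial>K)" if "x \<in> space M" for x
      proof -
        have "(\<integral>\<^sup>+y. G (x, y) / m y \<partial>K) = (\<integral>\<^sup>+y. m y * (G (x, y) / m y) \<partial>N)"
          using that unfolding K_def by (subst nn_integral_density) auto
        also have "\<dots> = u x" unfolding u_def
        proof (rule nn_integral_cong_AE)
          have "m y * (G (x, y) / m y) = G (x, y)" if "m y \<noteq> \<infinity>" "y \<in> space N" for y
            using mpos[OF that(2)] that(1)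
            by (metis ennreal_divide_self ennreal_times_divide infinity_ennreal_def less_irrefl mult.commute mult.right_neutral top.not_eq_extremum)
          then show "AE y in N. m y * (G (x, y) / m y) = G (x, y)" using mfin by (auto elim: AE_mp)
        qed
        finally show ?thesis ..
      qed
      \<comment> \<open>Jensen for \<open>K\<close>, of total mass \<open>R\<close>, costs the
        factor R^(r-1). After exchanging the integrals each slice contributes at most
        \<open>m y\<close>, since the slice of \<open>G / m\<close> has norm
        \<open>n y / m y \<le> 1\<close>. What remains is R^(r-1) times R.\<close>
      have "(\<integral>\<^sup>+x. ennreal_powr (u x) r \<partial>M)
         \<le> (\<integral>\<^sup>+x. ennreal (measure K (space K) powr (r - 1)) * (\<integral>\<^sup>+y. m y * ennreal_powr (G (x, y) / m y) r \<partial>N) \<partial>M)"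
      proof (rule nn_integral_mono)
        fix x assume x: "x \<in> space M"
        have "ennreal_powr (u x) r \<le> ennreal (measure K (space K) powr (r - 1)) * (\<integral>\<^sup>+y. ennreal_powr (G (x, y) / m y) r \<partial>K)"
          unfolding ueq[OF x] using 2 x K Rfin by (intro nn_integral_powr_le) (auto simp: K_def)
        also have "(\<integral>\<^sup>+y. ennreal_powr (G (x, y) / m y) r \<partial>K) = (\<integral>\<^sup>+y. m y * ennreal_powr (G (x, y) / m y) r \<partial>N)"
          using x unfolding K_def by (subst nn_integral_density) auto
        finally show "ennreal_powr (u x) r \<le> ennreal (measure K (space K) powr (r - 1)) * (\<integral>\<^sup>+y. m y * ennreal_powr (G (x, y) / m y) r \<partial>N)" .
      qed
      also have "\<dots> = ennreal (measure K (space K) powr (r - 1)) * (\<integral>\<^sup>+x. (\<integral>\<^sup>+y. m y * ennreal_powr (G (x, y) / m y) r \<partial>N) \<partial>M)"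
        by (rule nn_integral_cmult) measurable
      also have "(\<integral>\<^sup>+x. (\<integral>\<^sup>+y. m y * ennreal_powr (G (x, y) / m y) r \<partial>N) \<partial>M)
          = (\<integral>\<^sup>+y. (\<integral>\<^sup>+x. m y * ennreal_powr (G (x, y) / m y) r \<partial>M) \<partial>N)"
        by (rule MN.Fubini'[symmetric]) measurable
      also have "\<dots> \<le> (\<integral>\<^sup>+y. m y \<partial>N)"
      proof (rule nn_integral_mono_AE)
        have "(\<integral>\<^sup>+x. m y * ennreal_powr (G (x, y) / m y) r \<partial>M) \<le> m y" if fy: "m y \<noteq> \<infinity>" and y: "y \<in> space N" for y
        proof -
          have "(\<integral>\<^sup>+x. m y * ennreal_powr (G (x, y) / m y) r \<partial>M) = m y * (\<integral>\<^sup>+x. ennreal_powr (inverse (m y)) r * ennreal_powr (G (x, y)) r \<partial>M)"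
            using y 2 by (subst nn_integral_cmult) (auto simp: divide_ennreal_def ennreal_powr_mult mult.commute)
          also have "\<dots> = m y * (ennreal_powr (inverse (m y)) r * ennreal_powr (n y) r)"
            using y 2 by (subst nn_integral_cmult) (auto simp: n_def Lp_norm_powr)
          also have "\<dots> = m y * ennreal_powr (n y / m y) r"
            using 2 by (simp add: divide_ennreal_def ennreal_powr_mult mult.commute)
          also have "\<dots> \<le> m y * ennreal_powr 1 r"
          proof -
            have "n y \<le> m y" by (simp add: m_def)
            then have "n y / m y \<le> m y / m y" by (rule divide_right_mono_ennreal)
            also have "\<dots> = 1" using mpos[OF y] fy by (simp add: ennreal_divide_self less_top)
            finally show ?thesis using 2 by (intro mult_left_mono ennreal_powr_mono) auto
          qed
          finally show ?thesis by simp
        qed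
        then show "AE y in N. (\<integral>\<^sup>+x. m y * ennreal_powr (G (x, y) / m y) r \<partial>M) \<le> m y"
          using mfin by (auto elim: AE_mp)
      qed
      also have "(\<integral>\<^sup>+y. m y \<partial>N) = R" by (simp add: R_def)
      also have "ennreal (measure K (space K) powr (r - 1)) * R = ennreal_powr R r"
      proof -
        have "measure K (space K) = enn2real R" by (simp add: measure_def K)
        moreover obtain t where t: "R = ennreal t" "0 \<le> t" using Rfin by (cases R) auto
        ultimately show ?thesis
          using 2 by (cases "t = 0") (auto simp: powr_diff simp flip: ennreal_mult)
      qed
      finally have "Lp_norm M p u \<le> R" unfolding 2(1) Lp_norm_le_iff[OF 2(2)]
        by (auto simp: mult_left_mono)
      then show ?thesis unfolding R .
    qed
    show ?thesis
    proof (cases "(\<integral>\<^sup>+y. n y \<partial>N) < top")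
      case True
      have "Lp_norm M p u \<le> (\<integral>\<^sup>+y. n y \<partial>N)"
      proof (rule ennreal_le_epsilon)
        fix e :: real assume e: "0 < e"
        obtain b where b: "integral\<^sup>N N k = ennreal b" "0 \<le> b" using kfin by (cases "integral\<^sup>N N k") auto
        \<comment> \<open>The auxiliary term of the density is made smaller than e;
          \<open>b + 1\<close> instead of \<open>b\<close> keeps the quotient meaningful when the
          integral of \<open>k\<close> vanishes.\<close>
        have "ennreal (e / (b + 1)) * integral\<^sup>N N k \<le> ennreal e"
          unfolding b using b e by (simp add: field_simps flip: ennreal_mult)
        then show "Lp_norm M p u \<le> (\<integral>\<^sup>+y. n y \<partial>N) + ennreal e"
          using main[OF True, of "e / (b + 1)"] e b(2)
          by (meson add_left_mono add_nonneg_pos divide_pos_pos order_trans zero_less_one)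
      qed
      then show ?thesis unfolding u_def[abs_def] .
    qed (simp add: not_less top_unique)
  qed
  then show ?thesis by (simp add: n_def)
qed

text \<open>A sum of two functions is an integral over a two-point space, so this is a case of the
  integral inequality.\<close>

lemma Lp_norm_add:
  assumes M: "sigma_finite_measure M" and p: "1 \<le> p"
    and [measurable]: "f \<in> borel_measurable M" "g \<in> borel_measurable M"
  shows "Lp_norm M p (\<lambda>x. f x + g x) \<le> Lp_norm M p f + Lp_norm M p g"
proof -
  let ?N = "count_space (UNIV :: bool set)"
  have "(\<lambda>z. if snd z then f (fst z) else g (fst z)) \<in> borel_measurable (M \<Otimes>\<^sub>M ?N)"
    by measurable
  from Lp_norm_nn_integral_le[OF M _ this p] show ?thesis
    by (simp add: nn_integral_count_space_finite UNIV_bool sigma_finite_measure_count_space add.commute)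
qed

lemma Lp_norm_0: "1 \<le> p \<Longrightarrow> Lp_norm M p (\<lambda>x. 0) = 0"
  using Lp_norm_cmult[of p "\<lambda>x. 0" M 0] by simp

lemma Lp_norm_sum:
  assumes M: "sigma_finite_measure M" and p: "1 \<le> p"
    and "\<And>j. j \<in> J \<Longrightarrow> f j \<in> borel_measurable M"
  shows "Lp_norm M p (\<lambda>x. \<Sum>j\<in>J. f j x) \<le> (\<Sum>j\<in>J. Lp_norm M p (f j))"
  using assms(3)
proof (induction J rule: infinite_finite_induct)
  case (insert j J)
  have "Lp_norm M p (\<lambda>x. \<Sum>j\<in>insert j J. f j x) = Lp_norm M p (\<lambda>x. f j x + (\<Sum>j\<in>J. f j x))"
    using insert by simp
  also have "\<dots> \<le> Lp_norm M p (f j) + Lp_norm M p (\<lambda>x. \<Sum>j\<in>J. f j x)"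
    using insert by (intro Lp_norm_add[OF M p] borel_measurable_sum) auto
  finally show ?case using insert by (auto intro: order_trans add_left_mono)
qed (simp_all add: Lp_norm_0 p)

text \<open>For finite exponents this is Fatou's lemma for r-th powers. The power is an increasing
  bijection with inverse exponent 1/r and therefore commutes with liminf, shown as two inequalities
  by moving thresholds through it. For p = \<infinity> all bounds hold off one common null
  set.\<close>

lemma Lp_norm_Fatou:
  assumes p: "1 \<le> p" and [measurable]: "\<And>n. g n \<in> borel_measurable M"
  shows "Lp_norm M p (\<lambda>x. liminf (\<lambda>n. g n x)) \<le> liminf (\<lambda>n. Lp_norm M p (g n))"
  using p
proof (cases rule: exponent_cases)
  case 1
  have "AE x in M. \<forall>n. g n x \<le> esssup M (g n)"
    using esssup_AE by (auto simp: AE_all_countable)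
  then have "AE x in M. liminf (\<lambda>n. g n x) \<le> liminf (\<lambda>n. esssup M (g n))"
    by (rule eventually_mono) (auto intro: Liminf_mono)
  then show ?thesis using 1 by (auto simp: Lp_norm_top)
next
  case (2 r)
  let ?L = "liminf (\<lambda>n. Lp_norm M p (g n))"
  have cont: "ennreal_powr (liminf a) r \<le> liminf (\<lambda>n. ennreal_powr (a n) r)" for a
    unfolding le_Liminf_iff
  proof (intro allI impI)
    fix y assume y: "y < ennreal_powr (liminf a) r"
    have "ennreal_powr y (1 / r) < liminf a"
    proof (rule ccontr)
      assume "\<not> ennreal_powr y (1 / r) < liminf a"
      then have "ennreal_powr (liminf a) r \<le> ennreal_powr (ennreal_powr y (1 / r)) r"
        using 2 by (intro ennreal_powr_mono) auto
      then show False using y 2 by (simp add: ennreal_powr_powr)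
    qed
    then have "eventually (\<lambda>n. ennreal_powr y (1 / r) < a n) sequentially"
      by (rule less_LiminfD)
    then show "\<forall>\<^sub>F n in sequentially. y < ennreal_powr (a n) r"
    proof (rule eventually_mono)
      fix n assume n: "ennreal_powr y (1 / r) < a n"
      show "y < ennreal_powr (a n) r"
      proof (rule ccontr)
        assume "\<not> y < ennreal_powr (a n) r"
        then have "ennreal_powr (ennreal_powr (a n) r) (1 / r) \<le> ennreal_powr y (1 / r)"
          using 2 by (intro ennreal_powr_mono) auto
        then show False using n 2 by (simp add: ennreal_powr_powr)
      qed
    qed
  qed
  have cont': "liminf (\<lambda>n. ennreal_powr (a n) r) \<le> ennreal_powr (liminf a) r" for a
  proof -
    have "ennreal_powr (liminf (\<lambda>n. ennreal_powr (a n) r)) (1 / r) \<le> liminf a"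
      unfolding le_Liminf_iff
    proof (intro allI impI)
      fix y assume y: "y < ennreal_powr (liminf (\<lambda>n. ennreal_powr (a n) r)) (1 / r)"
      have "ennreal_powr y r < liminf (\<lambda>n. ennreal_powr (a n) r)"
      proof (rule ccontr)
        assume "\<not> ennreal_powr y r < liminf (\<lambda>n. ennreal_powr (a n) r)"
        then have "ennreal_powr (liminf (\<lambda>n. ennreal_powr (a n) r)) (1 / r) \<le> ennreal_powr (ennreal_powr y r) (1 / r)"
          using 2 by (intro ennreal_powr_mono) auto
        then show False using y 2 by (simp add: ennreal_powr_powr)
      qed
      then have "eventually (\<lambda>n. ennreal_powr y r < ennreal_powr (a n) r) sequentially"
        by (rule less_LiminfD)
      then show "\<forall>\<^sub>F n in sequentially. y < a n"
        by (rule eventually_mono) (use 2 in \<open>meson ennreal_powr_mono leD leI order_trans zero_le_one\<close>)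
    qed
    then have "ennreal_powr (ennreal_powr (liminf (\<lambda>n. ennreal_powr (a n) r)) (1 / r)) r \<le> ennreal_powr (liminf a) r"
      using 2 by (intro ennreal_powr_mono) auto
    then show ?thesis using 2 by (simp add: ennreal_powr_powr)
  qed
  have "(\<integral>\<^sup>+x. ennreal_powr (liminf (\<lambda>n. g n x)) r \<partial>M) \<le> (\<integral>\<^sup>+x. liminf (\<lambda>n. ennreal_powr (g n x) r) \<partial>M)"
    by (intro nn_integral_mono cont)
  also have "\<dots> \<le> liminf (\<lambda>n. \<integral>\<^sup>+x. ennreal_powr (g n x) r \<partial>M)"
    by (intro nn_integral_liminf) measurable
  also have "\<dots> = liminf (\<lambda>n. ennreal_powr (Lp_norm M p (g n)) r)"
    using 2 by (simp add: Lp_norm_powr)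
  also have "\<dots> \<le> ennreal_powr ?L r" by (rule cont')
  finally show ?thesis unfolding 2(1) Lp_norm_le_iff[OF 2(2)] .
qed

lemma Lp_norm_count_space_ge:
  assumes "1 \<le> q" "i \<in> I"
  shows "a i \<le> Lp_norm (count_space I) q a"
  using assms(1)
proof (cases rule: exponent_cases)
  case 1
  have "AE j in count_space I. a j \<le> esssup (count_space I) a" by (rule esssup_AE)
  then show ?thesis using 1 assms by (simp add: AE_count_space Lp_norm_top)
next
  case (2 r)
  have "ennreal_powr (a i) r = (\<integral>\<^sup>+j. ennreal_powr (a i) r * indicator {i} j \<partial>count_space I)"
    using assms by (subst nn_integral_cmult_indicator) auto
  also have "\<dots> \<le> (\<integral>\<^sup>+j. ennreal_powr (a j) r \<partial>count_space I)"
    by (intro nn_integral_mono) (auto simp: indicator_def)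
  finally have "ennreal_powr (ennreal_powr (a i) r) (1 / r) \<le> Lp_norm (count_space I) q a"
    using 2 by (simp add: Lp_norm_finite ennreal_powr_mono)
  then show ?thesis using 2 by (simp add: ennreal_powr_powr)
qed

text \<open>A substitute for Hoelder's inequality that treats all exponents at once: a weight
  \<open>k\<close> with both mass and values at most c is used as a density. Jensen gives c^(r-1)
  from the mass, and the pointwise bound gives the last factor c.\<close>

lemma nn_integral_mult_le_Lp_norm:
  assumes p: "1 \<le> p" and [measurable]: "g \<in> borel_measurable M" "k \<in> borel_measurable M"
    and c: "(\<integral>\<^sup>+x. k x \<partial>M) \<le> ennreal c" "\<And>x. x \<in> space M \<Longrightarrow> k x \<le> ennreal c" "0 \<le> c"
  shows "(\<integral>\<^sup>+x. g x * k x \<partial>M) \<le> ennreal c * Lp_norm M p g"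
  using p
proof (cases rule: exponent_cases)
  case 1
  have "(\<integral>\<^sup>+x. g x * k x \<partial>M) \<le> (\<integral>\<^sup>+x. esssup M g * k x \<partial>M)"
    using esssup_AE[of g M] by (intro nn_integral_mono_AE) (auto elim!: eventually_mono intro: mult_right_mono)
  also have "\<dots> = esssup M g * (\<integral>\<^sup>+x. k x \<partial>M)" by (rule nn_integral_cmult) measurable
  also have "\<dots> \<le> esssup M g * ennreal c" using c by (intro mult_left_mono) auto
  finally show ?thesis using 1 by (simp add: Lp_norm_top mult.commute)
next
  case (2 r)
  define K where "K = density M k"
  have K: "emeasure K (space K) = (\<integral>\<^sup>+x. k x \<partial>M)"
    by (simp add: K_def emeasure_density cong: nn_integral_cong)
  have mK: "measure K (space K) \<le> c"
    using c(1,3) K by (simp add: measure_def enn2real_leI)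
  have fin: "emeasure K (space K) < \<infinity>" unfolding K using c(1) by (simp add: le_less_trans)
  have [measurable]: "g \<in> borel_measurable K" by (simp add: K_def)
  have "ennreal_powr (\<integral>\<^sup>+x. g x * k x \<partial>M) r = ennreal_powr (\<integral>\<^sup>+x. g x \<partial>K) r"
    unfolding K_def by (subst nn_integral_density) (auto simp: mult.commute)
  also have "\<dots> \<le> ennreal (measure K (space K) powr (r - 1)) * (\<integral>\<^sup>+x. ennreal_powr (g x) r \<partial>K)"
    using 2 fin by (intro nn_integral_powr_le) auto
  also have "\<dots> \<le> ennreal (c powr (r - 1)) * (\<integral>\<^sup>+x. ennreal_powr (g x) r \<partial>K)"
    using 2 mK by (intro mult_right_mono ennreal_leI powr_mono2) auto
  also have "(\<integral>\<^sup>+x. ennreal_powr (g x) r \<partial>K) = (\<integral>\<^sup>+x. k x * ennreal_powr (g x) r \<partial>M)"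
    unfolding K_def by (subst nn_integral_density) auto
  also have "\<dots> \<le> (\<integral>\<^sup>+x. ennreal c * ennreal_powr (g x) r \<partial>M)"
    using c by (intro nn_integral_mono mult_right_mono) auto
  also have "\<dots> = ennreal c * ennreal_powr (Lp_norm M p g) r"
    using 2 by (simp add: nn_integral_cmult Lp_norm_powr)
  also have "ennreal (c powr (r - 1)) * \<dots> = ennreal_powr (ennreal c * Lp_norm M p g) r"
    using 2 c(3) by (cases "c = 0") (auto simp: ennreal_powr_mult powr_diff ennreal_mult simp flip: mult.assoc ennreal_mult)
  finally have "ennreal_powr (ennreal_powr (\<integral>\<^sup>+x. g x * k x \<partial>M) r) (1 / r)
      \<le> ennreal_powr (ennreal_powr (ennreal c * Lp_norm M p g) r) (1 / r)"
    using 2 by (rule_tac ennreal_powr_mono) (auto simp: mult_left_mono)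
  then show ?thesis using 2 by (simp add: ennreal_powr_powr)
qed

subsection \<open>Smooth functions\<close>

lemma frechet_derivative_expand:
  fixes f :: "real^'d \<Rightarrow> complex"
  assumes "f differentiable (at x)"
  shows "frechet_derivative f (at x) t = (\<Sum>j\<in>UNIV. t $ j *\<^sub>R partials [j] f x)"
proof -
  have lin: "linear (frechet_derivative f (at x))"
    using assms by (rule linear_frechet_derivative)
  have "t = (\<Sum>j\<in>UNIV. t $ j *\<^sub>R axis j 1)"
    using basis_expansion[of t] by (simp add: scalar_mult_eq_scaleR)
  then have "frechet_derivative f (at x) t = frechet_derivative f (at x) (\<Sum>j\<in>UNIV. t $ j *\<^sub>R axis j 1)"
    by simp
  also have "\<dots> = (\<Sum>j\<in>UNIV. t $ j *\<^sub>R frechet_derivative f (at x) (axis j 1))"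
    using lin by (simp add: linear_sum linear_cmul)
  finally show ?thesis by simp
qed

lemma partials_1_eq:
  assumes "(f has_derivative D) (at x)"
  shows "partials [j] f x = D (axis j 1)"
  using frechet_derivative_at[OF assms] by simp

lemma partials_Cons: "partials (j # js) f = partials [j] (partials js f)"
  by simp

lemma partials_single: "partials [j] f x = frechet_derivative f (at x) (axis j 1)"
  by simp

declare partials.simps(2) [simp del]

lemma partials_append: "partials (js @ ks) f = partials js (partials ks f)"
proof (induction js)
  case (Cons j js)
  then show ?case by (simp add: partials_Cons[of j js] partials_Cons[of j "js @ ks"])
qed simp

lemma partials_differentiable: "smooth_fun f \<Longrightarrow> partials js f differentiable (at x)"
  unfolding smooth_fun_def differentiable_on_def by simp

lemma smooth_fun_partials: "smooth_fun f \<Longrightarrow> smooth_fun (partials js f)"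
  unfolding smooth_fun_def by (simp flip: partials_append)

lemma smooth_fun_differentiable: "smooth_fun f \<Longrightarrow> f differentiable (at x)"
  using partials_differentiable[of f "[]"] by simp

lemma smooth_fun_continuous: "smooth_fun f \<Longrightarrow> continuous_on S f"
  by (meson continuous_at_imp_continuous_on differentiable_imp_continuous_within smooth_fun_differentiable)

section \<open>Characters of the additive group, the kernel of the Fourier transform\<close>

definition chi :: "real^'d \<Rightarrow> real^'d \<Rightarrow> complex" where
  "chi x \<xi> = exp (2 * of_real pi * \<i> * of_real (x \<bullet> \<xi>))"

lemma norm_chi [simp]: "cmod (chi x \<xi>) = 1"
  by (simp add: chi_def)

lemma chi_commute: "chi x \<xi> = chi \<xi> x"
  by (simp add: chi_def inner_commute)

lemma chi_add_left: "chi (x + y) \<xi> = chi x \<xi> * chi y \<xi>"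
  by (simp add: chi_def inner_add_left ring_distribs exp_add)

lemma chi_0 [simp]: "chi 0 \<xi> = 1" "chi \<xi> 0 = 1"
  by (simp_all add: chi_def)

lemma cnj_chi: "cnj (chi x \<xi>) = chi (- x) \<xi>" "cnj (chi x \<xi>) = chi x (- \<xi>)"
  by (simp_all add: chi_def exp_cnj)

lemma chi_minus: "chi (- x) \<xi> = chi x (- \<xi>)"
  by (simp add: chi_def)

lemma continuous_chi [continuous_intros]:
  "continuous_on S f \<Longrightarrow> continuous_on S g \<Longrightarrow> continuous_on S (\<lambda>p. chi (f p) (g p))"
  unfolding chi_def by (intro continuous_intros)

lemma chi_measurable [measurable]:
  assumes [measurable]: "f \<in> borel_measurable M" "g \<in> borel_measurable M"
  shows "(\<lambda>p. chi (f p) (g p)) \<in> borel_measurable M"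
  unfolding chi_def by measurable

lemma chi_has_derivative:
  "(chi x has_derivative (\<lambda>t. 2 * of_real pi * \<i> * of_real (x \<bullet> t) * chi x \<xi>)) (at \<xi>)"
proof -
  have "((\<lambda>\<xi>. 2 * of_real pi * \<i> * complex_of_real (x \<bullet> \<xi>)) has_derivative
      (\<lambda>t. 2 * of_real pi * \<i> * of_real (x \<bullet> t))) (at \<xi>)"
    by (intro bounded_linear_imp_has_derivative bounded_linear_compose[OF bounded_linear_mult_right]
        bounded_linear_compose[OF bounded_linear_of_real] bounded_linear_inner_right)
  from has_derivative_compose[OF this DERIV_exp[unfolded has_field_derivative_def]] show ?thesis
    unfolding chi_def by (simp add: mult_ac)
qed

lemma partials_chi: "partials [j] (chi x) \<xi> = 2 * of_real pi * \<i> * of_real (x $ j) * chi x \<xi>"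
  unfolding partials_1_eq[OF chi_has_derivative] by (simp add: inner_axis)

subsection \<open>Smooth families of polynomial growth\<close>

definition poly_growth :: "('p::real_normed_vector \<Rightarrow> real) \<Rightarrow> bool" where
  "poly_growth c \<longleftrightarrow> (\<exists>C\<ge>0. \<exists>n. \<forall>p. c p \<le> C * (1 + norm p) ^ n)"

lemma poly_growthE:
  assumes "poly_growth c"
  obtains C n where "0 \<le> C" "\<And>p. c p \<le> C * (1 + norm p) ^ n"
  using assms unfolding poly_growth_def by blast

lemma poly_growthI:
  assumes "\<And>p. c p \<le> C * (1 + norm p) ^ n"
  shows "poly_growth c"
proof -
  have "c p \<le> max C 0 * (1 + norm p) ^ n" for p
    using assms[of p] by (smt (verit, best) mult_right_mono zero_le_power norm_ge_zero max.cobounded1)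
  then show ?thesis unfolding poly_growth_def by (intro exI[of _ "max C 0"]) auto
qed

lemma poly_growth_const: "poly_growth (\<lambda>p. c)"
  by (rule poly_growthI[of _ c 0]) simp

lemma poly_growth_norm: "poly_growth norm"
  by (rule poly_growthI[of _ 1 1]) simp

lemma poly_growth_mono: "poly_growth c \<Longrightarrow> (\<And>p. b p \<le> c p) \<Longrightarrow> poly_growth b"
  unfolding poly_growth_def by (meson order_trans)

lemma poly_growth_mult:
  assumes "poly_growth b" "poly_growth c" "\<And>p. 0 \<le> b p" "\<And>p. 0 \<le> c p"
  shows "poly_growth (\<lambda>p. b p * c p)"
proof -
  obtain B n C m where B: "0 \<le> B" "\<And>p. b p \<le> B * (1 + norm p) ^ n"
    and C: "0 \<le> C" "\<And>p. c p \<le> C * (1 + norm p) ^ m"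
    using assms(1,2) by (metis poly_growthE)
  have "b p * c p \<le> (B * C) * (1 + norm p) ^ (n + m)" for p
  proof -
    have "b p * c p \<le> (B * (1 + norm p) ^ n) * (C * (1 + norm p) ^ m)"
      using assms B C by (intro mult_mono) auto
    then show ?thesis by (simp add: power_add mult_ac)
  qed
  then show ?thesis by (rule poly_growthI)
qed

lemma poly_growth_add:
  assumes "poly_growth b" "poly_growth c"
  shows "poly_growth (\<lambda>p. b p + c p)"
proof -
  obtain B n C m where B: "0 \<le> B" "\<And>p. b p \<le> B * (1 + norm p) ^ n"
    and C: "0 \<le> C" "\<And>p. c p \<le> C * (1 + norm p) ^ m"
    using assms by (metis poly_growthE)
  have "b p + c p \<le> (B + C) * (1 + norm p) ^ (max n m)" for p
  proof -
    have "b p \<le> B * (1 + norm p) ^ (max n m)"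
      using B by (meson order_trans mult_left_mono power_increasing max.cobounded1 le_add_same_cancel1 norm_ge_zero)
    moreover have "c p \<le> C * (1 + norm p) ^ (max n m)"
      using C by (meson order_trans mult_left_mono power_increasing max.cobounded2 le_add_same_cancel1 norm_ge_zero)
    ultimately show ?thesis by (simp add: algebra_simps)
  qed
  then show ?thesis by (rule poly_growthI)
qed

text \<open>The closure of the building blocks that occur: fixed smooth functions, scalar factors,
  dilations, characters. Generating the class inductively lets continuity, differentiability,
  stability under partial derivatives and growth bounds be proved once by rule induction. A dilated
  function must have bounded derivatives, so that it stays bounded whatever the matrix
  \<open>A p\<close> is.\<close>

inductive smooth_family :: "('p::real_normed_vector \<Rightarrow> real^'d \<Rightarrow> complex) \<Rightarrow> bool" where
  smooth_family_const: "smooth_fun a \<Longrightarrow> smooth_family (\<lambda>p. a)"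
| smooth_family_param: "continuous_on UNIV c \<Longrightarrow> poly_growth (\<lambda>p. cmod (c p)) \<Longrightarrow> smooth_family (\<lambda>p \<xi>. c p)"
| smooth_family_comp: "smooth_fun (a :: real^'d \<Rightarrow> complex) \<Longrightarrow> (\<And>js. bounded (range (partials js a))) \<Longrightarrow> continuous_on UNIV A \<Longrightarrow>
    (\<And>i j. poly_growth (\<lambda>p. \<bar>A p $ i $ j\<bar>)) \<Longrightarrow> smooth_family (\<lambda>p \<xi>. a (A p *v \<xi>))"
| smooth_family_chi: "continuous_on UNIV y \<Longrightarrow> (\<And>j. poly_growth (\<lambda>p. \<bar>y p $ j\<bar>)) \<Longrightarrow> smooth_family (\<lambda>p. chi (y p))"
| smooth_family_add: "smooth_family F \<Longrightarrow> smooth_family G \<Longrightarrow> smooth_family (\<lambda>p \<xi>. F p \<xi> + G p \<xi>)"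
| smooth_family_mult: "smooth_family F \<Longrightarrow> smooth_family G \<Longrightarrow> smooth_family (\<lambda>p \<xi>. F p \<xi> * G p \<xi>)"

lemma partials_add:
  assumes "f differentiable (at x)" "g differentiable (at x)"
  shows "partials [j] (\<lambda>x. f x + g x) x = partials [j] f x + partials [j] g x"
  using partials_1_eq[OF has_derivative_add[OF assms[THEN frechet_derivative_works[THEN iffD1]]]]
  by (simp add: partials_single)

lemma partials_mult:
  assumes "f differentiable (at x)" "g differentiable (at x)"
  shows "partials [j] (\<lambda>x. f x * g x) x = f x * partials [j] g x + partials [j] f x * g x"
  using partials_1_eq[OF has_derivative_mult[OF assms[THEN frechet_derivative_works[THEN iffD1]]]]
  by (simp add: partials_single)

lemma partials_const: "partials [j] (\<lambda>x. c) = (\<lambda>x. 0)"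
  using partials_1_eq[OF has_derivative_const] by auto

lemma matrix_vector_axis: "A *v axis j 1 = (\<chi> i. A $ i $ j)"
  by (simp add: matrix_vector_mult_def vec_eq_iff axis_def if_distrib sum.delta cong: if_cong)

lemma matrix_vector_has_derivative: "((\<lambda>x. A *v x) has_derivative (\<lambda>x. A *v x)) (at x)" for A :: "real^'n^'m"
  by (intro bounded_linear_imp_has_derivative linear_linear[THEN iffD2] matrix_vector_mul_linear)

lemma comp_matrix_has_derivative:
  fixes a :: "real^'d \<Rightarrow> complex" and A :: "real^'d^'d"
  assumes "smooth_fun a"
  shows "((\<lambda>\<xi>. a (A *v \<xi>)) has_derivative (\<lambda>t. frechet_derivative a (at (A *v \<xi>)) (A *v t))) (at \<xi>)"
  by (rule has_derivative_compose[OF matrix_vector_has_derivative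
        smooth_fun_differentiable[OF assms, THEN frechet_derivative_works[THEN iffD1]]])

lemma partials_comp_matrix:
  fixes a :: "real^'d \<Rightarrow> complex" and A :: "real^'d^'d"
  assumes "smooth_fun a"
  shows "partials [j] (\<lambda>\<xi>. a (A *v \<xi>)) \<xi> = (\<Sum>i\<in>UNIV. of_real (A $ i $ j) * partials [i] a (A *v \<xi>))"
  unfolding partials_1_eq[OF comp_matrix_has_derivative[OF assms]]
    frechet_derivative_expand[OF smooth_fun_differentiable[OF assms]]
  by (simp add: matrix_vector_axis scaleR_conv_of_real)

lemma smooth_family_0: "smooth_family (\<lambda>p \<xi>. 0)"
  using smooth_family_param[of "\<lambda>_. 0"] by (simp add: poly_growth_const)

lemma smooth_family_sum:
  "finite S \<Longrightarrow> (\<And>i. i \<in> S \<Longrightarrow> smooth_family (F i)) \<Longrightarrow> smooth_family (\<lambda>p \<xi>. \<Sum>i\<in>S. F i p \<xi>)"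
proof (induction rule: finite_induct)
  case empty
  then show ?case using smooth_family_0 by simp
next
  case (insert i S)
  then show ?case using smooth_family_add[of "F i" "\<lambda>p \<xi>. \<Sum>i\<in>S. F i p \<xi>"] by simp
qed

lemma smooth_family_continuous:
  assumes "smooth_family F"
  shows "continuous_on UNIV (\<lambda>(p, \<xi>). F p \<xi>)"
  using assms
proof induction
  case (smooth_family_const a)
  then show ?case
    using continuous_on_compose2[OF smooth_fun_continuous[of a UNIV] continuous_on_snd[OF continuous_on_id]]
    by (simp add: case_prod_beta)
next
  case (smooth_family_param c)
  then show ?case
    using continuous_on_compose2[OF smooth_family_param(1) continuous_on_fst[OF continuous_on_id]]
    by (simp add: case_prod_beta)
next
  case (smooth_family_comp a A)
  have "continuous_on UNIV (\<lambda>z. A (fst z) *v snd z)"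
    unfolding matrix_vector_mult_def
    by (intro continuous_intros continuous_on_compose2[OF smooth_family_comp(3) continuous_on_fst[OF continuous_on_id]]) auto
  then show ?case
    using continuous_on_compose2[OF smooth_fun_continuous[OF smooth_family_comp(1), of UNIV]]
    by (simp add: case_prod_beta)
next
  case (smooth_family_chi y)
  then show ?case
    unfolding case_prod_beta
    by (intro continuous_intros continuous_on_compose2[OF smooth_family_chi(1) continuous_on_fst[OF continuous_on_id]]) auto
next
  case (smooth_family_add F G)
  then show ?case unfolding case_prod_beta by (intro continuous_on_add)
next
  case (smooth_family_mult F G)
  then show ?case unfolding case_prod_beta by (intro continuous_on_mult)
qed

lemma smooth_family_differentiable:
  assumes "smooth_family F"
  shows "F p differentiable (at \<xi>)"
  using assms
proof (induction arbitrary: p \<xi>)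
  case (smooth_family_comp a A)
  then show ?case using comp_matrix_has_derivative differentiableI by blast
next
  case (smooth_family_chi y)
  then show ?case using chi_has_derivative differentiableI by blast
next
  case (smooth_family_add F G)
  then show ?case by (intro differentiable_add)
next
  case (smooth_family_mult F G)
  then show ?case by (intro differentiable_mult)
next
  case (smooth_family_const a)
  then show ?case by (rule smooth_fun_differentiable)
next
  case (smooth_family_param c)
  show ?case by simp
qed

lemma smooth_family_partial:
  assumes "smooth_family F"
  shows "smooth_family (\<lambda>p. partials [j] (F p))"
  using assms
proof induction
  case (smooth_family_const a)
  then show ?case by (intro smooth_family.smooth_family_const smooth_fun_partials)
next
  case (smooth_family_param c)
  then show ?case by (simp only: partials_const smooth_family_0)
next
  case (smooth_family_comp a A)
  have "smooth_family (\<lambda>p \<xi>. \<Sum>i\<in>UNIV. of_real (A p $ i $ j) * partials [i] a (A p *v \<xi>))"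
  proof (intro smooth_family_sum smooth_family_mult, goal_cases)
    case (2 i)
    have "continuous_on UNIV (\<lambda>p. complex_of_real (A p $ i $ j))"
      by (intro continuous_intros smooth_family_comp)
    then show ?case by (rule smooth_family.smooth_family_param) (simp add: smooth_family_comp)
  next
    case (3 i)
    have "bounded (range (partials js (partials [i] a)))" for js
      using smooth_family_comp(2)[of "js @ [i]"] by (simp add: partials_append)
    then show ?case
      by (intro smooth_family.smooth_family_comp smooth_fun_partials smooth_family_comp)
  qed simp
  moreover have "(\<lambda>p. partials [j] (\<lambda>\<xi>. a (A p *v \<xi>)))
      = (\<lambda>p \<xi>. \<Sum>i\<in>UNIV. of_real (A p $ i $ j) * partials [i] a (A p *v \<xi>))"
    by (intro ext partials_comp_matrix smooth_family_comp)
  ultimately show ?case by (simp only:)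
next
  case (smooth_family_chi y)
  have "smooth_family (\<lambda>p. (\<lambda>\<xi>. 2 * of_real pi * \<i> * complex_of_real (y p $ j)) :: real^'b \<Rightarrow> complex)"
    by (rule smooth_family.smooth_family_param, intro continuous_intros smooth_family_chi)
      (use poly_growth_mult[OF poly_growth_const[of "2 * pi"] smooth_family_chi(2)[of j]] in \<open>simp add: norm_mult\<close>)
  from smooth_family_mult[OF this smooth_family.smooth_family_chi[OF smooth_family_chi]]
  show ?case by (simp only: partials_chi[abs_def])
next
  case (smooth_family_add F G)
  then show ?case
    by (simp only: partials_add[OF smooth_family_differentiable smooth_family_differentiable]
      smooth_family.smooth_family_add)
next
  case (smooth_family_mult F G)
  then show ?case
    by (simp only: partials_mult[OF smooth_family_differentiable smooth_family_differentiable]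
      smooth_family.smooth_family_add smooth_family.smooth_family_mult)
qed

lemma smooth_family_partials: "smooth_family F \<Longrightarrow> smooth_family (\<lambda>p. partials js (F p))"
proof (induction js)
  case (Cons j js)
  then show ?case using smooth_family_partial[of "\<lambda>p. partials js (F p)" j] by (simp add: partials_Cons[of j js])
qed simp

text \<open>All iterated partial derivatives stay in the class, and every member of the class is
  differentiable.\<close>

lemma smooth_family_smooth: "smooth_family F \<Longrightarrow> smooth_fun (F p)"
  unfolding smooth_fun_def differentiable_on_def
  using smooth_family_differentiable[OF smooth_family_partials] by blast

text \<open>The bound is uniform in \<xi> and polynomial in p. The restriction to a ball serves the
  fixed smooth functions, which may be unbounded at infinity.\<close>

lemma smooth_family_bound:
  assumes "smooth_family F"
  obtains c where "poly_growth c" "\<And>p. 0 \<le> c p" "\<And>p \<xi>. norm \<xi> \<le> R \<Longrightarrow> cmod (F p \<xi>) \<le> c p"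
proof -
  have "\<exists>c. poly_growth c \<and> (\<forall>p. 0 \<le> c p) \<and> (\<forall>p \<xi>. norm \<xi> \<le> R \<longrightarrow> cmod (F p \<xi>) \<le> c p)"
    using assms
  proof induction
    case (smooth_family_const a)
    have "bounded (a ` cball 0 R)"
      by (intro compact_imp_bounded compact_continuous_image smooth_fun_continuous smooth_family_const compact_cball)
    then obtain B where "\<forall>\<xi>\<in>cball 0 R. cmod (a \<xi>) \<le> B"
      unfolding bounded_iff by auto
    then show ?case by (intro exI[of _ "\<lambda>p. max B 0"]) (auto intro: poly_growth_const max.coboundedI1)
  next
    case (smooth_family_param c)
    then show ?case by (intro exI[of _ "\<lambda>p. cmod (c p)"]) auto
  next
    case (smooth_family_comp a A)
    obtain B where "\<And>\<xi>. cmod (a \<xi>) \<le> B"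
      using smooth_family_comp(2)[of "[]"] unfolding bounded_iff by auto
    then show ?case by (intro exI[of _ "\<lambda>p. max B 0"]) (auto intro: poly_growth_const max.coboundedI1)
  next
    case (smooth_family_chi y)
    then show ?case by (intro exI[of _ "\<lambda>p. 1"]) (auto intro: poly_growth_const)
  next
    case (smooth_family_add F G)
    then obtain c d where c: "poly_growth c" "\<forall>p. 0 \<le> c p" "\<forall>p \<xi>. norm \<xi> \<le> R \<longrightarrow> cmod (F p \<xi>) \<le> c p"
      and d: "poly_growth d" "\<forall>p. 0 \<le> d p" "\<forall>p \<xi>. norm \<xi> \<le> R \<longrightarrow> cmod (G p \<xi>) \<le> d p" by blast
    then show ?case
      by (intro exI[of _ "\<lambda>p. c p + d p"]) (auto intro!: poly_growth_add norm_triangle_mono)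
  next
    case (smooth_family_mult F G)
    then obtain c d where c: "poly_growth c" "\<forall>p. 0 \<le> c p" "\<forall>p \<xi>. norm \<xi> \<le> R \<longrightarrow> cmod (F p \<xi>) \<le> c p"
      and d: "poly_growth d" "\<forall>p. 0 \<le> d p" "\<forall>p \<xi>. norm \<xi> \<le> R \<longrightarrow> cmod (G p \<xi>) \<le> d p" by blast
    then show ?case
      by (intro exI[of _ "\<lambda>p. c p * d p"]) (auto intro!: poly_growth_mult mult_mono simp: norm_mult)
  qed
  then show ?thesis using that by blast
qed

lemma smooth_fun_mult:
  assumes "smooth_fun f" "smooth_fun g"
  shows "smooth_fun (\<lambda>x. f x * g x)"
  by (rule smooth_family_smooth[OF smooth_family_mult[OF smooth_family_const[OF assms(1)] smooth_family_const[OF assms(2)]]])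

lemma smooth_fun_chi: "smooth_fun (chi x)"
  using smooth_family_smooth[OF smooth_family_chi[of "\<lambda>_. x"]] by (simp add: poly_growth_const)

text \<open>A coinductive criterion: a set of differentiable functions closed under first partial
  derivatives consists of smooth functions.\<close>

lemma smooth_funI_differentiable:
  assumes "f \<in> X" "\<And>g x. g \<in> X \<Longrightarrow> g differentiable (at x)" "\<And>g j. g \<in> X \<Longrightarrow> partials [j] g \<in> X"
  shows "smooth_fun f"
proof -
  have "partials js f \<in> X" for js
  proof (induction js)
    case (Cons j js)
    then show ?case using assms(3)[of "partials js f" j] by (simp add: partials_Cons[of j js])
  qed (use assms in simp)
  then show ?thesis unfolding smooth_fun_def differentiable_on_def using assms(2) by simp
qed

lemma smooth_fun_const: "smooth_fun (\<lambda>x. c)"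
  by (rule smooth_funI_differentiable[of _ "range (\<lambda>c x. c)"]) (auto simp: partials_const)

lemma coordinate_has_derivative: "((\<lambda>x. complex_of_real (x $ i)) has_derivative (\<lambda>t. of_real (t $ i))) (at x)"
  by (intro bounded_linear_imp_has_derivative bounded_linear_compose[OF bounded_linear_of_real bounded_linear_vec_nth])

lemma smooth_fun_coordinate: "smooth_fun (\<lambda>x. complex_of_real (x $ i))"
proof (rule smooth_funI_differentiable[of _ "insert (\<lambda>x. complex_of_real (x $ i)) (range (\<lambda>c x. c))"], goal_cases)
  case (2 g x)
  then show ?case using coordinate_has_derivative[of i x] differentiableI by auto
next
  case (3 g j)
  have "partials [j] (\<lambda>x::real^'a. complex_of_real (x $ i)) = (\<lambda>x. of_real (axis j 1 $ i))"
    using partials_1_eq[OF coordinate_has_derivative] by blast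
  then show ?case using 3 by (auto simp: partials_const)
qed simp

lemma smooth_fun_cnj:
  assumes "smooth_fun f"
  shows "smooth_fun (\<lambda>x. cnj (f x))" "partials js (\<lambda>x. cnj (f x)) = (\<lambda>x. cnj (partials js f x))"
proof -
  have d: "((\<lambda>x. cnj (g x)) has_derivative (\<lambda>t. cnj (frechet_derivative g (at x) t))) (at x)"
    if "smooth_fun g" for g :: "real^'a \<Rightarrow> complex" and x
    using smooth_fun_differentiable[OF that, of x]
    by (intro has_derivative_cnj) (auto simp: frechet_derivative_works)
  have 1: "partials js (\<lambda>x. cnj (f x)) = (\<lambda>x. cnj (partials js f x))" for js
  proof (induction js)
    case (Cons j js)
    have "partials [j] (\<lambda>x. cnj (partials js f x)) x = cnj (partials [j] (partials js f) x)" for x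
      using partials_1_eq[OF d[OF smooth_fun_partials[OF assms]]] by (simp add: partials_single)
    then show ?case unfolding partials_Cons[of j js] Cons.IH by (rule ext)
  qed simp
  show "partials js (\<lambda>x. cnj (f x)) = (\<lambda>x. cnj (partials js f x))" by (rule 1)
  show "smooth_fun (\<lambda>x. cnj (f x))"
    unfolding smooth_fun_def differentiable_on_def 1
    using differentiableI[OF d[OF smooth_fun_partials[OF assms]]] by auto
qed

subsection \<open>Test functions\<close>

lemma test_fun_supp: "f \<in> test_funs \<Omega> \<Longrightarrow> x \<notin> fun_supp f \<Longrightarrow> f x = 0"
  unfolding fun_supp_def using closure_subset[of "{x. f x \<noteq> 0}"] by auto

lemma test_funsD:
  assumes "f \<in> test_funs \<Omega>"
  shows "smooth_fun f" "compact (fun_supp f)" "fun_supp f \<subseteq> \<Omega>" "x \<notin> \<Omega> \<Longrightarrow> f x = 0"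
  using assms test_fun_supp[OF assms] by (auto simp: test_funs_def)

lemma test_funsI:
  assumes "smooth_fun f" "compact K" "K \<subseteq> \<Omega>" "\<And>x. x \<notin> K \<Longrightarrow> f x = 0"
  shows "f \<in> test_funs \<Omega>" "fun_supp f \<subseteq> K"
proof -
  show *: "fun_supp f \<subseteq> K"
    unfolding fun_supp_def using assms by (intro closure_minimal compact_imp_closed) auto
  have "compact (K \<inter> fun_supp f)"
    using assms by (intro compact_Int_closed) (auto simp: fun_supp_def)
  then have "compact (fun_supp f)" using * by (simp add: Int_absorb1)
  then show "f \<in> test_funs \<Omega>" using assms * by (auto simp: test_funs_def)
qed

lemma test_funs_UNIV: "f \<in> test_funs \<Omega> \<Longrightarrow> f \<in> test_funs UNIV"
  by (auto simp: test_funs_def)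

lemma test_funs_mult:
  assumes "f \<in> test_funs \<Omega>" "smooth_fun g"
  shows "(\<lambda>x. f x * g x) \<in> test_funs \<Omega>" "fun_supp (\<lambda>x. f x * g x) \<subseteq> fun_supp f"
proof -
  have 0: "f x * g x = 0" if "x \<notin> fun_supp f" for x
    using that assms test_fun_supp by auto
  have s: "smooth_fun (\<lambda>x. f x * g x)" using assms by (auto intro: smooth_fun_mult simp: test_funs_def)
  show "(\<lambda>x. f x * g x) \<in> test_funs \<Omega>" "fun_supp (\<lambda>x. f x * g x) \<subseteq> fun_supp f"
    using test_funsI[OF s test_funsD(2,3)[OF assms(1)] 0] by auto
qed

lemma test_funs_mult': "smooth_fun g \<Longrightarrow> f \<in> test_funs \<Omega> \<Longrightarrow> (\<lambda>x. g x * f x) \<in> test_funs \<Omega>"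
  using test_funs_mult(1)[of f \<Omega> g] by (simp add: mult.commute)

lemma partials_eq_0:
  assumes "closed K" "\<And>x. x \<notin> K \<Longrightarrow> f x = 0" "x \<notin> K"
  shows "partials js f x = 0"
  using assms(3)
proof (induction js arbitrary: x)
  case (Cons j js)
  have "(partials js f has_derivative (\<lambda>t. 0)) (at x)"
    by (rule has_derivative_transform_within_open[of "\<lambda>_. 0" _ _ _ "- K"])
      (use Cons assms(1) in auto)
  from partials_1_eq[OF this] show ?case by (simp add: partials_Cons[of j js])
qed (use assms in simp)

lemma test_funs_partials:
  assumes "f \<in> test_funs \<Omega>"
  shows "partials js f \<in> test_funs \<Omega>"
proof (rule test_funsI[of _ "fun_supp f"])
  show "partials js f x = 0" if "x \<notin> fun_supp f" for x
    by (rule partials_eq_0[OF _ test_fun_supp[OF assms] that]) (simp add: fun_supp_def)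
qed (use test_funsD[OF assms] in \<open>auto intro: smooth_fun_partials\<close>)

lemma test_funs_cnj:
  assumes "f \<in> test_funs \<Omega>"
  shows "(\<lambda>x. cnj (f x)) \<in> test_funs \<Omega>" "fun_supp (\<lambda>x. cnj (f x)) = fun_supp f"
  using assms by (auto simp: test_funs_def smooth_fun_cnj fun_supp_def)

lemma test_funs_0: "(\<lambda>x. 0) \<in> test_funs \<Omega>"
  by (rule test_funsI[of _ "{}"]) (auto intro: smooth_fun_const)

lemma test_funs_sum:
  "finite S \<Longrightarrow> (\<And>i. i \<in> S \<Longrightarrow> F i \<in> test_funs \<Omega>) \<Longrightarrow> (\<lambda>x. \<Sum>i\<in>S. c i * F i x) \<in> test_funs \<Omega>"
proof (induction S rule: finite_induct)
  case (insert i S)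
  then show ?case using test_funs_linear[of "F i" \<Omega> "\<lambda>x. \<Sum>i\<in>S. c i * F i x" "c i" 1] by simp
qed (simp add: test_funs_0)

lemma test_funs_bounded:
  assumes "f \<in> test_funs \<Omega>"
  shows "bounded (range f)"
proof -
  have "bounded (f ` fun_supp f)"
    using assms by (intro compact_imp_bounded compact_continuous_image) (auto simp: test_funsD smooth_fun_continuous)
  moreover have "range f \<subseteq> insert 0 (f ` fun_supp f)"
    using test_fun_supp[OF assms] by auto
  ultimately show ?thesis by (meson bounded_insert bounded_subset)
qed

lemma test_funs_smooth_family_comp:
  fixes a :: "real^'d \<Rightarrow> complex" and A :: "'p::real_normed_vector \<Rightarrow> real^'d^'d"
  assumes "a \<in> test_funs \<Omega>" "continuous_on UNIV A" "\<And>i j. poly_growth (\<lambda>p. \<bar>A p $ i $ j\<bar>)"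
  shows "smooth_family (\<lambda>p \<xi>. a (A p *v \<xi>))"
  by (rule smooth_family_comp[OF test_funsD(1)[OF assms(1)] test_funs_bounded[OF test_funs_partials[OF assms(1)]] assms(2,3)])

lemma test_funs_comp_matrix:
  fixes A :: "real^'d^'d"
  assumes "a \<in> test_funs \<Omega>"
  shows "smooth_fun (\<lambda>\<xi>. a (A *v \<xi>))"
  using smooth_family_smooth[OF test_funs_smooth_family_comp[OF assms, of "\<lambda>_::real. A"]]
  by (simp add: poly_growth_const)

lemma integrable_compact_support:
  fixes f :: "real^'d \<Rightarrow> complex"
  assumes "continuous_on UNIV f" "compact K" "\<And>x. x \<notin> K \<Longrightarrow> f x = 0"
  shows "integrable lborel f"
proof -
  have "integrable lborel (\<lambda>x. indicator K x *\<^sub>R f x)"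
    using assms by (intro borel_integrable_compact) (auto intro: continuous_on_subset)
  moreover have "(\<lambda>x. indicator K x *\<^sub>R f x) = f" using assms(3) by (auto simp: indicator_def)
  ultimately show ?thesis by simp
qed

lemma test_funs_integrable: "f \<in> test_funs \<Omega> \<Longrightarrow> integrable lborel f"
  by (rule integrable_compact_support[of f "fun_supp f"])
    (auto intro: smooth_fun_continuous test_funsD test_fun_supp)

lemma test_funs_measurable: "f \<in> test_funs \<Omega> \<Longrightarrow> f \<in> borel_measurable borel"
  using test_funs_integrable by force

subsection \<open>Differentiation under the integral sign\<close>

text \<open>Dominated convergence along an arbitrary sequence tending to \<open>x\<close>, applied
  to the remainder of the first-order expansion divided by the distance. One function
  \<open>B\<close> has to dominate the partial derivatives in all directions on the unit ball around
  \<open>x\<close>.\<close>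

lemma has_derivative_lebesgue_integral:
  fixes G :: "'m \<Rightarrow> real^'d \<Rightarrow> complex"
  assumes dif: "\<And>m y. m \<in> space M \<Longrightarrow> G m differentiable (at y)"
    and int: "\<And>y. integrable M (\<lambda>m. G m y)"
    and meas: "\<And>j y. (\<lambda>m. partials [j] (G m) y) \<in> borel_measurable M"
    and bound: "\<And>j y m. m \<in> space M \<Longrightarrow> y \<in> ball x 1 \<Longrightarrow> cmod (partials [j] (G m) y) \<le> B m"
    and B: "integrable M B"
  shows "((\<lambda>y. LINT m|M. G m y) has_derivative
          (\<lambda>t. \<Sum>j\<in>UNIV. t $ j *\<^sub>R (LINT m|M. partials [j] (G m) x))) (at x)"
    and "integrable M (\<lambda>m. partials [j] (G m) x)"
proof -
  have B0: "0 \<le> B m" if "m \<in> space M" for m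
    using bound[OF that, of x undefined] by (meson centre_in_ball norm_ge_zero order_trans zero_less_one)
  show pint: "integrable M (\<lambda>m. partials [j] (G m) x)" for j
    using bound[of _ x j] B0 by (intro Bochner_Integration.integrable_bound[OF B meas] AE_I2) force
  let ?D = "\<lambda>m y t. \<Sum>j\<in>UNIV. t $ j *\<^sub>R partials [j] (G m) y"
  let ?d = "real CARD('d)"
  have der: "(G m has_derivative ?D m y) (at y)" if "m \<in> space M" for m y
  proof -
    have "?D m y = frechet_derivative (G m) (at y)"
      using frechet_derivative_expand[OF dif[OF that]] by auto
    then show ?thesis using dif[OF that, of y] frechet_derivative_works by metis
  qed
  have Dbound: "cmod (?D m y t) \<le> ?d * B m * norm t" if "m \<in> space M" "y \<in> ball x 1" for m y t
  proof -
    have "cmod (?D m y t) \<le> (\<Sum>j\<in>(UNIV::'d set). norm t * B m)"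
      by (intro sum_norm_le) (use bound[OF that] component_le_norm_cart[of t] in \<open>simp add: mult_mono\<close>)
    then show ?thesis by (simp add: mult_ac)
  qed
  show "((\<lambda>y. LINT m|M. G m y) has_derivative (\<lambda>t. \<Sum>j\<in>UNIV. t $ j *\<^sub>R (LINT m|M. partials [j] (G m) x))) (at x)"
    unfolding has_derivative_iff_norm
  proof
    show "bounded_linear (\<lambda>t. \<Sum>j\<in>UNIV. t $ j *\<^sub>R (LINT m|M. partials [j] (G m) x))"
      unfolding linear_conv_bounded_linear[symmetric]
      by (rule linearI) (simp_all add: sum.distrib scaleR_add_left scaleR_sum_right)
    let ?Q = "\<lambda>y m. (1 / norm (y - x)) *\<^sub>R (G m y - G m x - ?D m x (y - x))"
    have eq: "norm ((LINT m|M. G m y) - (LINT m|M. G m x) - (\<Sum>j\<in>UNIV. (y - x) $ j *\<^sub>R (LINT m|M. partials [j] (G m) x))) / norm (y - x)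
       = norm (LINT m|M. ?Q y m)" for y
      using int pint by (simp add: divide_inverse_commute)
    have lim: "((\<lambda>y. LINT m|M. ?Q y m) \<longlongrightarrow> 0) (at x)"
      unfolding tendsto_at_iff_sequentially
    proof (intro allI impI)
      fix Y :: "nat \<Rightarrow> real^'d"
      assume Yne: "\<forall>i. Y i \<in> UNIV - {x}" and Y: "Y \<longlonglongrightarrow> x"
      have "eventually (\<lambda>i. Y i \<in> ball x 1) sequentially"
        using topological_tendstoD[OF Y open_ball] by simp
      then obtain i0 where i0: "\<And>i. i0 \<le> i \<Longrightarrow> Y i \<in> ball x 1"
        unfolding eventually_sequentially by auto
      have "(\<lambda>i. LINT m|M. ?Q (Y (i + i0)) m) \<longlonglongrightarrow> (LINT m|M. 0)"
      proof (rule integral_dominated_convergence[where w = "\<lambda>m. 2 * ?d * B m"])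
        show "integrable M (\<lambda>m. 2 * ?d * B m)" using B by simp
        show "(\<lambda>m. ?Q (Y (i + i0)) m) \<in> borel_measurable M" for i
          using int meas by (intro borel_measurable_scaleR borel_measurable_diff borel_measurable_sum borel_measurable_const) (auto dest: borel_measurable_integrable)
        show "AE m in M. (\<lambda>i. ?Q (Y (i + i0)) m) \<longlonglongrightarrow> 0"
        proof (rule AE_I2)
          fix m assume m: "m \<in> space M"
          have "((\<lambda>y. norm (G m y - G m x - ?D m x (y - x)) / norm (y - x)) \<longlongrightarrow> 0) (at x)"
            using der[OF m, of x] unfolding has_derivative_iff_norm by blast
          then have "((\<lambda>y. norm (G m y - G m x - ?D m x (y - x)) / norm (y - x)) \<circ> (\<lambda>i. Y (i + i0))) \<longlonglongrightarrow> 0"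
            using Yne LIMSEQ_ignore_initial_segment[OF Y, of i0]
            by (elim tendsto_at_iff_sequentially[THEN iffD1, rule_format]) auto
          then show "(\<lambda>i. ?Q (Y (i + i0)) m) \<longlonglongrightarrow> 0"
            by (subst tendsto_norm_zero_iff[symmetric]) (simp add: o_def divide_inverse_commute)
        qed
        show "AE m in M. norm (?Q (Y (i + i0)) m) \<le> 2 * ?d * B m" for i
        proof (rule AE_I2)
          fix m assume m: "m \<in> space M"
          let ?y = "Y (i + i0)"
          have y: "?y \<in> ball x 1" using i0 by simp
          \<comment> \<open>The mean value inequality on the unit ball, with the dimension as the
            price for passing from partial derivatives to the operator norm. The linear term has the
            same bound, hence the factor 2 in the dominating function.\<close>
          have "norm (G m ?y - G m x) \<le> (?d * B m) * norm (?y - x)"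
          proof (rule differentiable_bound[of "ball x 1" "G m" "?D m"])
            show "(G m has_derivative ?D m z) (at z within ball x 1)" for z
              using der[OF m] by (rule has_derivative_at_withinI)
            show "onorm (?D m z) \<le> ?d * B m" if "z \<in> ball x 1" for z
              using Dbound[OF m that] B0[OF m] by (intro onorm_bound) auto
          qed (use y in auto)
          moreover have "norm (?D m x (?y - x)) \<le> ?d * B m * norm (?y - x)"
            by (rule Dbound[OF m]) simp
          ultimately have "norm (G m ?y - G m x - ?D m x (?y - x)) \<le> 2 * ?d * B m * norm (?y - x)"
            using norm_triangle_ineq4[of "G m ?y - G m x" "?D m x (?y - x)"] by linarith
          moreover have "0 < norm (?y - x)" using Yne by simp
          ultimately show "norm (?Q ?y m) \<le> 2 * ?d * B m"
            unfolding norm_scaleR by (simp add: pos_divide_le_eq)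
        qed
      qed simp
      then have "(\<lambda>i. (LINT m|M. ?Q (Y (i + i0)) m)) \<longlonglongrightarrow> 0" by simp
      then have "(\<lambda>i. (LINT m|M. ?Q (Y i) m)) \<longlonglongrightarrow> 0" by (rule LIMSEQ_offset)
      then show "((\<lambda>y. LINT m|M. ?Q y m) \<circ> Y) \<longlonglongrightarrow> 0" by (simp add: o_def)
    qed
    from tendsto_norm_zero[OF lim]
    show "((\<lambda>y. norm ((LINT m|M. G m y) - (LINT m|M. G m x) - (\<Sum>j\<in>UNIV. (y - x) $ j *\<^sub>R (LINT m|M. partials [j] (G m) x))) / norm (y - x)) \<longlongrightarrow> 0) (at x)"
      unfolding eq .
  qed
qed

lemma smooth_fun_lebesgue_integral:
  fixes G :: "'m \<Rightarrow> real^'d \<Rightarrow> complex"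
  assumes sm: "\<And>m. m \<in> space M \<Longrightarrow> smooth_fun (G m)"
    and meas: "\<And>js y. (\<lambda>m. partials js (G m) y) \<in> borel_measurable M"
    and bound: "\<And>js y m. m \<in> space M \<Longrightarrow> cmod (partials js (G m) y) \<le> B js m"
    and B: "\<And>js. integrable M (B js)"
  shows "smooth_fun (\<lambda>y. LINT m|M. G m y)"
    and "partials js (\<lambda>y. LINT m|M. G m y) = (\<lambda>y. LINT m|M. partials js (G m) y)"
    and "integrable M (\<lambda>m. partials js (G m) y)"
proof -
  show int: "integrable M (\<lambda>m. partials js (G m) y)" for js y
    using bound[of _ js y] by (intro Bochner_Integration.integrable_bound[OF B[of js] meas] AE_I2) force
  have d: "((\<lambda>y. LINT m|M. partials js (G m) y) has_derivative
          (\<lambda>t. \<Sum>j\<in>UNIV. t $ j *\<^sub>R (LINT m|M. partials [j] (partials js (G m)) x))) (at x)" for js x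
  \<comment> \<open>Summing over the directions gives the single dominating function that the lemma
    asks for.\<close>
  proof (rule has_derivative_lebesgue_integral[where B = "\<lambda>m. \<Sum>j\<in>UNIV. B (j # js) m"])
    show "cmod (partials [j] (partials js (G m)) y) \<le> (\<Sum>j\<in>UNIV. B (j # js) m)" if m: "m \<in> space M" for m y j
    proof -
      have "cmod (partials (j # js) (G m) y) \<le> B (j # js) m" by (rule bound[OF m])
      also have "0 \<le> B (i # js) m" for i by (rule order_trans[OF norm_ge_zero bound[OF m]])
      then have "B (j # js) m \<le> (\<Sum>j\<in>UNIV. B (j # js) m)" by (intro member_le_sum) auto
      finally show ?thesis by (simp add: partials_Cons[of j js])
    qed
    show "(\<lambda>m. partials [j] (partials js (G m)) y) \<in> borel_measurable M" for j y
      using meas[of "j # js" y] by (simp add: partials_Cons[of j js])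
  qed (auto intro: partials_differentiable sm int B)
  have ax: "(\<Sum>j\<in>UNIV. axis i 1 $ j *\<^sub>R c j) = c i" for i :: 'd and c :: "'d \<Rightarrow> complex"
    by (simp add: axis_def if_distrib[of "\<lambda>r. r *\<^sub>R _"] sum.delta cong: if_cong)
  show p: "partials js (\<lambda>y. LINT m|M. G m y) = (\<lambda>y. LINT m|M. partials js (G m) y)" for js
  proof (induction js)
    case (Cons j js)
    show ?case
      unfolding partials_Cons[of j js] Cons.IH
      using partials_1_eq[OF d[of js], of j] ax by (intro ext) simp
  qed simp
  show "smooth_fun (\<lambda>y. LINT m|M. G m y)"
    unfolding smooth_fun_def differentiable_on_def p using differentiableI[OF d] by auto
qed

subsection \<open>Linear changes of variables\<close>

lemma nn_integral_lborel_shift: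
  fixes c :: "'a::euclidean_space"
  assumes [measurable]: "f \<in> borel_measurable borel"
  shows "(\<integral>\<^sup>+x. f (c + x) \<partial>lborel) = (\<integral>\<^sup>+x. f x \<partial>lborel)"
proof -
  have "(\<integral>\<^sup>+x. f x \<partial>lborel) = (\<integral>\<^sup>+x. f x \<partial>distr lborel borel ((+) c))"
    by (simp add: lborel_distr_plus)
  also have "\<dots> = (\<integral>\<^sup>+x. f (c + x) \<partial>lborel)"
    by (subst nn_integral_distr) auto
  finally show ?thesis ..
qed

lemma lborel_distr_reflect: "distr lborel borel (\<lambda>x. c - x) = (lborel :: 'a::euclidean_space measure)"
  using lborel_affine[of "-1" c] by (simp add: density_1)

lemma nn_integral_lborel_reflect:
  fixes c :: "'a::euclidean_space"
  assumes [measurable]: "f \<in> borel_measurable borel"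
  shows "(\<integral>\<^sup>+x. f (c - x) \<partial>lborel) = (\<integral>\<^sup>+x. f x \<partial>lborel)"
proof -
  have "(\<integral>\<^sup>+x. f x \<partial>lborel) = (\<integral>\<^sup>+x. f x \<partial>distr lborel borel (\<lambda>x. c - x))"
    by (simp add: lborel_distr_reflect)
  also have "\<dots> = (\<integral>\<^sup>+x. f (c - x) \<partial>lborel)"
    by (subst nn_integral_distr) auto
  finally show ?thesis ..
qed

lemma integral_lborel_shift:
  fixes f :: "'a::euclidean_space \<Rightarrow> complex"
  assumes [measurable]: "f \<in> borel_measurable borel"
  shows "(LINT x|lborel. f (c + x)) = (LINT x|lborel. f x)"
proof -
  have "(LINT x|lborel. f x) = (LINT x|distr lborel borel ((+) c). f x)"
    by (simp add: lborel_distr_plus)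
  also have "\<dots> = (LINT x|lborel. f (c + x))"
    by (subst integral_distr) auto
  finally show ?thesis ..
qed

lemma integral_lborel_reflect:
  fixes f :: "'a::euclidean_space \<Rightarrow> complex"
  assumes [measurable]: "f \<in> borel_measurable borel"
  shows "(LINT x|lborel. f (c - x)) = (LINT x|lborel. f x)"
proof -
  have "(LINT x|lborel. f x) = (LINT x|distr lborel borel (\<lambda>x. c - x). f x)"
    by (simp add: lborel_distr_reflect)
  also have "\<dots> = (LINT x|lborel. f (c - x))"
    by (subst integral_distr) auto
  finally show ?thesis ..
qed

lemma integrable_lborel_shift:
  fixes f :: "'a::euclidean_space \<Rightarrow> complex"
  assumes "integrable lborel f"
  shows "integrable lborel (\<lambda>x. f (c + x))"
proof -
  have "integrable (distr lborel borel ((+) c)) f"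
    using assms by (simp add: lborel_distr_plus)
  then show ?thesis by (subst (asm) integrable_distr_eq) (use assms in auto)
qed

lemma matrix_vector_measurable [measurable]:
  fixes A :: "real^'n^'m"
  assumes [measurable]: "f \<in> borel_measurable M"
  shows "(\<lambda>x. A *v f x) \<in> borel_measurable M"
  by (rule measurable_compose[OF assms], rule borel_measurable_continuous_onI)
     (intro linear_continuous_on matrix_vector_mul_bounded_linear)

lemma matrix_inv_cancel:
  fixes A :: "real^'d^'d"
  assumes "invertible A"
  shows "A ** matrix_inv A = mat 1" "matrix_inv A ** A = mat 1"
  using someI_ex[OF assms[unfolded invertible_def]] unfolding matrix_inv_def by auto

lemma invertible_matrix_inv: "invertible A \<Longrightarrow> invertible (matrix_inv A)" for A :: "real^'d^'d"
  unfolding invertible_def using matrix_inv_cancel[of A, unfolded invertible_def] by blast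

text \<open>
  Fubini's theorem and translation invariance show that Lebesgue measure transforms under an
  invertible matrix by a constant factor.  The factor is multiplicative, which determines it on
  the elementary matrices: a transposition is an involution, and a shear is conjugate to its square.
\<close>

lemma nn_integral_matrix_ratio:
  fixes A :: "real^'d^'d"
  assumes A: "invertible A" and [measurable]: "f \<in> borel_measurable borel" "g \<in> borel_measurable borel"
  shows "(\<integral>\<^sup>+x. f x \<partial>lborel) * (\<integral>\<^sup>+y. g (A *v y) \<partial>lborel) = (\<integral>\<^sup>+y. f (A *v y) \<partial>lborel) * (\<integral>\<^sup>+x. g x \<partial>lborel)"
proof -
  have Ainv: "A *v (matrix_inv A *v x) = x" for x
    using A by (simp add: matrix_vector_mul_assoc matrix_inv_cancel)
  have "(\<integral>\<^sup>+x. f x \<partial>lborel) * (\<integral>\<^sup>+y. g (A *v y) \<partial>lborel) = (\<integral>\<^sup>+y. (\<integral>\<^sup>+x. f x \<partial>lborel) * g (A *v y) \<partial>lborel)"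
    by (simp add: nn_integral_cmult)
  also have "\<dots> = (\<integral>\<^sup>+y. (\<integral>\<^sup>+x. f (A *v y + x) \<partial>lborel) * g (A *v y) \<partial>lborel)"
    by (simp add: nn_integral_lborel_shift)
  also have "\<dots> = (\<integral>\<^sup>+y. (\<integral>\<^sup>+x. f (A *v y + x) * g (A *v y) \<partial>lborel) \<partial>lborel)"
    by (simp add: nn_integral_multc)
  also have "\<dots> = (\<integral>\<^sup>+x. (\<integral>\<^sup>+y. f (A *v y + x) * g (A *v y) \<partial>lborel) \<partial>lborel)"
    by (rule lborel_pair.Fubini') measurable
  \<comment> \<open>Translating y by the preimage of x under \<open>A\<close> moves the shift from
    the argument of f to that of g, so that the remaining x-integral involves g alone.\<close>
  also have "\<dots> = (\<integral>\<^sup>+x. (\<integral>\<^sup>+y. f (A *v y) * g (A *v y - x) \<partial>lborel) \<partial>lborel)"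
  proof (rule nn_integral_cong)
    fix x
    have "(\<integral>\<^sup>+y. f (A *v y + x) * g (A *v y) \<partial>lborel)
        = (\<integral>\<^sup>+y. f (A *v (matrix_inv A *v x + y)) * g (A *v (matrix_inv A *v x + y) - x) \<partial>lborel)"
      by (simp add: matrix_vector_right_distrib Ainv add.commute)
    also have "\<dots> = (\<integral>\<^sup>+y. f (A *v y) * g (A *v y - x) \<partial>lborel)"
      by (rule nn_integral_lborel_shift[where f = "\<lambda>y. f (A *v y) * g (A *v y - x)"]) measurable
    finally show "(\<integral>\<^sup>+y. f (A *v y + x) * g (A *v y) \<partial>lborel) = (\<integral>\<^sup>+y. f (A *v y) * g (A *v y - x) \<partial>lborel)" .
  qed
  also have "\<dots> = (\<integral>\<^sup>+y. (\<integral>\<^sup>+x. f (A *v y) * g (A *v y - x) \<partial>lborel) \<partial>lborel)"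
    by (rule lborel_pair.Fubini'[symmetric]) measurable
  also have "\<dots> = (\<integral>\<^sup>+y. f (A *v y) * (\<integral>\<^sup>+x. g (A *v y - x) \<partial>lborel) \<partial>lborel)"
    by (simp add: nn_integral_cmult)
  also have "\<dots> = (\<integral>\<^sup>+y. f (A *v y) \<partial>lborel) * (\<integral>\<^sup>+x. g x \<partial>lborel)"
    by (simp add: nn_integral_lborel_reflect nn_integral_multc)
  finally show ?thesis .
qed

text \<open>The volume of the preimage of the unit cube. Comparing an arbitrary function with the
  indicator of the cube shows that this is the factor for every function.\<close>

definition matrix_modulus :: "real^'d^'d \<Rightarrow> ennreal" where
  "matrix_modulus A = (\<integral>\<^sup>+x. indicator (cbox 0 One) (A *v x) \<partial>lborel)"

lemma nn_integral_matrix_modulus: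
  fixes A :: "real^'d^'d"
  assumes "invertible A" and [measurable]: "f \<in> borel_measurable borel"
  shows "(\<integral>\<^sup>+x. f (A *v x) \<partial>lborel) = matrix_modulus A * (\<integral>\<^sup>+x. f x \<partial>lborel)"
proof -
  have 1: "(\<integral>\<^sup>+x. indicator (cbox 0 One) x \<partial>(lborel :: (real^'d) measure)) = 1"
    by (simp add: emeasure_lborel_cbox_eq)
  show ?thesis
    using nn_integral_matrix_ratio[OF assms(1), of f "indicator (cbox 0 One)"]
    unfolding 1 matrix_modulus_def by (simp add: mult.commute)
qed

lemma matrix_modulus_mult:
  fixes A B :: "real^'d^'d"
  assumes "invertible A" "invertible B"
  shows "matrix_modulus (A ** B) = matrix_modulus A * matrix_modulus B"
proof -
  have "matrix_modulus (A ** B) = (\<integral>\<^sup>+x. indicator (cbox 0 One) (A *v (B *v x)) \<partial>lborel)"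
    by (simp add: matrix_modulus_def matrix_vector_mul_assoc)
  also have "\<dots> = matrix_modulus B * (\<integral>\<^sup>+x. indicator (cbox 0 One) (A *v x) \<partial>lborel)"
    by (rule nn_integral_matrix_modulus[OF assms(2), where f = "\<lambda>x. indicator (cbox 0 One) (A *v x)"]) measurable
  finally show ?thesis by (simp add: matrix_modulus_def mult.commute)
qed

lemma matrix_modulus_1: "matrix_modulus (mat 1 :: real^'d^'d) = 1"
  unfolding matrix_modulus_def by (simp add: emeasure_lborel_cbox_eq)

lemma matrix_modulus_pos_finite:
  fixes A :: "real^'d^'d"
  assumes "invertible A"
  shows "matrix_modulus A \<noteq> 0" "matrix_modulus A \<noteq> top"
proof -
  have "matrix_modulus A * matrix_modulus (matrix_inv A) = 1"
    using matrix_modulus_mult[OF assms invertible_matrix_inv[OF assms]] assms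
    by (simp add: matrix_inv_cancel matrix_modulus_1)
  then show "matrix_modulus A \<noteq> 0" "matrix_modulus A \<noteq> top"
    by (auto simp: ennreal_top_mult split: if_splits)
qed

lemma bij_betw_axis_Basis: "bij_betw (\<lambda>i. axis i (1::real)) UNIV (Basis :: (real^'d) set)"
  by (auto simp: bij_betw_def inj_on_def axis_eq_axis Basis_vec_def)

text \<open>The one case that is computed directly, from scaling along coordinates; the other
  elementary matrices have factor 1 by algebra.\<close>

lemma matrix_modulus_diagonal:
  fixes A :: "real^'d^'d"
  assumes diag: "\<And>i j. i \<noteq> j \<Longrightarrow> A $ i $ j = 0" and inv: "invertible A"
  shows "matrix_modulus A = ennreal (1 / \<bar>det A\<bar>)"
proof -
  have det: "det A = (\<Prod>i\<in>UNIV. A $ i $ i)" by (rule det_diagonal) (use diag in auto)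
  then have nz: "A $ i $ i \<noteq> 0" for i using inv by (auto simp: invertible_det_nz)
  define c where "c b = (A *v b) \<bullet> b" for b
  have c: "c (axis i 1) = A $ i $ i" for i
    by (simp add: c_def matrix_vector_axis inner_axis)
  have T: "0 + (\<Sum>j\<in>Basis. (c j * (x \<bullet> j)) *\<^sub>R j) = A *v x" for x
  proof -
    have "(\<Sum>j\<in>Basis. (c j * (x \<bullet> j)) *\<^sub>R j) = (\<Sum>i\<in>UNIV. (A $ i $ i * x $ i) *\<^sub>R axis i 1)"
      using sum.reindex_bij_betw[OF bij_betw_axis_Basis, of "\<lambda>j. (c j * (x \<bullet> j)) *\<^sub>R j"]
      by (simp add: c inner_axis)
    also have "\<dots> = A *v x"
    proof (subst vec_eq_iff, rule allI)
      fix i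
      have "(\<Sum>i\<in>UNIV. (A $ i $ i * x $ i) *\<^sub>R axis i 1) $ i = A $ i $ i * x $ i"
        by (simp add: axis_def if_distrib[of "\<lambda>r. _ * r"] cong: if_cong)
      also have "\<dots> = (\<Sum>j\<in>UNIV. A $ i $ j * x $ j)"
      proof -
        have "(\<Sum>j\<in>UNIV. A $ i $ j * x $ j) = (\<Sum>j\<in>UNIV. if j = i then A $ i $ i * x $ i else 0)"
          by (intro sum.cong) (use diag in auto)
        then show ?thesis by simp
      qed
      finally show "(\<Sum>i\<in>UNIV. (A $ i $ i * x $ i) *\<^sub>R axis i 1) $ i = (A *v x) $ i"
        by (simp add: matrix_vector_mult_def)
    qed
    finally show ?thesis by simp
  qed
  have cnz: "\<And>j. j \<in> Basis \<Longrightarrow> c j \<noteq> 0" using c nz by (auto simp: Basis_vec_def)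
  have prod: "(\<Prod>j\<in>Basis. \<bar>c j\<bar>) = \<bar>det A\<bar>"
    using prod.reindex_bij_betw[OF bij_betw_axis_Basis, of "\<lambda>j. \<bar>c j\<bar>"] by (simp add: c det abs_prod)
  have *: "lborel = density (distr lborel borel ((*v) A)) (\<lambda>_. ennreal \<bar>det A\<bar>)"
    using lborel_affine_euclidean[of c 0, OF cnz] unfolding T prod by (simp add: eta_contract_eq)
  have "1 = (\<integral>\<^sup>+x. indicator (cbox 0 One) x \<partial>(lborel :: (real^'d) measure))"
    by (simp add: emeasure_lborel_cbox_eq)
  also have "\<dots> = (\<integral>\<^sup>+x. indicator (cbox 0 One) x \<partial>density (distr lborel borel ((*v) A)) (\<lambda>_. ennreal \<bar>det A\<bar>))"
    using * by simp
  also have "\<dots> = ennreal \<bar>det A\<bar> * matrix_modulus A"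
    unfolding matrix_modulus_def
    by (subst nn_integral_density, simp, simp, subst nn_integral_distr, simp, simp) (simp add: nn_integral_cmult)
  finally have 1: "ennreal \<bar>det A\<bar> * matrix_modulus A = 1" ..
  have nz': "det A \<noteq> 0" using inv by (simp add: invertible_det_nz)
  have "matrix_modulus A = ennreal (1 / \<bar>det A\<bar>) * (ennreal \<bar>det A\<bar> * matrix_modulus A)"
    using nz' by (simp flip: mult.assoc ennreal_mult)
  then show ?thesis unfolding 1 by simp
qed

lemma ennreal_idem_mult: "(k::ennreal) * k = k \<Longrightarrow> k \<noteq> 0 \<Longrightarrow> k \<noteq> top \<Longrightarrow> k = 1"
  by (cases k) (auto simp flip: ennreal_mult simp: ennreal_eq_1)

lemma matrix_modulus_eq:
  fixes A :: "real^'d^'d"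
  shows "invertible A \<longrightarrow> matrix_modulus A = ennreal (1 / \<bar>det A\<bar>)"
proof (induction A rule: induct_matrix_elementary_alt)
  case (1 A B)
  show ?case
  proof
    assume "invertible (A ** B)"
    then have "invertible A" "invertible B" by (auto simp: invertible_det_nz det_mul)
    then show "matrix_modulus (A ** B) = ennreal (1 / \<bar>det (A ** B)\<bar>)"
      using 1 by (simp add: matrix_modulus_mult det_mul abs_mult flip: ennreal_mult)
  qed
next
  case (2 A i)
  then show ?case by (auto simp: invertible_det_nz det_zero_row)
next
  case (3 A)
  then show ?case using matrix_modulus_diagonal by blast
next
  case (4 m n)
  let ?A = "(\<chi> i j. mat 1 $ i $ Transposition.transpose m n j) :: real^'d^'d"
  have mult: "(?A ** B) $ i $ j = B $ (Transposition.transpose m n i) $ j" for B :: "real^'d^'d" and i j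
  proof -
    have "(?A ** B) $ i $ j = (\<Sum>k\<in>UNIV. if k = Transposition.transpose m n i then B $ k $ j else 0)"
    proof -
      have "i = Transposition.transpose m n k \<longleftrightarrow> k = Transposition.transpose m n i" for k
        by (metis transpose_involutory)
      then show ?thesis
        unfolding matrix_matrix_mult_def mat_def by (simp add: if_distrib[of "\<lambda>r. r * _"] cong: if_cong)
    qed
    then show ?thesis by simp
  qed
  have sq: "?A ** ?A = mat 1"
    unfolding vec_eq_iff mult by (auto simp: mat_def dest: arg_cong[where f = "Transposition.transpose m n"])
  then have inv: "invertible ?A" unfolding invertible_def by blast
  have "matrix_modulus ?A * matrix_modulus ?A = 1"
    using matrix_modulus_mult[OF inv inv] sq by (simp add: matrix_modulus_1)
  then have "matrix_modulus ?A = 1"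
    using matrix_modulus_pos_finite[OF inv] by (cases "matrix_modulus ?A")
      (auto simp flip: ennreal_mult simp: ennreal_eq_1 square_eq_1_iff)
  moreover have "\<bar>det ?A\<bar> = 1"
    using det_mul[of ?A ?A] sq by (simp add: abs_square_eq_1 power2_eq_square[symmetric])
  ultimately show ?case by simp
next
  case (5 m n)
  let ?S = "(\<chi> i j. of_bool (i = m \<and> j = n \<or> i = j)) :: real^'d^'d"
  \<comment> \<open>Doubling coordinate m doubles the amount of the shear, so conjugation by
    \<open>?D\<close> turns \<open>?S\<close> into its square. Its factor and its determinant are
    then equal to their own squares.\<close>
  let ?D = "(\<chi> i j. if i = j then if i = m then 2 else 1 else 0) :: real^'d^'d"
  have Dl: "(?D ** B) $ i $ j = (if i = m then 2 else 1) * B $ i $ j" for B i j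
    by (simp add: matrix_matrix_mult_def if_distrib[of "\<lambda>r. r * _"] cong: if_cong)
  have Dr: "(B ** ?D) $ i $ j = B $ i $ j * (if j = m then 2 else 1)" for B i j
    by (simp add: matrix_matrix_mult_def if_distrib[of "\<lambda>r. _ * r"] cong: if_cong)
  have S: "(?S ** B) $ i $ j = (if i = m then B $ m $ j + B $ n $ j else B $ i $ j)" for B i j
  proof -
    have "(?S ** B) $ i $ j = (\<Sum>k\<in>UNIV. (if k = i then B $ i $ j else 0) + (if i = m \<and> k = n then B $ n $ j else 0))"
      unfolding matrix_matrix_mult_def using 5 by (auto intro!: sum.cong)
    then show ?thesis by (simp add: sum.distrib)
  qed
  have comm: "?D ** ?S = (?S ** ?S) ** ?D"
    unfolding vec_eq_iff Dl Dr S using 5 by auto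
  have dD: "det ?D \<noteq> 0" by (subst det_diagonal) auto
  then have invD: "invertible ?D" by (simp add: invertible_det_nz)
  show ?case
  proof
    assume inv: "invertible ?S"
    have inv2: "invertible (?S ** ?S)" using inv by (simp add: invertible_det_nz det_mul)
    have "matrix_modulus ?D * matrix_modulus ?S = matrix_modulus ?S * matrix_modulus ?S * matrix_modulus ?D"
      using comm matrix_modulus_mult[OF invD inv] matrix_modulus_mult[OF inv2 invD] matrix_modulus_mult[OF inv inv] by simp
    then have "matrix_modulus ?S * matrix_modulus ?S = matrix_modulus ?S"
      using matrix_modulus_pos_finite[OF invD] by (simp add: mult.commute[of _ "matrix_modulus ?D"] ennreal_mult_cancel_left)
    then have "matrix_modulus ?S = 1"
      using matrix_modulus_pos_finite[OF inv] by (intro ennreal_idem_mult)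
    moreover have "det ?D * det ?S = det ?S * det ?S * det ?D"
      using arg_cong[where f = det, OF comm] unfolding det_mul .
    then have "det ?S = 1" using dD inv by (simp add: invertible_det_nz)
    ultimately show "matrix_modulus ?S = ennreal (1 / \<bar>det ?S\<bar>)" by simp
  qed
qed

lemma nn_integral_lborel_matrix:
  fixes A :: "real^'d^'d"
  assumes "invertible A" "f \<in> borel_measurable borel"
  shows "(\<integral>\<^sup>+x. f (A *v x) \<partial>lborel) = ennreal (1 / \<bar>det A\<bar>) * (\<integral>\<^sup>+x. f x \<partial>lborel)"
  using nn_integral_matrix_modulus[OF assms] matrix_modulus_eq[of A] assms by simp

lemma lborel_distr_matrix:
  fixes A :: "real^'d^'d"
  assumes "invertible A"
  shows "distr lborel borel (\<lambda>x. A *v x) = density lborel (\<lambda>_. ennreal (1 / \<bar>det A\<bar>))"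
proof (rule measure_eqI)
  fix X assume "X \<in> sets (distr lborel borel (\<lambda>x. A *v x))"
  then have [measurable]: "X \<in> sets borel" by simp
  have "emeasure (distr lborel borel (\<lambda>x. A *v x)) X = (\<integral>\<^sup>+x. indicator X (A *v x) \<partial>lborel)"
    by (subst nn_integral_indicator[symmetric], simp, subst nn_integral_distr) auto
  also have "\<dots> = emeasure (density lborel (\<lambda>_. ennreal (1 / \<bar>det A\<bar>))) X"
    by (subst nn_integral_lborel_matrix[OF assms]) (auto simp: emeasure_density nn_integral_cmult)
  finally show "emeasure (distr lborel borel (\<lambda>x. A *v x)) X = emeasure (density lborel (\<lambda>_. ennreal (1 / \<bar>det A\<bar>))) X" .
qed simp

lemma integral_lborel_matrix:
  fixes A :: "real^'d^'d" and f :: "real^'d \<Rightarrow> complex"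
  assumes "invertible A" and [measurable]: "f \<in> borel_measurable borel"
  shows "(LINT x|lborel. f (A *v x)) = of_real (1 / \<bar>det A\<bar>) * (LINT x|lborel. f x)"
proof -
  have "(LINT x|lborel. f (A *v x)) = (LINT x|distr lborel borel (\<lambda>x. A *v x). f x)"
    by (subst integral_distr) auto
  also have "\<dots> = (LINT x|lborel. (1 / \<bar>det A\<bar>) *\<^sub>R f x)"
    unfolding lborel_distr_matrix[OF assms(1)] by (subst integral_density) auto
  also have "\<dots> = of_real (1 / \<bar>det A\<bar>) * (LINT x|lborel. f x)"
    by (simp add: scaleR_conv_of_real)
  finally show ?thesis .
qed

subsection \<open>Rapidly decreasing functions\<close>

lemma integrable_inverse_one_plus_square: "integrable lborel (\<lambda>x::real. inverse (1 + x\<^sup>2))"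
  using integrable_inverse_1_plus_square unfolding set_integrable_def by simp

lemma integrable_prod_inverse:
  "integrable lborel (\<lambda>x::real^'d. \<Prod>b\<in>Basis. inverse (1 + (x \<bullet> b)\<^sup>2))"
proof (rule integrableI_bounded)
  have "(\<integral>\<^sup>+x. ennreal (norm (\<Prod>b\<in>Basis. inverse (1 + ((x::real^'d) \<bullet> b)\<^sup>2))) \<partial>lborel)
      = (\<integral>\<^sup>+x. (\<Prod>b\<in>Basis. ennreal (inverse (1 + ((x::real^'d) \<bullet> b)\<^sup>2))) \<partial>lborel)"
    by (intro nn_integral_cong) (simp add: prod_ennreal prod_nonneg abs_of_nonneg)
  also have "\<dots> = (\<Prod>b\<in>(Basis::(real^'d) set). \<integral>\<^sup>+x. ennreal (inverse (1 + x\<^sup>2)) \<partial>lborel)"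
    by (rule nn_integral_lborel_prod) auto
  also have "\<dots> < \<infinity>"
    using integrable_inverse_one_plus_square
    by (auto simp: integrable_iff_bounded power_less_top_ennreal)
  finally show "(\<integral>\<^sup>+x. ennreal (norm (\<Prod>b\<in>Basis. inverse (1 + ((x::real^'d) \<bullet> b)\<^sup>2))) \<partial>lborel) < \<infinity>" .
qed measurable

text \<open>The exponent is twice the dimension because each of the one-dimensional factors 1 + t^2
  is at most (1 + |x|)^2, and the product of their inverses is integrable.\<close>

lemma integrable_polynomial_decay:
  "integrable lborel (\<lambda>x::real^'d. 1 / (1 + norm x) ^ (2 * CARD('d)))"
proof (rule Bochner_Integration.integrable_bound[OF integrable_prod_inverse])
  have "norm (1 / (1 + norm x) ^ (2 * CARD('d))) \<le> norm (\<Prod>b\<in>Basis. inverse (1 + (x \<bullet> b)\<^sup>2))" for x :: "real^'d"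
  proof -
    have "(\<Prod>b\<in>Basis. 1 + (x \<bullet> b)\<^sup>2) \<le> (\<Prod>b\<in>(Basis::(real^'d) set). (1 + norm x)\<^sup>2)"
    proof (intro prod_mono conjI)
      fix b :: "real^'d" assume "b \<in> Basis"
      then have "(x \<bullet> b)\<^sup>2 \<le> (norm x)\<^sup>2" using Basis_le_norm[of b x] abs_le_square_iff[of "x \<bullet> b" "norm x"] by simp
      then show "1 + (x \<bullet> b)\<^sup>2 \<le> (1 + norm x)\<^sup>2" using mult_nonneg_nonneg[of 2 "norm x"] norm_ge_zero[of x] unfolding power2_sum by (simp add: add_increasing2)
    qed simp
    also have "\<dots> = (1 + norm x) ^ (2 * CARD('d))" by (simp add: power_mult)
    finally have "(\<Prod>b\<in>Basis. 1 + (x \<bullet> b)\<^sup>2) \<le> (1 + norm x) ^ (2 * CARD('d))" .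
    moreover have "0 < (\<Prod>b\<in>Basis. 1 + (x \<bullet> b)\<^sup>2)" by (intro prod_pos) (simp add: add_pos_nonneg)
    ultimately have "1 / (1 + norm x) ^ (2 * CARD('d)) \<le> 1 / (\<Prod>b\<in>Basis. 1 + (x \<bullet> b)\<^sup>2)"
      by (intro divide_left_mono mult_pos_pos) (auto intro: zero_less_power add_pos_nonneg)
    then show ?thesis by (simp add: prod_inversef[symmetric] inverse_eq_divide prod_nonneg abs_of_nonneg prod_dividef)
  qed
  then show "AE x in lborel. norm (1 / (1 + norm x) ^ (2 * CARD('d))) \<le> norm (\<Prod>b\<in>Basis. inverse (1 + ((x::real^'d) \<bullet> b)\<^sup>2))"
    by simp
qed measurable

text \<open>Decay of the function alone, without derivatives: this is what integration against a
  family of polynomial growth requires.\<close>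

definition rapidly_decreasing :: "(real^'d \<Rightarrow> complex) \<Rightarrow> bool" where
  "rapidly_decreasing \<theta> \<longleftrightarrow> \<theta> \<in> borel_measurable lborel \<and>
     (\<forall>n. \<exists>C. \<forall>x. (1 + norm x) ^ n * cmod (\<theta> x) \<le> C)"

lemma norm_one_plus_norm_power_mult:
  "cmod (of_real ((1 + norm x) ^ n) * z) = (1 + norm x) ^ n * cmod z"
  unfolding norm_mult norm_of_real by simp

lemma rapidly_decreasing_integrable:
  assumes "rapidly_decreasing \<theta>"
  shows "integrable lborel (\<lambda>x. of_real ((1 + norm x) ^ n) * \<theta> x)" "integrable lborel \<theta>"
proof -
  have *: "integrable lborel (\<lambda>x. of_real ((1 + norm x) ^ n) * \<theta> x)" for n
  proof -
    have [measurable]: "\<theta> \<in> borel_measurable lborel" using assms by (simp add: rapidly_decreasing_def)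
    obtain C where C: "\<And>x. (1 + norm x) ^ (n + 2 * CARD('a)) * cmod (\<theta> x) \<le> C"
      using assms unfolding rapidly_decreasing_def by blast
    show ?thesis
    proof (rule Bochner_Integration.integrable_bound)
      show "integrable lborel (\<lambda>x::real^'a. C * (1 / (1 + norm x) ^ (2 * CARD('a))))"
        by (intro integrable_mult_right integrable_polynomial_decay)
      have "norm (of_real ((1 + norm x) ^ n) * \<theta> x) \<le> norm (C * (1 / (1 + norm x) ^ (2 * CARD('a))))" for x
      proof -
        have p: "0 < (1 + norm x) ^ (2 * CARD('a))" by (intro zero_less_power) (simp add: add_pos_nonneg)
        have "((1 + norm x) ^ n * cmod (\<theta> x)) * (1 + norm x) ^ (2 * CARD('a)) \<le> C"
          using C[of x] by (simp add: power_add mult_ac)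
        then have "(1 + norm x) ^ n * cmod (\<theta> x) \<le> C * (1 / (1 + norm x) ^ (2 * CARD('a)))"
          using p by (simp add: field_simps)
        moreover have "C \<le> \<bar>C\<bar>" by simp
        then have "C * (1 / (1 + norm x) ^ (2 * CARD('a))) \<le> \<bar>C\<bar> * (1 / (1 + norm x) ^ (2 * CARD('a)))"
          using p by (intro mult_right_mono) auto
        ultimately show ?thesis unfolding norm_one_plus_norm_power_mult by simp
      qed
      then show "AE x in lborel. norm (of_real ((1 + norm x) ^ n) * \<theta> x) \<le> norm (C * (1 / (1 + norm x) ^ (2 * CARD('a))))"
        by simp
    qed measurable
  qed
  show "integrable lborel (\<lambda>x. of_real ((1 + norm x) ^ n) * \<theta> x)" by (rule *)
  show "integrable lborel \<theta>" using *[of 0] by simp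
qed

lemma schwartz_rapidly_decreasing:
  assumes "\<theta> \<in> schwartz_funs"
  shows "rapidly_decreasing \<theta>"
  unfolding rapidly_decreasing_def
proof (intro conjI allI)
  have "smooth_fun \<theta>" using assms by (simp add: schwartz_funs_def)
  then show "\<theta> \<in> borel_measurable lborel"
    using smooth_fun_continuous[of \<theta> UNIV] by (simp add: borel_measurable_continuous_onI)
  fix n
  have "bounded (range (\<lambda>x. of_real ((1 + norm x) ^ n) * partials [] \<theta> x))"
    using assms unfolding schwartz_funs_def by blast
  then show "\<exists>C. \<forall>x. (1 + norm x) ^ n * cmod (\<theta> x) \<le> C"
    unfolding bounded_iff ball_simps norm_one_plus_norm_power_mult by simp
qed

subsection \<open>The Fourier transform of test functions\<close>

lemma inv_fourier_chi: "inv_fourier g x = (LINT \<xi>|lborel. g \<xi> * chi x \<xi>)"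
  by (simp add: inv_fourier_def chi_def)

lemma fourier_chi: "fourier f \<xi> = (LINT x|lborel. f x * chi \<xi> (- x))"
  by (simp add: fourier_def chi_def inner_commute)

lemma fourier_chi': "fourier f \<xi> = (LINT x|lborel. f x * chi x (- \<xi>))"
  by (simp add: fourier_def chi_def)

lemma fourier_eq_inv_fourier: "fourier f \<xi> = inv_fourier f (- \<xi>)"
  by (simp add: fourier_chi inv_fourier_chi chi_minus)

lemma cnj_fourier: "cnj (fourier f \<xi>) = inv_fourier (\<lambda>x. cnj (f x)) \<xi>"
  unfolding fourier_chi inv_fourier_chi Bochner_Integration.integral_cnj[symmetric] complex_cnj_mult cnj_chi(2) minus_minus ..

lemma cnj_inv_fourier: "cnj (inv_fourier f \<xi>) = fourier (\<lambda>x. cnj (f x)) \<xi>"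
  unfolding fourier_chi inv_fourier_chi Bochner_Integration.integral_cnj[symmetric] complex_cnj_mult cnj_chi(2) ..

lemma (in pair_sigma_finite) integrable_product:
  fixes f g :: "_ \<Rightarrow> complex"
  assumes f: "integrable M1 f" and g: "integrable M2 g"
  shows "integrable (M1 \<Otimes>\<^sub>M M2) (\<lambda>(x, y). f x * g y)"
proof (rule Fubini_integrable)
  have [measurable]: "f \<in> borel_measurable M1" "g \<in> borel_measurable M2" using f g by auto
  show "(\<lambda>(x, y). f x * g y) \<in> borel_measurable (M1 \<Otimes>\<^sub>M M2)" by measurable
  show "integrable M1 (\<lambda>x. \<integral>y. norm (case (x, y) of (x, y) \<Rightarrow> f x * g y) \<partial>M2)"
    using f by (simp add: norm_mult)
  show "AE x in M1. integrable M2 (\<lambda>y. case (x, y) of (x, y) \<Rightarrow> f x * g y)"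
    using g by simp
qed

lemma integrable_mult_bounded:
  fixes f g :: "'m \<Rightarrow> complex"
  assumes "integrable M f" "g \<in> borel_measurable M" "\<And>m. m \<in> space M \<Longrightarrow> cmod (g m) \<le> B"
  shows "integrable M (\<lambda>m. f m * g m)"
proof (rule Bochner_Integration.integrable_bound)
  show "integrable M (\<lambda>m. of_real B * f m)" using assms(1) by simp
  show "(\<lambda>m. f m * g m) \<in> borel_measurable M" using assms by measurable
  have "norm (f m * g m) \<le> norm (of_real B * f m)" if "m \<in> space M" for m
  proof -
    have "cmod (f m) * cmod (g m) \<le> cmod (f m) * \<bar>B\<bar>"
      using assms(3)[OF that] by (intro mult_left_mono) auto
    then show ?thesis by (simp add: norm_mult mult.commute)
  qed
  then show "AE m in M. norm (f m * g m) \<le> norm (of_real B * f m)" by simp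
qed

lemma integrable_mult_chi:
  "integrable lborel f \<Longrightarrow> integrable lborel (\<lambda>\<xi>. f \<xi> * chi x \<xi>)"
  by (rule integrable_mult_bounded[where B = 1]) auto

lemma inv_fourier_linear:
  assumes "integrable lborel f" "integrable lborel g"
  shows "inv_fourier (\<lambda>\<xi>. a * f \<xi> + b * g \<xi>) x = a * inv_fourier f x + b * inv_fourier g x"
  using assms by (simp add: inv_fourier_chi ring_distribs mult.assoc integrable_mult_chi)

lemma inv_fourier_norm_le:
  "cmod (inv_fourier f x) \<le> (LINT \<xi>|lborel. cmod (f \<xi>))"
  unfolding inv_fourier_chi by (rule order_trans[OF integral_norm_bound]) (simp add: norm_mult)

lemma inv_fourier_modulate: "inv_fourier (\<lambda>\<xi>. chi x \<xi> * f \<xi>) y = inv_fourier f (y + x)"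
  by (simp add: inv_fourier_chi chi_add_left mult_ac)

text \<open>The pairing of y with \<xi> equals that of the images of y under the inverse of h and of
  \<xi> under the transpose of h; the Jacobian gives the scalar.\<close>

lemma inv_fourier_comp_transpose:
  fixes h :: "real^'d^'d"
  assumes h: "invertible h" and [measurable]: "f \<in> borel_measurable borel"
  shows "inv_fourier (\<lambda>\<xi>. f (transpose h *v \<xi>)) y = of_real (1 / \<bar>det h\<bar>) * inv_fourier f (matrix_inv h *v y)"
proof -
  have inv: "invertible (transpose h)" using h by (simp add: invertible_det_nz)
  have "y \<bullet> \<xi> = (matrix_inv h *v y) \<bullet> (transpose h *v \<xi>)" for \<xi>
    by (metis dot_lmul_matrix h matrix_inv_cancel(1) matrix_vector_mul_assoc matrix_vector_mul_lid transpose_matrix_vector inner_commute)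
  then have "inv_fourier (\<lambda>\<xi>. f (transpose h *v \<xi>)) y
      = (LINT \<xi>|lborel. (\<lambda>\<zeta>. f \<zeta> * chi (matrix_inv h *v y) \<zeta>) (transpose h *v \<xi>))"
    by (simp add: inv_fourier_chi chi_def)
  also have "\<dots> = of_real (1 / \<bar>det (transpose h)\<bar>) * (LINT \<zeta>|lborel. f \<zeta> * chi (matrix_inv h *v y) \<zeta>)"
    by (rule integral_lborel_matrix[OF inv]) measurable
  finally show ?thesis by (simp add: inv_fourier_chi)
qed

lemma test_funs_coordinate_mult: "f \<in> test_funs \<Omega> \<Longrightarrow> (\<lambda>x. c * of_real (x $ j) * f x) \<in> test_funs \<Omega>"
  by (intro test_funs_mult' smooth_fun_mult smooth_fun_const smooth_fun_coordinate)

lemma inv_fourier_has_derivative: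
  assumes "a \<in> test_funs \<Omega>"
  shows "inv_fourier a differentiable (at x)"
    and "partials [j] (inv_fourier a) = inv_fourier (\<lambda>\<xi>. 2 * of_real pi * \<i> * of_real (\<xi> $ j) * a \<xi>)"
proof -
  let ?G = "\<lambda>\<xi> x. a \<xi> * chi x \<xi>"
  have dchi: "((\<lambda>x. a \<xi> * chi x \<xi>) has_derivative (\<lambda>t. a \<xi> * (2 * of_real pi * \<i> * of_real (\<xi> \<bullet> t) * chi \<xi> x))) (at x)" for \<xi> x
    using has_derivative_mult_right[OF chi_has_derivative[of \<xi> x], of "a \<xi>"] by (simp add: chi_commute[of _ \<xi>])
  have pG: "partials [j] (?G \<xi>) x = (2 * of_real pi * \<i> * of_real (\<xi> $ j) * a \<xi>) * chi x \<xi>" for j \<xi> x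
    using partials_1_eq[OF dchi, of j \<xi> x] by (simp add: inner_axis chi_commute[of \<xi>] mult_ac)
  have int: "integrable lborel (\<lambda>\<xi>. 2 * of_real pi * \<i> * of_real (\<xi> $ j) * a \<xi>)" for j
    by (rule test_funs_integrable[OF test_funs_coordinate_mult[OF assms]])
  have bnd: "cmod (partials [j] (?G \<xi>) y) \<le> (\<Sum>j\<in>UNIV. cmod (2 * of_real pi * \<i> * of_real (\<xi> $ j) * a \<xi>))" for j \<xi> y
    unfolding pG norm_mult[of _ "chi y \<xi>"] norm_chi mult_1_right
    by (rule member_le_sum) auto
  have m: "(\<lambda>\<xi>. partials [j] (?G \<xi>) y) \<in> borel_measurable lborel" for j y
    unfolding pG using int[of j] by measurable
  have d: "((\<lambda>y. LINT \<xi>|lborel. ?G \<xi> y) has_derivative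
          (\<lambda>t. \<Sum>j\<in>UNIV. t $ j *\<^sub>R (LINT \<xi>|lborel. partials [j] (?G \<xi>) x))) (at x)" for x
    by (rule has_derivative_lebesgue_integral(1)[OF differentiableI[OF dchi] integrable_mult_chi[OF test_funs_integrable[OF assms]] m bnd])
       (intro Bochner_Integration.integrable_sum integrable_norm int)
  show "inv_fourier a differentiable (at x)"
    unfolding inv_fourier_chi[abs_def] using d by (rule differentiableI)
  show "partials [j] (inv_fourier a) = inv_fourier (\<lambda>\<xi>. 2 * of_real pi * \<i> * of_real (\<xi> $ j) * a \<xi>)"
    unfolding inv_fourier_chi[abs_def]
    by (rule ext, subst partials_1_eq[OF d])
       (simp add: pG axis_def if_distrib[of "\<lambda>r. r *\<^sub>R _"] sum.delta cong: if_cong)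
qed

text \<open>The integral of a translate does not depend on the translation. Differentiating this
  constant under the integral sign at 0 gives the claim without integrating along lines.\<close>

lemma integral_partials_eq_0:
  fixes f :: "real^'d \<Rightarrow> complex"
  assumes f: "f \<in> test_funs \<Omega>"
  shows "(LINT x|lborel. partials [j] f x) = 0"
proof -
  let ?G = "\<lambda>m y. f (m + y)"
  obtain r where r: "\<And>x. x \<in> fun_supp f \<Longrightarrow> norm x \<le> r"
    using test_funsD(2)[OF f, THEN compact_imp_bounded] unfolding bounded_iff by auto
  have der: "(?G m has_derivative frechet_derivative f (at (m + y))) (at y)" for m y
    by (rule has_derivative_compose[of "\<lambda>y. m + y" "\<lambda>t. t", OF _ smooth_fun_differentiable[OF test_funsD(1)[OF f], THEN frechet_derivative_works[THEN iffD1]], simplified])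
      (auto intro!: derivative_eq_intros)
  have p: "partials [j] (?G m) y = partials [j] f (m + y)" for j m y
    unfolding partials_1_eq[OF der] partials_single ..
  have "\<exists>B\<ge>0. \<forall>x. cmod (partials [j] f x) \<le> B" for j
    using test_funs_bounded[OF test_funs_partials[OF f]] unfolding bounded_iff
    by (metis norm_ge_zero order_trans rangeI)
  then obtain B where B: "\<And>j. 0 \<le> B j" "\<And>j x. cmod (partials [j] f x) \<le> B j" by metis
  \<comment> \<open>For |y| < 1 the translate by y vanishes unless |m| is at most r + 1, and there
    every first derivative is below the sum of the bounds.\<close>
  let ?b = "\<lambda>m :: real^'d. (\<Sum>j\<in>UNIV. B j) * indicator (cball 0 (r + 1)) m"
  have d: "((\<lambda>y. LINT m|lborel. ?G m y) has_derivative
      (\<lambda>t. \<Sum>j\<in>UNIV. t $ j *\<^sub>R (LINT m|lborel. partials [j] (?G m) 0))) (at 0)"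
  proof (rule has_derivative_lebesgue_integral(1)[where B = ?b])
    show "integrable lborel (\<lambda>m. f (m + y))" for y
      using integrable_lborel_shift[OF test_funs_integrable[OF f], of y] by (simp add: add.commute)
    have "integrable lborel (partials [j] f)" for j
      using test_funs_integrable[OF test_funs_partials[OF f]] .
    then have sh: "integrable lborel (\<lambda>m. partials [j] f (y + m))" for j y
      by (rule integrable_lborel_shift)
    show "(\<lambda>m. partials [j] (\<lambda>y. f (m + y)) y) \<in> borel_measurable lborel" for j y
      using borel_measurable_integrable[OF sh[of j y]] unfolding p add.commute[of y] .
    show "cmod (partials [j] (\<lambda>y. f (m + y)) y) \<le> ?b m" if "y \<in> ball 0 1" for j y m
    proof (cases "m \<in> cball 0 (r + 1)")
      case True
      have "B j \<le> (\<Sum>j\<in>UNIV. B j)" using B(1) by (intro member_le_sum) auto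
      then show ?thesis unfolding p using B(2)[of j "m + y"] True by auto
    next
      case False
      have "r < norm (m + y)"
        using False that norm_triangle_ineq4[of "m + y" y] by (auto simp: dist_norm)
      then have "m + y \<notin> fun_supp f" using r by force
      then have "partials [j] f (m + y) = 0"
        by (intro partials_eq_0[of "fun_supp f"] test_fun_supp[OF f]) (auto simp: fun_supp_def)
      then show ?thesis unfolding p using False by simp
    qed
    show "integrable lborel ?b"
      using emeasure_lborel_cball_finite[of "0::real^'d" "r + 1"]
      by (intro integrable_mult_right integrable_real_indicator) auto
    show "(\<lambda>y. f (m + y)) differentiable at y" for m y using der by (rule differentiableI)
  qed
  have "(LINT m|lborel. f (m + y)) = (LINT m|lborel. f m)" for y
    using integral_lborel_shift[of f y] test_funs_measurable[OF f] by (simp add: add.commute)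
  then have "((\<lambda>y. LINT m|lborel. ?G m y) has_derivative (\<lambda>t. 0)) (at 0)" by simp
  from fun_cong[OF has_derivative_unique[OF d this], of "axis j 1"]
  have "(\<Sum>i\<in>UNIV. axis j 1 $ i *\<^sub>R (LINT m|lborel. partials [i] f m)) = 0"
    unfolding p by simp
  then show ?thesis
    by (simp add: axis_def if_distrib[of "\<lambda>r. r *\<^sub>R _"] sum.delta cong: if_cong)
qed

text \<open>Integration by parts: \<open>integral_partials_eq_0\<close> for the product of f with a
  character.\<close>

lemma inv_fourier_partials:
  assumes f: "f \<in> test_funs \<Omega>"
  shows "inv_fourier (partials [j] f) x = - (2 * of_real pi * \<i> * of_real (x $ j)) * inv_fourier f x"
proof -
  have t: "(\<lambda>\<xi>. f \<xi> * chi x \<xi>) \<in> test_funs \<Omega>" by (rule test_funs_mult(1)[OF f smooth_fun_chi])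
  have "0 = (LINT \<xi>|lborel. partials [j] (\<lambda>\<xi>. f \<xi> * chi x \<xi>) \<xi>)"
    using integral_partials_eq_0[OF t] by simp
  also have "\<dots> = (LINT \<xi>|lborel. (2 * of_real pi * \<i> * of_real (x $ j)) * (f \<xi> * chi x \<xi>) + partials [j] f \<xi> * chi x \<xi>)"
    by (simp add: partials_mult smooth_fun_differentiable smooth_fun_chi test_funsD(1)[OF f] partials_chi mult_ac)
  also have "\<dots> = (2 * of_real pi * \<i> * of_real (x $ j)) * inv_fourier f x + inv_fourier (partials [j] f) x"
    unfolding inv_fourier_chi
    using integrable_mult_chi[OF test_funs_integrable[OF f]] integrable_mult_chi[OF test_funs_integrable[OF test_funs_partials[OF f]]]
    by simp
  finally show ?thesis by (simp add: eq_neg_iff_add_eq_0 add.commute)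
qed

text \<open>Induction on n. One factor 1 + |x| is at most 1 plus the sum of the |x_j|, and
  multiplication by x_j is paid for by one derivative of f. The factor 2 pi only helps and is
  dropped; the 1 + d terms per step give the power in the constant.\<close>

lemma inv_fourier_decay:
  fixes f :: "real^'d \<Rightarrow> complex"
  assumes "f \<in> test_funs \<Omega>" "\<And>js. length js \<le> n \<Longrightarrow> (LINT \<xi>|lborel. cmod (partials js f \<xi>)) \<le> W"
  shows "(1 + norm x) ^ n * cmod (inv_fourier f x) \<le> (1 + real CARD('d)) ^ n * W"
  using assms
proof (induction n arbitrary: f)
  case 0
  then show ?case using inv_fourier_norm_le[of f x] by (force intro: order_trans)
next
  case (Suc n)
  have 1: "(1 + norm x) ^ n * cmod (inv_fourier f x) \<le> (1 + real CARD('d)) ^ n * W"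
    using Suc.prems by (intro Suc.IH) auto
  have 2: "(1 + norm x) ^ n * (\<bar>x $ j\<bar> * cmod (inv_fourier f x)) \<le> (1 + real CARD('d)) ^ n * W" for j
  proof -
    have "\<bar>x $ j\<bar> * cmod (inv_fourier f x) \<le> 2 * pi * (\<bar>x $ j\<bar> * cmod (inv_fourier f x))"
      using pi_ge_two by (intro mult_right_mono[of 1 "2 * pi", simplified]) auto
    also have "\<dots> = cmod (inv_fourier (partials [j] f) x)"
      unfolding inv_fourier_partials[OF Suc.prems(1)] by (simp add: norm_mult)
    finally have "(1 + norm x) ^ n * (\<bar>x $ j\<bar> * cmod (inv_fourier f x)) \<le> (1 + norm x) ^ n * cmod (inv_fourier (partials [j] f) x)"
      by (intro mult_left_mono) auto
    also have "\<dots> \<le> (1 + real CARD('d)) ^ n * W"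
      using Suc.prems(2)[of "_ @ [j]"] by (intro Suc.IH test_funs_partials[OF Suc.prems(1)]) (simp add: partials_append)
    finally show ?thesis .
  qed
  have "(1 + norm x) ^ Suc n * cmod (inv_fourier f x)
      \<le> (1 + (\<Sum>j\<in>UNIV. \<bar>x $ j\<bar>)) * ((1 + norm x) ^ n * cmod (inv_fourier f x))"
    unfolding power_Suc mult.assoc using norm_le_l1_cart[of x] by (intro mult_right_mono) auto
  also have "\<dots> = (1 + norm x) ^ n * cmod (inv_fourier f x) + (\<Sum>j\<in>UNIV. (1 + norm x) ^ n * (\<bar>x $ j\<bar> * cmod (inv_fourier f x)))"
    by (simp add: ring_distribs sum_distrib_right sum_distrib_left mult_ac)
  also have "\<dots> \<le> (1 + real CARD('d)) ^ n * W + (\<Sum>j\<in>(UNIV::'d set). (1 + real CARD('d)) ^ n * W)"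
    using 1 2 by (intro add_mono sum_mono) auto
  also have "\<dots> = (1 + real CARD('d)) ^ Suc n * W"
    by (simp add: algebra_simps)
  finally show ?case .
qed

lemma test_funs_L1_partials_bounded:
  assumes "f \<in> test_funs \<Omega>"
  obtains W where "\<And>js. length js \<le> n \<Longrightarrow> (LINT \<xi>|lborel. cmod (partials js f \<xi>)) \<le> W"
proof -
  have "finite {js :: 'a list. length js \<le> n}"
    using finite_lists_length_le[of "UNIV :: 'a set" n] by simp
  then have "(LINT \<xi>|lborel. cmod (partials js f \<xi>)) \<le> (\<Sum>js\<in>{js. length js \<le> n}. LINT \<xi>|lborel. cmod (partials js f \<xi>))"
    if "length js \<le> n" for js
    using that by (intro member_le_sum) auto
  then show ?thesis using that by blast
qed

lemma inv_fourier_rapid_bound: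
  assumes "f \<in> test_funs \<Omega>"
  obtains C where "\<And>x. (1 + norm x) ^ n * cmod (inv_fourier f x) \<le> C"
  using test_funs_L1_partials_bounded[OF assms] inv_fourier_decay[OF assms] by metis

lemma smooth_fun_inv_fourier:
  assumes "f \<in> test_funs \<Omega>"
  shows "smooth_fun (inv_fourier f)" "\<exists>g\<in>test_funs \<Omega>. partials js (inv_fourier f) = inv_fourier g"
proof -
  show *: "\<exists>g\<in>test_funs \<Omega>. partials js (inv_fourier f) = inv_fourier g" for js
  proof (induction js)
    case (Cons j js)
    then obtain g where g: "g \<in> test_funs \<Omega>" "partials js (inv_fourier f) = inv_fourier g" by blast
    show ?case
      unfolding partials_Cons[of j js] g(2) inv_fourier_has_derivative(2)[OF g(1)]
      using test_funs_coordinate_mult[OF g(1)] by blast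
  qed (use assms in auto)
  show "smooth_fun (inv_fourier f)"
    unfolding smooth_fun_def differentiable_on_def using * inv_fourier_has_derivative(1) by metis
qed

lemma schwartz_inv_fourier:
  assumes "f \<in> test_funs \<Omega>"
  shows "inv_fourier f \<in> schwartz_funs"
  unfolding schwartz_funs_def
proof (intro CollectI conjI allI smooth_fun_inv_fourier(1)[OF assms])
  fix js and n :: nat
  obtain g where g: "g \<in> test_funs \<Omega>" "partials js (inv_fourier f) = inv_fourier g"
    using smooth_fun_inv_fourier(2)[OF assms] by blast
  obtain C where "\<And>x. (1 + norm x) ^ n * cmod (inv_fourier g x) \<le> C"
    using inv_fourier_rapid_bound[OF g(1)] by blast
  then show "bounded (range (\<lambda>x. of_real ((1 + norm x) ^ n) * partials js (inv_fourier f) x))"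
    unfolding g(2) bounded_iff ball_simps norm_one_plus_norm_power_mult by blast
qed

lemma test_funs_reflect: "f \<in> test_funs UNIV \<Longrightarrow> (\<lambda>x. f (- x)) \<in> test_funs UNIV"
proof -
  assume f: "f \<in> test_funs UNIV"
  have "(- mat 1) *v \<xi> = - \<xi>" for \<xi> :: "real^'a"
    by (simp add: vec_eq_iff matrix_vector_mult_def mat_def if_distrib[of "\<lambda>r. - r"] if_distrib[of "\<lambda>r. r * _"] sum_negf cong: if_cong)
  then have eq: "(\<lambda>\<xi>. f ((- mat 1) *v \<xi>)) = (\<lambda>x. f (- x))" by simp
  have "compact (uminus ` fun_supp f)"
    by (rule compact_negations[OF test_funsD(2)[OF f]])
  moreover have "f (- x) = 0" if "x \<notin> uminus ` fun_supp f" for x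
    using that test_fun_supp[OF f, of "- x"] by force
  moreover have "smooth_fun (\<lambda>x. f (- x))"
    using test_funs_comp_matrix[OF f, of "- mat 1"] unfolding eq .
  ultimately show ?thesis by (intro test_funsI[of _ "uminus ` fun_supp f"]) auto
qed

lemma fourier_eq_inv_fourier_reflect:
  assumes [measurable]: "f \<in> borel_measurable borel"
  shows "fourier f = inv_fourier (\<lambda>x. f (- x))"
proof
  fix \<xi>
  have "fourier f \<xi> = (LINT x|lborel. (\<lambda>x. f (- x) * chi \<xi> x) (0 - x))"
    by (simp add: fourier_chi)
  also have "\<dots> = (LINT x|lborel. f (- x) * chi \<xi> x)"
    by (rule integral_lborel_reflect) measurable
  finally show "fourier f \<xi> = inv_fourier (\<lambda>x. f (- x)) \<xi>" by (simp add: inv_fourier_chi)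
qed

lemma schwartz_fourier:
  assumes "f \<in> test_funs \<Omega>"
  shows "fourier f \<in> schwartz_funs"
  using schwartz_inv_fourier[OF test_funs_reflect[OF test_funs_UNIV[OF assms]]]
    fourier_eq_inv_fourier_reflect[OF test_funs_measurable[OF assms]] by simp

subsection \<open>Fourier inversion\<close>

text \<open>exp(-|x|^2 / 2), written as a product over coordinates so that its transform factors
  into one-dimensional ones.\<close>

definition gauss :: "real^'d \<Rightarrow> real" where
  "gauss x = (\<Prod>b\<in>Basis. exp (- (x \<bullet> b)\<^sup>2 / 2))"

text \<open>The transform of \<open>gauss\<close>. Being a product of normal densities of standard
  deviation 1/(2 pi), it has total mass 1, which normalises the inversion formula.\<close>

definition gauss_hat :: "real^'d \<Rightarrow> real" where
  "gauss_hat x = (\<Prod>b\<in>Basis. normal_density 0 (1 / (2 * pi)) (x \<bullet> b))"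

lemma integral_lborel_prod:
  fixes f :: "'a::euclidean_space \<Rightarrow> real \<Rightarrow> complex"
  assumes "\<And>b. b \<in> Basis \<Longrightarrow> integrable lborel (f b)"
  shows "(LINT x|lborel. (\<Prod>b\<in>Basis. f b (x \<bullet> b))) = (\<Prod>b\<in>Basis. LINT t|lborel. f b t)"
    and "integrable lborel (\<lambda>x. \<Prod>b\<in>Basis. f b (x \<bullet> b))"
proof -
  interpret product_sigma_finite "\<lambda>_. lborel :: real measure" ..
  have [measurable]: "b \<in> Basis \<Longrightarrow> f b \<in> borel_measurable borel" for b using assms[of b] by auto
  have 1: "(\<Prod>b\<in>Basis. f b ((\<Sum>b\<in>Basis. g b *\<^sub>R b) \<bullet> b)) = (\<Prod>b\<in>Basis. f b (g b))" for g
    by (intro prod.cong refl) (simp add: inner_sum_left inner_Basis if_distrib sum.delta cong: if_cong)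
  have m: "(\<lambda>g. \<Sum>b\<in>Basis. g b *\<^sub>R b) \<in> measurable (Pi\<^sub>M Basis (\<lambda>_. lborel)) (borel :: 'a measure)"
    by measurable
  have m2: "(\<lambda>x. \<Prod>b\<in>Basis. f b (x \<bullet> b)) \<in> borel_measurable borel" by measurable
  show "(LINT x|lborel. (\<Prod>b\<in>Basis. f b (x \<bullet> b))) = (\<Prod>b\<in>Basis. LINT t|lborel. f b t)"
    unfolding lborel_eq[where 'a = 'a]
    by (subst integral_distr[OF m m2], subst 1, rule product_integral_prod) (use assms in auto)
  show "integrable lborel (\<lambda>x. \<Prod>b\<in>Basis. f b (x \<bullet> b))"
    unfolding lborel_eq[where 'a = 'a]
    by (subst integrable_distr_eq[OF m m2], subst 1, rule product_integrable_prod) (use assms in auto)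
qed

text \<open>The Gaussian is a multiple of the standard normal density, whose characteristic function
  is known; it is evaluated at 2 pi s.\<close>

lemma gauss_fourier_1:
  "integrable lborel (\<lambda>t::real. complex_of_real (exp (- t\<^sup>2 / 2)))"
  "(LINT t|lborel. complex_of_real (exp (- t\<^sup>2 / 2)) * exp (2 * of_real pi * \<i> * of_real (t * s))) = of_real (normal_density 0 (1 / (2 * pi)) s)"
proof -
  have e: "exp (- t\<^sup>2 / 2) = sqrt (2 * pi) * std_normal_density t" for t :: real
    by (simp add: std_normal_density_def)
  have "integrable lborel (\<lambda>t::real. sqrt (2 * pi) * std_normal_density t)"
    by (intro integrable_mult_right integrable_normal_density) simp
  then show "integrable lborel (\<lambda>t::real. complex_of_real (exp (- t\<^sup>2 / 2)))"
    unfolding e by (rule integrable_of_real)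
  have "(LINT t|lborel. complex_of_real (exp (- t\<^sup>2 / 2)) * exp (2 * of_real pi * \<i> * of_real (t * s)))
     = (LINT t|lborel. of_real (sqrt (2 * pi)) * (std_normal_density t *\<^sub>R iexp (2 * pi * s * t)))"
    unfolding e by (intro Bochner_Integration.integral_cong) (simp_all add: scaleR_conv_of_real mult_ac)
  also have "\<dots> = of_real (sqrt (2 * pi)) * (LINT t|lborel. std_normal_density t *\<^sub>R iexp (2 * pi * s * t))"
    by (rule integral_mult_right_zero)
  also have "(LINT t|lborel. std_normal_density t *\<^sub>R iexp (2 * pi * s * t)) = char std_normal_distribution (2 * pi * s)"
    unfolding char_def by (subst integral_density) (auto simp: mult_ac)
  also have "\<dots> = of_real (exp (- (2 * pi * s)\<^sup>2 / 2))"
    unfolding char_std_normal_distribution ..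
  finally show "(LINT t|lborel. complex_of_real (exp (- t\<^sup>2 / 2)) * exp (2 * of_real pi * \<i> * of_real (t * s))) = of_real (normal_density 0 (1 / (2 * pi)) s)"
    by (simp add: normal_density_def power2_eq_square field_simps real_sqrt_divide real_sqrt_mult)
qed

lemma gauss_integrable: "integrable lborel (\<lambda>x. complex_of_real (gauss x))"
  unfolding gauss_def of_real_prod by (rule integral_lborel_prod(2)) (rule gauss_fourier_1(1))

lemma gauss_0: "gauss 0 = 1"
  by (simp add: gauss_def)

lemma gauss_bounds: "0 \<le> gauss x" "gauss x \<le> 1"
  by (auto simp: gauss_def intro!: prod_nonneg prod_le_1)

lemma gauss_continuous: "continuous_on UNIV gauss"
  unfolding gauss_def by (intro continuous_intros) auto

lemma gauss_measurable [measurable]: "gauss \<in> borel_measurable borel"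
  by (rule borel_measurable_continuous_onI[OF gauss_continuous])

lemma inv_fourier_gauss: "inv_fourier (\<lambda>x. of_real (gauss x)) z = of_real (gauss_hat z)"
proof -
  have "of_real (gauss x) * chi z x = (\<Prod>b\<in>Basis. of_real (exp (- (x \<bullet> b)\<^sup>2 / 2)) * exp (2 * of_real pi * \<i> * of_real ((x \<bullet> b) * (z \<bullet> b))))" for x
    unfolding gauss_def chi_def euclidean_inner[of z x] of_real_prod prod.distrib
    by (simp add: sum_distrib_left exp_sum mult_ac)
  then have "inv_fourier (\<lambda>x. of_real (gauss x)) z = (LINT x|lborel. (\<Prod>b\<in>Basis. of_real (exp (- (x \<bullet> b)\<^sup>2 / 2)) * exp (2 * of_real pi * \<i> * of_real ((x \<bullet> b) * (z \<bullet> b)))))"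
    by (simp add: inv_fourier_chi)
  also have "\<dots> = (\<Prod>b\<in>Basis. LINT t|lborel. of_real (exp (- t\<^sup>2 / 2)) * exp (2 * of_real pi * \<i> * of_real (t * (z \<bullet> b))))"
    by (rule integral_lborel_prod(1)) (rule integrable_mult_bounded[OF gauss_fourier_1(1), where B = 1]; simp)
  also have "\<dots> = of_real (gauss_hat z)"
    unfolding gauss_fourier_1(2) gauss_hat_def by simp
  finally show ?thesis .
qed

lemma gauss_hat_integral:
  "integrable lborel (\<lambda>x :: real^'d. complex_of_real (gauss_hat x))"
  "(LINT x|lborel. complex_of_real (gauss_hat (x :: real^'d))) = 1"
proof -
  have i: "integrable lborel (\<lambda>t. complex_of_real (normal_density 0 (1 / (2 * pi)) t))"
    by (intro integrable_of_real integrable_normal_density) simp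
  show "integrable lborel (\<lambda>x :: real^'d. complex_of_real (gauss_hat x))"
    unfolding gauss_hat_def of_real_prod by (rule integral_lborel_prod(2)) (rule i)
  have "(LINT x|lborel. complex_of_real (gauss_hat (x :: real^'d))) = (\<Prod>b\<in>(Basis::(real^'d) set). LINT t|lborel. complex_of_real (normal_density 0 (1 / (2 * pi)) t))"
    unfolding gauss_hat_def of_real_prod using i
    by (rule integral_lborel_prod(1)[of "\<lambda>_::real^'d. \<lambda>t. complex_of_real (normal_density 0 (1 / (2 * pi)) t)"])
  also have "\<dots> = 1" unfolding integral_complex_of_real by (subst integral_normal_density) auto
  finally show "(LINT x|lborel. complex_of_real (gauss_hat (x :: real^'d))) = 1" .
qed

lemma chi_diff_right: "chi x (\<xi> - y) = chi x \<xi> * chi x (- y)"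
  by (simp add: chi_def inner_diff_right mult_exp_exp algebra_simps)

lemma scaleR_mat_1:
  "(c *\<^sub>R mat 1 :: real^'d^'d) *v x = c *\<^sub>R x" "det (c *\<^sub>R mat 1 :: real^'d^'d) = c ^ CARD('d)"
  by (simp_all only: scaleR_matrix_vector_assoc[symmetric] matrix_vector_mul_lid) (simp add: det_diagonal mat_def)

lemma integral_lborel_scale:
  fixes f :: "real^'d \<Rightarrow> complex"
  assumes "0 < c" and [measurable]: "f \<in> borel_measurable borel"
  shows "(LINT x|lborel. f (y + c *\<^sub>R x)) = of_real (1 / c ^ CARD('d)) * (LINT x|lborel. f x)"
proof -
  have "invertible (c *\<^sub>R mat 1 :: real^'d^'d)"
    using assms by (simp add: invertible_det_nz scaleR_mat_1)
  from integral_lborel_matrix[OF this, of "\<lambda>x. f (y + x)"] assms(1) show ?thesis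
    by (simp add: scaleR_mat_1 integral_lborel_shift)
qed

lemma inv_fourier_gauss_scaled:
  fixes z :: "real^'d"
  assumes "0 < \<epsilon>"
  shows "(LINT x|lborel. of_real (gauss (\<epsilon> *\<^sub>R x)) * chi x z) = of_real (gauss_hat (z /\<^sub>R \<epsilon>) / \<epsilon> ^ CARD('d))"
proof -
  let ?A = "\<epsilon> *\<^sub>R mat 1 :: real^'d^'d"
  have Av: "?A *v x = \<epsilon> *\<^sub>R x" for x :: "real^'d" by (rule scaleR_mat_1)
  have det: "det ?A = \<epsilon> ^ CARD('d)" by (rule scaleR_mat_1)
  then have inv: "invertible ?A" using assms by (simp add: invertible_det_nz)
  have "(LINT x|lborel. of_real (gauss (\<epsilon> *\<^sub>R x)) * chi x z) = (LINT x|lborel. (\<lambda>y. of_real (gauss y) * chi (z /\<^sub>R \<epsilon>) y) (?A *v x))"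
  proof -
    have "chi x z = chi (z /\<^sub>R \<epsilon>) (\<epsilon> *\<^sub>R x)" for x
      using assms by (simp add: chi_def inner_commute flip: of_real_mult mult.assoc)
    then show ?thesis unfolding Av by simp
  qed
  also have "\<dots> = of_real (1 / \<bar>det ?A\<bar>) * inv_fourier (\<lambda>x. of_real (gauss x)) (z /\<^sub>R \<epsilon>)"
    unfolding inv_fourier_chi by (rule integral_lborel_matrix[OF inv]) measurable
  finally show ?thesis using assms by (simp add: det inv_fourier_gauss)
qed

text \<open>The Gaussian factor makes Fubini's theorem applicable.\<close>

lemma inv_fourier_regularized:
  fixes a :: "real^'d \<Rightarrow> complex"
  assumes a: "integrable lborel a" "continuous_on UNIV a" "\<And>x. cmod (a x) \<le> B"
  shows "(\<lambda>n. LINT x|lborel. inv_fourier a x * of_real (gauss (x /\<^sub>R real (Suc n))) * chi x (- y)) \<longlonglongrightarrow> a y"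
proof -
  have [measurable]: "a \<in> borel_measurable borel" using a(1) by auto
  \<comment> \<open>Integrating in x first leaves a transformed Gaussian. After rescaling, the
    regularised integral is an average of \<open>a\<close> around \<open>y\<close> at scale 1/(n+1)
    with weight \<open>gauss_hat\<close>, hence tends to \<open>a y\<close> by dominated
    convergence.\<close>
  have "(LINT x|lborel. inv_fourier a x * of_real (gauss (x /\<^sub>R real (Suc n))) * chi x (- y))
      = (LINT z|lborel. a (y + z /\<^sub>R real (Suc n)) * of_real (gauss_hat z))" for n
  proof -
    let ?\<epsilon> = "inverse (real (Suc n))"
    let ?g = "\<lambda>x :: real^'d. complex_of_real (gauss (?\<epsilon> *\<^sub>R x))"
    have e: "0 < ?\<epsilon>" by simp
    have gi: "integrable lborel ?g"
    proof -
      have "integrable lborel (\<lambda>x. (?\<epsilon> ^ CARD('d)) *\<^sub>R ?g x)"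
        using gauss_integrable[where 'a = 'd]
        by (subst (asm) lborel_affine[of "?\<epsilon>" 0]) (auto simp: integrable_density integrable_distr_eq)
      then have "integrable lborel (\<lambda>x. inverse (?\<epsilon> ^ CARD('d)) *\<^sub>R ((?\<epsilon> ^ CARD('d)) *\<^sub>R ?g x))"
        by (rule integrable_scaleR_right)
      moreover have c: "?\<epsilon> ^ CARD('d) \<noteq> 0" using e by simp
      ultimately show ?thesis by (simp only: scaleR_scaleR left_inverse[OF c] scaleR_one)
    qed
    have "(LINT x|lborel. inv_fourier a x * ?g x * chi x (- y))
        = (LINT x|lborel. (LINT \<xi>|lborel. a \<xi> * chi x \<xi> * ?g x * chi x (- y)))"
      unfolding inv_fourier_chi by simp
    also have "\<dots> = (LINT \<xi>|lborel. (LINT x|lborel. a \<xi> * chi x \<xi> * ?g x * chi x (- y)))"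
    proof (rule lborel_pair.Fubini_integral)
      have "integrable (lborel \<Otimes>\<^sub>M lborel) (\<lambda>(\<xi>, x). a \<xi> * ?g x)"
        by (rule lborel_pair.integrable_product[OF a(1) gi])
      then have "integrable (lborel \<Otimes>\<^sub>M lborel) (\<lambda>z. (case z of (\<xi>, x) \<Rightarrow> a \<xi> * ?g x) * (chi (snd z) (fst z) * chi (snd z) (- y)))"
        by (rule integrable_mult_bounded[where B = 1]) (auto simp: norm_mult)
      then show "integrable (lborel \<Otimes>\<^sub>M lborel) (\<lambda>(\<xi>, x). a \<xi> * chi x \<xi> * ?g x * chi x (- y))"
        by (simp add: case_prod_unfold mult_ac)
    qed
    also have "\<dots> = (LINT \<xi>|lborel. a \<xi> * (LINT x|lborel. ?g x * chi x (\<xi> - y)))"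
      by (intro Bochner_Integration.integral_cong refl)
         (simp add: chi_diff_right mult_ac flip: integral_mult_right_zero)
    also have "\<dots> = (LINT \<xi>|lborel. a \<xi> * of_real (gauss_hat ((\<xi> - y) /\<^sub>R ?\<epsilon>) / ?\<epsilon> ^ CARD('d)))"
      unfolding inv_fourier_gauss_scaled[OF e] ..
    also have "\<dots> = of_real (1 / ?\<epsilon> ^ CARD('d)) * (LINT \<xi>|lborel. a \<xi> * of_real (gauss_hat ((\<xi> - y) /\<^sub>R ?\<epsilon>)))"
      unfolding integral_mult_right_zero[symmetric] of_real_divide by (simp del: of_nat_Suc)
    also have "\<dots> = (LINT z|lborel. a (y + ?\<epsilon> *\<^sub>R z) * of_real (gauss_hat ((y + ?\<epsilon> *\<^sub>R z - y) /\<^sub>R ?\<epsilon>)))"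
    proof -
      have [measurable]: "gauss_hat \<in> borel_measurable borel" unfolding gauss_hat_def by measurable
      show ?thesis
        by (rule integral_lborel_scale[OF e, symmetric]) measurable
    qed
    also have "\<dots> = (LINT z|lborel. a (y + z /\<^sub>R real (Suc n)) * of_real (gauss_hat z))"
      by (simp del: of_nat_Suc)
    finally show ?thesis .
  qed
  moreover have "(\<lambda>n. LINT z|lborel. a (y + z /\<^sub>R real (Suc n)) * of_real (gauss_hat z)) \<longlonglongrightarrow> (LINT z|lborel. a y * of_real (gauss_hat (z :: real^'d)))"
  proof (rule integral_dominated_convergence[where w = "\<lambda>z :: real^'d. B * cmod (of_real (gauss_hat z))"])
    show "integrable lborel (\<lambda>z :: real^'d. B * cmod (of_real (gauss_hat z)))"
      using gauss_hat_integral(1) by (intro integrable_mult_right integrable_norm)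
    have [measurable]: "gauss_hat \<in> borel_measurable borel" unfolding gauss_hat_def by measurable
    show "(\<lambda>z. a (y + z /\<^sub>R real (Suc n)) * of_real (gauss_hat z)) \<in> borel_measurable lborel" for n by measurable
    show "(\<lambda>z :: real^'d. a y * of_real (gauss_hat z)) \<in> borel_measurable lborel" by measurable
    have "(\<lambda>n. a (y + z /\<^sub>R real (Suc n))) \<longlonglongrightarrow> a y" for z
    proof -
      have "(\<lambda>n. y + z /\<^sub>R real (Suc n)) \<longlonglongrightarrow> y + 0 *\<^sub>R z"
        by (intro tendsto_intros LIMSEQ_inverse_real_of_nat)
      then show ?thesis
        using continuous_on_tendsto_compose[OF a(2), of "\<lambda>n. y + z /\<^sub>R real (Suc n)" y sequentially] by simp
    qed
    then show "AE z in lborel. (\<lambda>n. a (y + z /\<^sub>R real (Suc n)) * of_real (gauss_hat z)) \<longlonglongrightarrow> a y * of_real (gauss_hat z)"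
      by (intro AE_I2 tendsto_mult) auto
    show "AE z in lborel. cmod (a (y + z /\<^sub>R real (Suc n)) * of_real (gauss_hat z)) \<le> B * cmod (of_real (gauss_hat z))" for n
      unfolding norm_mult by (intro AE_I2 mult_right_mono a(3)) auto
  qed
  moreover have "(LINT z|lborel. a y * of_real (gauss_hat (z :: real^'d))) = a y"
    unfolding integral_mult_right_zero gauss_hat_integral(2) by simp
  ultimately show ?thesis by (simp del: of_nat_Suc integral_mult_right_zero)
qed

text \<open>The regularised integrals have two limits: letting the Gaussian factor tend to 1 under
  the integral gives the left side, and \<open>inv_fourier_regularized\<close> gives the right
  side.\<close>

lemma fourier_inv_fourier_continuous:
  fixes a :: "real^'d \<Rightarrow> complex"
  assumes a: "integrable lborel a" "continuous_on UNIV a" "\<And>x. cmod (a x) \<le> B"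
    and i: "integrable lborel (inv_fourier a)"
  shows "fourier (inv_fourier a) y = a y"
proof -
  have [measurable]: "inv_fourier a \<in> borel_measurable borel" using i by auto
  have "(\<lambda>n. LINT x|lborel. inv_fourier a x * of_real (gauss (x /\<^sub>R real (Suc n))) * chi x (- y)) \<longlonglongrightarrow> (LINT x|lborel. inv_fourier a x * of_real 1 * chi x (- y))"
  proof (rule integral_dominated_convergence[where w = "\<lambda>x. cmod (inv_fourier a x)"])
    show "integrable lborel (\<lambda>x. cmod (inv_fourier a x))" using i by (rule integrable_norm)
    have "(\<lambda>n. gauss (x /\<^sub>R real (Suc n))) \<longlonglongrightarrow> 1" for x :: "real^'d"
    proof -
      have "(\<lambda>n. x /\<^sub>R real (Suc n)) \<longlonglongrightarrow> 0 *\<^sub>R x"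
        by (intro tendsto_intros LIMSEQ_inverse_real_of_nat)
      then show ?thesis
        using continuous_on_tendsto_compose[OF gauss_continuous, of "\<lambda>n. x /\<^sub>R real (Suc n)" 0 sequentially] by (simp add: gauss_0)
    qed
    then show "AE x in lborel. (\<lambda>n. inv_fourier a x * of_real (gauss (x /\<^sub>R real (Suc n))) * chi x (- y)) \<longlonglongrightarrow> inv_fourier a x * of_real 1 * chi x (- y)"
      by (intro AE_I2 tendsto_intros)
    show "AE x in lborel. cmod (inv_fourier a x * of_real (gauss (x /\<^sub>R real (Suc n))) * chi x (- y)) \<le> cmod (inv_fourier a x)" for n
    proof (rule AE_I2)
      fix x :: "real^'d"
      have "cmod (inv_fourier a x) * gauss (x /\<^sub>R real (Suc n)) \<le> cmod (inv_fourier a x)"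
        by (intro mult_left_le gauss_bounds) simp
      then show "cmod (inv_fourier a x * of_real (gauss (x /\<^sub>R real (Suc n))) * chi x (- y)) \<le> cmod (inv_fourier a x)"
        by (simp add: norm_mult abs_of_nonneg[OF gauss_bounds(1)] del: of_nat_Suc)
    qed
  qed measurable
  from LIMSEQ_unique[OF this inv_fourier_regularized[OF a]]
  show ?thesis by (simp add: fourier_chi chi_commute[of y] chi_minus)
qed

lemma inv_fourier_eq_0_imp:
  fixes a :: "real^'d \<Rightarrow> complex"
  assumes a: "integrable lborel a" "continuous_on UNIV a" "\<And>x. cmod (a x) \<le> B"
    and "\<And>x. inv_fourier a x = 0"
  shows "a y = 0"
proof -
  have "inv_fourier a = (\<lambda>x. 0)" using assms(4) by auto
  then show ?thesis using fourier_inv_fourier_continuous[OF a, of y] by (simp add: fourier_chi)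
qed

lemma inv_fourier_integrable: "a \<in> test_funs \<Omega> \<Longrightarrow> integrable lborel (inv_fourier a)"
  by (rule rapidly_decreasing_integrable(2)[OF schwartz_rapidly_decreasing[OF schwartz_inv_fourier]])

lemma fourier_integrable: "a \<in> test_funs \<Omega> \<Longrightarrow> integrable lborel (fourier a)"
  by (rule rapidly_decreasing_integrable(2)[OF schwartz_rapidly_decreasing[OF schwartz_fourier]])

lemma fourier_inv_fourier:
  assumes a: "a \<in> test_funs \<Omega>"
  shows "fourier (inv_fourier a) = a"
proof -
  obtain B where "\<And>x. cmod (a x) \<le> B" using test_funs_bounded[OF a] unfolding bounded_iff by auto
  then show ?thesis
    using fourier_inv_fourier_continuous[OF test_funs_integrable[OF a] smooth_fun_continuous[OF test_funsD(1)[OF a]] _ inv_fourier_integrable[OF a]]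
    by blast
qed

lemma inv_fourier_fourier:
  assumes a: "a \<in> test_funs \<Omega>"
  shows "inv_fourier (fourier a) = a"
proof
  fix x
  have "inv_fourier (fourier a) x = fourier (inv_fourier (\<lambda>x. a (- x))) (- x)"
    by (simp add: fourier_eq_inv_fourier_reflect[OF test_funs_measurable[OF a]] fourier_eq_inv_fourier)
  then show "inv_fourier (fourier a) x = a x"
    by (simp add: fourier_inv_fourier[OF test_funs_reflect[OF test_funs_UNIV[OF a]]])
qed

lemma Parseval:
  assumes a: "a \<in> test_funs \<Omega>" and b: "b \<in> test_funs \<Omega>"
  shows "(LINT x|lborel. inv_fourier a x * cnj (inv_fourier b x)) = (LINT \<xi>|lborel. a \<xi> * cnj (b \<xi>))"
proof -
  have "(LINT x|lborel. inv_fourier a x * cnj (inv_fourier b x)) = (LINT x|lborel. (LINT \<xi>|lborel. inv_fourier a x * (cnj (b \<xi>) * chi x (- \<xi>))))"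
    by (simp add: cnj_inv_fourier fourier_chi)
  also have "\<dots> = (LINT \<xi>|lborel. (LINT x|lborel. inv_fourier a x * (cnj (b \<xi>) * chi x (- \<xi>))))"
  proof (rule lborel_pair.Fubini_integral)
    have "integrable (lborel \<Otimes>\<^sub>M lborel) (\<lambda>(\<xi>, x). cnj (b \<xi>) * inv_fourier a x)"
      by (rule lborel_pair.integrable_product[OF test_funs_integrable[OF test_funs_cnj(1)[OF b]] inv_fourier_integrable[OF a]])
    then have "integrable (lborel \<Otimes>\<^sub>M lborel) (\<lambda>z. (case z of (\<xi>, x) \<Rightarrow> cnj (b \<xi>) * inv_fourier a x) * chi (snd z) (- fst z))"
      by (rule integrable_mult_bounded[where B = 1]) auto
    then show "integrable (lborel \<Otimes>\<^sub>M lborel) (\<lambda>(\<xi>, x). inv_fourier a x * (cnj (b \<xi>) * chi x (- \<xi>)))"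
      by (simp add: case_prod_unfold mult_ac)
  qed
  also have "\<dots> = (LINT \<xi>|lborel. cnj (b \<xi>) * fourier (inv_fourier a) \<xi>)"
    by (intro Bochner_Integration.integral_cong refl)
       (simp add: fourier_chi' mult_ac flip: integral_mult_right_zero)
  finally show ?thesis by (simp add: fourier_inv_fourier[OF a] mult.commute)
qed

text \<open>Writing b as the transform of its inverse transform shows that the inverse transform of
  a product is a convolution. The rest is Fubini and translation invariance.\<close>

lemma inv_fourier_mult_L1:
  assumes a: "a \<in> test_funs \<Omega>" and b: "b \<in> test_funs \<Omega>"
  shows "(\<integral>\<^sup>+x. ennreal (cmod (inv_fourier (\<lambda>\<xi>. a \<xi> * b \<xi>) x)) \<partial>lborel)
     \<le> (\<integral>\<^sup>+x. ennreal (cmod (inv_fourier a x)) \<partial>lborel) * (\<integral>\<^sup>+x. ennreal (cmod (inv_fourier b x)) \<partial>lborel)"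
proof -
  note [measurable] = borel_measurable_integrable[OF inv_fourier_integrable[OF a], simplified]
    borel_measurable_integrable[OF inv_fourier_integrable[OF b], simplified]
  have "inv_fourier (\<lambda>\<xi>. a \<xi> * b \<xi>) y = (LINT z|lborel. inv_fourier b z * inv_fourier a (y - z))" for y
  proof -
    have "inv_fourier (\<lambda>\<xi>. a \<xi> * b \<xi>) y = (LINT \<xi>|lborel. a \<xi> * fourier (inv_fourier b) \<xi> * chi y \<xi>)"
      by (simp add: inv_fourier_chi fourier_inv_fourier[OF b])
    also have "\<dots> = (LINT \<xi>|lborel. (LINT z|lborel. a \<xi> * inv_fourier b z * (chi \<xi> (- z) * chi y \<xi>)))"
      by (simp add: fourier_chi mult_ac flip: integral_mult_right_zero integral_mult_left_zero)
    also have "\<dots> = (LINT z|lborel. (LINT \<xi>|lborel. a \<xi> * inv_fourier b z * (chi \<xi> (- z) * chi y \<xi>)))"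
    proof (rule lborel_pair.Fubini_integral)
      have "integrable (lborel \<Otimes>\<^sub>M lborel) (\<lambda>(z, \<xi>). inv_fourier b z * a \<xi>)"
        by (rule lborel_pair.integrable_product[OF inv_fourier_integrable[OF b] test_funs_integrable[OF a]])
      then have "integrable (lborel \<Otimes>\<^sub>M lborel) (\<lambda>w. (case w of (z, \<xi>) \<Rightarrow> inv_fourier b z * a \<xi>) * (chi (snd w) (- fst w) * chi y (snd w)))"
        by (rule integrable_mult_bounded[where B = 1]) (auto simp: norm_mult)
      then show "integrable (lborel \<Otimes>\<^sub>M lborel) (\<lambda>(z, \<xi>). a \<xi> * inv_fourier b z * (chi \<xi> (- z) * chi y \<xi>))"
        by (simp add: case_prod_unfold mult_ac)
    qed
    also have "\<dots> = (LINT z|lborel. inv_fourier b z * inv_fourier a (y - z))"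
    proof -
      have "chi \<xi> (- z) * chi y \<xi> = chi (y - z) \<xi>" for \<xi> z
        using chi_add_left[of y "- z" \<xi>] by (simp add: chi_commute mult.commute)
      then show ?thesis by (simp add: inv_fourier_chi mult_ac flip: integral_mult_right_zero)
    qed
    finally show ?thesis .
  qed
  then have "(\<integral>\<^sup>+x. ennreal (cmod (inv_fourier (\<lambda>\<xi>. a \<xi> * b \<xi>) x)) \<partial>lborel)
      = (\<integral>\<^sup>+y. ennreal (cmod (LINT z|lborel. inv_fourier b z * inv_fourier a (y - z))) \<partial>lborel)" by simp
  also have "\<dots> \<le> (\<integral>\<^sup>+y. (\<integral>\<^sup>+z. ennreal (cmod (inv_fourier b z)) * ennreal (cmod (inv_fourier a (y - z))) \<partial>lborel) \<partial>lborel)"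
  proof (rule nn_integral_mono)
    fix y
    have "ennreal (cmod (LINT z|lborel. inv_fourier b z * inv_fourier a (y - z))) \<le> (\<integral>\<^sup>+z. ennreal (cmod (inv_fourier b z * inv_fourier a (y - z))) \<partial>lborel)"
      by (cases "integrable lborel (\<lambda>z. inv_fourier b z * inv_fourier a (y - z))")
         (auto simp: integral_norm_bound_ennreal not_integrable_integral_eq)
    then show "ennreal (cmod (LINT z|lborel. inv_fourier b z * inv_fourier a (y - z))) \<le> (\<integral>\<^sup>+z. ennreal (cmod (inv_fourier b z)) * ennreal (cmod (inv_fourier a (y - z))) \<partial>lborel)"
      by (simp add: norm_mult ennreal_mult)
  qed
  also have "\<dots> = (\<integral>\<^sup>+z. (\<integral>\<^sup>+y. ennreal (cmod (inv_fourier b z)) * ennreal (cmod (inv_fourier a (y - z))) \<partial>lborel) \<partial>lborel)"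
    by (rule lborel_pair.Fubini') measurable
  also have "\<dots> = (\<integral>\<^sup>+z. ennreal (cmod (inv_fourier b z)) * (\<integral>\<^sup>+y. ennreal (cmod (inv_fourier a (- z + y))) \<partial>lborel) \<partial>lborel)"
    by (subst nn_integral_cmult) (auto simp: add.commute)
  also have "\<dots> = (\<integral>\<^sup>+z. ennreal (cmod (inv_fourier b z)) * (\<integral>\<^sup>+y. ennreal (cmod (inv_fourier a y)) \<partial>lborel) \<partial>lborel)"
    by (subst nn_integral_lborel_shift) auto
  finally show ?thesis by (simp add: nn_integral_multc mult.commute)
qed

subsection \<open>Distributions\<close>

text \<open>The seminorm form of continuity on test functions: on each compact set some finite order
  suffices. Linearity is not part of it, so that antilinear functionals can be tested as
  well.\<close>

definition test_bounded :: "(real^'d) set \<Rightarrow> ((real^'d \<Rightarrow> complex) \<Rightarrow> complex) \<Rightarrow> bool" where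
  "test_bounded \<Omega> \<Lambda> \<longleftrightarrow> (\<forall>K. compact K \<and> K \<subseteq> \<Omega> \<longrightarrow> (\<exists>n C. 0 \<le> C \<and> (\<forall>f\<in>test_funs \<Omega>. \<forall>B. fun_supp f \<subseteq> K \<longrightarrow>
     (\<forall>js. length js \<le> n \<longrightarrow> (\<forall>x. cmod (partials js f x) \<le> B)) \<longrightarrow> cmod (\<Lambda> f) \<le> C * B)))"

definition distribution_on :: "(real^'d) set \<Rightarrow> ((real^'d \<Rightarrow> complex) \<Rightarrow> complex) \<Rightarrow> bool" where
  "distribution_on \<Omega> \<Lambda> \<longleftrightarrow> test_bounded \<Omega> \<Lambda> \<and>
     (\<forall>f\<in>test_funs \<Omega>. \<forall>g\<in>test_funs \<Omega>. \<forall>a b. \<Lambda> (\<lambda>x. a * f x + b * g x) = a * \<Lambda> f + b * \<Lambda> g)"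

lemma distribution_linear:
  "distribution_on \<Omega> \<Lambda> \<Longrightarrow> f \<in> test_funs \<Omega> \<Longrightarrow> g \<in> test_funs \<Omega> \<Longrightarrow>
     \<Lambda> (\<lambda>x. a * f x + b * g x) = a * \<Lambda> f + b * \<Lambda> g"
  unfolding distribution_on_def by blast

lemma test_boundedE:
  assumes "test_bounded \<Omega> \<Lambda>" "compact K" "K \<subseteq> \<Omega>"
  obtains n C where "0 \<le> C" "\<And>f B. f \<in> test_funs \<Omega> \<Longrightarrow> fun_supp f \<subseteq> K \<Longrightarrow>
     (\<And>js x. length js \<le> n \<Longrightarrow> cmod (partials js f x) \<le> B) \<Longrightarrow> cmod (\<Lambda> f) \<le> C * B"
  using assms unfolding test_bounded_def by meson

lemma test_bounded_mono:
  assumes "test_bounded \<Omega> \<Lambda>" "\<And>f. f \<in> test_funs \<Omega> \<Longrightarrow> cmod (\<Lambda>' f) \<le> cmod (\<Lambda> f)"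
  shows "test_bounded \<Omega> \<Lambda>'"
  using assms unfolding test_bounded_def by (meson order_trans)

lemma test_bounded_cnj:
  assumes "test_bounded \<Omega> \<Lambda>"
  shows "test_bounded \<Omega> (\<lambda>\<theta>. \<Lambda> (\<lambda>x. cnj (\<theta> x)))"
  unfolding test_bounded_def
proof (intro allI impI)
  fix K assume K: "compact K \<and> K \<subseteq> \<Omega>"
  obtain n C where C: "0 \<le> C" "\<And>f B. f \<in> test_funs \<Omega> \<Longrightarrow> fun_supp f \<subseteq> K \<Longrightarrow>
     (\<And>js x. length js \<le> n \<Longrightarrow> cmod (partials js f x) \<le> B) \<Longrightarrow> cmod (\<Lambda> f) \<le> C * B"
    using K by (elim conjE) (rule test_boundedE[OF assms], assumption, assumption, blast)
  show "\<exists>n C. 0 \<le> C \<and> (\<forall>f\<in>test_funs \<Omega>. \<forall>B. fun_supp f \<subseteq> K \<longrightarrow>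
     (\<forall>js. length js \<le> n \<longrightarrow> (\<forall>x. cmod (partials js f x) \<le> B)) \<longrightarrow> cmod (\<Lambda> (\<lambda>x. cnj (f x))) \<le> C * B)"
    by (intro exI[of _ n] exI[of _ C])
       (auto intro!: C simp: test_funs_cnj smooth_fun_cnj(2)[OF test_funsD(1)])
qed

lemma partials_cmult:
  assumes "smooth_fun f"
  shows "partials js (\<lambda>x. c * f x) = (\<lambda>x. c * partials js f x)"
  using partials_linear[OF assms assms, of js c 0] by simp

lemma partials_diff:
  assumes "smooth_fun f" "smooth_fun g"
  shows "partials js (\<lambda>x. f x - g x) = (\<lambda>x. partials js f x - partials js g x)"
  using partials_linear[OF assms, of js 1 "-1"] by simp

lemma test_funs_cmult: "f \<in> test_funs \<Omega> \<Longrightarrow> (\<lambda>x. c * f x) \<in> test_funs \<Omega>"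
  using test_funs_linear[of f \<Omega> f c 0] by simp

lemma test_funs_diff: "f \<in> test_funs \<Omega> \<Longrightarrow> g \<in> test_funs \<Omega> \<Longrightarrow> (\<lambda>x. f x - g x) \<in> test_funs \<Omega>"
  using test_funs_linear[of f \<Omega> g 1 "-1"] by simp

lemma fun_supp_subset:
  assumes "compact K" "\<And>x. x \<notin> K \<Longrightarrow> f x = 0"
  shows "fun_supp f \<subseteq> K"
  unfolding fun_supp_def using assms by (intro closure_minimal compact_imp_closed) auto

text \<open>The preimage of the unit ball contains a neighbourhood of 0, into which f is scaled.
  Homogeneity is asked for real scalars only, which covers linear and antilinear
  functionals.\<close>

lemma test_continuous_imp_bounded:
  assumes cont: "\<And>U. open U \<Longrightarrow> openin (test_topology \<Omega>) {\<theta> \<in> test_funs \<Omega>. L \<theta> \<in> U}"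
    and hom: "\<And>\<theta> r. \<theta> \<in> test_funs \<Omega> \<Longrightarrow> L (\<lambda>x. of_real r * \<theta> x) = of_real r * L \<theta>"
  shows "test_bounded \<Omega> L"
  unfolding test_bounded_def
proof (intro allI impI)
  fix K assume K: "compact K \<and> K \<subseteq> \<Omega>"
  have "L (\<lambda>x. 0) = 0" using hom[OF test_funs_0, of 0] by simp
  then have "(\<lambda>x. 0) \<in> {\<theta> \<in> test_funs \<Omega>. L \<theta> \<in> ball 0 1}" by (simp add: test_funs_0)
  moreover have "\<forall>f\<in>{\<theta> \<in> test_funs \<Omega>. L \<theta> \<in> ball 0 1}. \<exists>V. test_nbhd0 \<Omega> V \<and> (\<lambda>g x. f x + g x) ` V \<subseteq> {\<theta> \<in> test_funs \<Omega>. L \<theta> \<in> ball 0 1}"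
    using cont[OF open_ball, of 0 1] unfolding openin_test_topology by (rule conjunct2)
  ultimately obtain V where V: "test_nbhd0 \<Omega> V" "(\<lambda>g x. 0 + g x) ` V \<subseteq> {\<theta> \<in> test_funs \<Omega>. L \<theta> \<in> ball 0 1}"
    by (meson bspec)
  have "\<exists>n::nat. \<exists>\<epsilon>>0. {f \<in> test_funs \<Omega>. fun_supp f \<subseteq> K \<and>
          (\<forall>js. length js \<le> n \<longrightarrow> (\<forall>x. cmod (partials js f x) < \<epsilon>))} \<subseteq> V"
    using V(1) K unfolding test_nbhd0_def by (elim conjE) simp
  then obtain n \<epsilon> where e: "0 < \<epsilon>" "{f \<in> test_funs \<Omega>. fun_supp f \<subseteq> K \<and>
          (\<forall>js. length js \<le> n \<longrightarrow> (\<forall>x. cmod (partials js f x) < \<epsilon>))} \<subseteq> V"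
    by (elim exE conjE) (rule that)
  have main: "cmod (L f) \<le> (2 / \<epsilon>) * B" if f: "f \<in> test_funs \<Omega>" "fun_supp f \<subseteq> K"
    and B: "\<forall>js. length js \<le> n \<longrightarrow> (\<forall>x. cmod (partials js f x) \<le> B)" for f B
  proof -
    have B0: "0 \<le> B" using B[rule_format, of "[]" undefined] by (simp add: order_trans[OF norm_ge_zero])
    \<comment> \<open>The bound \<open>B\<close> may be 0, and then scaling by \<epsilon>/(2B) would
      make no sense; \<delta> is removed at the end.\<close>
    have "cmod (L f) \<le> (2 / \<epsilon>) * (B + \<delta>)" if "0 < \<delta>" for \<delta>
    proof -
      define r where "r = \<epsilon> / (2 * (B + \<delta>))"
      have r: "0 < r" using e that B0 by (simp add: r_def)
      have rB: "r * B < \<epsilon>"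
      proof -
        have "r * B \<le> r * (B + \<delta>)" using r that by simp
        also have "\<dots> = \<epsilon> / 2" using add_nonneg_pos[OF B0 that] by (simp add: r_def field_simps)
        finally show ?thesis using e by simp
      qed
      have "cmod (partials js (\<lambda>x. of_real r * f x) x) < \<epsilon>" if "length js \<le> n" for js x
      proof -
        have "cmod (partials js (\<lambda>x. of_real r * f x) x) = r * cmod (partials js f x)"
          using r by (simp add: partials_cmult[OF test_funsD(1)[OF f(1)]] norm_mult)
        also have "\<dots> \<le> r * B" using B that r by (intro mult_left_mono) auto
        finally show ?thesis using rB by simp
      qed
      moreover have "fun_supp (\<lambda>x. of_real r * f x) \<subseteq> K"
        using K f test_fun_supp[OF f(1)] by (intro fun_supp_subset) auto
      ultimately have "(\<lambda>x. of_real r * f x) \<in> V"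
        using test_funs_cmult[OF f(1)] by (intro subsetD[OF e(2)]) simp
      then have "cmod (L (\<lambda>x. of_real r * f x)) < 1" using V(2) by auto
      then have "r * cmod (L f) < 1" using r by (simp add: hom[OF f(1)] norm_mult)
      then have "cmod (L f) < 1 / r" using r by (simp add: field_simps)
      also have "1 / r = (2 / \<epsilon>) * (B + \<delta>)" by (simp add: r_def)
      finally show ?thesis by simp
    qed
    note le = this
    show ?thesis
    proof (rule field_le_epsilon)
      fix d :: real assume d: "0 < d"
      have "cmod (L f) \<le> (2 / \<epsilon>) * (B + d * \<epsilon> / 2)"
        using e d by (intro le) simp
      also have "\<dots> = (2 / \<epsilon>) * B + d" using e by (simp add: field_simps)
      finally show "cmod (L f) \<le> (2 / \<epsilon>) * B + d" .
    qed
  qed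
  show "\<exists>n C. 0 \<le> C \<and> (\<forall>f\<in>test_funs \<Omega>. \<forall>B. fun_supp f \<subseteq> K \<longrightarrow>
     (\<forall>js. length js \<le> n \<longrightarrow> (\<forall>x. cmod (partials js f x) \<le> B)) \<longrightarrow> cmod (L f) \<le> C * B)"
    using main e(1) by (intro exI[of _ n] exI[of _ "2 / \<epsilon>"] conjI ballI allI impI) simp_all
qed

text \<open>The set where L is smaller than \<delta> is absolutely convex, and the seminorm bound
  makes it a neighbourhood of 0. The hypothesis \<open>sub\<close> replaces homogeneity so that the
  antilinear case is included.\<close>

lemma test_bounded_imp_continuous:
  assumes bdd: "test_bounded \<Omega> L"
    and add: "\<And>f g. f \<in> test_funs \<Omega> \<Longrightarrow> g \<in> test_funs \<Omega> \<Longrightarrow> L (\<lambda>x. f x + g x) = L f + L g"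
    and sub: "\<And>f g a b. f \<in> test_funs \<Omega> \<Longrightarrow> g \<in> test_funs \<Omega> \<Longrightarrow>
        cmod (L (\<lambda>x. a * f x + b * g x)) \<le> cmod a * cmod (L f) + cmod b * cmod (L g)"
    and U: "open U"
  shows "openin (test_topology \<Omega>) {\<theta> \<in> test_funs \<Omega>. L \<theta> \<in> U}"
  unfolding openin_test_topology
proof (intro conjI ballI)
  fix f assume "f \<in> {\<theta> \<in> test_funs \<Omega>. L \<theta> \<in> U}"
  then have f: "f \<in> test_funs \<Omega>" "L f \<in> U" by auto
  then obtain \<delta> where \<delta>: "0 < \<delta>" "ball (L f) \<delta> \<subseteq> U" using U by (metis open_contains_ball)
  let ?V = "{g \<in> test_funs \<Omega>. cmod (L g) < \<delta>}"
  have "test_nbhd0 \<Omega> ?V"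
    unfolding test_nbhd0_def
  proof (intro conjI ballI allI impI)
    fix g k a b assume gk: "g \<in> ?V" "k \<in> ?V" and ab: "cmod a + cmod b \<le> 1"
    have "cmod (L (\<lambda>x. a * g x + b * k x)) \<le> cmod a * cmod (L g) + cmod b * cmod (L k)"
      using gk by (intro sub) auto
    also have "\<dots> \<le> cmod a * max (cmod (L g)) (cmod (L k)) + cmod b * max (cmod (L g)) (cmod (L k))"
      by (intro add_mono mult_left_mono) auto
    also have "\<dots> = (cmod a + cmod b) * max (cmod (L g)) (cmod (L k))" by (simp add: algebra_simps)
    also have "\<dots> \<le> 1 * max (cmod (L g)) (cmod (L k))" using ab by (intro mult_right_mono) (auto simp: le_max_iff_disj)
    also have "\<dots> < \<delta>" using gk by simp
    finally show "(\<lambda>x. a * g x + b * k x) \<in> ?V" using gk by (simp add: test_funs_linear)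
  next
    fix K assume K: "compact K \<and> K \<subseteq> \<Omega>"
    obtain n C where C: "0 \<le> C" "\<And>f B. f \<in> test_funs \<Omega> \<Longrightarrow> fun_supp f \<subseteq> K \<Longrightarrow>
       (\<And>js x. length js \<le> n \<Longrightarrow> cmod (partials js f x) \<le> B) \<Longrightarrow> cmod (L f) \<le> C * B"
      using K by (elim conjE) (rule test_boundedE[OF bdd], assumption, assumption, blast)
    have "cmod (L g) < \<delta>" if "g \<in> test_funs \<Omega>" "fun_supp g \<subseteq> K"
      "\<forall>js. length js \<le> n \<longrightarrow> (\<forall>x. cmod (partials js g x) < \<delta> / (C + 1))" for g
    proof -
      have "cmod (L g) \<le> C * (\<delta> / (C + 1))" using that by (intro C(2)) (auto intro: less_imp_le)
      also have "\<dots> < \<delta>" using C(1) \<delta>(1) by (simp add: field_simps)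
      finally show ?thesis .
    qed
    then show "\<exists>n. \<exists>\<epsilon>>0. {f \<in> test_funs \<Omega>. fun_supp f \<subseteq> K \<and> (\<forall>js. length js \<le> n \<longrightarrow> (\<forall>x. cmod (partials js f x) < \<epsilon>))} \<subseteq> ?V"
      using C(1) \<delta>(1) by (intro exI[of _ n] exI[of _ "\<delta> / (C + 1)"]) auto
  qed auto
  moreover have "(\<lambda>g x. f x + g x) ` ?V \<subseteq> {\<theta> \<in> test_funs \<Omega>. L \<theta> \<in> U}"
  proof safe
    fix g assume g: "g \<in> test_funs \<Omega>" "cmod (L g) < \<delta>"
    show "(\<lambda>x. f x + g x) \<in> test_funs \<Omega>" using test_funs_linear[OF f(1) g(1), of 1 1] by simp
    show "L (\<lambda>x. f x + g x) \<in> U"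
      using g \<delta>(2) by (auto simp: add[OF f(1) g(1)] dist_norm)
  qed
  ultimately show "\<exists>V. test_nbhd0 \<Omega> V \<and> (\<lambda>g x. f x + g x) ` V \<subseteq> {\<theta> \<in> test_funs \<Omega>. L \<theta> \<in> U}" by blast
qed auto

lemma continuous_map_transport_test:
  "continuous_map (transport_topology T (test_topology \<Omega>)) euclidean f \<longleftrightarrow>
     (\<forall>U. open U \<longrightarrow> openin (test_topology \<Omega>) {\<theta> \<in> test_funs \<Omega>. f (T \<theta>) \<in> U})"
proof -
  have "{\<theta> \<in> test_funs \<Omega>. T \<theta> \<in> T ` test_funs \<Omega> \<and> f (T \<theta>) \<in> U} = {\<theta> \<in> test_funs \<Omega>. f (T \<theta>) \<in> U}" for U by auto
  then show ?thesis
    by (auto simp: continuous_map_def topspace_transport_topology openin_transport_topology topspace_test_topology)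
qed

text \<open>Continuity for the transported inductive limit topology is replaced by seminorm bounds
  on the frequency side; all later arguments use only these.\<close>

lemma S_antidual_iff:
  "f \<in> S_antidual \<Omega> \<longleftrightarrow> test_bounded \<Omega> (\<lambda>\<theta>. f (inv_fourier \<theta>)) \<and>
     (\<forall>\<phi>\<in>S_space \<Omega>. \<forall>\<theta>\<in>S_space \<Omega>. \<forall>a b.
        f (\<lambda>x. a * \<phi> x + b * \<theta> x) = cnj a * f \<phi> + cnj b * f \<theta>) \<and>
     (\<forall>\<phi>. \<phi> \<notin> S_space \<Omega> \<longrightarrow> f \<phi> = 0)" (is "_ \<longleftrightarrow> ?B \<and> ?L \<and> ?Z")
proof -
  have "continuous_map (S_topology \<Omega>) euclidean f \<longleftrightarrow> ?B" if L: ?L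
  proof -
    have lin: "f (inv_fourier (\<lambda>x. a * \<phi> x + b * \<theta> x)) = cnj a * f (inv_fourier \<phi>) + cnj b * f (inv_fourier \<theta>)"
      if "\<phi> \<in> test_funs \<Omega>" "\<theta> \<in> test_funs \<Omega>" for a b \<phi> \<theta>
    proof -
      have "inv_fourier (\<lambda>x. a * \<phi> x + b * \<theta> x) = (\<lambda>x. a * inv_fourier \<phi> x + b * inv_fourier \<theta> x)"
        using that by (intro ext inv_fourier_linear test_funs_integrable)
      then show ?thesis using L that by (auto simp: S_space_def)
    qed
    show ?thesis
    proof
      assume "continuous_map (S_topology \<Omega>) euclidean f"
      then show ?B
        unfolding S_topology_def continuous_map_transport_test
        by (intro test_continuous_imp_bounded) (use lin[of _ _ _ 0] in auto)
    next
      assume ?B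
      then show "continuous_map (S_topology \<Omega>) euclidean f"
        unfolding S_topology_def continuous_map_transport_test
      proof (intro allI impI test_bounded_imp_continuous)
        fix \<phi> \<theta> a b assume *: "\<phi> \<in> test_funs \<Omega>" "\<theta> \<in> test_funs \<Omega>"
        show "f (inv_fourier (\<lambda>x. \<phi> x + \<theta> x)) = f (inv_fourier \<phi>) + f (inv_fourier \<theta>)"
          using lin[OF *, of 1 1] by simp
        show "cmod (f (inv_fourier (\<lambda>x. a * \<phi> x + b * \<theta> x))) \<le> cmod a * cmod (f (inv_fourier \<phi>)) + cmod b * cmod (f (inv_fourier \<theta>))"
          unfolding lin[OF *] by (rule order_trans[OF norm_triangle_ineq]) (simp add: norm_mult)
      qed
    qed
  qed
  then show ?thesis unfolding S_antidual_def by auto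
qed

lemma Z_dual_iff:
  "f \<in> Z_dual \<Omega> \<longleftrightarrow> test_bounded \<Omega> (\<lambda>\<theta>. f (fourier \<theta>)) \<and>
     (\<forall>\<phi>\<in>Z_space \<Omega>. \<forall>\<theta>\<in>Z_space \<Omega>. \<forall>a b.
        f (\<lambda>x. a * \<phi> x + b * \<theta> x) = a * f \<phi> + b * f \<theta>) \<and>
     (\<forall>\<phi>. \<phi> \<notin> Z_space \<Omega> \<longrightarrow> f \<phi> = 0)" (is "_ \<longleftrightarrow> ?B \<and> ?L \<and> ?Z")
proof -
  have "continuous_map (Z_topology \<Omega>) euclidean f \<longleftrightarrow> ?B" if L: ?L
  proof -
    have lin: "f (fourier (\<lambda>x. a * \<phi> x + b * \<theta> x)) = a * f (fourier \<phi>) + b * f (fourier \<theta>)"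
      if "\<phi> \<in> test_funs \<Omega>" "\<theta> \<in> test_funs \<Omega>" for a b \<phi> \<theta>
    proof -
      have "fourier (\<lambda>x. a * \<phi> x + b * \<theta> x) = (\<lambda>x. a * fourier \<phi> x + b * fourier \<theta> x)"
        unfolding fourier_eq_inv_fourier using that by (intro ext inv_fourier_linear test_funs_integrable)
      then show ?thesis using L that by (auto simp: Z_space_def)
    qed
    show ?thesis
    proof
      assume "continuous_map (Z_topology \<Omega>) euclidean f"
      then show ?B
        unfolding Z_topology_def continuous_map_transport_test
        by (intro test_continuous_imp_bounded) (use lin[of _ _ _ 0] in auto)
    next
      assume ?B
      then show "continuous_map (Z_topology \<Omega>) euclidean f"
        unfolding Z_topology_def continuous_map_transport_test
      proof (intro allI impI test_bounded_imp_continuous)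
        fix \<phi> \<theta> a b assume *: "\<phi> \<in> test_funs \<Omega>" "\<theta> \<in> test_funs \<Omega>"
        show "f (fourier (\<lambda>x. \<phi> x + \<theta> x)) = f (fourier \<phi>) + f (fourier \<theta>)"
          using lin[OF *, of 1 1] by simp
        show "cmod (f (fourier (\<lambda>x. a * \<phi> x + b * \<theta> x))) \<le> cmod a * cmod (f (fourier \<phi>)) + cmod b * cmod (f (fourier \<theta>))"
          unfolding lin[OF *] by (rule order_trans[OF norm_triangle_ineq]) (simp add: norm_mult)
      qed
    qed
  qed
  then show ?thesis unfolding Z_dual_def by auto
qed

text \<open>The Fourier transform of f as a distribution on \<Omega>. Conjugating \<theta> turns the
  antilinear f into a linear functional; by \<open>Gamma_map_fourier\<close> it agrees on test
  functions with \<open>distr_hat\<close> of \<open>Gamma_map\<close>.\<close>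

definition antidual_hat :: "((real^'d \<Rightarrow> complex) \<Rightarrow> complex) \<Rightarrow> (real^'d \<Rightarrow> complex) \<Rightarrow> complex" where
  "antidual_hat f \<theta> = f (inv_fourier (\<lambda>\<xi>. cnj (\<theta> \<xi>)))"

lemma distribution_antidual_hat:
  assumes "f \<in> S_antidual \<Omega>"
  shows "distribution_on \<Omega> (antidual_hat f)"
  unfolding distribution_on_def
proof (intro conjI ballI allI)
  show "test_bounded \<Omega> (antidual_hat f)"
    unfolding antidual_hat_def[abs_def]
    using assms by (intro test_bounded_cnj[of _ "\<lambda>\<theta>. f (inv_fourier \<theta>)"]) (simp add: S_antidual_iff)
  fix \<phi> \<theta> a b assume *: "\<phi> \<in> test_funs \<Omega>" "\<theta> \<in> test_funs \<Omega>"
  have "inv_fourier (\<lambda>\<xi>. cnj (a * \<phi> \<xi> + b * \<theta> \<xi>)) = (\<lambda>x. cnj a * inv_fourier (\<lambda>\<xi>. cnj (\<phi> \<xi>)) x + cnj b * inv_fourier (\<lambda>\<xi>. cnj (\<theta> \<xi>)) x)"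
    unfolding complex_cnj_add complex_cnj_mult using *
    by (intro ext inv_fourier_linear test_funs_integrable test_funs_cnj)
  then show "antidual_hat f (\<lambda>x. a * \<phi> x + b * \<theta> x) = a * antidual_hat f \<phi> + b * antidual_hat f \<theta>"
    using assms * by (auto simp: antidual_hat_def S_antidual_iff S_space_def test_funs_cnj)
qed

lemma S_space_cnj_iff: "(\<lambda>x. cnj (s x)) \<in> S_space \<Omega> \<longleftrightarrow> s \<in> Z_space \<Omega>"
proof
  assume "(\<lambda>x. cnj (s x)) \<in> S_space \<Omega>"
  then obtain \<theta> where t: "\<theta> \<in> test_funs \<Omega>" "(\<lambda>x. cnj (s x)) = inv_fourier \<theta>" by (auto simp: S_space_def)
  have "s = fourier (\<lambda>\<xi>. cnj (\<theta> \<xi>))"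
    using fun_cong[OF t(2)] by (metis cnj_inv_fourier complex_cnj_cnj ext)
  then show "s \<in> Z_space \<Omega>" using test_funs_cnj(1)[OF t(1)] by (auto simp: Z_space_def)
next
  assume "s \<in> Z_space \<Omega>"
  then obtain \<theta> where "\<theta> \<in> test_funs \<Omega>" "s = fourier \<theta>" by (auto simp: Z_space_def)
  then show "(\<lambda>x. cnj (s x)) \<in> S_space \<Omega>"
    by (auto simp: S_space_def cnj_fourier intro!: test_funs_cnj)
qed

lemma Gamma_map_fourier:
  "\<theta> \<in> test_funs \<Omega> \<Longrightarrow> Gamma_map \<Omega> f (fourier \<theta>) = antidual_hat f \<theta>"
  by (auto simp: Gamma_map_def Z_space_def antidual_hat_def cnj_fourier)

lemma Gamma_map_in_Z_dual:
  assumes f: "f \<in> S_antidual \<Omega>"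
  shows "Gamma_map \<Omega> f \<in> Z_dual \<Omega>"
  unfolding Z_dual_iff
proof (intro conjI ballI allI impI)
  show "test_bounded \<Omega> (\<lambda>\<theta>. Gamma_map \<Omega> f (fourier \<theta>))"
    using distribution_antidual_hat[OF f] unfolding distribution_on_def
    by (auto intro: test_bounded_mono simp: Gamma_map_fourier)
  fix \<phi> \<theta> a b assume *: "\<phi> \<in> Z_space \<Omega>" "\<theta> \<in> Z_space \<Omega>"
  have "(\<lambda>x. a * \<phi> x + b * \<theta> x) \<in> Z_space \<Omega>"
  proof -
    obtain \<phi>' \<theta>' where t: "\<phi>' \<in> test_funs \<Omega>" "\<phi> = fourier \<phi>'" "\<theta>' \<in> test_funs \<Omega>" "\<theta> = fourier \<theta>'"
      using * by (auto simp: Z_space_def)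
    then have "(\<lambda>x. a * \<phi> x + b * \<theta> x) = fourier (\<lambda>x. a * \<phi>' x + b * \<theta>' x)"
      by (simp add: fourier_eq_inv_fourier inv_fourier_linear[OF test_funs_integrable test_funs_integrable] fun_eq_iff)
    then show ?thesis unfolding Z_space_def by (simp only:) (intro imageI test_funs_linear t(1,3))
  qed
  then show "Gamma_map \<Omega> f (\<lambda>x. a * \<phi> x + b * \<theta> x) = a * Gamma_map \<Omega> f \<phi> + b * Gamma_map \<Omega> f \<theta>"
    using f * by (simp add: Gamma_map_def S_antidual_iff S_space_cnj_iff)
qed (simp add: Gamma_map_def)

lemma bij_betw_Gamma_map: "bij_betw (Gamma_map \<Omega>) (S_antidual \<Omega>) (Z_dual \<Omega>)"
\<comment> \<open>Conjugating the argument is an involution, so the inverse has the same shape, cut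
  off outside \<open>S_space\<close> because functionals are normalised to vanish there.\<close>
proof (rule bij_betwI[where g = "\<lambda>z s. if s \<in> S_space \<Omega> then z (\<lambda>x. cnj (s x)) else 0"])
  show "Gamma_map \<Omega> \<in> S_antidual \<Omega> \<rightarrow> Z_dual \<Omega>" using Gamma_map_in_Z_dual by blast
  have ZS: "(\<lambda>x. cnj (s x)) \<in> Z_space \<Omega> \<longleftrightarrow> s \<in> S_space \<Omega>" for s
    using S_space_cnj_iff[of "\<lambda>x. cnj (s x)"] by simp
  show "(\<lambda>s. if s \<in> S_space \<Omega> then Gamma_map \<Omega> f (\<lambda>x. cnj (s x)) else 0) = f" if "f \<in> S_antidual \<Omega>" for f
    using that by (auto simp: Gamma_map_def ZS S_antidual_def fun_eq_iff)
  show "Gamma_map \<Omega> (\<lambda>s. if s \<in> S_space \<Omega> then z (\<lambda>x. cnj (s x)) else 0) = z" if "z \<in> Z_dual \<Omega>" for z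
    using that by (auto simp: Gamma_map_def S_space_cnj_iff Z_dual_def fun_eq_iff)
  show "(\<lambda>z s. if s \<in> S_space \<Omega> then z (\<lambda>x. cnj (s x)) else 0) \<in> Z_dual \<Omega> \<rightarrow> S_antidual \<Omega>"
  proof (intro Pi_I)
    fix z assume z: "z \<in> Z_dual \<Omega>"
    have zl: "z (\<lambda>x. a * \<phi> x + b * \<theta> x) = a * z \<phi> + b * z \<theta>" if "\<phi> \<in> Z_space \<Omega>" "\<theta> \<in> Z_space \<Omega>" for \<phi> \<theta> a b
      using z that unfolding Z_dual_iff by blast
    let ?f = "\<lambda>s. if s \<in> S_space \<Omega> then z (\<lambda>x. cnj (s x)) else 0"
    show "?f \<in> S_antidual \<Omega>"
      unfolding S_antidual_iff
    proof (intro conjI ballI allI impI)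
      have "test_bounded \<Omega> (\<lambda>\<theta>. z (fourier (\<lambda>x. cnj (\<theta> x))))"
        using z by (intro test_bounded_cnj[of _ "\<lambda>\<theta>. z (fourier \<theta>)"]) (simp add: Z_dual_iff)
      then show "test_bounded \<Omega> (\<lambda>\<theta>. ?f (inv_fourier \<theta>))"
        by (rule test_bounded_mono) (auto simp: S_space_def cnj_inv_fourier)
      fix \<phi> \<theta> a b assume *: "\<phi> \<in> S_space \<Omega>" "\<theta> \<in> S_space \<Omega>"
      have lin: "(\<lambda>x. a * \<phi> x + b * \<theta> x) \<in> S_space \<Omega>"
      proof -
        obtain \<phi>' \<theta>' where t: "\<phi>' \<in> test_funs \<Omega>" "\<phi> = inv_fourier \<phi>'" "\<theta>' \<in> test_funs \<Omega>" "\<theta> = inv_fourier \<theta>'"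
          using * by (auto simp: S_space_def)
        then have "(\<lambda>x. a * \<phi> x + b * \<theta> x) = inv_fourier (\<lambda>x. a * \<phi>' x + b * \<theta>' x)"
          by (simp add: inv_fourier_linear[OF test_funs_integrable test_funs_integrable] fun_eq_iff)
        then show ?thesis unfolding S_space_def by (simp only:) (intro imageI test_funs_linear t(1,3))
      qed
      have "(\<lambda>x. cnj (\<phi> x)) \<in> Z_space \<Omega>" "(\<lambda>x. cnj (\<theta> x)) \<in> Z_space \<Omega>" using * ZS by auto
      then have "z (\<lambda>x. cnj a * cnj (\<phi> x) + cnj b * cnj (\<theta> x)) = cnj a * z (\<lambda>x. cnj (\<phi> x)) + cnj b * z (\<lambda>x. cnj (\<theta> x))"
        by (rule zl)
      then show "?f (\<lambda>x. a * \<phi> x + b * \<theta> x) = cnj a * ?f \<phi> + cnj b * ?f \<theta>"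
        using * lin by simp
    qed auto
  qed
qed

lemma distribution_cmult:
  assumes "distribution_on \<Omega> \<Lambda>" "f \<in> test_funs \<Omega>"
  shows "\<Lambda> (\<lambda>x. c * f x) = c * \<Lambda> f"
proof -
  have "\<Lambda> (\<lambda>x. c * f x + 0 * f x) = c * \<Lambda> f + 0 * \<Lambda> f"
    using assms unfolding distribution_on_def by blast
  then show ?thesis by simp
qed

lemma distribution_sum:
  assumes L: "distribution_on \<Omega> \<Lambda>" and "finite S" "\<And>i. i \<in> S \<Longrightarrow> F i \<in> test_funs \<Omega>"
  shows "\<Lambda> (\<lambda>x. \<Sum>i\<in>S. c i * F i x) = (\<Sum>i\<in>S. c i * \<Lambda> (F i))"
  using assms(2,3)
proof (induction S rule: finite_induct)
  case empty
  have "\<Lambda> (\<lambda>x. 0) = 0"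
    using distribution_cmult[OF L test_funs_0[of \<Omega>], of 0] by simp
  then show ?case by simp
next
  case (insert i S)
  have "(\<lambda>x. \<Sum>i\<in>S. c i * F i x) \<in> test_funs \<Omega>" using insert by (intro test_funs_sum) auto
  then have "\<Lambda> (\<lambda>x. c i * F i x + 1 * (\<Sum>i\<in>S. c i * F i x)) = c i * \<Lambda> (F i) + 1 * \<Lambda> (\<lambda>x. \<Sum>i\<in>S. c i * F i x)"
    using insert.prems[of i] by (intro distribution_linear[OF L]) auto
  then show ?case using insert by simp
qed

lemma distribution_diff:
  assumes "distribution_on \<Omega> \<Lambda>" "f \<in> test_funs \<Omega>" "g \<in> test_funs \<Omega>"
  shows "\<Lambda> (\<lambda>x. f x - g x) = \<Lambda> f - \<Lambda> g"
proof -
  have "\<Lambda> (\<lambda>x. 1 * f x + (- 1) * g x) = 1 * \<Lambda> f + (- 1) * \<Lambda> g"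
    using assms unfolding distribution_on_def by blast
  then show ?thesis by simp
qed

section \<open>Families of test functions with a common compact support\<close>

locale supported_family =
  fixes \<Omega> K :: "(real^'d) set" and F :: "'p::euclidean_space \<Rightarrow> real^'d \<Rightarrow> complex"
  assumes family: "smooth_family F"
    and K: "compact K" "K \<subseteq> \<Omega>" and supp: "\<And>p \<xi>. \<xi> \<notin> K \<Longrightarrow> F p \<xi> = 0"
begin

lemma smooth: "smooth_fun (F p)"
  by (rule smooth_family_smooth[OF family])

lemma test: "F p \<in> test_funs \<Omega>" "fun_supp (F p) \<subseteq> K"
  using test_funsI[OF smooth K supp] by auto

lemma partials_0: "\<xi> \<notin> K \<Longrightarrow> partials js (F p) \<xi> = 0"
  using K(1) supp by (intro partials_eq_0[of K]) (auto simp: compact_imp_closed)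

lemma partials_bound:
  obtains c where "poly_growth c" "\<And>p. 0 \<le> c p" "\<And>p \<xi>. cmod (partials js (F p) \<xi>) \<le> c p"
proof -
  obtain R where R: "\<And>\<xi>. \<xi> \<in> K \<Longrightarrow> norm \<xi> \<le> R"
    using compact_imp_bounded[OF K(1)] unfolding bounded_iff by auto
  obtain c where "poly_growth c" "\<And>p. 0 \<le> c p" "\<And>p \<xi>. norm \<xi> \<le> R \<Longrightarrow> cmod (partials js (F p) \<xi>) \<le> c p"
    by (rule smooth_family_bound[OF smooth_family_partials[OF family]]) blast
  then show ?thesis using R partials_0 that by (metis norm_zero)
qed

lemma partials_continuous: "continuous_on UNIV (\<lambda>p. partials js (F p) \<xi>)"
  using continuous_on_compose2[OF smooth_family_continuous[OF smooth_family_partials[OF family]], of UNIV "\<lambda>p. (p, \<xi>)"]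
  by (simp add: continuous_on_Pair continuous_on_id continuous_on_const)

lemma partials_measurable:
  assumes "X \<in> borel_measurable M"
  shows "(\<lambda>m. partials js (F (X m)) \<xi>) \<in> borel_measurable M"
  by (rule measurable_compose[OF assms borel_measurable_continuous_onI[OF partials_continuous]])

text \<open>Joint continuity in (p, \<xi>) together with compactness of \<open>K\<close> gives
  convergence uniform in \<xi>, and outside \<open>K\<close> all derivatives vanish.\<close>

lemma partials_uniform:
  assumes P: "P \<longlonglongrightarrow> p" and e: "0 < e"
  shows "\<forall>\<^sub>F k in sequentially. \<forall>\<xi>. cmod (partials js (F (P k)) \<xi> - partials js (F p) \<xi>) \<le> e"
proof -
  have "continuous_on (UNIV \<times> K) (\<lambda>(p, \<xi>). partials js (F p) \<xi>)"
    using smooth_family_continuous[OF smooth_family_partials[OF family]] continuous_on_subset by blast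
  from continuous_on_prod_compactE[OF this K(1) UNIV_I[of p] e] obtain X0 where X0: "p \<in> X0" "open X0"
    "\<forall>x\<in>X0. \<forall>t\<in>K. dist (partials js (F x) t) (partials js (F p) t) \<le> e" by auto
  have "\<forall>\<^sub>F k in sequentially. P k \<in> X0" using topological_tendstoD[OF P X0(2,1)] .
  then show ?thesis
  proof (rule eventually_mono)
    fix k assume k: "P k \<in> X0"
    show "\<forall>\<xi>. cmod (partials js (F (P k)) \<xi> - partials js (F p) \<xi>) \<le> e"
    proof
      fix \<xi>
      show "cmod (partials js (F (P k)) \<xi> - partials js (F p) \<xi>) \<le> e"
        using X0(3) k partials_0[of \<xi> js] e by (cases "\<xi> \<in> K") (auto simp: dist_norm)
    qed
  qed
qed

text \<open>Each derivative of the family grows polynomially in p, so finite moments of the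
  coefficient \<open>c\<close> dominate every derivative of the integrand.\<close>

lemma integral_smooth:
  fixes M :: "'m measure"
  assumes X: "X \<in> borel_measurable M" and c: "c \<in> borel_measurable M"
    and int: "\<And>n. integrable M (\<lambda>m. (1 + norm (X m)) ^ n * cmod (c m))"
  shows "(\<lambda>\<xi>. LINT m|M. c m * F (X m) \<xi>) \<in> test_funs \<Omega>"
    and "fun_supp (\<lambda>\<xi>. LINT m|M. c m * F (X m) \<xi>) \<subseteq> K"
    and "partials js (\<lambda>\<xi>. LINT m|M. c m * F (X m) \<xi>) = (\<lambda>\<xi>. LINT m|M. c m * partials js (F (X m)) \<xi>)"
    and "integrable M (\<lambda>m. c m * partials js (F (X m)) \<xi>)"
proof -
  have "\<exists>C n. \<forall>p \<xi>. cmod (partials js (F p) \<xi>) \<le> C * (1 + norm p) ^ n" for js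
  proof -
    obtain b where b: "poly_growth b" "\<And>p \<xi>. cmod (partials js (F p) \<xi>) \<le> b p"
      by (rule partials_bound[of js]) blast
    obtain C n where "\<And>p. b p \<le> C * (1 + norm p) ^ n" using poly_growthE[OF b(1)] by blast
    then show ?thesis using b(2) by (intro exI[of _ C] exI[of _ n] allI) (rule order_trans)
  qed
  then obtain C n where C: "\<And>js p \<xi>. cmod (partials js (F p) \<xi>) \<le> C js * (1 + norm p) ^ n js" by metis
  have p: "partials js (\<lambda>\<xi>. c m * F (X m) \<xi>) = (\<lambda>\<xi>. c m * partials js (F (X m)) \<xi>)" for js m
    by (rule partials_cmult[OF smooth])
  have bnd: "cmod (partials js (\<lambda>\<xi>. c m * F (X m) \<xi>) \<xi>) \<le> C js * ((1 + norm (X m)) ^ n js * cmod (c m))" for js m \<xi>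
  proof -
    have "cmod (c m) * cmod (partials js (F (X m)) \<xi>) \<le> cmod (c m) * (C js * (1 + norm (X m)) ^ n js)"
      by (intro mult_left_mono C) simp
    then show ?thesis unfolding p norm_mult by (simp add: mult_ac)
  qed
  have meas: "(\<lambda>m. partials js (\<lambda>\<xi>. c m * F (X m) \<xi>) \<xi>) \<in> borel_measurable M" for js \<xi>
    unfolding p using partials_measurable[OF X, of js \<xi>] c by measurable
  have sm: "smooth_fun (\<lambda>\<xi>. c m * F (X m) \<xi>)" for m
    by (intro smooth_fun_mult smooth_fun_const smooth)
  have int': "integrable M (\<lambda>m. C js * ((1 + norm (X m)) ^ n js * cmod (c m)))" for js
    by (intro integrable_mult_right int)
  note * = smooth_fun_lebesgue_integral[OF sm meas bnd int']
  have "(LINT m|M. c m * F (X m) \<xi>) = 0" if "\<xi> \<notin> K" for \<xi> using supp[OF that] by simp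
  from test_funsI[OF *(1) K this]
  show "(\<lambda>\<xi>. LINT m|M. c m * F (X m) \<xi>) \<in> test_funs \<Omega>" "fun_supp (\<lambda>\<xi>. LINT m|M. c m * F (X m) \<xi>) \<subseteq> K" by auto
  show "partials js (\<lambda>\<xi>. LINT m|M. c m * F (X m) \<xi>) = (\<lambda>\<xi>. LINT m|M. c m * partials js (F (X m)) \<xi>)"
    using *(2) unfolding p .
  show "integrable M (\<lambda>m. c m * partials js (F (X m)) \<xi>)"
    using *(3) unfolding p .
qed

context
  fixes \<Lambda> assumes L: "distribution_on \<Omega> \<Lambda>"
begin

text \<open>On functions supported in \<open>K\<close> the distribution sees derivatives up to one
  order only. These are finitely many, so a single index serves them all.\<close>

lemma distribution_tendsto:
  assumes f: "\<And>k. f k \<in> test_funs \<Omega>" "\<And>k. fun_supp (f k) \<subseteq> K" and g: "g \<in> test_funs \<Omega>" "fun_supp g \<subseteq> K"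
    and lim: "\<And>js e. 0 < e \<Longrightarrow> \<forall>\<^sub>F k in sequentially. \<forall>\<xi>. cmod (partials js (f k) \<xi> - partials js g \<xi>) \<le> e"
  shows "(\<lambda>k. \<Lambda> (f k)) \<longlonglongrightarrow> \<Lambda> g"
proof (rule LIMSEQ_I)
  fix r :: real assume r: "0 < r"
  have tb: "test_bounded \<Omega> \<Lambda>" using L by (simp add: distribution_on_def)
  obtain n C where C: "0 \<le> C" "\<And>f B. f \<in> test_funs \<Omega> \<Longrightarrow> fun_supp f \<subseteq> K \<Longrightarrow>
     (\<And>js x. length js \<le> n \<Longrightarrow> cmod (partials js f x) \<le> B) \<Longrightarrow> cmod (\<Lambda> f) \<le> C * B"
    by (rule test_boundedE[OF tb K]) blast
  define e where "e = r / (2 * (C + 1))"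
  have e: "0 < e" using r C(1) by (simp add: e_def)
  have "finite {js :: 'd list. length js \<le> n}"
    using finite_lists_length_le[of "UNIV :: 'd set" n] by simp
  then have "\<forall>\<^sub>F k in sequentially. \<forall>js\<in>{js. length js \<le> n}. \<forall>\<xi>. cmod (partials js (f k) \<xi> - partials js g \<xi>) \<le> e"
    using lim[OF e] by (intro eventually_ball_finite) auto
  then obtain k0 where k0: "\<And>k js \<xi>. k0 \<le> k \<Longrightarrow> length js \<le> n \<Longrightarrow> cmod (partials js (f k) \<xi> - partials js g \<xi>) \<le> e"
    unfolding eventually_sequentially by auto
  have "norm (\<Lambda> (f k) - \<Lambda> g) < r" if "k0 \<le> k" for k
  proof -
    have "norm (\<Lambda> (f k) - \<Lambda> g) = cmod (\<Lambda> (\<lambda>x. f k x - g x))"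
      by (simp add: distribution_diff[OF L f(1) g(1)])
    also have "\<dots> \<le> C * e"
    proof (rule C(2))
      show "(\<lambda>x. f k x - g x) \<in> test_funs \<Omega>" by (rule test_funs_diff[OF f(1) g(1)])
      show "fun_supp (\<lambda>x. f k x - g x) \<subseteq> K"
      proof (rule fun_supp_subset[OF K(1)])
        fix x assume "x \<notin> K"
        then have "f k x = 0" "g x = 0"
          using f(2)[of k] g(2) by (auto intro: test_fun_supp[OF f(1)] test_fun_supp[OF g(1)])
        then show "f k x - g x = 0" by simp
      qed
      show "cmod (partials js (\<lambda>x. f k x - g x) x) \<le> e" if "length js \<le> n" for js x
        using k0[OF \<open>k0 \<le> k\<close> that] by (simp add: partials_diff test_funsD(1)[OF f(1)] test_funsD(1)[OF g(1)])
    qed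
    also have "\<dots> < r"
    proof -
      have "C * e \<le> (C + 1) * e" using e by (simp add: mult_right_mono)
      also have "\<dots> = r / 2" using C(1) by (simp add: e_def field_simps)
      finally show ?thesis using r by simp
    qed
    finally show ?thesis .
  qed
  then show "\<exists>no. \<forall>k\<ge>no. norm (\<Lambda> (f k) - \<Lambda> g) < r" by blast
qed

lemma distribution_family_tendsto: "P \<longlonglongrightarrow> p \<Longrightarrow> (\<lambda>k. \<Lambda> (F (P k))) \<longlonglongrightarrow> \<Lambda> (F p)"
  by (rule distribution_tendsto) (auto simp: test partials_uniform)

lemma distribution_family_continuous: "continuous_on UNIV (\<lambda>p. \<Lambda> (F p))"
  by (rule continuous_on_sequentiallyI) (rule distribution_family_tendsto)

lemma distribution_family_measurable:
  "X \<in> borel_measurable M \<Longrightarrow> (\<lambda>m. \<Lambda> (F (X m))) \<in> borel_measurable M"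
  by (rule measurable_compose[OF _ borel_measurable_continuous_onI[OF distribution_family_continuous]])

text \<open>The growth bounds of the finitely many seminorms that control \<open>\<Lambda>\<close>
  on \<open>K\<close> are added up. This provides the dominating function when integrals of
  \<open>\<Lambda> (F p)\<close> are taken.\<close>

lemma distribution_family_bound:
  obtains C n where "0 \<le> C" "\<And>p. cmod (\<Lambda> (F p)) \<le> C * (1 + norm p) ^ n"
proof -
  have tb: "test_bounded \<Omega> \<Lambda>" using L by (simp add: distribution_on_def)
  obtain n C where C: "0 \<le> C" "\<And>f B. f \<in> test_funs \<Omega> \<Longrightarrow> fun_supp f \<subseteq> K \<Longrightarrow>
     (\<And>js x. length js \<le> n \<Longrightarrow> cmod (partials js f x) \<le> B) \<Longrightarrow> cmod (\<Lambda> f) \<le> C * B"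
    by (rule test_boundedE[OF tb K]) blast
  have "\<exists>c. poly_growth c \<and> (\<forall>p. 0 \<le> c p) \<and> (\<forall>p \<xi>. cmod (partials js (F p) \<xi>) \<le> c p)" for js
    by (rule partials_bound[of js]) blast
  then obtain c where c: "\<And>js. poly_growth (c js)" "\<And>js p. 0 \<le> c js p" "\<And>js p \<xi>. cmod (partials js (F p) \<xi>) \<le> c js p"
    by metis
  have fin: "finite {js :: 'd list. length js \<le> n}"
    using finite_lists_length_le[of "UNIV :: 'd set" n] by simp
  have pg: "poly_growth (\<lambda>p. \<Sum>js\<in>S. c js p)" if "finite S" for S
    using that by (induction S rule: finite_induct) (auto intro: poly_growth_const poly_growth_add c(1))
  have "cmod (\<Lambda> (F p)) \<le> C * (\<Sum>js\<in>{js. length js \<le> n}. c js p)" for p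
  proof (rule C(2)[OF test])
    fix js :: "'d list" and x assume "length js \<le> n"
    then have "c js p \<le> (\<Sum>js\<in>{js. length js \<le> n}. c js p)"
      using c(2) fin by (intro member_le_sum) auto
    then show "cmod (partials js (F p) x) \<le> (\<Sum>js\<in>{js. length js \<le> n}. c js p)"
      using c(3)[of js p x] by simp
  qed
  moreover have "poly_growth (\<lambda>p. C * (\<Sum>js\<in>{js. length js \<le> n}. c js p))"
    using C(1) c(2) by (intro poly_growth_mult poly_growth_const pg[OF fin] sum_nonneg)
  ultimately have "poly_growth (\<lambda>p. cmod (\<Lambda> (F p)))" by (rule poly_growth_mono[rotated])
  then show ?thesis by (rule poly_growthE) (rule that)
qed

lemma distribution_integral_simple:
  fixes M :: "'m measure"
  assumes X: "simple_function M X" and c: "c \<in> borel_measurable M"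
    and int: "integrable M (\<lambda>m. cmod (c m))"
  shows "\<Lambda> (\<lambda>\<xi>. LINT m|M. c m * F (X m) \<xi>) = (LINT m|M. c m * \<Lambda> (F (X m)))"
proof -
  have fin: "finite (X ` space M)" using X by (simp add: simple_function_def)
  let ?I = "\<lambda>p. indicator (X -` {p} \<inter> space M) :: 'm \<Rightarrow> real"
  have meas: "X -` {p} \<inter> space M \<in> sets M" for p using simple_functionD(2)[OF X] .
  have ic: "integrable M c" using c int by (subst integrable_norm_iff[symmetric]) auto
  have icI: "integrable M (\<lambda>m. ?I p m *\<^sub>R c m)" for p
    by (rule integrable_mult_indicator[OF meas ic])
  have split: "(LINT m|M. c m * G (X m)) = (\<Sum>p\<in>X ` space M. (LINT m|M. ?I p m *\<^sub>R c m) * G p)" for G :: "'p \<Rightarrow> complex"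
  proof -
    have "(LINT m|M. c m * G (X m)) = (LINT m|M. (\<Sum>p\<in>X ` space M. (?I p m *\<^sub>R c m) * G p))"
    proof (rule Bochner_Integration.integral_cong)
      fix m assume m: "m \<in> space M"
      have "(\<Sum>p\<in>X ` space M. (?I p m *\<^sub>R c m) * G p) = (\<Sum>p\<in>X ` space M. if p = X m then c m * G p else 0)"
        using m by (intro sum.cong) (auto simp: indicator_def)
      then show "c m * G (X m) = (\<Sum>p\<in>X ` space M. (?I p m *\<^sub>R c m) * G p)"
        using m fin by simp
    qed simp
    also have "\<dots> = (\<Sum>p\<in>X ` space M. (LINT m|M. (?I p m *\<^sub>R c m) * G p))"
      using icI by (intro Bochner_Integration.integral_sum integrable_mult_left)
    finally show ?thesis by (simp only: integral_mult_left_zero)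
  qed
  show ?thesis
    unfolding split[of "\<lambda>p. F p _"] split[of "\<lambda>p. \<Lambda> (F p)"]
    by (rule distribution_sum[OF L fin test(1)])
qed

text \<open>
  The distribution is exchanged with the integral first for simple functions, where the integral is
  a finite sum; the integrals against simple approximations converge in the test function topology.
\<close>

lemma distribution_integral:
  fixes M :: "'m measure"
  assumes X: "X \<in> borel_measurable M" and c: "c \<in> borel_measurable M"
    and int: "\<And>n. integrable M (\<lambda>m. (1 + norm (X m)) ^ n * cmod (c m))"
  shows "\<Lambda> (\<lambda>\<xi>. LINT m|M. c m * F (X m) \<xi>) = (LINT m|M. c m * \<Lambda> (F (X m)))"
    and "integrable M (\<lambda>m. c m * \<Lambda> (F (X m)))"
proof -
  obtain S where S: "\<And>k. simple_function M (S k)" "\<And>m. m \<in> space M \<Longrightarrow> (\<lambda>k. S k m) \<longlonglongrightarrow> X m"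
    "\<And>k m. m \<in> space M \<Longrightarrow> dist (S k m) 0 \<le> 2 * dist (X m) 0"
    using borel_measurable_implies_sequence_metric[OF X, of 0] by metis
  have Sm: "S k \<in> borel_measurable M" for k by (rule borel_measurable_simple_function[OF S(1)])
  \<comment> \<open>The approximations are at most twice as large as \<open>X\<close>, hence the
    factor 2^n in all dominating functions.\<close>
  have Sle: "(1 + norm (S k m)) ^ n \<le> 2 ^ n * (1 + norm (X m)) ^ n" if "m \<in> space M" for k m n
  proof -
    have "1 + norm (S k m) \<le> 2 * (1 + norm (X m))" using S(3)[OF that, of k] by simp
    then have "(1 + norm (S k m)) ^ n \<le> (2 * (1 + norm (X m))) ^ n" by (intro power_mono) auto
    then show ?thesis unfolding power_mult_distrib .
  qed
  have intS: "integrable M (\<lambda>m. (1 + norm (S k m)) ^ n * cmod (c m))" for k n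
  proof (rule Bochner_Integration.integrable_bound)
    show "integrable M (\<lambda>m. 2 ^ n * ((1 + norm (X m)) ^ n * cmod (c m)))"
      by (intro integrable_mult_right int)
    show "(\<lambda>m. (1 + norm (S k m)) ^ n * cmod (c m)) \<in> borel_measurable M" using Sm[of k] c by measurable
    show "AE m in M. norm ((1 + norm (S k m)) ^ n * cmod (c m)) \<le> norm (2 ^ n * ((1 + norm (X m)) ^ n * cmod (c m)))"
      using Sle by (intro AE_I2) (simp add: abs_mult mult_right_mono flip: mult.assoc)
  qed
  have intc: "integrable M (\<lambda>m. cmod (c m))" using int[of 0] by simp
  obtain C n where C: "0 \<le> C" "\<And>p. cmod (\<Lambda> (F p)) \<le> C * (1 + norm p) ^ n"
    by (rule distribution_family_bound) blast
  have bd: "cmod (c m * \<Lambda> (F p)) \<le> C * ((1 + norm p) ^ n * cmod (c m))" for m p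
    unfolding norm_mult using mult_left_mono[OF C(2)[of p], of "cmod (c m)"] by (simp add: mult_ac)
  show iL: "integrable M (\<lambda>m. c m * \<Lambda> (F (X m)))"
  proof (rule Bochner_Integration.integrable_bound)
    show "integrable M (\<lambda>m. C * ((1 + norm (X m)) ^ n * cmod (c m)))" by (intro integrable_mult_right int)
    show "(\<lambda>m. c m * \<Lambda> (F (X m))) \<in> borel_measurable M"
      using distribution_family_measurable[OF X] c by measurable
    show "AE m in M. norm (c m * \<Lambda> (F (X m))) \<le> norm (C * ((1 + norm (X m)) ^ n * cmod (c m)))"
    proof (rule AE_I2)
      show "norm (c m * \<Lambda> (F (X m))) \<le> norm (C * ((1 + norm (X m)) ^ n * cmod (c m)))" for m
        using bd[of m "X m"] by (simp only: real_norm_def)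
    qed
  qed
  let ?R = "\<lambda>X \<xi>. LINT m|M. c m * F (X m) \<xi>"
  have "(\<lambda>k. \<Lambda> (?R (S k))) \<longlonglongrightarrow> \<Lambda> (?R X)"
  proof (rule distribution_tendsto[OF integral_smooth(1,2)[OF Sm c intS] integral_smooth(1,2)[OF X c int]])
    fix js :: "'d list" and e :: real assume e: "0 < e"
    define v where "v k \<xi> = (LINT m|M. c m * (partials js (F (S k m)) \<xi> - partials js (F (X m)) \<xi>))" for k \<xi>
    have v: "partials js (?R (S k)) \<xi> - partials js (?R X) \<xi> = v k \<xi>" for k \<xi>
      unfolding v_def integral_smooth(3)[OF Sm c intS] integral_smooth(3)[OF X c int] right_diff_distrib
      by (rule Bochner_Integration.integral_diff[symmetric]) (intro integral_smooth(4)[OF Sm c intS] integral_smooth(4)[OF X c int])+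
    \<comment> \<open>Dominated convergence is pointwise, but uniformity in \<xi> is required. For
      each k a point violating the bound is chosen, if there is one; convergence along these points
      then rules out violations for large k.\<close>
    define \<xi> where "\<xi> k = (SOME \<zeta>. e < cmod (v k \<zeta>))" for k
    have \<xi>: "e < cmod (v k (\<xi> k))" if "\<exists>\<zeta>. e < cmod (v k \<zeta>)" for k
      unfolding \<xi>_def by (rule someI_ex[OF that])
    obtain b where b: "poly_growth b" "\<And>p. 0 \<le> b p" "\<And>p \<xi>. cmod (partials js (F p) \<xi>) \<le> b p"
      by (rule partials_bound[of js]) blast
    obtain D l where D0: "0 \<le> D" "\<forall>p. b p \<le> D * (1 + norm p) ^ l"
      using b(1) unfolding poly_growth_def by (elim exE conjE) (rule that)
    then have D: "0 \<le> D" "\<And>p. b p \<le> D * (1 + norm p) ^ l" by simp_all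
    have "(\<lambda>k. v k (\<xi> k)) \<longlonglongrightarrow> (LINT m|M. 0)"
      unfolding v_def
    proof (rule integral_dominated_convergence[where w = "\<lambda>m. (2 ^ l * D + D) * ((1 + norm (X m)) ^ l * cmod (c m))"])
      show "integrable M (\<lambda>m. (2 ^ l * D + D) * ((1 + norm (X m)) ^ l * cmod (c m)))"
        by (intro integrable_mult_right int)
      show "(\<lambda>m. c m * (partials js (F (S k m)) (\<xi> k) - partials js (F (X m)) (\<xi> k))) \<in> borel_measurable M" for k
        using partials_measurable[OF Sm[of k], of js "\<xi> k"] partials_measurable[OF X, of js "\<xi> k"] c by measurable
      show "AE m in M. (\<lambda>k. c m * (partials js (F (S k m)) (\<xi> k) - partials js (F (X m)) (\<xi> k))) \<longlonglongrightarrow> 0"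
      proof (intro AE_I2 tendsto_mult_right_zero LIMSEQ_I)
        fix m and r :: real assume m: "m \<in> space M" and r: "0 < r"
        from partials_uniform[OF S(2)[OF m], of "r / 2" js] r
        have "\<forall>\<^sub>F k in sequentially. \<forall>\<xi>. cmod (partials js (F (S k m)) \<xi> - partials js (F (X m)) \<xi>) \<le> r / 2" by simp
        then show "\<exists>no. \<forall>k\<ge>no. norm (partials js (F (S k m)) (\<xi> k) - partials js (F (X m)) (\<xi> k) - 0) < r"
          unfolding eventually_sequentially diff_zero using r
          by (elim exE) (rule exI, intro allI impI, rule le_less_trans[of _ "r / 2"], auto)
      qed
      show "AE m in M. norm (c m * (partials js (F (S k m)) (\<xi> k) - partials js (F (X m)) (\<xi> k))) \<le> (2 ^ l * D + D) * ((1 + norm (X m)) ^ l * cmod (c m))" for k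
      proof (rule AE_I2)
        fix m assume m: "m \<in> space M"
        have "cmod (partials js (F (S k m)) (\<xi> k) - partials js (F (X m)) (\<xi> k)) \<le> b (S k m) + b (X m)"
          using b(3)[of "S k m" "\<xi> k"] b(3)[of "X m" "\<xi> k"] norm_triangle_ineq4[of "partials js (F (S k m)) (\<xi> k)" "partials js (F (X m)) (\<xi> k)"] by linarith
        also have "b (S k m) \<le> D * (2 ^ l * (1 + norm (X m)) ^ l)"
          using D mult_left_mono[OF Sle[OF m, of k l] D(1)] by (meson order_trans)
        also have "b (X m) \<le> D * (1 + norm (X m)) ^ l" by (rule D(2))
        finally have "cmod (partials js (F (S k m)) (\<xi> k) - partials js (F (X m)) (\<xi> k)) \<le> (2 ^ l * D + D) * (1 + norm (X m)) ^ l"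
          by (simp add: algebra_simps)
        from mult_left_mono[OF this, of "cmod (c m)"]
        show "norm (c m * (partials js (F (S k m)) (\<xi> k) - partials js (F (X m)) (\<xi> k))) \<le> (2 ^ l * D + D) * ((1 + norm (X m)) ^ l * cmod (c m))"
          by (simp add: norm_mult mult_ac)
      qed
    qed simp
    then have "\<forall>\<^sub>F k in sequentially. cmod (v k (\<xi> k)) < e"
      using e by (simp add: tendsto_iff dist_norm)
    then show "\<forall>\<^sub>F k in sequentially. \<forall>\<zeta>. cmod (partials js (?R (S k)) \<zeta> - partials js (?R X) \<zeta>) \<le> e"
      unfolding v
    proof (rule eventually_mono)
      fix k assume k: "cmod (v k (\<xi> k)) < e"
      then have "\<not> (\<exists>\<zeta>. e < cmod (v k \<zeta>))" using \<xi>[of k] by (meson less_asym)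
      then show "\<forall>\<zeta>. cmod (v k \<zeta>) \<le> e" by (simp add: not_less)
    qed
  qed
  moreover have "(\<lambda>k. \<Lambda> (?R (S k))) \<longlonglongrightarrow> (LINT m|M. c m * \<Lambda> (F (X m)))"
    unfolding distribution_integral_simple[OF S(1) c intc]
  proof (rule integral_dominated_convergence[where w = "\<lambda>m. (C * 2 ^ n) * ((1 + norm (X m)) ^ n * cmod (c m))"])
    show "integrable M (\<lambda>m. (C * 2 ^ n) * ((1 + norm (X m)) ^ n * cmod (c m)))"
      by (intro integrable_mult_right int)
    show "(\<lambda>m. c m * \<Lambda> (F (S k m))) \<in> borel_measurable M" for k
      using distribution_family_measurable[OF Sm[of k]] c by measurable
    show "(\<lambda>m. c m * \<Lambda> (F (X m))) \<in> borel_measurable M" using iL by auto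
    show "AE m in M. (\<lambda>k. c m * \<Lambda> (F (S k m))) \<longlonglongrightarrow> c m * \<Lambda> (F (X m))"
      using S(2) by (intro AE_I2 tendsto_mult tendsto_const distribution_family_tendsto)
    show "AE m in M. norm (c m * \<Lambda> (F (S k m))) \<le> (C * 2 ^ n) * ((1 + norm (X m)) ^ n * cmod (c m))" for k
    proof (rule AE_I2)
      fix m assume m: "m \<in> space M"
      have "(1 + norm (S k m)) ^ n * cmod (c m) \<le> 2 ^ n * (1 + norm (X m)) ^ n * cmod (c m)"
        by (intro mult_right_mono Sle[OF m]) simp
      from mult_left_mono[OF this C(1)] bd[of m "S k m"]
      show "norm (c m * \<Lambda> (F (S k m))) \<le> (C * 2 ^ n) * ((1 + norm (X m)) ^ n * cmod (c m))"
        by (simp add: mult_ac)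
    qed
  qed
  ultimately show "\<Lambda> (?R X) = (LINT m|M. c m * \<Lambda> (F (X m)))" by (rule LIMSEQ_unique)
qed

end

end

lemma supported_family_chi:
  assumes "a \<in> test_funs \<Omega>"
  shows "supported_family \<Omega> (fun_supp a) (\<lambda>x \<xi>. a \<xi> * chi x \<xi>)"
proof
  have "smooth_family (\<lambda>x::real^'d. chi x)"
    by (rule smooth_family_chi)
      (auto intro: continuous_on_id poly_growth_mono[OF poly_growth_norm] component_le_norm_cart)
  then show "smooth_family (\<lambda>x \<xi>. a \<xi> * chi x \<xi>)"
    by (intro smooth_family_mult smooth_family_const test_funsD[OF assms])
qed (use test_funsD[OF assms] test_fun_supp[OF assms] in auto)

text \<open>The inverse Fourier transform of \<open>a \<Lambda>\<close> is therefore the function \<open>x \<mapsto> \<Lambda> (a * chi x)\<close>.\<close>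

lemma distribution_mult_inv_fourier:
  assumes L: "distribution_on \<Omega> \<Lambda>" and a: "a \<in> test_funs \<Omega>" and \<theta>: "rapidly_decreasing \<theta>"
  shows "(\<lambda>\<xi>. a \<xi> * inv_fourier \<theta> \<xi>) \<in> test_funs \<Omega>"
    and "\<Lambda> (\<lambda>\<xi>. a \<xi> * inv_fourier \<theta> \<xi>) = (LINT x|lborel. \<Lambda> (\<lambda>\<xi>. a \<xi> * chi x \<xi>) * \<theta> x)"
    and "integrable lborel (\<lambda>x. \<Lambda> (\<lambda>\<xi>. a \<xi> * chi x \<xi>) * \<theta> x)"
proof -
  interpret supported_family \<Omega> "fun_supp a" "\<lambda>x \<xi>. a \<xi> * chi x \<xi>" by (rule supported_family_chi[OF a])
  have m: "\<theta> \<in> borel_measurable lborel" using \<theta> by (simp add: rapidly_decreasing_def)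
  have int: "integrable lborel (\<lambda>x. (1 + norm x) ^ n * cmod (\<theta> x))" for n
    using integrable_norm[OF rapidly_decreasing_integrable(1)[OF \<theta>, of n]]
    unfolding norm_one_plus_norm_power_mult .
  have eq: "(\<lambda>\<xi>. LINT x|lborel. \<theta> x * (a \<xi> * chi x \<xi>)) = (\<lambda>\<xi>. a \<xi> * inv_fourier \<theta> \<xi>)"
    by (simp add: inv_fourier_chi chi_commute mult_ac fun_eq_iff flip: integral_mult_right_zero)
  show "(\<lambda>\<xi>. a \<xi> * inv_fourier \<theta> \<xi>) \<in> test_funs \<Omega>"
    using integral_smooth(1)[of "\<lambda>x. x" lborel \<theta>, OF _ m int] unfolding eq by simp
  show "\<Lambda> (\<lambda>\<xi>. a \<xi> * inv_fourier \<theta> \<xi>) = (LINT x|lborel. \<Lambda> (\<lambda>\<xi>. a \<xi> * chi x \<xi>) * \<theta> x)"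
    using distribution_integral(1)[OF L, of "\<lambda>x. x" lborel \<theta>, OF _ m int] unfolding eq by (simp add: mult.commute)
  show "integrable lborel (\<lambda>x. \<Lambda> (\<lambda>\<xi>. a \<xi> * chi x \<xi>) * \<theta> x)"
    using distribution_integral(2)[OF L, of "\<lambda>x. x" lborel \<theta>, OF _ m int] by (simp add: mult.commute)
qed

subsection \<open>Integrably admissible matrix groups\<close>

lemma continuous_det [continuous_intros]:
  fixes A :: "'a::topological_space \<Rightarrow> real^'d^'d"
  shows "continuous_on S A \<Longrightarrow> continuous_on S (\<lambda>x. det (A x))"
  unfolding det_def by (intro continuous_intros)

lemma continuous_matrix_mult [continuous_intros]:
  fixes A :: "'a::topological_space \<Rightarrow> real^'d^'d" and B :: "'a \<Rightarrow> real^'d^'d"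
  shows "continuous_on S A \<Longrightarrow> continuous_on S B \<Longrightarrow> continuous_on S (\<lambda>x. A x ** B x)"
  unfolding matrix_matrix_mult_def by (intro continuous_intros)

lemma continuous_matrix_mult_left [continuous_intros]:
  "continuous_on (S :: (real^'d^'d) set) ((**) (g :: real^'d^'d))"
  by (rule continuous_matrix_mult[OF continuous_on_const continuous_on_id])

lemma cnj_measurable [measurable (raw)]: "f \<in> borel_measurable M \<Longrightarrow> (\<lambda>x. cnj (f x)) \<in> borel_measurable M"
  by (rule measurable_compose[OF _ borel_measurable_continuous_onI[OF continuous_on_cnj[OF continuous_on_id]]])

lemma continuous_matrix_vector_mult [continuous_intros]:
  fixes A :: "'a::topological_space \<Rightarrow> real^'d^'d"
  shows "continuous_on S A \<Longrightarrow> continuous_on S x \<Longrightarrow> continuous_on S (\<lambda>t. A t *v x t)"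
  unfolding matrix_vector_mult_def by (intro continuous_intros)

lemma continuous_transpose [continuous_intros]:
  fixes A :: "'a::topological_space \<Rightarrow> real^'d^'d"
  shows "continuous_on S A \<Longrightarrow> continuous_on S (\<lambda>x. transpose (A x))"
  unfolding transpose_def by (intro continuous_intros)

lemma abs_component_le_norm: "\<bar>A $ i $ j\<bar> \<le> norm (A :: real^'d^'d)"
  by (metis Finite_Cartesian_Product.norm_nth_le order_trans real_norm_def)

lemma cmod_square_eq: "complex_of_real ((cmod z)\<^sup>2) = z * cnj z"
  by (simp add: complex_norm_square flip: of_real_power)

declare transpose_matrix_vector [simp del]

lemma matrix_inv_mat_unique:
  fixes A B :: "real^'d^'d"
  assumes "invertible A"
  shows "matrix_inv A ** (A ** B) = B" "A ** (matrix_inv A ** B) = B"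
  using matrix_inv_cancel[OF assms] by (simp_all add: matrix_mul_assoc)

lemma transpose_matrix_inv_vector:
  fixes A :: "real^'d^'d"
  assumes "invertible A"
  shows "transpose A *v (transpose (matrix_inv A) *v x) = x" "transpose (matrix_inv A) *v (transpose A *v x) = x"
  using matrix_inv_cancel[OF assms] by (simp_all add: matrix_vector_mul_assoc flip: matrix_transpose_mul)

text \<open>On the frequency side translation becomes modulation and dilation acts through the
  transpose of h. The Jacobian |det h| turns the exponent -1/2 into 1/2.\<close>

lemma quasi_regular_inv_fourier:
  fixes h :: "real^'d^'d"
  assumes h: "invertible h" and \<eta>: "\<eta> \<in> borel_measurable borel"
  shows "quasi_regular (x, h) (inv_fourier \<eta>)
    = inv_fourier (\<lambda>\<xi>. of_real (\<bar>det h\<bar> powr (1 / 2)) * (chi (- x) \<xi> * \<eta> (transpose h *v \<xi>)))"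
proof
  fix y
  have d: "0 < \<bar>det h\<bar>" using h by (simp add: invertible_det_nz)
  have "inv_fourier (\<lambda>\<xi>. of_real (\<bar>det h\<bar> powr (1 / 2)) * (chi (- x) \<xi> * \<eta> (transpose h *v \<xi>))) y
      = of_real (\<bar>det h\<bar> powr (1 / 2)) * inv_fourier (\<lambda>\<xi>. chi (- x) \<xi> * \<eta> (transpose h *v \<xi>)) y"
    unfolding inv_fourier_chi integral_mult_right_zero[symmetric] by (simp add: mult.assoc)
  also have "\<dots> = of_real (\<bar>det h\<bar> powr (1 / 2) * (1 / \<bar>det h\<bar>)) * inv_fourier \<eta> (matrix_inv h *v (y - x))"
    unfolding inv_fourier_modulate inv_fourier_comp_transpose[OF h \<eta>] by simp
  also have "\<bar>det h\<bar> powr (1 / 2) * (1 / \<bar>det h\<bar>) = \<bar>det h\<bar> powr (- 1 / 2)"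
    using d powr_diff[of "\<bar>det h\<bar>" "1 / 2" 1] by (simp add: powr_minus)
  finally show "quasi_regular (x, h) (inv_fourier \<eta>) y = inv_fourier (\<lambda>\<xi>. of_real (\<bar>det h\<bar> powr (1 / 2)) * (chi (- x) \<xi> * \<eta> (transpose h *v \<xi>))) y"
    by (simp add: quasi_regular_def)
qed

locale admissible_group =
  fixes H :: "(real^'d^'d) set" and \<mu> :: "(real^'d^'d) measure" and \<Omega> :: "(real^'d) set"
  assumes group: "closed_subgroup_GL H" and haar: "left_haar_measure H \<mu>"
    and adm: "integrably_admissible H \<Omega>"
begin

lemma group_simps: "mat 1 \<in> H" "h \<in> H \<Longrightarrow> k \<in> H \<Longrightarrow> h ** k \<in> H" "h \<in> H \<Longrightarrow> matrix_inv h \<in> H"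
  using group by (auto simp: closed_subgroup_GL_def)

lemma group_invertible: "h \<in> H \<Longrightarrow> invertible h"
  using group closedin_subset[of "top_of_set {A. invertible A}" H] by (auto simp: closed_subgroup_GL_def)

lemma group_det: "h \<in> H \<Longrightarrow> det h \<noteq> 0"
  using group_invertible invertible_det_nz by blast

lemma group_closed: obtains T where "closed T" "H = {A. invertible A} \<inter> T"
  using group by (auto simp: closed_subgroup_GL_def closedin_closed)

lemma sets_mu: "sets \<mu> = sets (restrict_space borel H)"
  using haar by (simp add: left_haar_measure_def)

lemma space_mu: "space \<mu> = H"
  using sets_eq_imp_space_eq[OF sets_mu] by (simp add: space_restrict_space)

lemma open_GL: "open {A :: real^'d^'d. invertible A}"
proof -
  have "continuous_on UNIV (\<lambda>A :: real^'d^'d. det A)" by (intro continuous_intros)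
  then have "open ((\<lambda>A :: real^'d^'d. det A) -` (- {0}))"
    by (intro open_vimage) auto
  also have "(\<lambda>A :: real^'d^'d. det A) -` (- {0}) = {A. invertible A}" by (auto simp: invertible_det_nz)
  finally show ?thesis .
qed

lemma group_borel: "H \<in> sets borel"
proof -
  obtain T where "closed T" "H = {A. invertible A} \<inter> T" by (rule group_closed)
  then show ?thesis using open_GL by (simp add: borel_closed borel_open sets.Int)
qed

lemma sets_mu_iff: "A \<in> sets \<mu> \<longleftrightarrow> A \<subseteq> H \<and> A \<in> sets borel"
  unfolding sets_mu using group_borel by (subst sets_restrict_space_iff) auto

lemma compact_sets_mu: "compact A \<Longrightarrow> A \<subseteq> H \<Longrightarrow> A \<in> sets \<mu>"
  by (simp add: sets_mu_iff borel_closed compact_imp_closed)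

lemma openin_sets_mu: "openin (top_of_set H) W \<Longrightarrow> W \<in> sets \<mu>"
  using group_borel by (auto simp: openin_open sets_mu_iff borel_open)

lemma compact_mu_finite: "compact A \<Longrightarrow> A \<subseteq> H \<Longrightarrow> emeasure \<mu> A < \<infinity>"
  using haar by (auto simp: left_haar_measure_def)

lemma openin_mu_pos: "openin (top_of_set H) W \<Longrightarrow> W \<noteq> {} \<Longrightarrow> 0 < emeasure \<mu> W"
  using haar by (auto simp: left_haar_measure_def)

lemma borel_measurable_mu: "f \<in> borel_measurable borel \<Longrightarrow> f \<in> borel_measurable \<mu>"
  by (subst measurable_cong_sets[OF sets_mu refl]) (rule measurable_restrict_space1)

lemma borel_measurable_mu_continuous:
  fixes f :: "real^'d^'d \<Rightarrow> 'a::topological_space"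
  assumes "continuous_on H f"
  shows "f \<in> borel_measurable \<mu>"
  by (subst measurable_cong_sets[OF sets_mu refl])
     (use borel_measurable_continuous_on_restrict[OF assms] in simp)

lemma id_measurable_mu [measurable]: "(\<lambda>h. h) \<in> borel_measurable \<mu>"
  by (rule borel_measurable_mu) simp

lemma pair_measurable_mu: "(\<lambda>p. p) \<in> borel_measurable ((lborel :: (real^'d) measure) \<Otimes>\<^sub>M \<mu>)"
proof -
  have "(\<lambda>p. (fst p, snd p)) \<in> measurable ((lborel :: (real^'d) measure) \<Otimes>\<^sub>M \<mu>) (borel \<Otimes>\<^sub>M borel)"
    by (intro measurable_Pair measurable_compose[OF measurable_snd id_measurable_mu] measurable_compose[OF measurable_fst]) simp
  then show ?thesis by (simp add: borel_prod)
qed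

text \<open>\<open>H\<close> is closed only inside the invertible matrices. Keeping the determinant
  away from 0 excludes singular limits, so the set is closed and bounded among all matrices.\<close>

lemma compact_exhaustion: "compact {h \<in> H. norm h \<le> r \<and> \<delta> \<le> \<bar>det h\<bar>}" if "0 < \<delta>"
proof -
  obtain T where T: "closed T" "H = {A. invertible A} \<inter> T" by (rule group_closed)
  have "closed ((\<lambda>h :: real^'d^'d. \<bar>det h\<bar>) -` {\<delta>..})"
    by (intro closed_vimage) (auto intro!: continuous_intros)
  then have "compact (cball 0 r \<inter> (T \<inter> (\<lambda>h :: real^'d^'d. \<bar>det h\<bar>) -` {\<delta>..}))"
    using T(1) by (intro compact_Int_closed closed_Int) auto
  also have "cball 0 r \<inter> (T \<inter> (\<lambda>h :: real^'d^'d. \<bar>det h\<bar>) -` {\<delta>..}) = {h \<in> H. norm h \<le> r \<and> \<delta> \<le> \<bar>det h\<bar>}"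
    using that by (auto simp: T(2) invertible_det_nz)
  finally show ?thesis .
qed

lemma sigma_finite_mu: "sigma_finite_measure \<mu>"
proof
  define A where "A n = {h \<in> H. norm h \<le> real n \<and> 1 / real (Suc n) \<le> \<bar>det h\<bar>}" for n
  have c: "compact (A n)" "A n \<subseteq> H" for n
    unfolding A_def by (rule compact_exhaustion) auto
  have "\<Union> (range A) = H"
  proof (intro equalityI subsetI)
    fix h assume h: "h \<in> H"
    obtain n where n: "norm h \<le> real n" using real_arch_simple by blast
    obtain m where m: "inverse (real (Suc m)) < \<bar>det h\<bar>" using reals_Archimedean[of "\<bar>det h\<bar>"] group_det[OF h] by auto
    have "1 / real (Suc (max n m)) \<le> 1 / real (Suc m)" by (simp add: frac_le)
    then have "h \<in> A (max n m)" using h n m by (auto simp: A_def inverse_eq_divide simp del: of_nat_Suc)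
    then show "h \<in> \<Union> (range A)" by blast
  qed (use c in auto)
  then show "\<exists>B. countable B \<and> B \<subseteq> sets \<mu> \<and> \<Union> B = space \<mu> \<and> (\<forall>a\<in>B. emeasure \<mu> a \<noteq> \<infinity>)"
    using c compact_sets_mu compact_mu_finite by (intro exI[of _ "range A"]) (auto simp: space_mu less_top)
qed

sublocale sigma_finite_measure \<mu> by (rule sigma_finite_mu)
sublocale lborel_mu: pair_sigma_finite "lborel :: (real^'d) measure" \<mu> ..

lemma translate_sets:
  assumes g: "g \<in> H" and A: "A \<in> sets \<mu>"
  shows "(\<lambda>k. g ** k) ` A \<in> sets \<mu>" "emeasure \<mu> ((\<lambda>k. g ** k) ` A) = emeasure \<mu> A"
proof -
  have "(\<lambda>k. g ** k) ` A = (\<lambda>k. matrix_inv g ** k) -` A \<inter> H"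
  proof (intro equalityI subsetI)
    fix k assume "k \<in> (\<lambda>k. g ** k) ` A"
    then show "k \<in> (\<lambda>k. matrix_inv g ** k) -` A \<inter> H"
      using A g group_simps(2) by (auto simp: sets_mu_iff matrix_inv_mat_unique[OF group_invertible[OF g]])
  next
    fix k assume "k \<in> (\<lambda>k. matrix_inv g ** k) -` A \<inter> H"
    then have "matrix_inv g ** k \<in> A" by simp
    then have "g ** (matrix_inv g ** k) \<in> (\<lambda>k. g ** k) ` A" by (rule imageI)
    then show "k \<in> (\<lambda>k. g ** k) ` A" by (simp add: matrix_inv_mat_unique[OF group_invertible[OF g]])
  qed
  moreover have "(\<lambda>k :: real^'d^'d. matrix_inv g ** k) \<in> borel_measurable borel"
    by (intro borel_measurable_continuous_onI continuous_intros)
  then have "(\<lambda>k. matrix_inv g ** k) -` A \<inter> H \<in> sets borel"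
    using A group_borel measurable_sets[of _ borel borel A] by (auto simp: sets_mu_iff)
  ultimately show "(\<lambda>k. g ** k) ` A \<in> sets \<mu>" by (simp add: sets_mu_iff)
  show "emeasure \<mu> ((\<lambda>k. g ** k) ` A) = emeasure \<mu> A"
    using haar g A by (auto simp: left_haar_measure_def)
qed

text \<open>The group elements that carry some point of \<open>K\<close> back into \<open>K\<close>.
  For compact \<open>K\<close> inside \<Omega> it is the projection to \<open>H\<close> of the set
  in the properness condition, hence compact.\<close>

definition return :: "(real^'d) set \<Rightarrow> (real^'d^'d) set" where
  "return K = {h \<in> H. \<exists>\<xi>\<in>K. transpose h *v \<xi> \<in> K}"

lemma null_Omega: "- \<Omega> \<in> null_sets lborel"
  and invariant_Omega: "h \<in> H \<Longrightarrow> \<xi> \<in> \<Omega> \<Longrightarrow> transpose h *v \<xi> \<in> \<Omega>"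
  using adm by (auto simp: integrably_admissible_def)

lemma return_compact:
  assumes "compact K" "K \<subseteq> \<Omega>"
  shows "compact (return K)" "return K \<subseteq> H"
proof -
  have "compact {(h, \<xi>). h \<in> H \<and> \<xi> \<in> \<Omega> \<and> (transpose h *v \<xi>, \<xi>) \<in> K \<times> K}"
    using adm assms by (auto simp: integrably_admissible_def)
  then have "compact (fst ` {(h, \<xi>). h \<in> H \<and> \<xi> \<in> \<Omega> \<and> (transpose h *v \<xi>, \<xi>) \<in> K \<times> K})"
    by (rule compact_continuous_image[OF continuous_on_fst[OF continuous_on_id]])
  also have "fst ` {(h, \<xi>). h \<in> H \<and> \<xi> \<in> \<Omega> \<and> (transpose h *v \<xi>, \<xi>) \<in> K \<times> K} = return K"
    using assms(2) by (force simp: return_def)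
  finally show "compact (return K)" .
  show "return K \<subseteq> H" by (auto simp: return_def)
qed

lemma return_inv:
  assumes "h \<in> return K" shows "matrix_inv h \<in> return K"
proof -
  obtain \<xi> where h: "h \<in> H" "\<xi> \<in> K" "transpose h *v \<xi> \<in> K" using assms by (auto simp: return_def)
  then have "transpose (matrix_inv h) *v (transpose h *v \<xi>) \<in> K"
    using transpose_matrix_inv_vector(2)[OF group_invertible[OF h(1)]] by simp
  then show ?thesis using h group_simps(3) by (auto simp: return_def)
qed

lemma inv_mult:
  assumes "h \<in> H" "k \<in> H"
  shows "matrix_inv (matrix_inv h ** k) = matrix_inv k ** h"
proof -
  have "(matrix_inv h ** k) ** (matrix_inv k ** h) = mat 1"
    using matrix_inv_mat_unique(2)[OF group_invertible[OF assms(2)], of h] matrix_inv_cancel[OF group_invertible[OF assms(1)]]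
    by (simp add: matrix_mul_assoc[symmetric])
  moreover have "invertible (matrix_inv h ** k)" using assms group_simps group_invertible by auto
  ultimately show ?thesis
    using matrix_inv_mat_unique(1)[of "matrix_inv h ** k" "matrix_inv k ** h"] by simp
qed

lemma return_translate_iff:
  assumes "h \<in> H" "k \<in> H"
  shows "matrix_inv h ** k \<in> return K \<longleftrightarrow> matrix_inv k ** h \<in> return K"
  using return_inv inv_mult assms by metis

text \<open>The transpose of the quotient of h and k carries the image of \<xi> under h to its image
  under k. Thus two elements sending one frequency into \<open>K\<close> differ by a returning
  element.\<close>

lemma return_translate:
  assumes "h \<in> H" "k \<in> H" "transpose h *v \<xi> \<in> K" "transpose k *v \<xi> \<in> K"
  shows "matrix_inv h ** k \<in> return K"
proof -
  have "transpose (matrix_inv h ** k) *v (transpose h *v \<xi>) = transpose k *v \<xi>"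
    using transpose_matrix_inv_vector(2)[OF group_invertible[OF assms(1)]]
    by (simp add: matrix_transpose_mul flip: matrix_vector_mul_assoc)
  then have "\<exists>\<xi>\<in>K. transpose (matrix_inv h ** k) *v \<xi> \<in> K"
    using assms(3,4) by (intro bexI[of _ "transpose h *v \<xi>"]) auto
  then show ?thesis using assms(1,2) group_simps(2,3) by (simp add: return_def)
qed

lemma compact_mult:
  fixes A B :: "(real^'d^'d) set"
  assumes "compact A" "compact B"
  shows "compact ((\<lambda>(a, b). a ** b) ` (A \<times> B) :: (real^'d^'d) set)"
  using assms by (intro compact_continuous_image compact_Times)
    (simp_all add: case_prod_unfold continuous_matrix_mult continuous_on_fst continuous_on_snd)

definition translate :: "(real^'d) set \<Rightarrow> real^'d^'d \<Rightarrow> (real^'d^'d) set" where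
  "translate K g = {h \<in> H. matrix_inv g ** h \<in> return K}"

lemma translate_image: "g \<in> H \<Longrightarrow> translate K g = (\<lambda>k. g ** k) ` return K"
proof -
  assume g: "g \<in> H"
  have "h \<in> (\<lambda>k. g ** k) ` return K" if "h \<in> H" "matrix_inv g ** h \<in> return K" for h
    using that matrix_inv_mat_unique(2)[OF group_invertible[OF g], of h] by (metis imageI)
  moreover have "matrix_inv g ** (g ** k) \<in> return K" if "k \<in> return K" for k
    using that matrix_inv_mat_unique(1)[OF group_invertible[OF g], of k] by simp
  moreover have "k \<in> H" if "k \<in> return K" for k using that by (simp add: return_def)
  ultimately show ?thesis using g group_simps(2) by (auto simp: translate_def)
qed

lemma translate_facts:
  assumes g: "g \<in> H" and K: "compact K" "K \<subseteq> \<Omega>"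
  shows "compact (translate K g)" "translate K g \<subseteq> H" "translate K g \<in> sets \<mu>"
    and "emeasure \<mu> (translate K g) = emeasure \<mu> (return K)"
proof -
  show "compact (translate K g)"
    unfolding translate_image[OF g] using return_compact[OF K] by (intro compact_continuous_image continuous_intros)
  then show "translate K g \<subseteq> H" "translate K g \<in> sets \<mu>"
    by (auto simp: translate_def intro!: compact_sets_mu)
  show "emeasure \<mu> (translate K g) = emeasure \<mu> (return K)"
    unfolding translate_image[OF g] using return_compact[OF K] g by (intro translate_sets compact_sets_mu)
qed

lemma translate_sym: "h \<in> H \<Longrightarrow> k \<in> H \<Longrightarrow> h \<in> translate K k \<longleftrightarrow> k \<in> translate K h"
  by (simp add: translate_def return_translate_iff[of k h])

text \<open>A packing argument: for the indices counted at \<open>h\<close>, the disjoint translates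
  of a small unit neighbourhood all lie in \<open>h\<close> times one fixed compact set
  \<open>P\<close>. By left invariance their number is at most the ratio of the two measures,
  whatever \<open>h\<close> is.\<close>

lemma bounded_overlap:
  assumes spread: "well_spread H I g" and K: "compact K" "K \<subseteq> \<Omega>"
  obtains N where "\<And>h. h \<in> H \<Longrightarrow> finite {i\<in>I. h \<in> translate K (g i)}"
    "\<And>h. h \<in> H \<Longrightarrow> card {i\<in>I. h \<in> translate K (g i)} \<le> N"
proof -
  have gH: "g i \<in> H" if "i \<in> I" for i using spread that by (auto simp: well_spread_def)
  obtain V where V: "unit_nbhd H V" "disjoint_family_on (\<lambda>i. (\<lambda>k. g i ** k) ` V) I"
    using spread by (auto simp: well_spread_def)
  obtain W where W: "openin (top_of_set H) W" "mat 1 \<in> W" "W \<subseteq> V" using V(1) by (auto simp: unit_nbhd_def)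
  \<comment> \<open>Shrinking the neighbourhood puts it into the compact set \<open>B\<close>, so
    that its measure is finite as well as positive. The bounds on norm and determinant hold strictly
    at the identity.\<close>
  define V' where "V' = W \<inter> {h. norm h < norm (mat 1 :: real^'d^'d) + 1 \<and> 1 / 2 < \<bar>det h\<bar>}"
  define B where "B = {h \<in> H. norm h \<le> norm (mat 1 :: real^'d^'d) + 1 \<and> 1 / 2 \<le> \<bar>det h\<bar>}"
  have "open {h :: real^'d^'d. norm h < norm (mat 1 :: real^'d^'d) + 1 \<and> 1 / 2 < \<bar>det h\<bar>}"
    unfolding Collect_conj_eq by (intro open_Int open_Collect_less continuous_intros)
  then have V'o: "openin (top_of_set H) V'" unfolding V'_def by (rule openin_Int_open[OF W(1)])
  have V'n: "mat 1 \<in> V'" unfolding V'_def using W(2) by simp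
  have B: "compact B" "B \<subseteq> H" unfolding B_def by (rule compact_exhaustion) auto
  have V'B: "V' \<subseteq> B" using W(1) openin_subset[OF W(1)] by (auto simp: V'_def B_def)
  \<comment> \<open>Symmetry of the relation puts each \<open>g i\<close> into \<open>h\<close>
    times \<open>return K\<close>, so its translate of \<open>V'\<close> lies in \<open>h\<close>
    times this product.\<close>
  define P where "P = (\<lambda>(a, b). a ** b) ` (return K \<times> B)"
  have P: "compact P" "P \<subseteq> H"
    unfolding P_def using return_compact[OF K] B group_simps by (auto intro!: compact_mult)
  define e where "e = measure \<mu> V'"
  define M where "M = measure \<mu> P"
  have V's: "V' \<in> sets \<mu>" by (rule openin_sets_mu[OF V'o])
  have eV: "emeasure \<mu> V' = ennreal e" "0 < e"
  proof -
    have "emeasure \<mu> V' \<le> emeasure \<mu> B" using V'B B by (intro emeasure_mono compact_sets_mu)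
    then have "emeasure \<mu> V' < \<infinity>" using compact_mu_finite[OF B] by (rule le_less_trans)
    then show *: "emeasure \<mu> V' = ennreal e" by (simp add: e_def emeasure_eq_ennreal_measure)
    have "0 < emeasure \<mu> V'" using V'n by (intro openin_mu_pos[OF V'o]) auto
    then show "0 < e" unfolding * by simp
  qed
  have eP: "emeasure \<mu> P = ennreal M" using compact_mu_finite[OF P] by (simp add: M_def emeasure_eq_ennreal_measure)
  have bound: "card F \<le> nat \<lceil>M / e\<rceil>" if h: "h \<in> H" and F: "finite F" "F \<subseteq> {i\<in>I. h \<in> translate K (g i)}" for h F
  proof -
    have sub: "(\<lambda>k. g i ** k) ` V' \<subseteq> (\<lambda>k. h ** k) ` P" if "i \<in> F" for i
    proof (safe)
      fix k assume k: "k \<in> V'"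
      have i: "i \<in> I" "h \<in> translate K (g i)" using F that by auto
      then have "g i \<in> translate K h" using h gH translate_sym by blast
      then have "matrix_inv h ** g i \<in> return K" by (simp add: translate_def)
      then have "(matrix_inv h ** g i) ** k \<in> P" using k V'B unfolding P_def by force
      moreover have "g i ** k = h ** ((matrix_inv h ** g i) ** k)"
        using matrix_inv_mat_unique(2)[OF group_invertible[OF h]] by (simp flip: matrix_mul_assoc)
      ultimately show "g i ** k \<in> (\<lambda>k. h ** k) ` P" by blast
    qed
    have "ennreal (real (card F) * e) = (\<Sum>i\<in>F. emeasure \<mu> ((\<lambda>k. g i ** k) ` V'))"
      using F gH less_imp_le[OF eV(2)] by (simp add: translate_sets(2)[OF _ V's] eV subset_iff ennreal_mult ennreal_of_nat_eq_real_of_nat)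
    also have "\<dots> = emeasure \<mu> (\<Union>i\<in>F. (\<lambda>k. g i ** k) ` V')"
    proof (rule sum_emeasure)
      show "(\<lambda>i. (\<lambda>k. g i ** k) ` V') ` F \<subseteq> sets \<mu>" using F gH V's translate_sets(1) by blast
      have "V' \<subseteq> V" using W(3) by (auto simp: V'_def)
      then show "disjoint_family_on (\<lambda>i. (\<lambda>k. g i ** k) ` V') F"
        using V(2) F(2) unfolding disjoint_family_on_def by blast
    qed (use F in auto)
    also have "\<dots> \<le> emeasure \<mu> ((\<lambda>k. h ** k) ` P)"
      using sub h P by (intro emeasure_mono translate_sets(1) compact_sets_mu) auto
    also have "\<dots> = ennreal M" using h P eP by (simp add: translate_sets(2) compact_sets_mu)
    finally have "real (card F) * e \<le> M" by (simp add: M_def)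
    then have "real (card F) \<le> M / e" using eV by (simp add: field_simps)
    then have "real (card F) \<le> real_of_int \<lceil>M / e\<rceil>" by (rule order_trans[OF _ le_of_int_ceiling])
    then show ?thesis by linarith
  qed
  \<comment> \<open>The bound was proved for finite subsets; an infinite index set would contain one
    that is too large.\<close>
  have "finite {i\<in>I. h \<in> translate K (g i)}" if h: "h \<in> H" for h
  proof (rule ccontr)
    assume "infinite {i\<in>I. h \<in> translate K (g i)}"
    then obtain F where "F \<subseteq> {i\<in>I. h \<in> translate K (g i)}" "finite F" "card F = Suc (nat \<lceil>M / e\<rceil>)"
      using infinite_arbitrarily_large by blast
    then show False using bound[OF h, of F] by simp
  qed
  then show ?thesis using that bound by blast
qed

subsection \<open>The Calderon condition\<close>

lemma dilated_test_funs:
  assumes h: "h \<in> H" and \<eta>: "\<eta> \<in> test_funs \<Omega>"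
  shows "(\<lambda>\<xi>. \<eta> (transpose h *v \<xi>)) \<in> test_funs \<Omega>"
proof (rule test_funsI(1))
  let ?K = "(\<lambda>k. transpose (matrix_inv h) *v k) ` fun_supp \<eta>"
  show "smooth_fun (\<lambda>\<xi>. \<eta> (transpose h *v \<xi>))" by (rule test_funs_comp_matrix[OF \<eta>])
  show "compact ?K" using test_funsD(2)[OF \<eta>] by (intro compact_continuous_image continuous_intros)
  show "?K \<subseteq> \<Omega>" using test_funsD(3)[OF \<eta>] h group_simps invariant_Omega by blast
  fix \<xi> assume "\<xi> \<notin> ?K"
  then have "transpose h *v \<xi> \<notin> fun_supp \<eta>"
    using transpose_matrix_inv_vector(2)[OF group_invertible[OF h], of \<xi>] by (metis imageI)
  then show "\<eta> (transpose h *v \<xi>) = 0" by (rule test_fun_supp[OF \<eta>])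
qed

lemma smooth_family_dilated:
  assumes "\<eta> \<in> test_funs \<Omega>'"
  shows "smooth_family (\<lambda>(p :: (real^'d) \<times> (real^'d^'d)) \<xi>. \<eta> (transpose (snd p) *v \<xi>))"
proof (rule test_funs_smooth_family_comp[OF assms])
  show "continuous_on UNIV (\<lambda>p :: (real^'d) \<times> (real^'d^'d). transpose (snd p))" by (intro continuous_intros)
  show "poly_growth (\<lambda>p :: (real^'d) \<times> (real^'d^'d). \<bar>transpose (snd p) $ i $ j\<bar>)" for i j
  proof (rule poly_growth_mono[OF poly_growth_norm])
    fix p :: "(real^'d) \<times> (real^'d^'d)"
    have "\<bar>transpose (snd p) $ i $ j\<bar> \<le> norm (snd p)"
      using abs_component_le_norm[of "snd p" j i] by (simp add: transpose_def)
    also have "\<dots> \<le> norm p" using norm_snd_le[of "snd p" "fst p"] by simp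
    finally show "\<bar>transpose (snd p) $ i $ j\<bar> \<le> norm p" .
  qed
qed

lemma smooth_family_chi_fst: "smooth_family (\<lambda>(p :: (real^'d) \<times> (real^'d^'d)). chi (fst p))"
proof (rule smooth_family_chi)
  show "poly_growth (\<lambda>p :: (real^'d) \<times> (real^'d^'d). \<bar>fst p $ j\<bar>)" for j
  proof (rule poly_growth_mono[OF poly_growth_norm])
    fix p :: "(real^'d) \<times> (real^'d^'d)"
    have "norm (fst p) \<le> norm p" using norm_fst_le[of "fst p" "snd p"] by simp
    then show "\<bar>fst p $ j\<bar> \<le> norm p" using component_le_norm_cart[of "fst p" j] by simp
  qed
qed (intro continuous_intros)

lemma integrable_on_compact:
  fixes f :: "real^'d^'d \<Rightarrow> real"
  assumes L: "compact L" "L \<subseteq> H" and f: "continuous_on UNIV f"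
  shows "integrable \<mu> (\<lambda>h. f h * indicator L h)"
proof -
  have "bounded (f ` L)"
    by (intro compact_imp_bounded compact_continuous_image L continuous_on_subset[OF f]) auto
  then obtain B where B: "\<And>h. h \<in> L \<Longrightarrow> \<bar>f h\<bar> \<le> B" unfolding bounded_iff by auto
  have i: "integrable \<mu> (\<lambda>h. B * indicator L h)"
    using compact_mu_finite[OF L] compact_sets_mu[OF L] by (intro integrable_mult_right integrable_real_indicator) auto
  have [measurable]: "L \<in> sets \<mu>" by (rule compact_sets_mu[OF L])
  show ?thesis
  proof (rule Bochner_Integration.integrable_bound[OF i])
    have [measurable]: "f \<in> borel_measurable \<mu>"
      by (intro borel_measurable_mu borel_measurable_continuous_onI f)
    show "(\<lambda>h. f h * indicator L h) \<in> borel_measurable \<mu>" by measurable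
    show "AE h in \<mu>. norm (f h * indicator L h) \<le> norm (B * indicator L h)"
      using B by (intro AE_I2) (force simp: indicator_def intro: order_trans)
  qed
qed

lemma integrable_indicator_growth:
  assumes "compact L" "L \<subseteq> H"
  shows "integrable \<mu> (\<lambda>h. (1 + norm (x :: real^'d, h)) ^ n * cmod (indicator L h))"
proof -
  have "cmod (indicator L h) = indicator L h" for h by (simp add: indicator_def)
  moreover have "continuous_on UNIV (\<lambda>h :: real^'d^'d. (1 + norm (x, h)) ^ n)" by (intro continuous_intros)
  ultimately show ?thesis using integrable_on_compact[OF assms, of "\<lambda>h. (1 + norm (x, h)) ^ n"] by simp
qed

context
  fixes \<eta> :: "real^'d \<Rightarrow> complex"
  assumes \<eta>: "\<eta> \<in> test_funs \<Omega>"
begin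

lemma supported_family_Calderon:
  assumes b: "b \<in> test_funs \<Omega>"
  shows "supported_family \<Omega> (fun_supp b)
    (\<lambda>(p :: (real^'d) \<times> (real^'d^'d)) \<xi>. b \<xi> * (chi (fst p) \<xi> * (\<eta> (transpose (snd p) *v \<xi>) * cnj (\<eta> (transpose (snd p) *v \<xi>)))))"
proof
  show "smooth_family (\<lambda>(p :: (real^'d) \<times> (real^'d^'d)) \<xi>. b \<xi> * (chi (fst p) \<xi> * (\<eta> (transpose (snd p) *v \<xi>) * cnj (\<eta> (transpose (snd p) *v \<xi>)))))"
    using test_funsD(1)[OF b] smooth_family_dilated[OF \<eta>] smooth_family_dilated[OF test_funs_cnj(1)[OF \<eta>]]
    by (intro smooth_family_mult smooth_family_const smooth_family_chi_fst)
qed (use test_funsD[OF b] test_fun_supp[OF b] in auto)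

lemma Calderon_support:
  assumes "h \<in> H" "\<xi> \<in> K" "fun_supp \<eta> \<subseteq> K" "\<eta> (transpose h *v \<xi>) \<noteq> 0"
  shows "h \<in> return K"
  using assms test_fun_supp[OF \<eta>, of "transpose h *v \<xi>"] by (auto simp: return_def)

lemma wavelet_L2_inv_fourier:
  assumes h: "h \<in> H" and b: "b \<in> test_funs \<Omega>"
  shows "wavelet_L2 (inv_fourier \<eta>) (inv_fourier b) (x, h)
    = of_real (\<bar>det h\<bar> powr (1 / 2)) * inv_fourier (\<lambda>\<xi>. b \<xi> * cnj (\<eta> (transpose h *v \<xi>))) x"
proof -
  let ?c = "\<lambda>\<xi>. of_real (\<bar>det h\<bar> powr (1 / 2)) * (chi (- x) \<xi> * \<eta> (transpose h *v \<xi>))"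
  have c: "?c \<in> test_funs \<Omega>"
    by (intro test_funs_cmult test_funs_mult' smooth_fun_chi dilated_test_funs[OF h \<eta>])
  have "wavelet_L2 (inv_fourier \<eta>) (inv_fourier b) (x, h) = (LINT y|lborel. inv_fourier b y * cnj (inv_fourier ?c y))"
    unfolding wavelet_L2_def quasi_regular_inv_fourier[OF group_invertible[OF h] test_funs_measurable[OF \<eta>]] ..
  also have "\<dots> = (LINT \<xi>|lborel. b \<xi> * cnj (?c \<xi>))" by (rule Parseval[OF b c])
  also have "\<dots> = (LINT \<xi>|lborel. of_real (\<bar>det h\<bar> powr (1 / 2)) * (b \<xi> * cnj (\<eta> (transpose h *v \<xi>)) * chi x \<xi>))"
    by (simp add: cnj_chi(1) mult_ac)
  finally show ?thesis by (simp add: inv_fourier_chi)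
qed

lemma Plancherel:
  assumes b: "b \<in> test_funs \<Omega>'"
  shows "(\<integral>\<^sup>+x. ennreal ((cmod (inv_fourier b x))\<^sup>2) \<partial>lborel) = (\<integral>\<^sup>+\<xi>. ennreal ((cmod (b \<xi>))\<^sup>2) \<partial>lborel)"
    and "integrable lborel (\<lambda>\<xi>. (cmod (b \<xi>))\<^sup>2)"
proof -
  have i1: "integrable lborel (\<lambda>\<xi>. b \<xi> * cnj (b \<xi>))"
    using test_funs_integrable[OF test_funs_mult(1)[OF b smooth_fun_cnj(1)[OF test_funsD(1)[OF b]]]] .
  obtain B where B: "\<And>x. cmod (inv_fourier b x) \<le> B" using inv_fourier_norm_le by blast
  have i2: "integrable lborel (\<lambda>x. inv_fourier b x * cnj (inv_fourier b x))"
    using inv_fourier_integrable[OF b] B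
    by (intro integrable_mult_bounded[where B = B]) auto
  have r1: "integrable lborel (\<lambda>\<xi>. (cmod (b \<xi>))\<^sup>2)" "integrable lborel (\<lambda>x. (cmod (inv_fourier b x))\<^sup>2)"
    using integrable_Re[OF i1] integrable_Re[OF i2] by (simp_all flip: cmod_square_eq)
  have "complex_of_real (LINT x|lborel. (cmod (inv_fourier b x))\<^sup>2) = complex_of_real (LINT \<xi>|lborel. (cmod (b \<xi>))\<^sup>2)"
    using Parseval[OF b b] unfolding cmod_square_eq[symmetric] integral_complex_of_real .
  then show "(\<integral>\<^sup>+x. ennreal ((cmod (inv_fourier b x))\<^sup>2) \<partial>lborel) = (\<integral>\<^sup>+\<xi>. ennreal ((cmod (b \<xi>))\<^sup>2) \<partial>lborel)"
    using r1 by (simp add: nn_integral_eq_integral)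
  show "integrable lborel (\<lambda>\<xi>. (cmod (b \<xi>))\<^sup>2)" by (rule r1)
qed

lemma Lp_norm_2: "Lp_norm M 2 f = ennreal_powr (\<integral>\<^sup>+x. (f x)\<^sup>2 \<partial>M) (1 / 2)"
proof -
  have p2: "ennreal_powr t 2 = t\<^sup>2" for t
    by (cases t) (auto simp: ennreal_power powr_numeral top_power_ennreal)
  show ?thesis using Lp_norm_finite[of 2 M f] by (simp add: p2)
qed

lemma Lp_norm_2_eq_iff:
  "Lp_norm M 2 f = Lp_norm N 2 g \<longleftrightarrow> (\<integral>\<^sup>+x. (f x)\<^sup>2 \<partial>M) = (\<integral>\<^sup>+x. (g x)\<^sup>2 \<partial>N)"
proof
  assume "Lp_norm M 2 f = Lp_norm N 2 g"
  then have "ennreal_powr (Lp_norm M 2 f) 2 = ennreal_powr (Lp_norm N 2 g) 2" by simp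
  then show "(\<integral>\<^sup>+x. (f x)\<^sup>2 \<partial>M) = (\<integral>\<^sup>+x. (g x)\<^sup>2 \<partial>N)"
    by (simp add: Lp_norm_2 ennreal_powr_powr)
qed (simp add: Lp_norm_2)

text \<open>Plancherel in x for fixed h removes the space variable. The factor |det h| from the
  normalised dilation cancels the density 1/|det h| of Haar measure on the semidirect
  product.\<close>

lemma isometry_frequency:
  assumes \<psi>: "admissible_vector \<mu> (inv_fourier \<eta>)" and b: "b \<in> test_funs \<Omega>"
  shows "(\<integral>\<^sup>+\<xi>. (\<integral>\<^sup>+h. ennreal ((cmod (b \<xi> * cnj (\<eta> (transpose h *v \<xi>))))\<^sup>2) \<partial>\<mu>) \<partial>lborel) = (\<integral>\<^sup>+\<xi>. ennreal ((cmod (b \<xi>))\<^sup>2) \<partial>lborel)"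
proof -
  let ?f = "inv_fourier b" and ?W = "wavelet_L2 (inv_fourier \<eta>) (inv_fourier b)"
  have fin: "(\<integral>\<^sup>+\<xi>. ennreal ((cmod (b \<xi>))\<^sup>2) \<partial>lborel) < \<infinity>"
    using Plancherel(2)[OF b] by (simp add: integrable_iff_bounded)
  have fm: "?f \<in> borel_measurable lborel" using inv_fourier_integrable[OF b] by auto
  have "Lp_norm lborel 2 (\<lambda>x. ennreal (cmod (?f x))) < \<infinity>"
    using fin by (simp add: Lp_norm_2 ennreal_power Plancherel(1)[OF b] top.not_eq_extremum[symmetric])
  then have "?f \<in> Lp_space lborel 2" using fm by (simp add: Lp_space_def)
  then have W: "?W \<in> Lp_space (haar_G \<mu>) 2"
    "Lp_norm (haar_G \<mu>) 2 (\<lambda>g. ennreal (cmod (?W g))) = Lp_norm lborel 2 (\<lambda>x. ennreal (cmod (?f x)))"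
    using \<psi> by (auto simp: admissible_vector_def)
  have Wm[measurable]: "?W \<in> borel_measurable (lborel \<Otimes>\<^sub>M \<mu>)" using W(1) by (simp add: Lp_space_def haar_G_def)
  have dm[measurable]: "(\<lambda>h. det h) \<in> borel_measurable \<mu>"
    by (intro borel_measurable_mu borel_measurable_continuous_onI continuous_intros)
  have bm[measurable]: "b \<in> borel_measurable borel" and em[measurable]: "\<eta> \<in> borel_measurable borel"
    using test_funs_measurable b \<eta> by auto
  have "(\<lambda>p::(real^'d) \<times> (real^'d^'d). transpose (snd p) *v fst p) \<in> borel_measurable borel"
    by (intro borel_measurable_continuous_onI continuous_intros)
  from measurable_compose[OF pair_measurable_mu this]
  have "(\<lambda>p. transpose (snd p) *v fst p) \<in> borel_measurable (lborel \<Otimes>\<^sub>M \<mu>)" .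
  then have jm[measurable]: "(\<lambda>p. \<eta> (transpose (snd p) *v fst p)) \<in> borel_measurable (lborel \<Otimes>\<^sub>M \<mu>)"
    by (rule measurable_compose[OF _ em])
  have "(\<integral>\<^sup>+\<xi>. ennreal ((cmod (b \<xi>))\<^sup>2) \<partial>lborel) = (\<integral>\<^sup>+x. (ennreal (cmod (?f x)))\<^sup>2 \<partial>lborel)"
    by (simp add: Plancherel(1)[OF b] ennreal_power)
  also have "\<dots> = (\<integral>\<^sup>+g. (ennreal (cmod (?W g)))\<^sup>2 \<partial>haar_G \<mu>)"
    using W(2) unfolding Lp_norm_2_eq_iff by simp
  also have "\<dots> = (\<integral>\<^sup>+g. ennreal (1 / \<bar>det (snd g)\<bar>) * (ennreal (cmod (?W g)))\<^sup>2 \<partial>(lborel \<Otimes>\<^sub>M \<mu>))"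
    unfolding haar_G_def case_prod_unfold by (subst nn_integral_density) auto
  also have "\<dots> = (\<integral>\<^sup>+h. (\<integral>\<^sup>+x. ennreal (1 / \<bar>det h\<bar>) * (ennreal (cmod (?W (x, h))))\<^sup>2 \<partial>lborel) \<partial>\<mu>)"
    by (subst lborel_mu.nn_integral_snd[symmetric]) auto
  also have "\<dots> = (\<integral>\<^sup>+h. (\<integral>\<^sup>+\<xi>. ennreal ((cmod (b \<xi> * cnj (\<eta> (transpose h *v \<xi>))))\<^sup>2) \<partial>lborel) \<partial>\<mu>)"
  proof (rule nn_integral_cong)
    fix h assume "h \<in> space \<mu>"
    then have h: "h \<in> H" by (simp add: space_mu)
    have t: "(\<lambda>\<xi>. b \<xi> * cnj (\<eta> (transpose h *v \<xi>))) \<in> test_funs \<Omega>"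
      by (intro test_funs_mult b smooth_fun_cnj test_funs_comp_matrix[OF \<eta>])
    have "ennreal (1 / \<bar>det h\<bar>) * (ennreal (cmod (?W (x, h))))\<^sup>2 = ennreal ((cmod (inv_fourier (\<lambda>\<xi>. b \<xi> * cnj (\<eta> (transpose h *v \<xi>))) x))\<^sup>2)" for x
    proof -
      have "(\<bar>det h\<bar> powr (1 / 2))\<^sup>2 = \<bar>det h\<bar>"
        by (simp add: powr_half_sqrt)
      then show ?thesis
        using group_det[OF h] unfolding wavelet_L2_inv_fourier[OF h b]
        by (simp add: norm_mult power_mult_distrib ennreal_power flip: ennreal_mult)
    qed
    then show "(\<integral>\<^sup>+x. ennreal (1 / \<bar>det h\<bar>) * (ennreal (cmod (?W (x, h))))\<^sup>2 \<partial>lborel)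
        = (\<integral>\<^sup>+\<xi>. ennreal ((cmod (b \<xi> * cnj (\<eta> (transpose h *v \<xi>))))\<^sup>2) \<partial>lborel)"
      by (simp add: Plancherel(1)[OF t])
  qed
  also have "\<dots> = (\<integral>\<^sup>+\<xi>. (\<integral>\<^sup>+h. ennreal ((cmod (b \<xi> * cnj (\<eta> (transpose h *v \<xi>))))\<^sup>2) \<partial>\<mu>) \<partial>lborel)"
    by (rule lborel_mu.Fubini') (auto simp: case_prod_unfold)
  finally show ?thesis ..
qed

text \<open>Restricting h to the compact set \<open>return K\<close> makes the integral a smooth
  function of \<xi>. Where b is nonzero nothing is lost, since any contributing h returns a point of
  \<open>K\<close> to \<open>K\<close>. The vanishing integral is then the isometry property for
  b.\<close>

lemma Calderon_on_test_fun:
  assumes \<psi>: "admissible_vector \<mu> (inv_fourier \<eta>)" and b: "b \<in> test_funs \<Omega>"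
    and K: "compact K" "K \<subseteq> \<Omega>" "fun_supp \<eta> \<subseteq> K" "fun_supp b \<subseteq> K"
  defines "a \<equiv> \<lambda>\<xi>. (LINT h|\<mu>. indicator (return K) h * (b \<xi> * cnj (b \<xi>) * (\<eta> (transpose h *v \<xi>) * cnj (\<eta> (transpose h *v \<xi>))))) - b \<xi> * cnj (b \<xi>)"
  shows "a \<in> test_funs \<Omega>" "(LINT \<xi>|lborel. a \<xi>) = 0"
proof -
  have bb: "(\<lambda>\<xi>. b \<xi> * cnj (b \<xi>)) \<in> test_funs \<Omega>"
    by (rule test_funs_mult(1)[OF b smooth_fun_cnj(1)[OF test_funsD(1)[OF b]]])
  interpret F: supported_family \<Omega> "fun_supp (\<lambda>\<xi>. b \<xi> * cnj (b \<xi>))"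
    "\<lambda>(p :: (real^'d) \<times> (real^'d^'d)) \<xi>. b \<xi> * cnj (b \<xi>) * (chi (fst p) \<xi> * (\<eta> (transpose (snd p) *v \<xi>) * cnj (\<eta> (transpose (snd p) *v \<xi>))))"
    by (rule supported_family_Calderon[OF bb])
  note ret = return_compact[OF K(1,2)]
  have [measurable]: "return K \<in> sets \<mu>" by (rule compact_sets_mu[OF ret])
  have Xm: "(\<lambda>h. (0 :: real^'d, h)) \<in> borel_measurable \<mu>"
    by (intro borel_measurable_mu borel_measurable_continuous_onI continuous_intros)
  define m where "m \<xi> = (LINT h|\<mu>. indicator (return K) h * (b \<xi> * cnj (b \<xi>) * (\<eta> (transpose h *v \<xi>) * cnj (\<eta> (transpose h *v \<xi>)))))" for \<xi>
  have im: "(\<lambda>h. indicator (return K) h) \<in> borel_measurable \<mu>" by measurable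
  note * = F.integral_smooth[OF Xm im integrable_indicator_growth[OF ret]]
  have mt: "m \<in> test_funs \<Omega>" using *(1) by (simp add: m_def[abs_def])
  then show at: "a \<in> test_funs \<Omega>" unfolding a_def m_def[symmetric] by (intro test_funs_diff bb)
  have cplx: "b \<xi> * cnj (b \<xi>) * (\<eta> \<zeta> * cnj (\<eta> \<zeta>)) = complex_of_real ((cmod (b \<xi> * cnj (\<eta> \<zeta>)))\<^sup>2)" for \<xi> \<zeta>
    unfolding cmod_square_eq by (simp add: mult_ac)
  have ms: "ennreal (Re (m \<xi>)) = (\<integral>\<^sup>+h. ennreal ((cmod (b \<xi> * cnj (\<eta> (transpose h *v \<xi>))))\<^sup>2) \<partial>\<mu>)" "m \<xi> = of_real (Re (m \<xi>))" "0 \<le> Re (m \<xi>)" for \<xi>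
  proof -
    let ?r = "\<lambda>h. indicator (return K) h * (cmod (b \<xi> * cnj (\<eta> (transpose h *v \<xi>))))\<^sup>2"
    have eq: "indicator (return K) h * (b \<xi> * cnj (b \<xi>) * (\<eta> (transpose h *v \<xi>) * cnj (\<eta> (transpose h *v \<xi>)))) = complex_of_real (?r h)" for h
      unfolding cplx by (simp add: indicator_def)
    have "integrable \<mu> (\<lambda>h. indicator (return K) h * (b \<xi> * cnj (b \<xi>) * (\<eta> (transpose h *v \<xi>) * cnj (\<eta> (transpose h *v \<xi>)))))"
      using *(4)[of "[]" \<xi>] by simp
    from integrable_Re[OF this] have i: "integrable \<mu> ?r" unfolding eq Re_complex_of_real .
    have mr: "m \<xi> = of_real (LINT h|\<mu>. ?r h)" unfolding m_def eq by (rule integral_complex_of_real)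
    then show "m \<xi> = of_real (Re (m \<xi>))" by simp
    show "0 \<le> Re (m \<xi>)" unfolding mr by (simp add: integral_nonneg_AE)
    have "ennreal (Re (m \<xi>)) = (\<integral>\<^sup>+h. ennreal (?r h) \<partial>\<mu>)"
      unfolding mr using i by (simp add: nn_integral_eq_integral)
    also have "\<dots> = (\<integral>\<^sup>+h. ennreal ((cmod (b \<xi> * cnj (\<eta> (transpose h *v \<xi>))))\<^sup>2) \<partial>\<mu>)"
    proof (rule nn_integral_cong)
      fix h assume "h \<in> space \<mu>"
      then have h: "h \<in> H" by (simp add: space_mu)
      show "ennreal (?r h) = ennreal ((cmod (b \<xi> * cnj (\<eta> (transpose h *v \<xi>))))\<^sup>2)"
      proof (cases "b \<xi> = 0 \<or> \<eta> (transpose h *v \<xi>) = 0")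
        case False
        then have "\<xi> \<in> K" using K(4) test_fun_supp[OF b] by blast
        then have "h \<in> return K" using False h K(3) by (intro Calderon_support) auto
        then show ?thesis by simp
      qed auto
    qed
    finally show "ennreal (Re (m \<xi>)) = (\<integral>\<^sup>+h. ennreal ((cmod (b \<xi> * cnj (\<eta> (transpose h *v \<xi>))))\<^sup>2) \<partial>\<mu>)" .
  qed
  have "(\<integral>\<^sup>+\<xi>. ennreal (Re (m \<xi>)) \<partial>lborel) = (\<integral>\<^sup>+\<xi>. ennreal ((cmod (b \<xi>))\<^sup>2) \<partial>lborel)"
    unfolding ms(1) by (rule isometry_frequency[OF \<psi> b])
  then have "(LINT \<xi>|lborel. Re (m \<xi>)) = (LINT \<xi>|lborel. (cmod (b \<xi>))\<^sup>2)"
    using ms(3) Plancherel(2)[OF b] integrable_Re[OF test_funs_integrable[OF mt]]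
    by (simp add: nn_integral_eq_integral integral_nonneg_AE)
  then have "complex_of_real (LINT \<xi>|lborel. Re (m \<xi>)) = complex_of_real (LINT \<xi>|lborel. (cmod (b \<xi>))\<^sup>2)" by simp
  then have "(LINT \<xi>|lborel. m \<xi>) = (LINT \<xi>|lborel. b \<xi> * cnj (b \<xi>))"
    unfolding integral_complex_of_real[symmetric] ms(2)[symmetric] cmod_square_eq .
  then show "(LINT \<xi>|lborel. a \<xi>) = 0"
    unfolding a_def m_def[symmetric] using test_funs_integrable[OF mt] test_funs_integrable[OF bb] by simp
qed

text \<open>
  The isometry property for \<open>b * (1 + z * chi t)\<close> with \<open>z = 1, \<i>\<close> shows that the continuous function
  \<open>\<bar>b\<bar>\<^sup>2 (\<integral> \<bar>\<eta>(h\<^sup>T \<xi>)\<bar>\<^sup>2 dh - 1)\<close> has vanishing Fourier transform.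
\<close>

lemma Calderon:
  assumes \<psi>: "admissible_vector \<mu> (inv_fourier \<eta>)" and b: "b \<in> test_funs \<Omega>"
    and K: "compact K" "K \<subseteq> \<Omega>" "fun_supp \<eta> \<subseteq> K" "fun_supp b \<subseteq> K" and \<xi>: "b \<xi> \<noteq> 0"
  shows "(LINT h|\<mu>. indicator (return K) h * (\<eta> (transpose h *v \<xi>) * cnj (\<eta> (transpose h *v \<xi>)))) = 1"
proof -
  define D where "D \<xi> = (LINT h|\<mu>. indicator (return K) h * (\<eta> (transpose h *v \<xi>) * cnj (\<eta> (transpose h *v \<xi>))))" for \<xi>
  define a where "a \<xi> = b \<xi> * cnj (b \<xi>) * (D \<xi> - 1)" for \<xi>
  have eq: "(LINT h|\<mu>. indicator (return K) h * (c * (\<eta> (transpose h *v \<xi>) * cnj (\<eta> (transpose h *v \<xi>))))) - c = c * (D \<xi> - 1)" for c \<xi>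
    unfolding D_def right_diff_distrib integral_mult_right_zero[symmetric] by (simp add: mult_ac)
  have a: "a \<in> test_funs \<Omega>" "(LINT \<xi>|lborel. a \<xi>) = 0"
    using Calderon_on_test_fun[OF \<psi> b K] unfolding eq a_def[abs_def] by auto
  have pol: "(LINT \<xi>|lborel. a \<xi> * (z * cnj z + 1) + (z * (a \<xi> * chi t \<xi>) + cnj z * (a \<xi> * chi (- t) \<xi>))) = 0" for z t
  proof -
    let ?b = "\<lambda>\<xi>. b \<xi> * (1 + z * chi t \<xi>)"
    have sm: "smooth_fun (\<lambda>\<xi>. 1 + z * chi t \<xi>)"
    proof -
      have "smooth_fun (\<lambda>\<xi>. (\<lambda>_. 1) \<xi> + (\<lambda>\<xi>. z * chi t \<xi>) \<xi>)"
        by (rule smooth_family_smooth[OF smooth_family_add[OF smooth_family_const smooth_family_const]])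
           (intro smooth_fun_const smooth_fun_mult smooth_fun_chi)+
      then show ?thesis by simp
    qed
    have t: "?b \<in> test_funs \<Omega>" "fun_supp ?b \<subseteq> K"
      using test_funs_mult[OF b sm] K(4) by auto
    have c1: "chi t \<xi> * chi (- t) \<xi> = 1" for \<xi>
      unfolding chi_add_left[symmetric] by simp
    have alg: "x * (1 + z * c) * (y * (1 + w * c')) * d = x * y * d * (z * w + 1) + (z * (x * y * d * c) + w * (x * y * d * c'))"
      if "c * c' = 1" for x y w d c c' :: complex
      using that by algebra
    have "?b \<xi> * cnj (?b \<xi>) * (D \<xi> - 1) = a \<xi> * (z * cnj z + 1) + (z * (a \<xi> * chi t \<xi>) + cnj z * (a \<xi> * chi (- t) \<xi>))" for \<xi>
      unfolding a_def complex_cnj_mult complex_cnj_add cnj_chi(1) complex_cnj_one by (rule alg[OF c1])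
    then show ?thesis
      using Calderon_on_test_fun(2)[OF \<psi> t(1) K(1-3) t(2)] unfolding eq by simp
  qed
  have "inv_fourier a t = 0" for t
  proof -
    have i: "integrable lborel a" "integrable lborel (\<lambda>\<xi>. a \<xi> * chi t \<xi>)" "integrable lborel (\<lambda>\<xi>. a \<xi> * chi (- t) \<xi>)"
      using test_funs_integrable[OF a(1)] integrable_mult_chi by auto
    have "z * inv_fourier a t + cnj z * inv_fourier a (- t) = 0" for z
      using pol[of z t] i a(2) by (simp add: inv_fourier_chi)
    from this[of 1] this[of \<i>] show ?thesis by (simp add: add_eq_0_iff)
  qed
  moreover obtain B where "\<And>x. cmod (a x) \<le> B" using test_funs_bounded[OF a(1)] unfolding bounded_iff by auto
  ultimately have "a \<xi> = 0"
    using inv_fourier_eq_0_imp[OF test_funs_integrable[OF a(1)] smooth_fun_continuous[OF test_funsD(1)[OF a(1)]]] by blast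
  then show ?thesis using \<xi> by (simp add: a_def D_def)
qed

end

end

subsection \<open>Convolution bounds\<close>

lemma Lp_norm_shift:
  fixes c :: "'a::euclidean_space"
  assumes "1 \<le> p" and f[measurable]: "f \<in> borel_measurable borel"
  shows "Lp_norm lborel p (\<lambda>x. f (c + x)) = Lp_norm lborel p f"
  using assms(1)
proof (cases rule: exponent_cases)
  case 1
  have "(AE x in lborel. f (c + x) \<le> b) \<longleftrightarrow> (AE x in lborel. f x \<le> b)" for b
  proof -
    have D: "distr lborel borel ((+) c) = (lborel :: 'a measure)" by (rule lborel_distr_plus)
    have "(AE x in distr lborel borel ((+) c). f x \<le> b) \<longleftrightarrow> (AE x in lborel. f (c + x) \<le> b)"
      by (rule AE_distr_iff) measurable
    then show ?thesis unfolding D ..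
  qed
  then have "esssup lborel (\<lambda>x. f (c + x)) \<le> b \<longleftrightarrow> esssup lborel f \<le> b" for b
    by (simp add: esssup_le_iff)
  then show ?thesis unfolding 1 Lp_norm_top by (meson antisym order_refl)
next
  case (2 r)
  then show ?thesis
    using nn_integral_lborel_shift[of "\<lambda>x. ennreal_powr (f x) r" c] by (simp add: Lp_norm_finite)
qed

text \<open>Young's inequality as Minkowski's inequality for a superposition of translates of f. The
  kernel is reflected because this is the form that \<open>fourier_modulate\<close>
  produces.\<close>

lemma Lp_norm_convolution_le:
  fixes k :: "'a::euclidean_space \<Rightarrow> real"
  assumes p: "1 \<le> p" and [measurable]: "f \<in> borel_measurable borel" "k \<in> borel_measurable borel"
  shows "Lp_norm lborel p (\<lambda>x. \<integral>\<^sup>+y. f y * ennreal (k (y - x)) \<partial>lborel) \<le> Lp_norm lborel p f * (\<integral>\<^sup>+y. ennreal (k y) \<partial>lborel)"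
proof -
  have "(\<integral>\<^sup>+y. f y * ennreal (k (y - x)) \<partial>lborel) = (\<integral>\<^sup>+z. ennreal (k z) * f (z + x) \<partial>lborel)" for x
    using nn_integral_lborel_shift[of "\<lambda>y. f y * ennreal (k (y - x))" x] by (simp add: add.commute mult.commute)
  then have "Lp_norm lborel p (\<lambda>x. \<integral>\<^sup>+y. f y * ennreal (k (y - x)) \<partial>lborel)
      = Lp_norm lborel p (\<lambda>x. \<integral>\<^sup>+z. (\<lambda>(x, z). ennreal (k z) * f (z + x)) (x, z) \<partial>lborel)" by simp
  also have "\<dots> \<le> (\<integral>\<^sup>+z. Lp_norm lborel p (\<lambda>x. (\<lambda>(x, z). ennreal (k z) * f (z + x)) (x, z)) \<partial>lborel)"
    by (rule Lp_norm_nn_integral_le[OF sigma_finite_lborel sigma_finite_lborel _ p]) measurable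
  also have "\<dots> = (\<integral>\<^sup>+z. ennreal (k z) * Lp_norm lborel p f \<partial>lborel)"
    by (intro nn_integral_cong) (simp add: Lp_norm_cmult[OF p] Lp_norm_shift[OF p])
  also have "\<dots> = Lp_norm lborel p f * (\<integral>\<^sup>+y. ennreal (k y) \<partial>lborel)"
    by (subst nn_integral_multc) (auto simp: mult.commute)
  finally show ?thesis .
qed

lemma cmod_integral_le:
  fixes f :: "'a \<Rightarrow> complex"
  shows "ennreal (cmod (LINT x|M. f x)) \<le> (\<integral>\<^sup>+x. ennreal (cmod (f x)) \<partial>M)"
  by (cases "integrable M f") (auto simp: integral_norm_bound_ennreal not_integrable_integral_eq)

lemma fourier_L1: "f \<in> borel_measurable borel \<Longrightarrow> integrable lborel (inv_fourier f) \<Longrightarrow>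
  (\<integral>\<^sup>+x. ennreal (cmod (fourier f x)) \<partial>lborel) = (\<integral>\<^sup>+x. ennreal (cmod (inv_fourier f x)) \<partial>lborel)"
  unfolding fourier_eq_inv_fourier
  using nn_integral_lborel_reflect[of "\<lambda>x. ennreal (cmod (inv_fourier f x))" 0] by auto

lemma fourier_modulate: "fourier (\<lambda>\<xi>. chi x \<xi> * f \<xi>) y = fourier f (y - x)"
  by (simp add: fourier_eq_inv_fourier inv_fourier_modulate add.commute)

lemma inv_fourier_L1_finite:
  "a \<in> test_funs \<Omega> \<Longrightarrow> (\<integral>\<^sup>+x. ennreal (cmod (inv_fourier a x)) \<partial>lborel) < \<infinity>"
  using inv_fourier_integrable by (auto simp: integrable_iff_bounded)

text \<open>The Jacobian of the dilation and the scalar in front of the transform cancel. This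
  invariance makes the constants of both estimates independent of h.\<close>

lemma inv_fourier_dilated_L1:
  fixes h :: "real^'d^'d"
  assumes h: "invertible h" and a: "a \<in> test_funs \<Omega>"
  shows "(\<integral>\<^sup>+x. ennreal (cmod (inv_fourier (\<lambda>\<xi>. a (transpose h *v \<xi>)) x)) \<partial>lborel) = (\<integral>\<^sup>+x. ennreal (cmod (inv_fourier a x)) \<partial>lborel)"
proof -
  have [measurable]: "inv_fourier a \<in> borel_measurable borel" using inv_fourier_integrable[OF a] by auto
  have "det h * det (matrix_inv h) = 1" using matrix_inv_cancel(1)[OF h] by (metis det_I det_mul)
  then have "\<bar>det h\<bar> * \<bar>det (matrix_inv h)\<bar> = 1" by (simp flip: abs_mult)
  then have d: "1 / \<bar>det (matrix_inv h)\<bar> = \<bar>det h\<bar>" "0 < \<bar>det h\<bar>"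
    by (auto simp: divide_eq_eq)
  have "(\<integral>\<^sup>+x. ennreal (cmod (inv_fourier (\<lambda>\<xi>. a (transpose h *v \<xi>)) x)) \<partial>lborel)
      = (\<integral>\<^sup>+x. ennreal (1 / \<bar>det h\<bar>) * ennreal (cmod (inv_fourier a (matrix_inv h *v x))) \<partial>lborel)"
    unfolding inv_fourier_comp_transpose[OF h test_funs_measurable[OF a]]
    by (simp add: norm_mult norm_divide flip: ennreal_mult)
  also have "\<dots> = ennreal (1 / \<bar>det h\<bar>) * (\<integral>\<^sup>+x. ennreal (cmod (inv_fourier a (matrix_inv h *v x))) \<partial>lborel)"
    by (rule nn_integral_cmult) measurable
  also have "\<dots> = ennreal (1 / \<bar>det h\<bar>) * (ennreal \<bar>det h\<bar> * (\<integral>\<^sup>+x. ennreal (cmod (inv_fourier a x)) \<partial>lborel))"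
    using nn_integral_lborel_matrix[OF invertible_matrix_inv[OF h], of "\<lambda>x. ennreal (cmod (inv_fourier a x))"] unfolding d(1) by simp
  also have "\<dots> = (\<integral>\<^sup>+x. ennreal (cmod (inv_fourier a x)) \<partial>lborel)"
    using d(2) by (simp flip: mult.assoc ennreal_mult)
  finally show ?thesis .
qed

subsection \<open>Comparison of the norms\<close>

locale coorbit_setup = admissible_group H \<mu> \<Omega>
  for H :: "(real^'d^'d) set" and \<mu> :: "(real^'d^'d) measure" and \<Omega> :: "(real^'d) set" +
  fixes C Q :: "(real^'d) set" and I :: "'i set" and g :: "'i \<Rightarrow> real^'d^'d"
    and \<phi> :: "'i \<Rightarrow> real^'d \<Rightarrow> complex" and p q :: ennreal
    and v :: "real^'d^'d \<Rightarrow> real" and u :: "real^'d \<Rightarrow> real" and w :: "'i \<Rightarrow> real"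
    and \<eta> :: "real^'d \<Rightarrow> complex"
  assumes gen: "compact_generator H \<Omega> C"
    and cover: "induced_cover H \<Omega> I g Q"
    and bapu: "BAPU \<Omega> I (cover_set g Q) \<phi>"
    and p: "1 \<le> p" and q: "1 \<le> q"
    and weight: "admissible_weight H (\<lambda>(x, h). v h)"
    and pull: "pull_back H \<Omega> C (\<lambda>h. \<bar>det h\<bar> powr (1 / 2 - enn2real (1 / q)) * v h) u"
    and disc: "discretization I (cover_set g Q) u w"
    and \<eta>: "\<eta> \<in> test_funs \<Omega>" and \<psi>: "admissible_vector \<mu> (inv_fourier \<eta>)"
begin

text \<open>One compact set for three purposes: \<open>C\<close> ties in the pulled-back weight, the
  closure of \<open>Q\<close> the cover, the support of \<eta> the wavelet. All comparisons then
  take place in translates of \<open>return K\<close>.\<close>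

definition K :: "(real^'d) set" where
  "K = C \<union> closure Q \<union> fun_supp \<eta>"

definition \<nu> :: "real^'d^'d \<Rightarrow> real" where
  "\<nu> h = \<bar>det h\<bar> powr (1 / 2 - enn2real (1 / q)) * v h"

abbreviation E :: "'i \<Rightarrow> (real^'d^'d) set" where
  "E i \<equiv> translate K (g i)"

abbreviation J :: "real^'d^'d \<Rightarrow> 'i set" where
  "J h \<equiv> {i \<in> I. h \<in> E i}"

lemma K: "compact K" "K \<subseteq> \<Omega>"
proof -
  have *: "compact C" "C \<subseteq> \<Omega>" "compact (closure Q)" "closure Q \<subseteq> \<Omega>"
    using gen cover unfolding compact_generator_def induced_cover_def by blast+
  show "compact K" unfolding K_def by (intro compact_Un * test_funsD(2)[OF \<eta>])
  show "K \<subseteq> \<Omega>" unfolding K_def by (intro Un_least * test_funsD(3)[OF \<eta>])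
qed

lemma spread: "well_spread H I g" and countable_I: "countable I" and g: "i \<in> I \<Longrightarrow> g i \<in> H"
  using cover by (auto simp: induced_cover_def well_spread_def)

lemma \<phi>: "i \<in> I \<Longrightarrow> \<phi> i \<in> test_funs \<Omega>"
  using bapu by (simp add: BAPU_def)

lemma cover_in_K: "i \<in> I \<Longrightarrow> \<xi> \<in> cover_set g Q i \<Longrightarrow> transpose (g i) *v \<xi> \<in> K"
  using transpose_matrix_inv_vector(1)[OF group_invertible[OF g]] closure_subset[of Q]
  by (auto simp: cover_set_def K_def)

lemma \<phi>_support: "i \<in> I \<Longrightarrow> \<phi> i \<xi> \<noteq> 0 \<Longrightarrow> transpose (g i) *v \<xi> \<in> K"
  using bapu test_funsD(4)[OF \<phi>] cover_in_K unfolding BAPU_def by blast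

lemma \<eta>_support: "\<eta> \<zeta> \<noteq> 0 \<Longrightarrow> \<zeta> \<in> K"
  using test_fun_supp[OF \<eta>] by (auto simp: K_def)

lemma in_E: "i \<in> I \<Longrightarrow> h \<in> H \<Longrightarrow> transpose (g i) *v \<xi> \<in> K \<Longrightarrow> transpose h *v \<xi> \<in> K \<Longrightarrow> h \<in> E i"
  unfolding translate_def using return_translate[OF g] by simp

lemma E_facts:
  assumes "i \<in> I"
  shows "compact (E i)" "E i \<subseteq> H" "E i \<in> sets \<mu>" "emeasure \<mu> (E i) = ennreal (measure \<mu> (return K))"
proof -
  show "compact (E i)" "E i \<subseteq> H" "E i \<in> sets \<mu>" using translate_facts[OF g[OF assms] K] by auto
  show "emeasure \<mu> (E i) = ennreal (measure \<mu> (return K))"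
    using translate_facts(4)[OF g[OF assms] K] compact_mu_finite[OF return_compact[OF K]]
    by (simp add: emeasure_eq_ennreal_measure)
qed

lemma weight_facts:
  "h \<in> H \<Longrightarrow> 0 < v h" "continuous_on H v"
  "\<exists>c>0. \<forall>h\<in>H. \<forall>k\<in>H. v (h ** k) \<le> c * v h * v k"
proof -
  show "h \<in> H \<Longrightarrow> 0 < v h" using weight by (auto simp: admissible_weight_def)
  have "continuous_on (UNIV \<times> H) (\<lambda>(x :: real^'d, h). v h)"
    using weight by (auto simp: admissible_weight_def)
  moreover have "continuous_on H (\<lambda>h. (0 :: real^'d, h))" by (intro continuous_intros)
  moreover have "(\<lambda>h. (0 :: real^'d, h)) ` H \<subseteq> UNIV \<times> H" by auto
  ultimately have "continuous_on H (\<lambda>h. (\<lambda>(x :: real^'d, h). v h) (0, h))" by (rule continuous_on_compose2)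
  then show "continuous_on H v" by simp
  obtain c where "c > 0" "\<forall>z\<in>UNIV \<times> H. \<forall>z'\<in>UNIV \<times> H. (\<lambda>(x :: real^'d, h). v h) (semidirect_mult z z') \<le> c * (\<lambda>(x, h). v h) z * (\<lambda>(x, h). v h) z'"
    using weight unfolding admissible_weight_def by blast
  then show "\<exists>c>0. \<forall>h\<in>H. \<forall>k\<in>H. v (h ** k) \<le> c * v h * v k"
    by (intro exI[of _ c]) (force simp: semidirect_mult_def)
qed

lemma \<nu>_pos: "h \<in> H \<Longrightarrow> 0 < \<nu> h"
  using weight_facts(1) group_det by (simp add: \<nu>_def)

lemma \<nu>_moderate:
  assumes P: "compact P" "P \<subseteq> H"
  obtains c where "0 < c" "\<And>h k. h \<in> H \<Longrightarrow> k \<in> P \<Longrightarrow> \<nu> (h ** k) \<le> c * \<nu> h"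
proof -
  obtain c where c: "c > 0" "\<And>h k. h \<in> H \<Longrightarrow> k \<in> H \<Longrightarrow> v (h ** k) \<le> c * v h * v k"
    using weight_facts(3) by blast
  have "continuous_on P \<nu>"
    unfolding \<nu>_def[abs_def]
    by (intro continuous_intros continuous_on_subset[OF weight_facts(2) P(2)]) (use P(2) group_det in auto)
  then have "bounded (\<nu> ` P)" using P(1) by (intro compact_imp_bounded compact_continuous_image)
  then obtain B where B: "\<forall>x\<in>\<nu> ` P. norm x \<le> B" unfolding bounded_iff by blast
  \<comment> \<open>\<open>B\<close> bounds \<nu> on \<open>P\<close>, which may be empty and then
    says nothing about the sign of \<open>B\<close>; the modified constant is positive in any
    case.\<close>
  have "\<nu> (h ** k) \<le> (c * (\<bar>B\<bar> + 1)) * \<nu> h" if "h \<in> H" "k \<in> P" for h k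
  proof -
    have k: "k \<in> H" using P that by auto
    have "\<nu> (h ** k) = \<bar>det h\<bar> powr (1 / 2 - enn2real (1 / q)) * \<bar>det k\<bar> powr (1 / 2 - enn2real (1 / q)) * v (h ** k)"
      by (simp add: \<nu>_def det_mul abs_mult powr_mult)
    also have "\<dots> \<le> \<bar>det h\<bar> powr (1 / 2 - enn2real (1 / q)) * \<bar>det k\<bar> powr (1 / 2 - enn2real (1 / q)) * (c * v h * v k)"
      by (intro mult_left_mono c(2) that k) auto
    also have "\<dots> = c * \<nu> k * \<nu> h" by (simp add: \<nu>_def mult_ac)
    also have "\<dots> \<le> c * (\<bar>B\<bar> + 1) * \<nu> h"
      using B that c(1) less_imp_le[OF \<nu>_pos[OF that(1)]] by (intro mult_right_mono mult_left_mono) force+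
    finally show ?thesis .
  qed
  then show ?thesis using that[of "c * (\<bar>B\<bar> + 1)"] c(1) by simp
qed

text \<open>The weight \<open>w i\<close> is the value of \<nu> at an element of \<open>E i\<close>:
  the sample point lies in \<open>Q i\<close> and is the image of a point of \<open>C\<close> under
  some k, so both \<open>g i\<close> and k carry it into \<open>K\<close>. On \<open>E i\<close> the
  moderate weight \<nu> varies by a bounded factor.\<close>

lemma weight_discretization:
  obtains c where "0 < c" "\<And>i. i \<in> I \<Longrightarrow> 0 < w i"
    "\<And>i h. i \<in> I \<Longrightarrow> h \<in> E i \<Longrightarrow> \<nu> h \<le> c * w i \<and> w i \<le> c * \<nu> h"
proof -
  \<comment> \<open>Two elements of the same \<open>E i\<close> differ by a product of two returning
    elements, passing through \<open>g i\<close>.\<close>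
  define P where "P = (\<lambda>(a, b). a ** b) ` (return K \<times> return K)"
  have P: "compact P" "P \<subseteq> H"
    unfolding P_def using return_compact[OF K] by (auto intro!: compact_mult group_simps(2))
  obtain c where c: "0 < c" "\<And>h k. h \<in> H \<Longrightarrow> k \<in> P \<Longrightarrow> \<nu> (h ** k) \<le> c * \<nu> h"
    using \<nu>_moderate[OF P] by metis
  have comp: "\<nu> k \<le> c * \<nu> h" if "i \<in> I" "h \<in> E i" "k \<in> E i" for h k i
  proof -
    have hk: "h \<in> H" "k \<in> H" using E_facts(2)[OF that(1)] that by auto
    have "g i \<in> translate K h" using translate_sym[OF hk(1) g[OF that(1)]] that(2) by simp
    then have 1: "matrix_inv h ** g i \<in> return K" by (simp add: translate_def)
    have 2: "matrix_inv (g i) ** k \<in> return K" using that(3) by (simp add: translate_def)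
    have "(matrix_inv h ** g i) ** (matrix_inv (g i) ** k) \<in> P"
      unfolding P_def using 1 2 by (intro image_eqI[of _ _ "(matrix_inv h ** g i, matrix_inv (g i) ** k)"]) auto
    moreover have "(matrix_inv h ** g i) ** (matrix_inv (g i) ** k) = matrix_inv h ** k"
      using matrix_inv_mat_unique(2)[OF group_invertible[OF g[OF that(1)]]] by (simp flip: matrix_mul_assoc)
    ultimately have "matrix_inv h ** k \<in> P" by simp
    from c(2)[OF hk(1) this] show ?thesis
      using matrix_inv_mat_unique(2)[OF group_invertible[OF hk(1)]] by simp
  qed
  have key: "\<exists>k\<in>E i. w i = \<nu> k" if i: "i \<in> I" for i
  proof -
    obtain x where x: "x \<in> cover_set g Q i" "w i = u x" using disc i unfolding discretization_def by blast
    have "x \<in> \<Omega>" using cover x(1) i unfolding induced_cover_def by blast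
    then obtain k \<zeta> where k: "k \<in> H" "\<zeta> \<in> C" "x = transpose (matrix_inv k) *v \<zeta>" "u x = \<nu> k"
      using pull unfolding pull_back_def \<nu>_def by blast
    have "transpose k *v x \<in> K"
      using k(2,3) transpose_matrix_inv_vector(1)[OF group_invertible[OF k(1)]] by (simp add: K_def)
    then have "k \<in> E i" using cover_in_K[OF i x(1)] by (intro in_E[OF i k(1)])
    then show ?thesis using x k by auto
  qed
  show ?thesis
  proof (rule that[OF c(1)])
    fix i assume i: "i \<in> I"
    obtain k where k: "k \<in> E i" "w i = \<nu> k" using key[OF i] by blast
    show "0 < w i" using k E_facts(2)[OF i] \<nu>_pos by auto
    fix h assume h: "h \<in> E i"
    show "\<nu> h \<le> c * w i \<and> w i \<le> c * \<nu> h" using comp[OF i] k h by simp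
  qed
qed

lemma smooth_family_\<phi>\<eta>:
  assumes "i \<in> I"
  shows "supported_family \<Omega> (fun_supp (\<phi> i)) (\<lambda>(z :: (real^'d) \<times> (real^'d^'d)) \<xi>. \<phi> i \<xi> * (chi (fst z) \<xi> * cnj (\<eta> (transpose (snd z) *v \<xi>))))"
proof
  show "smooth_family (\<lambda>(z :: (real^'d) \<times> (real^'d^'d)) \<xi>. \<phi> i \<xi> * (chi (fst z) \<xi> * cnj (\<eta> (transpose (snd z) *v \<xi>))))"
    using test_funsD(1)[OF \<phi>[OF assms]] smooth_family_dilated[OF test_funs_cnj(1)[OF \<eta>]]
    by (intro smooth_family_mult smooth_family_const smooth_family_chi_fst)
qed (use test_funsD[OF \<phi>[OF assms]] test_fun_supp[OF \<phi>[OF assms]] in auto)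

lemma \<eta>_cnj_dilated: "h \<in> H \<Longrightarrow> (\<lambda>\<xi>. cnj (\<eta> (transpose h *v \<xi>))) \<in> test_funs \<Omega>"
  by (rule dilated_test_funs[OF _ test_funs_cnj(1)[OF \<eta>]])

text \<open>The L1 norm of the wavelet, and by dilation invariance also of all its dilated
  versions.\<close>

definition A\<^sub>\<eta> :: ennreal where
  "A\<^sub>\<eta> = (\<integral>\<^sup>+x. ennreal (cmod (inv_fourier \<eta> x)) \<partial>lborel)"

lemma fourier_\<eta>_L1:
  assumes h: "h \<in> H"
  shows "(\<integral>\<^sup>+x. ennreal (cmod (fourier (\<lambda>\<xi>. cnj (\<eta> (transpose h *v \<xi>))) x)) \<partial>lborel) = A\<^sub>\<eta>"
    "(\<integral>\<^sup>+x. ennreal (cmod (inv_fourier (\<lambda>\<xi>. \<eta> (transpose h *v \<xi>)) x)) \<partial>lborel) = A\<^sub>\<eta>"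
proof -
  show 1: "(\<integral>\<^sup>+x. ennreal (cmod (inv_fourier (\<lambda>\<xi>. \<eta> (transpose h *v \<xi>)) x)) \<partial>lborel) = A\<^sub>\<eta>"
    unfolding A\<^sub>\<eta>_def by (rule inv_fourier_dilated_L1[OF group_invertible[OF h] \<eta>])
  have "cmod (fourier (\<lambda>\<xi>. cnj (\<eta> (transpose h *v \<xi>))) x) = cmod (inv_fourier (\<lambda>\<xi>. \<eta> (transpose h *v \<xi>)) x)" for x
    by (metis cnj_inv_fourier complex_mod_cnj)
  then show "(\<integral>\<^sup>+x. ennreal (cmod (fourier (\<lambda>\<xi>. cnj (\<eta> (transpose h *v \<xi>))) x)) \<partial>lborel) = A\<^sub>\<eta>"
    using 1 by simp
qed

lemma A\<^sub>\<eta>_finite: "A\<^sub>\<eta> < \<infinity>"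
  unfolding A\<^sub>\<eta>_def by (rule inv_fourier_L1_finite[OF \<eta>])

lemma \<phi>_sum:
  assumes "\<xi> \<in> \<Omega>" "finite S" "S \<subseteq> I" "\<And>i. i \<in> I - S \<Longrightarrow> \<phi> i \<xi> = 0"
  shows "(\<Sum>i\<in>S. \<phi> i \<xi>) = 1"
proof -
  have "((\<lambda>i. \<phi> i \<xi>) has_sum 1) I" using bapu assms(1) by (simp add: BAPU_def)
  moreover have "((\<lambda>i. \<phi> i \<xi>) has_sum 1) I \<longleftrightarrow> ((\<lambda>i. \<phi> i \<xi>) has_sum 1) S"
    using assms by (intro has_sum_cong_neutral) auto
  ultimately have "((\<lambda>i. \<phi> i \<xi>) has_sum 1) S" by simp
  then show ?thesis using has_sum_unique[OF has_sum_finite[OF assms(2)]] by metis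
qed

lemma overlap:
  obtains N where "\<And>h. h \<in> H \<Longrightarrow> finite (J h)" "\<And>h. h \<in> H \<Longrightarrow> card (J h) \<le> N"
  by (rule bounded_overlap[OF spread K]) blast

lemma finite_J: "h \<in> H \<Longrightarrow> finite (J h)"
  by (rule overlap) blast

section \<open>Bounding the wavelet transform by the localised pieces\<close>

context
  fixes f :: "(real^'d \<Rightarrow> complex) \<Rightarrow> complex"
  assumes f: "f \<in> S_antidual \<Omega>"
begin

abbreviation \<Lambda> :: "(real^'d \<Rightarrow> complex) \<Rightarrow> complex" where
  "\<Lambda> \<equiv> antidual_hat f"

lemma \<Lambda>: "distribution_on \<Omega> \<Lambda>"
  by (rule distribution_antidual_hat[OF f])

abbreviation T :: "'i \<Rightarrow> (real^'d \<Rightarrow> complex) \<Rightarrow> complex" where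
  "T i \<equiv> distr_inv_fourier (distr_mult (\<phi> i) (distr_hat (Gamma_map \<Omega> f)))"

lemma T_eq: "(\<lambda>\<xi>. \<phi> i \<xi> * inv_fourier \<theta> \<xi>) \<in> test_funs \<Omega> \<Longrightarrow> T i \<theta> = \<Lambda> (\<lambda>\<xi>. \<phi> i \<xi> * inv_fourier \<theta> \<xi>)"
  by (simp add: distr_inv_fourier_def distr_mult_def distr_hat_def Gamma_map_fourier)

lemma wavelet_eq:
  assumes h: "h \<in> H"
  shows "wavelet (inv_fourier \<eta>) f (x, h) = of_real (\<bar>det h\<bar> powr (1 / 2)) * \<Lambda> (\<lambda>\<xi>. cnj (\<eta> (transpose h *v \<xi>)) * chi x \<xi>)"
proof -
  let ?c = "\<lambda>\<xi>. cnj (\<eta> (transpose h *v \<xi>)) * chi x \<xi>"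
  have c: "?c \<in> test_funs \<Omega>" by (intro test_funs_mult smooth_fun_chi \<eta>_cnj_dilated h)
  have "wavelet (inv_fourier \<eta>) f (x, h) = f (inv_fourier (\<lambda>\<xi>. of_real (\<bar>det h\<bar> powr (1 / 2)) * (chi (- x) \<xi> * \<eta> (transpose h *v \<xi>))))"
    unfolding wavelet_def quasi_regular_inv_fourier[OF group_invertible[OF h] test_funs_measurable[OF \<eta>]] ..
  also have "\<dots> = \<Lambda> (\<lambda>\<xi>. of_real (\<bar>det h\<bar> powr (1 / 2)) * ?c \<xi>)"
    by (simp add: antidual_hat_def cnj_chi(1) mult_ac)
  also have "\<dots> = of_real (\<bar>det h\<bar> powr (1 / 2)) * \<Lambda> ?c" by (rule distribution_cmult[OF \<Lambda> c])
  finally show ?thesis .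
qed

text \<open>Where the dilated wavelet is nonzero, only indices in \<open>J h\<close> contribute to
  the partition of unity. Larger finite sets \<open>S\<close> are allowed so that one index set can
  serve different h.\<close>

lemma \<Lambda>_split:
  assumes h: "h \<in> H" and S: "finite S" "J h \<subseteq> S" "S \<subseteq> I"
  shows "\<Lambda> (\<lambda>\<xi>. cnj (\<eta> (transpose h *v \<xi>)) * chi x \<xi>) = (\<Sum>i\<in>S. \<Lambda> (\<lambda>\<xi>. \<phi> i \<xi> * (chi x \<xi> * cnj (\<eta> (transpose h *v \<xi>)))))"
proof -
  have "cnj (\<eta> (transpose h *v \<xi>)) * chi x \<xi> = (\<Sum>i\<in>S. 1 * (\<phi> i \<xi> * (chi x \<xi> * cnj (\<eta> (transpose h *v \<xi>)))))" for \<xi>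
  proof (cases "\<eta> (transpose h *v \<xi>) = 0")
    case False
    then have k: "transpose h *v \<xi> \<in> K" by (rule \<eta>_support)
    have "\<phi> i \<xi> = 0" if "i \<in> I - S" for i
      using in_E[OF _ h \<phi>_support k] that S(2) by blast
    moreover have "\<xi> \<in> \<Omega>" using False test_funsD(4)[OF \<eta>_cnj_dilated[OF h], of \<xi>] by auto
    ultimately have "(\<Sum>i\<in>S. \<phi> i \<xi>) = 1" using \<phi>_sum S by blast
    then show ?thesis by (simp flip: sum_distrib_right)
  qed simp
  then have "\<Lambda> (\<lambda>\<xi>. cnj (\<eta> (transpose h *v \<xi>)) * chi x \<xi>) = \<Lambda> (\<lambda>\<xi>. \<Sum>i\<in>S. 1 * (\<phi> i \<xi> * (chi x \<xi> * cnj (\<eta> (transpose h *v \<xi>)))))"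
    by simp
  also have "\<dots> = (\<Sum>i\<in>S. 1 * \<Lambda> (\<lambda>\<xi>. \<phi> i \<xi> * (chi x \<xi> * cnj (\<eta> (transpose h *v \<xi>)))))"
    using S \<phi> test_funsD(1)[OF \<eta>_cnj_dilated[OF h]]
    by (intro distribution_sum[OF \<Lambda>] test_funs_mult smooth_fun_mult smooth_fun_chi) auto
  finally show ?thesis by simp
qed

lemma \<Lambda>_\<phi>\<eta>_measurable:
  assumes "i \<in> I"
  shows "(\<lambda>z. \<Lambda> (\<lambda>\<xi>. \<phi> i \<xi> * (chi (fst z) \<xi> * cnj (\<eta> (transpose (snd z) *v \<xi>))))) \<in> borel_measurable (lborel \<Otimes>\<^sub>M \<mu>)"
proof -
  interpret F: supported_family \<Omega> "fun_supp (\<phi> i)" "\<lambda>(z :: (real^'d) \<times> (real^'d^'d)) \<xi>. \<phi> i \<xi> * (chi (fst z) \<xi> * cnj (\<eta> (transpose (snd z) *v \<xi>)))"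
    by (rule smooth_family_\<phi>\<eta>[OF assms])
  show ?thesis by (rule F.distribution_family_measurable[OF \<Lambda> pair_measurable_mu])
qed

text \<open>The relevant index set varies with h, so measurability is read off from sums over
  initial segments of an enumeration of \<open>I\<close>. At each point these sums are eventually
  constant.\<close>

lemma wavelet_measurable: "wavelet (inv_fourier \<eta>) f \<in> borel_measurable (lborel \<Otimes>\<^sub>M \<mu>)"
proof -
  let ?L = "\<lambda>z i. \<Lambda> (\<lambda>\<xi>. \<phi> i \<xi> * (chi (fst z) \<xi> * cnj (\<eta> (transpose (snd z) *v \<xi>))))"
  define S where "S n = {i \<in> I. to_nat_on I i < n}" for n
  have S: "finite (S n)" "S n \<subseteq> I" for n
  proof -
    have "inj_on (to_nat_on I) (S n)" using inj_on_to_nat_on[OF countable_I] by (rule inj_on_subset) (auto simp: S_def)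
    moreover have "to_nat_on I ` S n \<subseteq> {..<n}" by (auto simp: S_def)
    ultimately show "finite (S n)" by (meson finite_imageD finite_lessThan finite_subset)
  qed (auto simp: S_def)
  have dm: "(\<lambda>h. \<bar>det h\<bar>) \<in> borel_measurable \<mu>"
    by (intro borel_measurable_mu borel_measurable_continuous_onI continuous_intros)
  have [measurable]: "(\<lambda>z. complex_of_real (\<bar>det (snd z)\<bar> powr (1 / 2))) \<in> borel_measurable ((lborel :: (real^'d) measure) \<Otimes>\<^sub>M \<mu>)"
    using measurable_compose[OF measurable_snd dm] by measurable
  have m: "(\<lambda>z. complex_of_real (\<bar>det (snd z)\<bar> powr (1 / 2)) * (\<Sum>i\<in>S n. ?L z i)) \<in> borel_measurable (lborel \<Otimes>\<^sub>M \<mu>)" for n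
    using \<Lambda>_\<phi>\<eta>_measurable S(2) by (intro borel_measurable_times borel_measurable_sum) auto
  show ?thesis
  proof (rule borel_measurable_LIMSEQ_metric[OF m])
    fix z assume "z \<in> space ((lborel :: (real^'d) measure) \<Otimes>\<^sub>M \<mu>)"
    then have h: "snd z \<in> H" by (auto simp: space_pair_measure space_mu)
    obtain n0 where n0: "\<And>i. i \<in> J (snd z) \<Longrightarrow> to_nat_on I i < n0"
      using finite_nat_bounded[of "to_nat_on I ` J (snd z)"] finite_J[OF h] by auto
    have "wavelet (inv_fourier \<eta>) f z = complex_of_real (\<bar>det (snd z)\<bar> powr (1 / 2)) * (\<Sum>i\<in>S n. ?L z i)" if "n0 \<le> n" for n
    proof -
      have "J (snd z) \<subseteq> S n" using n0 that by (force simp: S_def)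
      from \<Lambda>_split[OF h S(1) this S(2), of "fst z"] wavelet_eq[OF h, of "fst z"] show ?thesis by simp
    qed
    then show "(\<lambda>n. complex_of_real (\<bar>det (snd z)\<bar> powr (1 / 2)) * (\<Sum>i\<in>S n. ?L z i)) \<longlonglongrightarrow> wavelet (inv_fourier \<eta>) f z"
      by (intro tendsto_eventually eventually_sequentiallyI[of n0]) simp
  qed
qed

definition WF :: "real^'d^'d \<Rightarrow> ennreal" where
  "WF h = Lp_norm lborel p (\<lambda>x. ennreal (cmod (of_real (v h) * wavelet (inv_fourier \<eta>) f (x, h))))"

lemma Co_norm_eq: "Co_norm \<mu> (inv_fourier \<eta>) p q (\<lambda>(x, h). v h) f = Lp_norm (density \<mu> (\<lambda>h. ennreal (1 / \<bar>det h\<bar>))) q WF"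
  by (simp add: Co_norm_def Lpq_norm_def WF_def[abs_def])

lemma weighted_wavelet_measurable:
  "(\<lambda>z. ennreal (cmod (of_real (v (snd z)) * wavelet (inv_fourier \<eta>) f z))) \<in> borel_measurable (lborel \<Otimes>\<^sub>M \<mu>)"
proof -
  have "v \<in> borel_measurable \<mu>" by (rule borel_measurable_mu_continuous[OF weight_facts(2)])
  then have [measurable]: "(\<lambda>z. v (snd z)) \<in> borel_measurable ((lborel :: (real^'d) measure) \<Otimes>\<^sub>M \<mu>)"
    by (rule measurable_compose[OF measurable_snd])
  note [measurable] = wavelet_measurable
  show ?thesis by measurable
qed

lemma WF_measurable [measurable]: "WF \<in> borel_measurable \<mu>"
  using Lp_norm_measurable[OF sigma_finite_lborel weighted_wavelet_measurable p] by (simp add: WF_def[abs_def])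

lemma wavelet_section_measurable:
  assumes "h \<in> H"
  shows "(\<lambda>x. wavelet (inv_fourier \<eta>) f (x, h)) \<in> borel_measurable borel"
  using measurable_compose[OF measurable_Pair2'[of h \<mu> lborel] wavelet_measurable] assms by (simp add: space_mu)

text \<open>The piece \<open>T i\<close> is tested on the Schwartz function \<open>fourier\<close>
  of the modulated \<open>a\<close>, whose inverse transform is the modulated \<open>a\<close>
  again. For every representing function this is a convolution with the transform of
  \<open>a\<close>.\<close>

lemma T_bound:
  assumes i: "i \<in> I" and a: "a \<in> test_funs \<Omega>"
  shows "Lp_norm lborel p (\<lambda>x. ennreal (cmod (\<Lambda> (\<lambda>\<xi>. \<phi> i \<xi> * (chi x \<xi> * a \<xi>)))))
     \<le> distr_Lp_norm p (T i) * (\<integral>\<^sup>+x. ennreal (cmod (fourier a x)) \<partial>lborel)"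
proof -
  have ca: "(\<lambda>\<xi>. chi x \<xi> * a \<xi>) \<in> test_funs \<Omega>" for x by (rule test_funs_mult'[OF smooth_fun_chi a])
  have [measurable]: "fourier a \<in> borel_measurable borel" using fourier_integrable[OF a] by auto
  have Lm: "(\<lambda>x. \<Lambda> (\<lambda>\<xi>. \<phi> i \<xi> * (chi x \<xi> * a \<xi>))) \<in> borel_measurable borel"
  proof -
    interpret F: supported_family \<Omega> "fun_supp (\<lambda>\<xi>. \<phi> i \<xi> * a \<xi>)" "\<lambda>x \<xi>. (\<phi> i \<xi> * a \<xi>) * chi x \<xi>"
      by (rule supported_family_chi[OF test_funs_mult(1)[OF \<phi>[OF i] test_funsD(1)[OF a]]])
    have "(\<lambda>x. \<Lambda> (\<lambda>\<xi>. (\<phi> i \<xi> * a \<xi>) * chi x \<xi>)) \<in> borel_measurable borel"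
      by (rule F.distribution_family_measurable[OF \<Lambda>]) simp
    then show ?thesis by (simp add: mult_ac)
  qed
  have main: "Lp_norm lborel p (\<lambda>x. ennreal (cmod (\<Lambda> (\<lambda>\<xi>. \<phi> i \<xi> * (chi x \<xi> * a \<xi>)))))
     \<le> Lp_norm lborel p (\<lambda>x. ennreal (cmod (G x))) * (\<integral>\<^sup>+x. ennreal (cmod (fourier a x)) \<partial>lborel)"
    if G: "G \<in> borel_measurable lborel" "\<forall>\<theta>\<in>schwartz_funs. integrable lborel (\<lambda>x. G x * \<theta> x) \<and> T i \<theta> = (LINT x|lborel. G x * \<theta> x)" for G
  proof -
    have [measurable]: "G \<in> borel_measurable borel" using G(1) by simp
    have "ennreal (cmod (\<Lambda> (\<lambda>\<xi>. \<phi> i \<xi> * (chi x \<xi> * a \<xi>)))) \<le> (\<integral>\<^sup>+y. ennreal (cmod (G y)) * ennreal (cmod (fourier a (y - x))) \<partial>lborel)" for x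
    proof -
      have t: "(\<lambda>\<xi>. \<phi> i \<xi> * (chi x \<xi> * a \<xi>)) \<in> test_funs \<Omega>"
        by (rule test_funs_mult(1)[OF \<phi>[OF i] test_funsD(1)[OF ca]])
      have "\<Lambda> (\<lambda>\<xi>. \<phi> i \<xi> * (chi x \<xi> * a \<xi>)) = T i (fourier (\<lambda>\<xi>. chi x \<xi> * a \<xi>))"
        using T_eq[of i "fourier (\<lambda>\<xi>. chi x \<xi> * a \<xi>)"] t unfolding inv_fourier_fourier[OF ca] by simp
      also have "\<dots> = (LINT y|lborel. G y * fourier (\<lambda>\<xi>. chi x \<xi> * a \<xi>) y)"
        using G(2) schwartz_fourier[OF ca] by blast
      finally have "\<Lambda> (\<lambda>\<xi>. \<phi> i \<xi> * (chi x \<xi> * a \<xi>)) = (LINT y|lborel. G y * fourier a (y - x))"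
        unfolding fourier_modulate .
      then show ?thesis using cmod_integral_le[of lborel "\<lambda>y. G y * fourier a (y - x)"] by (simp add: norm_mult ennreal_mult)
    qed
    then have "Lp_norm lborel p (\<lambda>x. ennreal (cmod (\<Lambda> (\<lambda>\<xi>. \<phi> i \<xi> * (chi x \<xi> * a \<xi>)))))
      \<le> Lp_norm lborel p (\<lambda>x. \<integral>\<^sup>+y. ennreal (cmod (G y)) * ennreal (cmod (fourier a (y - x))) \<partial>lborel)"
      using Lm by (intro Lp_norm_mono[OF p]) auto
    also have "\<dots> \<le> Lp_norm lborel p (\<lambda>x. ennreal (cmod (G x))) * (\<integral>\<^sup>+x. ennreal (cmod (fourier a x)) \<partial>lborel)"
      by (rule Lp_norm_convolution_le[OF p]) measurable
    finally show ?thesis .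
  qed
  let ?A = "\<integral>\<^sup>+x. ennreal (cmod (fourier a x)) \<partial>lborel"
  let ?X = "{Lp_norm lborel p (\<lambda>x. ennreal (cmod (G x))) | G. G \<in> borel_measurable lborel \<and>
       (\<forall>\<theta>\<in>schwartz_funs. integrable lborel (\<lambda>x. G x * \<theta> x) \<and> T i \<theta> = (LINT x|lborel. G x * \<theta> x))}"
  let ?l = "Lp_norm lborel p (\<lambda>x. ennreal (cmod (\<Lambda> (\<lambda>\<xi>. \<phi> i \<xi> * (chi x \<xi> * a \<xi>)))))"
  have fin: "?A < top" using fourier_integrable[OF a] by (simp add: integrable_iff_bounded)
  show ?thesis
  \<comment> \<open>To reach the infimum over representing functions the bound is divided by
    \<open>?A\<close>. If \<open>?A\<close> is 0, the right side is 0 even when the infimum is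
    \<infinity>, so the left side has to vanish; it does, because inversion gives
    \<open>a = 0\<close>.\<close>
  proof (cases "?A = 0")
    case True
    have "ennreal (cmod (\<Lambda> (\<lambda>\<xi>. \<phi> i \<xi> * (chi x \<xi> * a \<xi>)))) = 0" for x
    proof -
      have "AE y in lborel. fourier a y = 0" using True by (subst (asm) nn_integral_0_iff_AE) auto
      then have "inv_fourier (fourier a) \<xi> = 0" for \<xi>
        unfolding inv_fourier_chi by (intro integral_eq_zero_AE) (auto elim: eventually_mono)
      then have "a \<xi> = 0" for \<xi> unfolding inv_fourier_fourier[OF a] .
      then show ?thesis using distribution_cmult[OF \<Lambda> test_funs_0, of 0] by simp
    qed
    then show ?thesis by (simp add: Lp_norm_0[OF p])
  next
    case False
    have "?l / ?A \<le> Inf ?X"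
    proof (rule Inf_greatest)
      fix s assume "s \<in> ?X"
      then have "?l \<le> s * ?A" using main by blast
      then have "?l / ?A \<le> s * ?A / ?A" by (rule divide_right_mono_ennreal)
      also have "\<dots> = s" using False fin by (simp add: ennreal_times_divide[symmetric] ennreal_divide_self)
      finally show "?l / ?A \<le> s" .
    qed
    then have "?l / ?A * ?A \<le> distr_Lp_norm p (T i) * ?A"
      unfolding distr_Lp_norm_def by (intro mult_right_mono) auto
    moreover have "?l / ?A * ?A = ?l" using False fin
      by (simp add: ennreal_divide_times ennreal_divide_self)
    ultimately show ?thesis by simp
  qed
qed

text \<open>The finite splitting over \<open>J h\<close>, with \<open>T_bound\<close> for each
  piece; the L1 norm there is \<open>A\<^sub>\<eta>\<close> for every h.\<close>

lemma WF_le: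
  assumes h: "h \<in> H"
  shows "WF h \<le> ennreal (v h * \<bar>det h\<bar> powr (1 / 2)) * A\<^sub>\<eta> * (\<Sum>i\<in>J h. distr_Lp_norm p (T i))"
proof -
  let ?L = "\<lambda>x i. \<Lambda> (\<lambda>\<xi>. \<phi> i \<xi> * (chi x \<xi> * cnj (\<eta> (transpose h *v \<xi>))))"
  have Lm: "(\<lambda>x. ?L x i) \<in> borel_measurable borel" if "i \<in> J h" for i
    using measurable_compose[OF measurable_Pair2'[of h \<mu> lborel] \<Lambda>_\<phi>\<eta>_measurable[of i]] that h by (simp add: space_mu)
  have "WF h \<le> Lp_norm lborel p (\<lambda>x. ennreal (v h * \<bar>det h\<bar> powr (1 / 2)) * (\<Sum>i\<in>J h. ennreal (cmod (?L x i))))"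
    unfolding WF_def
  proof (rule Lp_norm_mono[OF p])
    show "(\<lambda>x. ennreal (cmod (of_real (v h) * wavelet (inv_fourier \<eta>) f (x, h)))) \<in> borel_measurable lborel"
      using wavelet_section_measurable[OF h] by measurable
    fix x
    have "cmod (\<Sum>i\<in>J h. ?L x i) \<le> (\<Sum>i\<in>J h. cmod (?L x i))" by (rule norm_sum)
    then have "cmod (of_real (v h) * wavelet (inv_fourier \<eta>) f (x, h)) \<le> (v h * \<bar>det h\<bar> powr (1 / 2)) * (\<Sum>i\<in>J h. cmod (?L x i))"
      unfolding wavelet_eq[OF h] \<Lambda>_split[OF h finite_J[OF h] order_refl, simplified]
      using weight_facts(1)[OF h] by (simp add: norm_mult mult.assoc mult_left_mono)
    then show "ennreal (cmod (of_real (v h) * wavelet (inv_fourier \<eta>) f (x, h))) \<le> ennreal (v h * \<bar>det h\<bar> powr (1 / 2)) * (\<Sum>i\<in>J h. ennreal (cmod (?L x i)))"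
      using weight_facts(1)[OF h] by (simp add: sum_ennreal ennreal_mult[symmetric] sum_nonneg ennreal_leI)
  qed
  also have "\<dots> = ennreal (v h * \<bar>det h\<bar> powr (1 / 2)) * Lp_norm lborel p (\<lambda>x. \<Sum>i\<in>J h. ennreal (cmod (?L x i)))"
    using Lm by (intro Lp_norm_cmult[OF p] borel_measurable_sum) auto
  also have "\<dots> \<le> ennreal (v h * \<bar>det h\<bar> powr (1 / 2)) * (\<Sum>i\<in>J h. Lp_norm lborel p (\<lambda>x. ennreal (cmod (?L x i))))"
    using Lm by (intro mult_left_mono Lp_norm_sum[OF sigma_finite_lborel p]) auto
  also have "\<dots> \<le> ennreal (v h * \<bar>det h\<bar> powr (1 / 2)) * (\<Sum>i\<in>J h. distr_Lp_norm p (T i) * A\<^sub>\<eta>)"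
    using T_bound[OF _ \<eta>_cnj_dilated[OF h]] by (intro mult_left_mono sum_mono) (auto simp: fourier_\<eta>_L1[OF h])
  finally show ?thesis by (simp add: sum_distrib_left mult_ac)
qed

end

section \<open>Passing from functions on the group to sequences and back\<close>

abbreviation \<sigma> :: real where
  "\<sigma> \<equiv> enn2real (1 / q)"

abbreviation haar_det :: "(real^'d^'d) measure" where
  "haar_det \<equiv> density \<mu> (\<lambda>h. ennreal (1 / \<bar>det h\<bar>))"

lemma det_measurable [measurable]: "(\<lambda>h. det h) \<in> borel_measurable \<mu>"
  by (intro borel_measurable_mu borel_measurable_continuous_onI continuous_intros)

lemma \<sigma>_eq: "q = ennreal r \<Longrightarrow> 1 \<le> r \<Longrightarrow> \<sigma> = 1 / r"
  by (simp add: divide_ennreal flip: ennreal_1)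

lemma nn_integral_J:
  assumes "h \<in> H"
  shows "(\<integral>\<^sup>+i. a i * indicator (E i) h \<partial>count_space I) = (\<Sum>i\<in>J h. a i)"
proof -
  have "(\<integral>\<^sup>+i. a i * indicator (E i) h \<partial>count_space I) = (\<Sum>i\<in>J h. a i * indicator (E i) h)"
    by (rule nn_integral_count_space'[OF finite_J[OF assms]]) (auto simp: indicator_def)
  also have "\<dots> = (\<Sum>i\<in>J h. a i)" by (intro sum.cong) auto
  finally show ?thesis .
qed

text \<open>Jensen for at most N summands costs N^(r-1), and integrating over h gives each index the
  measure m of its set \<open>E i\<close>; hence the constant N^(r-1) m before the root. The power
  of the determinant cancels the density of \<open>haar_det\<close>.\<close>

lemma outer_norm_le:
  obtains B where "0 \<le> B"
    "\<And>F a. F \<in> borel_measurable \<mu> \<Longrightarrow> (\<And>h. h \<in> H \<Longrightarrow> F h \<le> ennreal (\<bar>det h\<bar> powr \<sigma>) * (\<Sum>i\<in>J h. a i)) \<Longrightarrow>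
      Lp_norm haar_det q F \<le> ennreal B * Lp_norm (count_space I) q a"
proof -
  obtain N where N: "\<And>h. h \<in> H \<Longrightarrow> finite (J h)" "\<And>h. h \<in> H \<Longrightarrow> card (J h) \<le> N" by (rule overlap) blast
  define m where "m = measure \<mu> (return K)"
  show ?thesis
    using q
  proof (cases rule: exponent_cases)
    case 1
    have "Lp_norm haar_det q F \<le> ennreal (real N) * Lp_norm (count_space I) q a"
      if F[measurable]: "F \<in> borel_measurable \<mu>" and le: "\<And>h. h \<in> H \<Longrightarrow> F h \<le> ennreal (\<bar>det h\<bar> powr \<sigma>) * (\<Sum>i\<in>J h. a i)" for F a
    proof -
      let ?S = "Lp_norm (count_space I) q a"
      have "F h \<le> ennreal (real N) * ?S" if h: "h \<in> H" for h
      proof -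
        \<comment> \<open>Here \<sigma> is 0, and the power with exponent 0 is 1 because the
          determinant is nonzero.\<close>
        have "F h \<le> (\<Sum>i\<in>J h. a i)" using le[OF h] group_det[OF h] 1 by simp
        also have "\<dots> \<le> (\<Sum>i\<in>J h. ?S)" by (intro sum_mono Lp_norm_count_space_ge[OF q]) simp
        also have "\<dots> = of_nat (card (J h)) * ?S" by simp
        also have "\<dots> \<le> of_nat N * ?S" using N(2)[OF h] by (intro mult_right_mono) auto
        finally show ?thesis by (simp add: ennreal_of_nat_eq_real_of_nat)
      qed
      then have "esssup haar_det F \<le> ennreal (real N) * ?S"
        by (intro esssup_I AE_I2) (auto simp: space_mu)
      then show ?thesis by (simp add: 1 Lp_norm_top)
    qed
    then show ?thesis using that[of "real N"] by simp
  next
    case (2 r)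
    define c where "c = real N powr (r - 1) * m"
    have c: "0 \<le> c" by (simp add: c_def m_def)
    have s: "\<sigma> = 1 / r" by (rule \<sigma>_eq[OF 2])
    have "Lp_norm haar_det q F \<le> ennreal (c powr (1 / r)) * Lp_norm (count_space I) q a"
      if F[measurable]: "F \<in> borel_measurable \<mu>" and le: "\<And>h. h \<in> H \<Longrightarrow> F h \<le> ennreal (\<bar>det h\<bar> powr \<sigma>) * (\<Sum>i\<in>J h. a i)" for F a
    proof -
      have pt: "ennreal (1 / \<bar>det h\<bar>) * ennreal_powr (F h) r \<le> ennreal (real N powr (r - 1)) * (\<Sum>i\<in>J h. ennreal_powr (a i) r)"
        if h: "h \<in> H" for h
      proof -
        have "ennreal_powr (F h) r \<le> ennreal_powr (ennreal (\<bar>det h\<bar> powr \<sigma>) * (\<Sum>i\<in>J h. a i)) r"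
          using le[OF h] 2 by (intro ennreal_powr_mono) auto
        also have "\<dots> = ennreal \<bar>det h\<bar> * ennreal_powr (\<Sum>i\<in>J h. a i) r"
          using 2(2) by (subst ennreal_powr_mult) (auto simp: s powr_powr)
        finally have "ennreal (1 / \<bar>det h\<bar>) * ennreal_powr (F h) r
            \<le> ennreal (1 / \<bar>det h\<bar>) * (ennreal \<bar>det h\<bar> * ennreal_powr (\<Sum>i\<in>J h. a i) r)"
          by (rule mult_left_mono) simp
        also have "\<dots> = ennreal_powr (\<Sum>i\<in>J h. a i) r"
          using group_det[OF h] by (simp flip: mult.assoc ennreal_mult)
        also have "\<dots> = ennreal_powr (\<integral>\<^sup>+i. a i \<partial>count_space (J h)) r"
          by (simp add: nn_integral_count_space_finite N(1)[OF h])
        also have "\<dots> \<le> ennreal (measure (count_space (J h)) (space (count_space (J h))) powr (r - 1)) * (\<integral>\<^sup>+i. ennreal_powr (a i) r \<partial>count_space (J h))"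
          using N(1)[OF h] 2 by (intro nn_integral_powr_le) (auto simp: emeasure_count_space of_nat_less_top)
        also have "\<dots> = ennreal (real (card (J h)) powr (r - 1)) * (\<Sum>i\<in>J h. ennreal_powr (a i) r)"
          by (simp add: nn_integral_count_space_finite N(1)[OF h] measure_count_space)
        also have "\<dots> \<le> ennreal (real N powr (r - 1)) * (\<Sum>i\<in>J h. ennreal_powr (a i) r)"
          using N(2)[OF h] 2 by (intro mult_right_mono ennreal_leI powr_mono2) auto
        finally show ?thesis .
      qed
      have "(\<integral>\<^sup>+h. ennreal_powr (F h) r \<partial>haar_det) = (\<integral>\<^sup>+h. ennreal (1 / \<bar>det h\<bar>) * ennreal_powr (F h) r \<partial>\<mu>)"
        by (rule nn_integral_density) measurable
      also have "\<dots> \<le> (\<integral>\<^sup>+h. (\<integral>\<^sup>+i. ennreal (real N powr (r - 1)) * ennreal_powr (a i) r * indicator (E i) h \<partial>count_space I) \<partial>\<mu>)"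
        using pt by (intro nn_integral_mono) (simp add: space_mu nn_integral_J sum_distrib_left)
      also have "\<dots> = (\<integral>\<^sup>+i. (\<integral>\<^sup>+h. ennreal (real N powr (r - 1)) * ennreal_powr (a i) r * indicator (E i) h \<partial>\<mu>) \<partial>count_space I)"
        using E_facts(3) by (intro nn_integral_count_space_nn_integral countable_I) auto
      also have "\<dots> = (\<integral>\<^sup>+i. ennreal c * ennreal_powr (a i) r \<partial>count_space I)"
        using E_facts(3,4) by (intro nn_integral_cong, subst nn_integral_cmult_indicator)
          (simp_all add: m_def c_def ennreal_mult mult_ac)
      also have "\<dots> = ennreal c * (\<integral>\<^sup>+i. ennreal_powr (a i) r \<partial>count_space I)"
        by (rule nn_integral_cmult) simp
      also have "\<dots> = ennreal_powr (ennreal (c powr (1 / r)) * Lp_norm (count_space I) (ennreal r) a) r"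
        using 2 c by (simp add: ennreal_powr_mult Lp_norm_powr powr_powr)
      finally show ?thesis unfolding 2(1) Lp_norm_le_iff[OF 2(2)] .
    qed
    then show ?thesis using that[of "c powr (1 / r)"] by simp
  qed
qed

text \<open>The roles are reversed: Jensen on \<open>E i\<close>, of mass m, costs m^(r-1), and
  summation over i counts each h at most N times, which gives m^(r-1) N before the root.\<close>

lemma outer_norm_ge:
  obtains B where "0 \<le> B"
    "\<And>F a. F \<in> borel_measurable \<mu> \<Longrightarrow> (\<And>i. i \<in> I \<Longrightarrow> a i \<le> (\<integral>\<^sup>+h. indicator (E i) h * (ennreal (\<bar>det h\<bar> powr (- \<sigma>)) * F h) \<partial>\<mu>)) \<Longrightarrow>
      Lp_norm (count_space I) q a \<le> ennreal B * Lp_norm haar_det q F"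
proof -
  obtain N where N: "\<And>h. h \<in> H \<Longrightarrow> finite (J h)" "\<And>h. h \<in> H \<Longrightarrow> card (J h) \<le> N" by (rule overlap) blast
  define m where "m = measure \<mu> (return K)"
  have m: "0 \<le> m" by (simp add: m_def)
  show ?thesis
    using q
  proof (cases rule: exponent_cases)
    case 1
    have "Lp_norm (count_space I) q a \<le> ennreal m * Lp_norm haar_det q F"
      if F[measurable]: "F \<in> borel_measurable \<mu>" and le: "\<And>i. i \<in> I \<Longrightarrow> a i \<le> (\<integral>\<^sup>+h. indicator (E i) h * (ennreal (\<bar>det h\<bar> powr (- \<sigma>)) * F h) \<partial>\<mu>)" for F a
    proof -
      let ?S = "esssup haar_det F"
      have "AE h in haar_det. F h \<le> ?S" by (rule esssup_AE)
      then have "AE h in \<mu>. 0 < ennreal (1 / \<bar>det h\<bar>) \<longrightarrow> F h \<le> ?S"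
        by (subst (asm) AE_density) auto
      then have AE: "AE h in \<mu>. F h \<le> ?S"
        by (rule AE_mp) (rule AE_I2, simp add: space_mu group_det)
      have "a i \<le> ennreal m * ?S" if i: "i \<in> I" for i
      proof -
        have "a i \<le> (\<integral>\<^sup>+h. indicator (E i) h * (ennreal (\<bar>det h\<bar> powr (- \<sigma>)) * F h) \<partial>\<mu>)" by (rule le[OF i])
        also have "\<dots> \<le> (\<integral>\<^sup>+h. ?S * indicator (E i) h \<partial>\<mu>)"
          using AE by (intro nn_integral_mono_AE, elim AE_mp, intro AE_I2)
            (auto simp: space_mu group_det 1 indicator_def)
        also have "\<dots> = ennreal m * ?S"
          using E_facts(3,4)[OF i] by (subst nn_integral_cmult_indicator) (simp_all add: m_def mult.commute)
        finally show ?thesis .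
      qed
      then have "esssup (count_space I) a \<le> ennreal m * ?S"
        by (intro esssup_I AE_I2) auto
      then show ?thesis by (simp add: 1 Lp_norm_top)
    qed
    then show ?thesis using that[of m] m by simp
  next
    case (2 r)
    define c where "c = m powr (r - 1) * real N"
    have c: "0 \<le> c" by (simp add: c_def m_def)
    have s: "\<sigma> = 1 / r" by (rule \<sigma>_eq[OF 2])
    have "Lp_norm (count_space I) q a \<le> ennreal (c powr (1 / r)) * Lp_norm haar_det q F"
      if F[measurable]: "F \<in> borel_measurable \<mu>" and le: "\<And>i. i \<in> I \<Longrightarrow> a i \<le> (\<integral>\<^sup>+h. indicator (E i) h * (ennreal (\<bar>det h\<bar> powr (- \<sigma>)) * F h) \<partial>\<mu>)" for F a
    proof -
      let ?G = "\<lambda>h. ennreal (1 / \<bar>det h\<bar>) * ennreal_powr (F h) r"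
      have pt: "ennreal_powr (a i) r \<le> ennreal (m powr (r - 1)) * (\<integral>\<^sup>+h. ?G h * indicator (E i) h \<partial>\<mu>)" if i: "i \<in> I" for i
      proof -
        let ?M = "density \<mu> (indicator (E i))"
        note [measurable] = E_facts(3)[OF i]
        have M: "emeasure ?M (space ?M) = ennreal m"
          using E_facts(3,4)[OF i] by (simp add: emeasure_density m_def sets.Int_space_eq2 nn_integral_indicator flip: indicator_inter_arith)
        have "ennreal_powr (a i) r \<le> ennreal_powr (\<integral>\<^sup>+h. indicator (E i) h * (ennreal (\<bar>det h\<bar> powr (- \<sigma>)) * F h) \<partial>\<mu>) r"
          using le[OF i] 2 by (intro ennreal_powr_mono) auto
        also have "(\<integral>\<^sup>+h. indicator (E i) h * (ennreal (\<bar>det h\<bar> powr (- \<sigma>)) * F h) \<partial>\<mu>) = (\<integral>\<^sup>+h. ennreal (\<bar>det h\<bar> powr (- \<sigma>)) * F h \<partial>?M)"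
          by (subst nn_integral_density) auto
        also have "ennreal_powr \<dots> r \<le> ennreal (measure ?M (space ?M) powr (r - 1)) * (\<integral>\<^sup>+h. ennreal_powr (ennreal (\<bar>det h\<bar> powr (- \<sigma>)) * F h) r \<partial>?M)"
          using M 2 by (intro nn_integral_powr_le) auto
        also have "measure ?M (space ?M) = m" using M m by (simp add: measure_def)
        also have "(\<integral>\<^sup>+h. ennreal_powr (ennreal (\<bar>det h\<bar> powr (- \<sigma>)) * F h) r \<partial>?M)
            = (\<integral>\<^sup>+h. indicator (E i) h * ennreal_powr (ennreal (\<bar>det h\<bar> powr (- \<sigma>)) * F h) r \<partial>\<mu>)"
          by (rule nn_integral_density) measurable
        also have "\<dots> = (\<integral>\<^sup>+h. ?G h * indicator (E i) h \<partial>\<mu>)"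
        proof (rule nn_integral_cong)
          fix h :: "real^'d^'d"
          have e: "\<sigma> * r = 1" unfolding s using 2(2) by simp
          have "(\<bar>det h\<bar> powr (- \<sigma>)) powr r = 1 / \<bar>det h\<bar>"
            unfolding powr_powr mult_minus_left e by (simp add: powr_minus_divide)
          then show "indicator (E i) h * ennreal_powr (ennreal (\<bar>det h\<bar> powr (- \<sigma>)) * F h) r = ?G h * indicator (E i) h"
            using 2 by (simp add: ennreal_powr_mult mult.commute)
        qed
        finally show ?thesis .
      qed
      have "(\<integral>\<^sup>+i. ennreal_powr (a i) r \<partial>count_space I) \<le> (\<integral>\<^sup>+i. ennreal (m powr (r - 1)) * (\<integral>\<^sup>+h. ?G h * indicator (E i) h \<partial>\<mu>) \<partial>count_space I)"
        using pt by (intro nn_integral_mono) simp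
      also have "\<dots> = ennreal (m powr (r - 1)) * (\<integral>\<^sup>+i. (\<integral>\<^sup>+h. ?G h * indicator (E i) h \<partial>\<mu>) \<partial>count_space I)"
        by (rule nn_integral_cmult) simp
      also have "(\<integral>\<^sup>+i. (\<integral>\<^sup>+h. ?G h * indicator (E i) h \<partial>\<mu>) \<partial>count_space I) = (\<integral>\<^sup>+h. (\<integral>\<^sup>+i. ?G h * indicator (E i) h \<partial>count_space I) \<partial>\<mu>)"
        using E_facts(3) by (intro nn_integral_count_space_nn_integral[symmetric] countable_I) auto
      also have "\<dots> \<le> (\<integral>\<^sup>+h. of_nat N * ?G h \<partial>\<mu>)"
      proof (rule nn_integral_mono)
        fix h assume h: "h \<in> space \<mu>"
        have "(\<integral>\<^sup>+i. ?G h * indicator (E i) h \<partial>count_space I) = of_nat (card (J h)) * ?G h"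
          using nn_integral_J[of h "\<lambda>i. ?G h"] h by (simp add: space_mu)
        also have "\<dots> \<le> of_nat N * ?G h" using N(2)[of h] h by (intro mult_right_mono) (auto simp: space_mu)
        finally show "(\<integral>\<^sup>+i. ?G h * indicator (E i) h \<partial>count_space I) \<le> of_nat N * ?G h" .
      qed
      also have "\<dots> = of_nat N * (\<integral>\<^sup>+h. ?G h \<partial>\<mu>)" by (rule nn_integral_cmult) measurable
      also have "(\<integral>\<^sup>+h. ?G h \<partial>\<mu>) = (\<integral>\<^sup>+h. ennreal_powr (F h) r \<partial>haar_det)"
        by (rule nn_integral_density[symmetric]) measurable
      finally have "(\<integral>\<^sup>+i. ennreal_powr (a i) r \<partial>count_space I) \<le> ennreal c * (\<integral>\<^sup>+h. ennreal_powr (F h) r \<partial>haar_det)"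
        by (simp add: c_def m_def ennreal_mult mult.assoc ennreal_of_nat_eq_real_of_nat mult_left_mono)
      also have "\<dots> = ennreal_powr (ennreal (c powr (1 / r)) * Lp_norm haar_det (ennreal r) F) r"
        using 2 c by (simp add: ennreal_powr_mult Lp_norm_powr powr_powr)
      finally show ?thesis unfolding 2(1) Lp_norm_le_iff[OF 2(2)] .
    qed
    then show ?thesis using that[of "c powr (1 / r)"] by simp
  qed
qed

section \<open>The two norm estimates\<close>

lemma weight_factor: "h \<in> H \<Longrightarrow> v h * \<bar>det h\<bar> powr (1 / 2) = \<nu> h * \<bar>det h\<bar> powr \<sigma>"
  using group_det[of h] by (simp add: \<nu>_def powr_diff)

text \<open>The constant collects the outer comparison \<open>B\<close>, the weight comparison
  \<open>c\<close> on \<open>E i\<close>, and the L1 norm \<open>A\<close> of the wavelet.\<close>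

lemma Co_norm_le:
  obtains B where "0 \<le> B" "\<And>f. f \<in> S_antidual \<Omega> \<Longrightarrow>
    Co_norm \<mu> (inv_fourier \<eta>) p q (\<lambda>(x, h). v h) f \<le> ennreal B * dec_norm I \<phi> p q w (Gamma_map \<Omega> f)"
proof -
  obtain B where B: "0 \<le> B" "\<And>F a. F \<in> borel_measurable \<mu> \<Longrightarrow> (\<And>h. h \<in> H \<Longrightarrow> F h \<le> ennreal (\<bar>det h\<bar> powr \<sigma>) * (\<Sum>i\<in>J h. a i)) \<Longrightarrow>
      Lp_norm haar_det q F \<le> ennreal B * Lp_norm (count_space I) q a"
    by (rule outer_norm_le) blast
  obtain c where c: "0 < c" "\<And>i. i \<in> I \<Longrightarrow> 0 < w i"
    "\<And>i h. i \<in> I \<Longrightarrow> h \<in> E i \<Longrightarrow> \<nu> h \<le> c * w i \<and> w i \<le> c * \<nu> h"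
    by (rule weight_discretization) blast
  obtain A where A: "0 \<le> A" "A\<^sub>\<eta> = ennreal A" using A\<^sub>\<eta>_finite by (cases "A\<^sub>\<eta>") auto
  have "Co_norm \<mu> (inv_fourier \<eta>) p q (\<lambda>(x, h). v h) f \<le> ennreal (B * (c * A)) * dec_norm I \<phi> p q w (Gamma_map \<Omega> f)"
    if f: "f \<in> S_antidual \<Omega>" for f
  proof -
    let ?a = "\<lambda>i. ennreal (w i) * distr_Lp_norm p (T f i)"
    have "WF f h \<le> ennreal (\<bar>det h\<bar> powr \<sigma>) * (\<Sum>i\<in>J h. ennreal (c * A) * ?a i)" if h: "h \<in> H" for h
    proof -
      have "WF f h \<le> ennreal (v h * \<bar>det h\<bar> powr (1 / 2)) * A\<^sub>\<eta> * (\<Sum>i\<in>J h. distr_Lp_norm p (T f i))"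
        by (rule WF_le[OF f h])
      also have "\<dots> = ennreal (\<bar>det h\<bar> powr \<sigma>) * (\<Sum>i\<in>J h. ennreal A * (ennreal (\<nu> h) * distr_Lp_norm p (T f i)))"
        unfolding weight_factor[OF h] A(2) using \<nu>_pos[OF h] by (simp add: ennreal_mult sum_distrib_left mult_ac)
      also have "\<dots> \<le> ennreal (\<bar>det h\<bar> powr \<sigma>) * (\<Sum>i\<in>J h. ennreal A * (ennreal (c * w i) * distr_Lp_norm p (T f i)))"
        using c(3) by (intro mult_left_mono sum_mono mult_right_mono ennreal_leI) auto
      also have "\<dots> = ennreal (\<bar>det h\<bar> powr \<sigma>) * (\<Sum>i\<in>J h. ennreal (c * A) * ?a i)"
      proof (rule arg_cong[where f = "\<lambda>z. ennreal (\<bar>det h\<bar> powr \<sigma>) * z"], rule sum.cong[OF refl])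
        fix i assume "i \<in> J h"
        then have "0 \<le> w i" using less_imp_le[OF c(2)] by simp
        then show "ennreal A * (ennreal (c * w i) * distr_Lp_norm p (T f i)) = ennreal (c * A) * ?a i"
          using c(1) A(1) by (simp add: ennreal_mult mult_ac)
      qed
      finally show ?thesis .
    qed
    from B(2)[OF WF_measurable[OF f] this]
    have "Lp_norm haar_det q (WF f) \<le> ennreal B * Lp_norm (count_space I) q (\<lambda>i. ennreal (c * A) * ?a i)" .
    also have "Lp_norm (count_space I) q (\<lambda>i. ennreal (c * A) * ?a i) = ennreal (c * A) * Lp_norm (count_space I) q ?a"
      by (rule Lp_norm_cmult[OF q]) auto
    finally show ?thesis
      unfolding Co_norm_eq[OF f] dec_norm_def using B(1) c(1) A(1) by (simp add: ennreal_mult mult.assoc)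
  qed
  then show ?thesis using that[of "B * (c * A)"] B(1) c(1) A(1) by simp
qed

text \<open>The Calderon identity is stated for a compact set containing the supports involved, so
  \<open>K\<close> is enlarged by the support of \<open>\<phi> i\<close>. Wherever the integrand is
  nonzero, h lies both in \<open>return K'\<close> and in \<open>E i\<close>, so the two cut-offs
  agree.\<close>

lemma Calderon_\<phi>:
  assumes i: "i \<in> I"
  shows "(LINT h|\<mu>. indicator (E i) h * (\<phi> i \<xi> * (chi x \<xi> * (\<eta> (transpose h *v \<xi>) * cnj (\<eta> (transpose h *v \<xi>)))))) = \<phi> i \<xi> * chi x \<xi>"
proof (cases "\<phi> i \<xi> = 0")
  case False
  define K' where "K' = K \<union> fun_supp (\<phi> i)"
  have K': "compact K'" "K' \<subseteq> \<Omega>" "fun_supp \<eta> \<subseteq> K'" "fun_supp (\<phi> i) \<subseteq> K'"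
    using K test_funsD[OF \<phi>[OF i]] by (auto simp: K'_def K_def intro!: compact_Un)
  have \<xi>: "\<xi> \<in> K'" using False test_fun_supp[OF \<phi>[OF i]] by (auto simp: K'_def)
  have "indicator (E i) h * (\<phi> i \<xi> * (chi x \<xi> * (\<eta> (transpose h *v \<xi>) * cnj (\<eta> (transpose h *v \<xi>)))))
    = \<phi> i \<xi> * chi x \<xi> * (indicator (return K') h * (\<eta> (transpose h *v \<xi>) * cnj (\<eta> (transpose h *v \<xi>))))" if h: "h \<in> H" for h
  proof (cases "\<eta> (transpose h *v \<xi>) = 0")
    case nz: False
    have "h \<in> E i" by (rule in_E[OF i h \<phi>_support[OF i False] \<eta>_support[OF nz]])
    moreover have "h \<in> return K'" by (rule Calderon_support[OF \<eta> h \<xi> K'(3) nz])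
    ultimately show ?thesis by simp
  qed simp
  then have "(LINT h|\<mu>. indicator (E i) h * (\<phi> i \<xi> * (chi x \<xi> * (\<eta> (transpose h *v \<xi>) * cnj (\<eta> (transpose h *v \<xi>))))))
    = (LINT h|\<mu>. \<phi> i \<xi> * chi x \<xi> * (indicator (return K') h * (\<eta> (transpose h *v \<xi>) * cnj (\<eta> (transpose h *v \<xi>)))))"
    by (intro Bochner_Integration.integral_cong refl) (simp add: space_mu)
  also have "\<dots> = \<phi> i \<xi> * chi x \<xi>"
    unfolding integral_mult_right_zero Calderon[OF \<eta> \<psi> \<phi>[OF i] K' False] by simp
  finally show ?thesis .
qed simp

context
  fixes f :: "(real^'d \<Rightarrow> complex) \<Rightarrow> complex"
  assumes f: "f \<in> S_antidual \<Omega>"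
begin

text \<open>The function on the right represents \<open>T f i\<close> on all Schwartz functions,
  hence is a competitor in the infimum.\<close>

lemma distr_Lp_norm_T_le:
  assumes i: "i \<in> I"
  shows "distr_Lp_norm p (T f i) \<le> Lp_norm lborel p (\<lambda>x. ennreal (cmod (antidual_hat f (\<lambda>\<xi>. \<phi> i \<xi> * chi x \<xi>))))"
proof -
  let ?g = "\<lambda>x. antidual_hat f (\<lambda>\<xi>. \<phi> i \<xi> * chi x \<xi>)"
  interpret F: supported_family \<Omega> "fun_supp (\<phi> i)" "\<lambda>x \<xi>. \<phi> i \<xi> * chi x \<xi>" by (rule supported_family_chi[OF \<phi>[OF i]])
  have "?g \<in> borel_measurable lborel" by (rule F.distribution_family_measurable[OF \<Lambda>[OF f]]) simp
  moreover have "integrable lborel (\<lambda>x. ?g x * \<theta> x) \<and> T f i \<theta> = (LINT x|lborel. ?g x * \<theta> x)" if "\<theta> \<in> schwartz_funs" for \<theta>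
  proof -
    note * = distribution_mult_inv_fourier[OF \<Lambda>[OF f] \<phi>[OF i] schwartz_rapidly_decreasing[OF that]]
    show ?thesis using *(2,3) T_eq[OF f *(1)] by simp
  qed
  ultimately show ?thesis unfolding distr_Lp_norm_def by (intro Inf_lower CollectI exI[of _ ?g]) auto
qed

text \<open>\<open>\<Lambda>\<close> is exchanged with the integral in
  \<open>Calderon_\<phi>\<close>. Compactness of \<open>E i\<close> makes all moments of its
  indicator finite, as the exchange requires.\<close>

lemma reproducing:
  assumes i: "i \<in> I"
  shows "antidual_hat f (\<lambda>\<xi>. \<phi> i \<xi> * chi x \<xi>)
    = (LINT h|\<mu>. indicator (E i) h * antidual_hat f (\<lambda>\<xi>. \<phi> i \<xi> * (chi x \<xi> * (\<eta> (transpose h *v \<xi>) * cnj (\<eta> (transpose h *v \<xi>))))))"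
proof -
  interpret F: supported_family \<Omega> "fun_supp (\<phi> i)" "\<lambda>(z :: (real^'d) \<times> (real^'d^'d)) \<xi>. \<phi> i \<xi> * (chi (fst z) \<xi> * (\<eta> (transpose (snd z) *v \<xi>) * cnj (\<eta> (transpose (snd z) *v \<xi>))))"
    by (rule supported_family_Calderon[OF \<eta> \<phi>[OF i]])
  have X: "(\<lambda>h. (x, h)) \<in> borel_measurable \<mu>"
    by (intro borel_measurable_mu borel_measurable_continuous_onI continuous_intros)
  have c: "(indicator (E i) :: _ \<Rightarrow> complex) \<in> borel_measurable \<mu>" using E_facts(3)[OF i] by simp
  from F.distribution_integral(1)[OF \<Lambda>[OF f] X c integrable_indicator_growth[OF E_facts(1,2)[OF i]]]
  show ?thesis unfolding fst_conv snd_conv Calderon_\<phi>[OF i] .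
qed

lemma Calderon_family_measurable:
  assumes i: "i \<in> I"
  shows "(\<lambda>z. antidual_hat f (\<lambda>\<xi>. \<phi> i \<xi> * (chi (fst z) \<xi> * (\<eta> (transpose (snd z) *v \<xi>) * cnj (\<eta> (transpose (snd z) *v \<xi>)))))) \<in> borel_measurable (lborel \<Otimes>\<^sub>M \<mu>)"
proof -
  interpret F: supported_family \<Omega> "fun_supp (\<phi> i)" "\<lambda>(z :: (real^'d) \<times> (real^'d^'d)) \<xi>. \<phi> i \<xi> * (chi (fst z) \<xi> * (\<eta> (transpose (snd z) *v \<xi>) * cnj (\<eta> (transpose (snd z) *v \<xi>))))"
    by (rule supported_family_Calderon[OF \<eta> \<phi>[OF i]])
  show ?thesis by (rule F.distribution_family_measurable[OF \<Lambda>[OF f] pair_measurable_mu])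
qed

text \<open>The factors are regrouped: the conjugated wavelet stays with \<open>\<Lambda>\<close>,
  which gives the wavelet transform at h up to a scalar, and its product with the test function
  \<open>\<phi> i\<close> times the dilated wavelet is a convolution. The kernel has L1 norm at most
  the product of those of \<open>\<phi> i\<close> and the wavelet.\<close>

lemma localized_norm_le:
  assumes i: "i \<in> I" and h: "h \<in> H"
  shows "Lp_norm lborel p (\<lambda>x. ennreal (cmod (antidual_hat f (\<lambda>\<xi>. \<phi> i \<xi> * (chi x \<xi> * (\<eta> (transpose h *v \<xi>) * cnj (\<eta> (transpose h *v \<xi>))))))))
    \<le> ennreal (1 / (v h * \<bar>det h\<bar> powr (1 / 2))) * WF f h * ((\<integral>\<^sup>+x. ennreal (cmod (inv_fourier (\<phi> i) x)) \<partial>lborel) * A\<^sub>\<eta>)"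
proof -
  let ?a = "\<lambda>\<xi>. cnj (\<eta> (transpose h *v \<xi>))" and ?e = "\<lambda>\<xi>. \<eta> (transpose h *v \<xi>)"
  let ?b = "\<lambda>\<xi>. \<phi> i \<xi> * ?e \<xi>"
  let ?c = "ennreal (1 / (v h * \<bar>det h\<bar> powr (1 / 2)))"
  let ?W = "\<lambda>x. ennreal (cmod (of_real (v h) * wavelet (inv_fourier \<eta>) f (x, h)))"
  have a: "?a \<in> test_funs \<Omega>" and e: "?e \<in> test_funs \<Omega>" using \<eta>_cnj_dilated[OF h] dilated_test_funs[OF h \<eta>] by auto
  have b: "?b \<in> test_funs \<Omega>" by (rule test_funs_mult(1)[OF \<phi>[OF i] test_funsD(1)[OF e]])
  have [measurable]: "fourier ?b \<in> borel_measurable borel" using fourier_integrable[OF b] by auto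
  have Wm[measurable]: "?W \<in> borel_measurable borel" using wavelet_section_measurable[OF f h] by measurable
  have pos: "0 < v h * \<bar>det h\<bar> powr (1 / 2)" using weight_facts(1)[OF h] group_det[OF h] by simp
  have A: "ennreal (cmod (antidual_hat f (\<lambda>\<xi>. ?a \<xi> * chi y \<xi>))) = ?c * ?W y" for y
  proof -
    have "cmod (of_real (v h) * wavelet (inv_fourier \<eta>) f (y, h)) = (v h * \<bar>det h\<bar> powr (1 / 2)) * cmod (antidual_hat f (\<lambda>\<xi>. ?a \<xi> * chi y \<xi>))"
      unfolding wavelet_eq[OF f h] using weight_facts(1)[OF h] by (simp add: norm_mult)
    then have "cmod (antidual_hat f (\<lambda>\<xi>. ?a \<xi> * chi y \<xi>)) = 1 / (v h * \<bar>det h\<bar> powr (1 / 2)) * cmod (of_real (v h) * wavelet (inv_fourier \<eta>) f (y, h))"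
      using weight_facts(1)[OF h] group_det[OF h] by auto
    then show ?thesis using pos by (simp only: ennreal_mult[symmetric] less_imp_le zero_le_divide_1_iff norm_ge_zero)
  qed
  have "ennreal (cmod (antidual_hat f (\<lambda>\<xi>. \<phi> i \<xi> * (chi x \<xi> * (?e \<xi> * ?a \<xi>))))) \<le> (\<integral>\<^sup>+y. ?c * ?W y * ennreal (cmod (fourier ?b (y - x))) \<partial>lborel)" for x
  proof -
    have cb: "(\<lambda>\<xi>. chi x \<xi> * ?b \<xi>) \<in> test_funs \<Omega>" by (rule test_funs_mult'[OF smooth_fun_chi b])
    from distribution_mult_inv_fourier(2)[OF \<Lambda>[OF f] a schwartz_rapidly_decreasing[OF schwartz_fourier[OF cb]]]
    have "antidual_hat f (\<lambda>\<xi>. ?a \<xi> * (chi x \<xi> * ?b \<xi>)) = (LINT y|lborel. antidual_hat f (\<lambda>\<xi>. ?a \<xi> * chi y \<xi>) * fourier ?b (y - x))"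
      unfolding inv_fourier_fourier[OF cb] fourier_modulate .
    moreover have "(\<lambda>\<xi>. ?a \<xi> * (chi x \<xi> * ?b \<xi>)) = (\<lambda>\<xi>. \<phi> i \<xi> * (chi x \<xi> * (?e \<xi> * ?a \<xi>)))" by (simp add: mult_ac)
    ultimately show ?thesis
      using cmod_integral_le[of lborel "\<lambda>y. antidual_hat f (\<lambda>\<xi>. ?a \<xi> * chi y \<xi>) * fourier ?b (y - x)"]
      by (simp only: norm_mult ennreal_mult norm_ge_zero A)
  qed
  then have "Lp_norm lborel p (\<lambda>x. ennreal (cmod (antidual_hat f (\<lambda>\<xi>. \<phi> i \<xi> * (chi x \<xi> * (?e \<xi> * ?a \<xi>))))))
      \<le> Lp_norm lborel p (\<lambda>x. \<integral>\<^sup>+y. ?c * ?W y * ennreal (cmod (fourier ?b (y - x))) \<partial>lborel)"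
    using measurable_compose[OF measurable_Pair2'[of h \<mu> lborel] Calderon_family_measurable[OF i]] h
    by (intro Lp_norm_mono[OF p]) (auto simp: space_mu)
  also have "\<dots> \<le> Lp_norm lborel p (\<lambda>y. ?c * ?W y) * (\<integral>\<^sup>+y. ennreal (cmod (fourier ?b y)) \<partial>lborel)"
    by (rule Lp_norm_convolution_le[OF p]) measurable
  also have "Lp_norm lborel p (\<lambda>y. ?c * ?W y) = ?c * WF f h"
    unfolding WF_def[OF f] by (rule Lp_norm_cmult[OF p _ ennreal_less_top]) (simp only: measurable_lborel2 Wm)
  also have "(\<integral>\<^sup>+y. ennreal (cmod (fourier ?b y)) \<partial>lborel) = (\<integral>\<^sup>+y. ennreal (cmod (inv_fourier ?b y)) \<partial>lborel)"
    by (rule fourier_L1[OF test_funs_measurable[OF b] inv_fourier_integrable[OF b]])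
  also have "?c * WF f h * \<dots> \<le> ?c * WF f h * ((\<integral>\<^sup>+x. ennreal (cmod (inv_fourier (\<phi> i) x)) \<partial>lborel) * A\<^sub>\<eta>)"
    using inv_fourier_mult_L1[OF \<phi>[OF i] e] unfolding fourier_\<eta>_L1(2)[OF h] by (rule mult_left_mono) simp
  finally show ?thesis .
qed

end

lemma BAPU_bound:
  obtains D where "0 \<le> D" "\<And>i. i \<in> I \<Longrightarrow> (\<integral>\<^sup>+x. ennreal (cmod (inv_fourier (\<phi> i) x)) \<partial>lborel) \<le> ennreal D"
proof -
  let ?S = "SUP i\<in>I. Lp_norm lborel 1 (\<lambda>x. ennreal (cmod (inv_fourier (\<phi> i) x)))"
  have "?S < \<infinity>" using bapu by (simp add: BAPU_def)
  then obtain D where D: "0 \<le> D" "?S = ennreal D" by (cases ?S) auto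
  have "(\<integral>\<^sup>+x. ennreal (cmod (inv_fourier (\<phi> i) x)) \<partial>lborel) \<le> ennreal D" if "i \<in> I" for i
    using SUP_upper[OF that, of "\<lambda>i. Lp_norm lborel 1 (\<lambda>x. ennreal (cmod (inv_fourier (\<phi> i) x)))"] D(2)
    by (simp add: Lp_norm_one)
  then show ?thesis using that D(1) by blast
qed

text \<open>Minkowski's inequality takes the norm in x inside the reproducing integral, after which
  each slice is covered by \<open>localized_norm_le\<close>. The constant adds to those of
  \<open>Co_norm_le\<close> the uniform L1 bound \<open>D\<close> of the partition of unity.\<close>

lemma dec_norm_le:
  obtains B where "0 \<le> B" "\<And>f. f \<in> S_antidual \<Omega> \<Longrightarrow>
    dec_norm I \<phi> p q w (Gamma_map \<Omega> f) \<le> ennreal B * Co_norm \<mu> (inv_fourier \<eta>) p q (\<lambda>(x, h). v h) f"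
proof -
  obtain B where B: "0 \<le> B" "\<And>F a. F \<in> borel_measurable \<mu> \<Longrightarrow> (\<And>i. i \<in> I \<Longrightarrow> a i \<le> (\<integral>\<^sup>+h. indicator (E i) h * (ennreal (\<bar>det h\<bar> powr (- \<sigma>)) * F h) \<partial>\<mu>)) \<Longrightarrow>
      Lp_norm (count_space I) q a \<le> ennreal B * Lp_norm haar_det q F"
    by (rule outer_norm_ge) blast
  obtain c where c: "0 < c" "\<And>i. i \<in> I \<Longrightarrow> 0 < w i"
    "\<And>i h. i \<in> I \<Longrightarrow> h \<in> E i \<Longrightarrow> \<nu> h \<le> c * w i \<and> w i \<le> c * \<nu> h"
    by (rule weight_discretization) blast
  obtain A where A: "0 \<le> A" "A\<^sub>\<eta> = ennreal A" using A\<^sub>\<eta>_finite by (cases "A\<^sub>\<eta>") auto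
  obtain D where D: "0 \<le> D" "\<And>i. i \<in> I \<Longrightarrow> (\<integral>\<^sup>+x. ennreal (cmod (inv_fourier (\<phi> i) x)) \<partial>lborel) \<le> ennreal D"
    by (rule BAPU_bound) blast
  have "dec_norm I \<phi> p q w (Gamma_map \<Omega> f) \<le> ennreal (B * (c * (D * A))) * Co_norm \<mu> (inv_fourier \<eta>) p q (\<lambda>(x, h). v h) f"
    if f: "f \<in> S_antidual \<Omega>" for f
  proof -
    let ?L = "\<lambda>i x h. antidual_hat f (\<lambda>\<xi>. \<phi> i \<xi> * (chi x \<xi> * (\<eta> (transpose h *v \<xi>) * cnj (\<eta> (transpose h *v \<xi>)))))"
    let ?C = "ennreal (c * (D * A))"
    have "ennreal (w i) * distr_Lp_norm p (T f i) \<le> (\<integral>\<^sup>+h. indicator (E i) h * (ennreal (\<bar>det h\<bar> powr (- \<sigma>)) * (?C * WF f h)) \<partial>\<mu>)"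
      if i: "i \<in> I" for i
    proof -
      note [measurable] = E_facts(3)[OF i] Calderon_family_measurable[OF f i] WF_measurable[OF f]
        borel_measurable_mu_continuous[OF weight_facts(2)]
      have Em: "(\<lambda>z. indicator (E i) (snd z) :: ennreal) \<in> borel_measurable ((lborel :: (real^'d) measure) \<Otimes>\<^sub>M \<mu>)"
        by (rule measurable_compose[OF measurable_snd]) measurable
      have gm: "(\<lambda>x. antidual_hat f (\<lambda>\<xi>. \<phi> i \<xi> * chi x \<xi>)) \<in> borel_measurable lborel"
      proof -
        interpret F: supported_family \<Omega> "fun_supp (\<phi> i)" "\<lambda>x \<xi>. \<phi> i \<xi> * chi x \<xi>" by (rule supported_family_chi[OF \<phi>[OF i]])
        show ?thesis by (rule F.distribution_family_measurable[OF \<Lambda>[OF f]]) simp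
      qed
      have "distr_Lp_norm p (T f i) \<le> Lp_norm lborel p (\<lambda>x. ennreal (cmod (antidual_hat f (\<lambda>\<xi>. \<phi> i \<xi> * chi x \<xi>))))"
        by (rule distr_Lp_norm_T_le[OF f i])
      also have "\<dots> \<le> Lp_norm lborel p (\<lambda>x. \<integral>\<^sup>+h. (\<lambda>z. indicator (E i) (snd z) * ennreal (cmod (?L i (fst z) (snd z)))) (x, h) \<partial>\<mu>)"
      proof (rule Lp_norm_mono[OF p])
        fix x
        have "ennreal (cmod (antidual_hat f (\<lambda>\<xi>. \<phi> i \<xi> * chi x \<xi>))) \<le> (\<integral>\<^sup>+h. ennreal (cmod (indicator (E i) h * ?L i x h)) \<partial>\<mu>)"
          unfolding reproducing[OF f i] by (rule cmod_integral_le)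
        also have "\<dots> = (\<integral>\<^sup>+h. indicator (E i) h * ennreal (cmod (?L i x h)) \<partial>\<mu>)"
          by (intro nn_integral_cong) (simp add: indicator_def)
        finally show "ennreal (cmod (antidual_hat f (\<lambda>\<xi>. \<phi> i \<xi> * chi x \<xi>))) \<le> (\<integral>\<^sup>+h. (\<lambda>z. indicator (E i) (snd z) * ennreal (cmod (?L i (fst z) (snd z)))) (x, h) \<partial>\<mu>)"
          by simp
      qed (use gm in measurable)
      also have "\<dots> \<le> (\<integral>\<^sup>+h. Lp_norm lborel p (\<lambda>x. (\<lambda>z. indicator (E i) (snd z) * ennreal (cmod (?L i (fst z) (snd z)))) (x, h)) \<partial>\<mu>)"
        using Em Calderon_family_measurable[OF f i] by (intro Lp_norm_nn_integral_le[OF sigma_finite_lborel sigma_finite_mu _ p]) measurable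
      also have "\<dots> \<le> (\<integral>\<^sup>+h. indicator (E i) h * (ennreal (1 / (v h * \<bar>det h\<bar> powr (1 / 2))) * WF f h * ennreal (D * A)) \<partial>\<mu>)"
      proof (rule nn_integral_mono)
        fix h assume "h \<in> space \<mu>"
        then have h: "h \<in> H" by (simp add: space_mu)
        have "Lp_norm lborel p (\<lambda>x. ennreal (cmod (?L i x h))) \<le> ennreal (1 / (v h * \<bar>det h\<bar> powr (1 / 2))) * WF f h * ((\<integral>\<^sup>+x. ennreal (cmod (inv_fourier (\<phi> i) x)) \<partial>lborel) * A\<^sub>\<eta>)"
          by (rule localized_norm_le[OF f i h])
        also have "\<dots> \<le> ennreal (1 / (v h * \<bar>det h\<bar> powr (1 / 2))) * WF f h * ennreal (D * A)"
          using D(2)[OF i] A D(1) by (intro mult_left_mono) (auto simp: ennreal_mult mult_right_mono)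
        finally show "Lp_norm lborel p (\<lambda>x. (\<lambda>z. indicator (E i) (snd z) * ennreal (cmod (?L i (fst z) (snd z)))) (x, h))
            \<le> indicator (E i) h * (ennreal (1 / (v h * \<bar>det h\<bar> powr (1 / 2))) * WF f h * ennreal (D * A))"
          by (cases "h \<in> E i") (simp_all add: Lp_norm_0[OF p])
      qed
      finally have "ennreal (w i) * distr_Lp_norm p (T f i) \<le> ennreal (w i) * (\<integral>\<^sup>+h. indicator (E i) h * (ennreal (1 / (v h * \<bar>det h\<bar> powr (1 / 2))) * WF f h * ennreal (D * A)) \<partial>\<mu>)"
        by (rule mult_left_mono) simp
      also have "\<dots> = (\<integral>\<^sup>+h. ennreal (w i) * (indicator (E i) h * (ennreal (1 / (v h * \<bar>det h\<bar> powr (1 / 2))) * WF f h * ennreal (D * A))) \<partial>\<mu>)"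
        by (rule nn_integral_cmult[symmetric]) measurable
      also have "\<dots> \<le> (\<integral>\<^sup>+h. indicator (E i) h * (ennreal (\<bar>det h\<bar> powr (- \<sigma>)) * (?C * WF f h)) \<partial>\<mu>)"
      proof (rule nn_integral_mono)
        fix h assume "h \<in> space \<mu>"
        then have h: "h \<in> H" by (simp add: space_mu)
        show "ennreal (w i) * (indicator (E i) h * (ennreal (1 / (v h * \<bar>det h\<bar> powr (1 / 2))) * WF f h * ennreal (D * A)))
            \<le> indicator (E i) h * (ennreal (\<bar>det h\<bar> powr (- \<sigma>)) * (?C * WF f h))"
        proof (cases "h \<in> E i")
          case True
          \<comment> \<open>\<open>weight_factor\<close> isolates \<nu>, which is comparable to
            \<open>w i\<close> on \<open>E i\<close>; the leftover power of the determinant is the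
            one that \<open>outer_norm_ge\<close> expects.\<close>
          have "w i * (1 / (v h * \<bar>det h\<bar> powr (1 / 2))) = w i / \<nu> h * \<bar>det h\<bar> powr (- \<sigma>)"
            unfolding weight_factor[OF h] using \<nu>_pos[OF h] by (simp add: powr_minus_divide)
          also have "\<dots> \<le> c * \<bar>det h\<bar> powr (- \<sigma>)"
            using c(3)[OF i True] \<nu>_pos[OF h] by (intro mult_right_mono) (auto simp: pos_divide_le_eq)
          finally have "ennreal (w i * (1 / (v h * \<bar>det h\<bar> powr (1 / 2)))) \<le> ennreal (c * \<bar>det h\<bar> powr (- \<sigma>))" by (rule ennreal_leI)
          then have "ennreal (w i) * ennreal (1 / (v h * \<bar>det h\<bar> powr (1 / 2))) * (WF f h * ennreal (D * A)) \<le> ennreal c * ennreal (\<bar>det h\<bar> powr (- \<sigma>)) * (WF f h * ennreal (D * A))"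
            using c(1) c(2)[OF i] weight_facts(1)[OF h] by (intro mult_right_mono) (simp_all add: ennreal_mult[symmetric])
          moreover have "?C = ennreal c * ennreal (D * A)" using c(1) D(1) A(1) by (simp add: ennreal_mult)
          ultimately show ?thesis using True by (simp add: mult_ac)
        qed simp
      qed
      finally show ?thesis .
    qed
    then have "Lp_norm (count_space I) q (\<lambda>i. ennreal (w i) * distr_Lp_norm p (T f i)) \<le> ennreal B * Lp_norm haar_det q (\<lambda>h. ?C * WF f h)"
      using WF_measurable[OF f] by (intro B(2)) auto
    also have "Lp_norm haar_det q (\<lambda>h. ?C * WF f h) = ?C * Lp_norm haar_det q (WF f)"
      using WF_measurable[OF f] by (intro Lp_norm_cmult[OF q]) auto
    finally show ?thesis
      unfolding Co_norm_eq[OF f] dec_norm_def using B(1) c(1) A(1) D(1) by (simp add: ennreal_mult mult.assoc)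
  qed
  then show ?thesis using that[of "B * (c * (D * A))"] B(1) c(1) A(1) D(1) by simp
qed

end

subsection \<open>A criterion for completeness\<close>

text \<open>Bounded evaluations (\<open>weak\<close>) make Cauchy sequences converge pointwise and
  force definiteness; the Fatou-type hypothesis puts the limit into the space. A loss by a constant
  \<open>D\<close> is permitted, since for the decomposition norm the closure property is reached
  only up to equivalence of norms.\<close>

lemma complex_banachI:
  fixes V :: "('a \<Rightarrow> complex) set"
  assumes zero: "(\<lambda>_. 0) \<in> V"
    and lin: "\<And>f g a b. f \<in> V \<Longrightarrow> g \<in> V \<Longrightarrow> (\<lambda>t. a * f t + b * g t) \<in> V"
    and fin: "\<And>f. f \<in> V \<Longrightarrow> N f < \<infinity>"
    and hom: "\<And>f a. f \<in> V \<Longrightarrow> N (\<lambda>t. a * f t) = ennreal (cmod a) * N f"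
    and neg: "\<And>f. N (\<lambda>t. - f t) = N f"
    and tri: "\<And>f g. f \<in> V \<Longrightarrow> g \<in> V \<Longrightarrow> N (\<lambda>t. f t + g t) \<le> N f + N g"
    and weak: "\<And>t. \<exists>c\<ge>0. \<forall>f\<in>V. ennreal (cmod (f t)) \<le> ennreal c * N f"
    and D: "0 \<le> D" "\<And>F f B. (\<And>n. F n \<in> V) \<Longrightarrow> (\<And>t. (\<lambda>n. F n t) \<longlonglongrightarrow> f t) \<Longrightarrow> 0 \<le> B \<Longrightarrow> (\<And>n. N (F n) \<le> ennreal B) \<Longrightarrow>
      f \<in> V \<and> N f \<le> ennreal (D * B)"
  shows "complex_banach V N"
proof -
  define d where "d f g = enn2real (N (\<lambda>t. f t - g t))" for f g
  have diff: "(\<lambda>t. f t - g t) \<in> V" if "f \<in> V" "g \<in> V" for f g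
    using lin[OF that, of 1 "-1"] by simp
  have d: "N (\<lambda>t. f t - g t) = ennreal (d f g)" if "f \<in> V" "g \<in> V" for f g
    using fin[OF diff[OF that]] by (simp add: d_def)
  have zero_iff: "N f = 0 \<longleftrightarrow> f = (\<lambda>_. 0)" if f: "f \<in> V" for f
  proof
    assume "N f = 0"
    moreover have "\<exists>c\<ge>0. ennreal (cmod (f t)) \<le> ennreal c * N f" for t using weak[of t] f by blast
    ultimately show "f = (\<lambda>_. 0)" by (auto simp: fun_eq_iff)
  next
    assume "f = (\<lambda>_. 0)"
    then show "N f = 0" using hom[OF zero, of 0] by simp
  qed
  have M: "Metric_space V d"
  proof
    show "0 \<le> d x y" for x y by (simp add: d_def)
    show "d x y = d y x" for x y using neg[of "\<lambda>t. x t - y t"] by (simp add: d_def)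
    show "d x y = 0 \<longleftrightarrow> x = y" if "x \<in> V" "y \<in> V" for x y
    proof -
      have "d x y = 0 \<longleftrightarrow> N (\<lambda>t. x t - y t) = 0"
        unfolding d[OF that] by (simp add: d_def order_antisym_conv)
      also have "\<dots> \<longleftrightarrow> x = y" unfolding zero_iff[OF diff[OF that]] by (simp add: fun_eq_iff)
      finally show ?thesis .
    qed
    show "d x z \<le> d x y + d y z" if "x \<in> V" "y \<in> V" "z \<in> V" for x y z
    proof -
      have "ennreal (d x z) \<le> ennreal (d x y) + ennreal (d y z)"
        using tri[OF diff[OF that(1,2)] diff[OF that(2,3)]] that by (simp add: d)
      also have "\<dots> = ennreal (d x y + d y z)" by (simp add: d_def)
      finally show ?thesis by (subst (asm) ennreal_le_iff) (simp_all add: d_def)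
    qed
  qed
  have "Metric_space.mcomplete V d"
    unfolding Metric_space.mcomplete_def[OF M]
  proof (intro allI impI)
    fix F assume "Metric_space.MCauchy V d F"
    then have FV: "\<And>n. F n \<in> V" and cauchy: "\<And>e. 0 < e \<Longrightarrow> \<exists>n0. \<forall>m n. n0 \<le> m \<longrightarrow> n0 \<le> n \<longrightarrow> d (F m) (F n) < e"
      unfolding Metric_space.MCauchy_def[OF M] by auto
    have "Cauchy (\<lambda>n. F n t)" for t
    proof (rule metric_CauchyI)
      fix e :: real assume e: "0 < e"
      obtain c where c: "0 \<le> c" "\<forall>f\<in>V. ennreal (cmod (f t)) \<le> ennreal c * N f" using weak by blast
      obtain n0 where n0: "\<forall>m n. n0 \<le> m \<longrightarrow> n0 \<le> n \<longrightarrow> d (F m) (F n) < e / (c + 1)"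
        using cauchy[of "e / (c + 1)"] e c(1) by auto
      have "dist (F m t) (F n t) < e" if "n0 \<le> m" "n0 \<le> n" for m n
      proof -
        have "ennreal (cmod (F m t - F n t)) \<le> ennreal (c * d (F m) (F n))"
          using c(2) diff[OF FV FV, of m n] d[OF FV FV, of m n] c(1) by (force simp: ennreal_mult d_def)
        then have "cmod (F m t - F n t) \<le> c * d (F m) (F n)"
          by (subst (asm) ennreal_le_iff) (use c(1) in \<open>auto simp: d_def\<close>)
        also have "\<dots> \<le> (c + 1) * d (F m) (F n)" by (intro mult_right_mono) (auto simp: d_def)
        also have "\<dots> < (c + 1) * (e / (c + 1))" using n0 that c(1) by (intro mult_strict_left_mono) auto
        finally show ?thesis using c(1) by (simp add: dist_norm)
      qed
      then show "\<exists>M. \<forall>m\<ge>M. \<forall>n\<ge>M. dist (F m t) (F n t) < e" by blast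
    qed
    then have "\<exists>l. (\<lambda>n. F n t) \<longlonglongrightarrow> l" for t by (simp add: Cauchy_convergent_iff convergent_def)
    then obtain f where f: "\<And>t. (\<lambda>n. F n t) \<longlonglongrightarrow> f t" by metis
    \<comment> \<open>The closure hypothesis is applied to the differences \<open>F m - F n\<close>
      with m fixed, so that the limit comes with an estimate of the distance.\<close>
    have close: "(\<lambda>t. F m t - f t) \<in> V \<and> N (\<lambda>t. F m t - f t) \<le> ennreal (D * e)"
      if e: "0 \<le> e" and n0: "\<And>n. n0 \<le> n \<Longrightarrow> d (F m) (F n) \<le> e" for m n0 e
    proof (rule D(2)[where F = "\<lambda>n t. F m t - F (n + n0) t"])
      show "(\<lambda>t. F m t - F (n + n0) t) \<in> V" for n by (rule diff[OF FV FV])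
      show "(\<lambda>n. F m t - F (n + n0) t) \<longlonglongrightarrow> F m t - f t" for t
        by (intro tendsto_intros LIMSEQ_ignore_initial_segment f)
      show "N (\<lambda>t. F m t - F (n + n0) t) \<le> ennreal e" for n
        unfolding d[OF FV FV] by (intro ennreal_leI n0) simp
    qed (rule e)
    obtain n1 where "\<forall>m n. n1 \<le> m \<longrightarrow> n1 \<le> n \<longrightarrow> d (F m) (F n) < 1" using cauchy[of 1] by auto
    then have "(\<lambda>t. F n1 t - f t) \<in> V" using close[of 1 n1 n1] by (simp add: less_imp_le)
    from diff[OF FV[of n1] this] have fV: "f \<in> V" by simp
    have "\<exists>n0. \<forall>n\<ge>n0. F n \<in> V \<and> d (F n) f < e" if e: "0 < e" for e
    proof -
      obtain n0 where n0: "\<forall>m n. n0 \<le> m \<longrightarrow> n0 \<le> n \<longrightarrow> d (F m) (F n) < e / (D + 1)"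
        using cauchy[of "e / (D + 1)"] e D(1) by auto
      have "d (F n) f < e" if n: "n0 \<le> n" for n
      proof -
        have "N (\<lambda>t. F n t - f t) \<le> ennreal (D * (e / (D + 1)))"
          using close[of "e / (D + 1)" n0 n] n0 n e D(1) by (simp add: less_imp_le)
        then have "d (F n) f \<le> D * (e / (D + 1))"
          unfolding d[OF FV fV] by (subst (asm) ennreal_le_iff) (use e D(1) in auto)
        also have "\<dots> < e" using e D(1) by (simp add: field_simps)
        finally show ?thesis .
      qed
      then show ?thesis using FV by blast
    qed
    then show "\<exists>x. limitin (Metric_space.mtopology V d) F x sequentially"
      unfolding Metric_space.limit_metric_sequentially[OF M] using fV by blast
  qed
  then have "Metric_space.mcomplete V (\<lambda>f g. enn2real (N (\<lambda>t. f t - g t)))"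
    unfolding d_def[abs_def] .
  then show ?thesis
    unfolding complex_banach_def by (intro conjI ballI allI zero lin fin hom tri zero_iff)
qed

subsection \<open>The norm of a tempered distribution\<close>

lemma ennreal_le_swap: "0 < B \<Longrightarrow> x \<le> ennreal B * y \<Longrightarrow> ennreal (1 / B) * x \<le> y"
proof -
  assume B: "0 < B" "x \<le> ennreal B * y"
  have "ennreal (1 / B) * x \<le> ennreal (1 / B) * (ennreal B * y)" using B(2) by (rule mult_left_mono) simp
  also have "\<dots> = y" using B(1) by (simp flip: mult.assoc ennreal_mult)
  finally show ?thesis .
qed

text \<open>Dividing by c first allows the greatest lower bound to be used. An empty
  \<open>X\<close> is covered, its infimum being \<infinity>: this is the case of a functional
  without representing function.\<close>

lemma ennreal_le_mult_Inf:
  assumes c: "0 < c" and le: "\<And>s. s \<in> X \<Longrightarrow> l \<le> ennreal c * s"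
  shows "l \<le> ennreal c * Inf X"
proof -
  have "ennreal (1 / c) * l \<le> Inf X"
  proof (rule Inf_greatest)
    fix s assume "s \<in> X"
    then have "ennreal (1 / c) * l \<le> ennreal (1 / c) * (ennreal c * s)" using le by (intro mult_left_mono) auto
    also have "\<dots> = s" using c by (simp flip: mult.assoc ennreal_mult)
    finally show "ennreal (1 / c) * l \<le> s" .
  qed
  then have "ennreal c * (ennreal (1 / c) * l) \<le> ennreal c * Inf X" by (rule mult_left_mono) simp
  moreover have "ennreal c * (ennreal (1 / c) * l) = l" using c by (simp flip: mult.assoc ennreal_mult)
  ultimately show ?thesis by simp
qed

lemma ennreal_less_add_pos: "x < top \<Longrightarrow> 0 < e \<Longrightarrow> x < x + ennreal e"
  by (cases x) (auto simp: ennreal_less_iff simp flip: ennreal_plus)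

lemma ennreal_le_add_Inf:
  fixes l :: ennreal
  assumes le: "\<And>s t. s \<in> X \<Longrightarrow> t \<in> Y \<Longrightarrow> l \<le> s + t"
  shows "l \<le> Inf X + Inf Y"
proof (rule ennreal_le_epsilon)
  fix e :: real assume e: "0 < e" and fin: "Inf X + Inf Y < top"
  have "Inf X < Inf X + ennreal (e / 2)" "Inf Y < Inf Y + ennreal (e / 2)"
    using e fin by (intro ennreal_less_add_pos; simp add: less_top)+
  then obtain s t where st: "s \<in> X" "s < Inf X + ennreal (e / 2)" "t \<in> Y" "t < Inf Y + ennreal (e / 2)"
    unfolding Inf_less_iff by blast
  have "l \<le> s + t" using le st by blast
  also have "\<dots> \<le> (Inf X + ennreal (e / 2)) + (Inf Y + ennreal (e / 2))" using st by (intro add_mono) auto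
  also have "\<dots> = Inf X + Inf Y + (ennreal (e / 2) + ennreal (e / 2))" by (simp add: add_ac)
  also have "ennreal (e / 2) + ennreal (e / 2) = ennreal e" using e by (simp flip: ennreal_plus)
  finally show "l \<le> Inf X + Inf Y + ennreal e" .
qed

definition represents :: "(real^'d \<Rightarrow> complex) \<Rightarrow> ((real^'d \<Rightarrow> complex) \<Rightarrow> complex) \<Rightarrow> bool" where
  "represents G T \<longleftrightarrow> G \<in> borel_measurable lborel \<and>
     (\<forall>\<theta>\<in>schwartz_funs. integrable lborel (\<lambda>x. G x * \<theta> x) \<and> T \<theta> = (LINT x|lborel. G x * \<theta> x))"

lemma distr_Lp_norm_represents:
  "distr_Lp_norm p T = Inf ((\<lambda>G. Lp_norm lborel p (\<lambda>x. ennreal (cmod (G x)))) ` {G. represents G T})"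
  unfolding distr_Lp_norm_def represents_def by (rule arg_cong[where f = Inf]) blast

lemma represents_measurable: "represents G T \<Longrightarrow> G \<in> borel_measurable borel"
  by (simp add: represents_def)

lemma represents_add: "represents G T \<Longrightarrow> represents G' T' \<Longrightarrow> represents (\<lambda>x. G x + G' x) (\<lambda>\<theta>. T \<theta> + T' \<theta>)"
  unfolding represents_def by (auto simp: distrib_right)

lemma represents_cmult: "represents G T \<Longrightarrow> represents (\<lambda>x. a * G x) (\<lambda>\<theta>. a * T \<theta>)"
  unfolding represents_def by (auto simp: mult.assoc)

lemma distr_Lp_norm_add:
  assumes p: "1 \<le> p"
  shows "distr_Lp_norm p (\<lambda>\<theta>. T \<theta> + T' \<theta>) \<le> distr_Lp_norm p T + distr_Lp_norm p T'"
  unfolding distr_Lp_norm_represents[of p T] distr_Lp_norm_represents[of p T']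
proof (rule ennreal_le_add_Inf, elim imageE CollectE)
  fix s t G G'
  assume st: "s = Lp_norm lborel p (\<lambda>x. ennreal (cmod (G x)))" "t = Lp_norm lborel p (\<lambda>x. ennreal (cmod (G' x)))"
    and G: "represents G T" "represents G' T'"
  note [measurable] = represents_measurable[OF G(1)] represents_measurable[OF G(2)]
  have "distr_Lp_norm p (\<lambda>\<theta>. T \<theta> + T' \<theta>) \<le> Lp_norm lborel p (\<lambda>x. ennreal (cmod (G x + G' x)))"
    unfolding distr_Lp_norm_represents using represents_add[OF G] by (intro Inf_lower image_eqI[OF refl]) simp
  also have "\<dots> \<le> Lp_norm lborel p (\<lambda>x. ennreal (cmod (G x)) + ennreal (cmod (G' x)))"
    by (intro Lp_norm_mono[OF p]) (auto simp: norm_triangle_ineq simp flip: ennreal_plus)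
  also have "\<dots> \<le> s + t" unfolding st by (rule Lp_norm_add[OF sigma_finite_lborel p]) measurable
  finally show "distr_Lp_norm p (\<lambda>\<theta>. T \<theta> + T' \<theta>) \<le> s + t" .
qed

text \<open>One inequality, for a and for 1/a. The scalar 0 is separate: the right side is then 0
  even if the norm of T is \<infinity>, and the zero function represents the zero
  functional.\<close>

lemma distr_Lp_norm_cmult:
  fixes T :: "(real^'d \<Rightarrow> complex) \<Rightarrow> complex"
  assumes p: "1 \<le> p"
  shows "distr_Lp_norm p (\<lambda>\<theta>. a * T \<theta>) = ennreal (cmod a) * distr_Lp_norm p T"
proof (cases "a = 0")
  case True
  have "represents (\<lambda>x. 0) (\<lambda>\<theta> :: real^'d \<Rightarrow> complex. 0)" by (simp add: represents_def)
  then have "distr_Lp_norm p (\<lambda>\<theta> :: real^'d \<Rightarrow> complex. 0 :: complex) \<le> Lp_norm lborel p (\<lambda>x :: real^'d. ennreal (cmod 0))"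
    unfolding distr_Lp_norm_represents by (intro Inf_lower image_eqI[of _ _ "\<lambda>x. 0"]) auto
  then show ?thesis using True by (simp add: Lp_norm_0[OF p])
next
  case False
  have le: "distr_Lp_norm p (\<lambda>\<theta>. a * T \<theta>) \<le> ennreal (cmod a) * distr_Lp_norm p T"
    if "a \<noteq> 0" for a and T :: "(real^'d \<Rightarrow> complex) \<Rightarrow> complex"
    unfolding distr_Lp_norm_represents[of p T]
  proof (rule ennreal_le_mult_Inf, simp add: that, elim imageE CollectE)
    fix s G assume s: "s = Lp_norm lborel p (\<lambda>x. ennreal (cmod (G x)))" and G: "represents G T"
    note [measurable] = represents_measurable[OF G]
    have "distr_Lp_norm p (\<lambda>\<theta>. a * T \<theta>) \<le> Lp_norm lborel p (\<lambda>x. ennreal (cmod (a * G x)))"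
      unfolding distr_Lp_norm_represents using represents_cmult[OF G] by (intro Inf_lower image_eqI[OF refl]) simp
    also have "\<dots> = ennreal (cmod a) * s"
      unfolding s norm_mult ennreal_mult[OF norm_ge_zero norm_ge_zero] by (rule Lp_norm_cmult[OF p]) auto
    finally show "distr_Lp_norm p (\<lambda>\<theta>. a * T \<theta>) \<le> ennreal (cmod a) * s" .
  qed
  have "ennreal (cmod a) * distr_Lp_norm p (\<lambda>\<theta>. 1 / a * (a * T \<theta>)) \<le> ennreal (cmod a) * (ennreal (cmod (1 / a)) * distr_Lp_norm p (\<lambda>\<theta>. a * T \<theta>))"
    using False by (intro mult_left_mono le) auto
  also have "\<dots> = distr_Lp_norm p (\<lambda>\<theta>. a * T \<theta>)"
    using False by (simp add: norm_divide flip: mult.assoc ennreal_mult)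
  finally show ?thesis using le[OF False, of T] False by simp
qed

text \<open>One constant bounds \<theta> both in L1 and in the supremum norm, which replaces the
  conjugate exponent for every p.\<close>

lemma distr_Lp_norm_pairing:
  fixes \<theta> :: "real^'d \<Rightarrow> complex"
  assumes p: "1 \<le> p" and \<theta>: "\<theta> \<in> schwartz_funs" "\<theta> \<in> borel_measurable borel" and c: "0 < c"
    "(\<integral>\<^sup>+x. ennreal (cmod (\<theta> x)) \<partial>lborel) \<le> ennreal c" "\<And>x. cmod (\<theta> x) \<le> c"
  shows "ennreal (cmod (T \<theta>)) \<le> ennreal c * distr_Lp_norm p T"
  unfolding distr_Lp_norm_represents
proof (rule ennreal_le_mult_Inf[OF c(1)], elim imageE CollectE)
  fix s G assume s: "s = Lp_norm lborel p (\<lambda>x. ennreal (cmod (G x)))" and G: "represents G T"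
  note [measurable] = represents_measurable[OF G] \<theta>(2)
  have "T \<theta> = (LINT x|lborel. G x * \<theta> x)" using G \<theta>(1) by (simp add: represents_def)
  then have "ennreal (cmod (T \<theta>)) \<le> (\<integral>\<^sup>+x. ennreal (cmod (G x)) * ennreal (cmod (\<theta> x)) \<partial>lborel)"
    using cmod_integral_le[of lborel "\<lambda>x. G x * \<theta> x"] by (simp add: norm_mult ennreal_mult)
  also have "\<dots> \<le> ennreal c * s"
    unfolding s using c by (intro nn_integral_mult_le_Lp_norm[OF p]) (auto intro: ennreal_leI)
  finally show "ennreal (cmod (T \<theta>)) \<le> ennreal c * s" .
qed

subsection \<open>Linear structure of the reservoirs\<close>

lemma S_antidual_linear:
  assumes f: "f \<in> S_antidual \<Omega>" and g: "g \<in> S_antidual \<Omega>"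
  shows "(\<lambda>t. a * f t + b * g t) \<in> S_antidual \<Omega>"
proof -
  have c: "continuous_map (S_topology \<Omega>) euclidean (\<lambda>t. a * f t)" if "f \<in> S_antidual \<Omega>" for a f
  proof -
    have "continuous_map euclidean euclidean (\<lambda>z. a * z)" by (simp add: continuous_on_mult_left)
    moreover have "continuous_map (S_topology \<Omega>) euclidean f" using that by (simp add: S_antidual_def)
    ultimately have "continuous_map (S_topology \<Omega>) euclidean ((\<lambda>z. a * z) \<circ> f)" by (rule continuous_map_compose[rotated])
    then show ?thesis by (simp add: o_def)
  qed
  show ?thesis
    unfolding S_antidual_def using f g continuous_map_add[OF c[OF f] c[OF g]]
    by (auto simp: S_antidual_def algebra_simps)
qed

lemma S_antidual_0: "(\<lambda>_. 0) \<in> S_antidual \<Omega>"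
  by (simp add: S_antidual_def)

lemma Gamma_map_linear: "Gamma_map \<Omega> (\<lambda>t. a * f t + b * g t) = (\<lambda>t. a * Gamma_map \<Omega> f t + b * Gamma_map \<Omega> g t)"
  by (auto simp: Gamma_map_def)

lemma dec_norm_add:
  assumes p: "1 \<le> p" and q: "1 \<le> q" and I: "countable I"
  shows "dec_norm I \<phi> p q w (\<lambda>t. f t + g t) \<le> dec_norm I \<phi> p q w f + dec_norm I \<phi> p q w g"
proof -
  let ?T = "\<lambda>f i. distr_inv_fourier (distr_mult (\<phi> i) (distr_hat f))"
  have "dec_norm I \<phi> p q w (\<lambda>t. f t + g t)
      \<le> Lp_norm (count_space I) q (\<lambda>i. ennreal (w i) * distr_Lp_norm p (?T f i) + ennreal (w i) * distr_Lp_norm p (?T g i))"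
    unfolding dec_norm_def
  proof (rule Lp_norm_mono[OF q])
    fix i
    have "?T (\<lambda>t. f t + g t) i = (\<lambda>\<theta>. ?T f i \<theta> + ?T g i \<theta>)"
      by (simp add: distr_inv_fourier_def distr_mult_def distr_hat_def)
    then have "distr_Lp_norm p (?T (\<lambda>t. f t + g t) i) \<le> distr_Lp_norm p (?T f i) + distr_Lp_norm p (?T g i)"
      using distr_Lp_norm_add[OF p] by simp
    then show "ennreal (w i) * distr_Lp_norm p (?T (\<lambda>t. f t + g t) i) \<le> ennreal (w i) * distr_Lp_norm p (?T f i) + ennreal (w i) * distr_Lp_norm p (?T g i)"
      unfolding distrib_left[symmetric] by (rule mult_left_mono) simp
  qed simp
  also have "\<dots> \<le> dec_norm I \<phi> p q w f + dec_norm I \<phi> p q w g"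
    unfolding dec_norm_def by (rule Lp_norm_add[OF sigma_finite_measure_count_space_countable[OF I] q]) auto
  finally show ?thesis .
qed

lemma dec_norm_cmult:
  assumes p: "1 \<le> p" and q: "1 \<le> q"
  shows "dec_norm I \<phi> p q w (\<lambda>t. a * f t) = ennreal (cmod a) * dec_norm I \<phi> p q w f"
proof -
  let ?T = "\<lambda>f i. distr_inv_fourier (distr_mult (\<phi> i) (distr_hat f))"
  have T: "?T (\<lambda>t. a * f t) i = (\<lambda>\<theta>. a * ?T f i \<theta>)" for i
    by (simp add: distr_inv_fourier_def distr_mult_def distr_hat_def)
  have "ennreal (w i) * distr_Lp_norm p (?T (\<lambda>t. a * f t) i) = ennreal (cmod a) * (ennreal (w i) * distr_Lp_norm p (?T f i))" for i
    unfolding T distr_Lp_norm_cmult[OF p] by (rule mult.left_commute)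
  then show ?thesis
    unfolding dec_norm_def by (simp add: Lp_norm_cmult[OF q])
qed

lemma linear_combination_finite:
  assumes "N (\<lambda>t. a * f t + b * g t) \<le> N (\<lambda>t. a * f t) + N (\<lambda>t. b * g t)"
    and "N (\<lambda>t. a * f t) = ennreal (cmod a) * N f" "N (\<lambda>t. b * g t) = ennreal (cmod b) * N g"
    and "N f < \<infinity>" "N g < \<infinity>"
  shows "N (\<lambda>t. a * f t + b * g t) < (\<infinity> :: ennreal)"
  using assms(1) unfolding assms(2,3) by (rule le_less_trans) (use assms(4,5) in \<open>simp add: ennreal_mult_less_top\<close>)

subsection \<open>Banach space isomorphism\<close>

context coorbit_setup
begin

abbreviation coN :: "((real^'d \<Rightarrow> complex) \<Rightarrow> complex) \<Rightarrow> ennreal" where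
  "coN \<equiv> Co_norm \<mu> (inv_fourier \<eta>) p q (\<lambda>(x, h). v h)"

abbreviation decN :: "((real^'d \<Rightarrow> complex) \<Rightarrow> complex) \<Rightarrow> ennreal" where
  "decN \<equiv> dec_norm I \<phi> p q w"

abbreviation CoV :: "((real^'d \<Rightarrow> complex) \<Rightarrow> complex) set" where
  "CoV \<equiv> Co_space \<Omega> \<mu> (inv_fourier \<eta>) p q (\<lambda>(x, h). v h)"

text \<open>Bounded overlap at the identity, with \<open>K\<close> enlarged by \<open>K0\<close>: if
  \<open>\<phi> i\<close> is nonzero at a point of \<open>K0\<close>, then \<open>g i\<close>
  carries that point into \<open>K\<close> and the identity leaves it in \<open>K0\<close>.\<close>

lemma frequency_localization_finite:
  assumes K0: "compact K0" "K0 \<subseteq> \<Omega>"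
  obtains S where "finite S" "S \<subseteq> I" "\<And>i \<xi>. i \<in> I - S \<Longrightarrow> \<xi> \<in> K0 \<Longrightarrow> \<phi> i \<xi> = 0"
proof -
  have K1: "compact (K \<union> K0)" "K \<union> K0 \<subseteq> \<Omega>" using K K0 by (auto intro: compact_Un)
  let ?S = "{i \<in> I. mat 1 \<in> translate (K \<union> K0) (g i)}"
  have "finite ?S" by (rule bounded_overlap[OF spread K1]) (use group_simps(1) in blast)
  moreover have "i \<in> ?S" if "i \<in> I" "\<xi> \<in> K0" "\<phi> i \<xi> \<noteq> 0" for i \<xi>
    using return_translate[OF g[OF that(1)] group_simps(1), of \<xi> "K \<union> K0"] \<phi>_support[OF that(1,3)] that group_simps(1)
    by (simp add: translate_def transpose_mat)
  ultimately show ?thesis using that[of ?S] by blast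
qed

text \<open>Derivatives up to twice the dimension give decay of that order, which is integrable. In
  the constant, m is the volume of \<open>K0\<close> from integrating the derivatives,
  \<open>Z\<close> the integral of the decaying majorant, and the added 1 makes it positive.\<close>

lemma fourier_uniform_bound:
  assumes K0: "compact K0"
  obtains c where "0 < c" "\<And>\<theta> M. \<theta> \<in> test_funs \<Omega> \<Longrightarrow> fun_supp \<theta> \<subseteq> K0 \<Longrightarrow> 0 < M \<Longrightarrow>
      (\<And>js \<xi>. length js \<le> 2 * CARD('d) \<Longrightarrow> cmod (partials js \<theta> \<xi>) \<le> M) \<Longrightarrow>
      (\<integral>\<^sup>+x. ennreal (cmod (fourier \<theta> x)) \<partial>lborel) \<le> ennreal (c * M) \<and> (\<forall>x. cmod (fourier \<theta> x) \<le> c * M)"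
proof -
  define n where "n = 2 * CARD('d)"
  define Z where "Z = (LINT x|lborel. 1 / (1 + norm (x :: real^'d)) ^ n)"
  define m where "m = measure lborel K0"
  define D where "D = (1 + real CARD('d)) ^ n * m"
  have Z: "0 \<le> Z" unfolding Z_def by (intro integral_nonneg_AE) auto
  have D: "0 \<le> D" by (simp add: D_def m_def)
  have "(\<integral>\<^sup>+x. ennreal (cmod (fourier \<theta> x)) \<partial>lborel) \<le> ennreal ((D * (Z + 1) + 1) * M) \<and> (\<forall>x. cmod (fourier \<theta> x) \<le> (D * (Z + 1) + 1) * M)"
    if \<theta>: "\<theta> \<in> test_funs \<Omega>" "fun_supp \<theta> \<subseteq> K0" and M: "0 < M" "\<And>js \<xi>. length js \<le> 2 * CARD('d) \<Longrightarrow> cmod (partials js \<theta> \<xi>) \<le> M"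
    for \<theta> :: "real^'d \<Rightarrow> complex" and M
  proof -
    have W: "(LINT \<xi>|lborel. cmod (partials js \<theta> \<xi>)) \<le> m * M" if js: "length js \<le> n" for js
    proof -
      have "(LINT \<xi>|lborel. cmod (partials js \<theta> \<xi>)) \<le> (LINT \<xi>|lborel. M * indicator K0 \<xi>)"
      proof (rule integral_mono)
        show "integrable lborel (\<lambda>\<xi>. cmod (partials js \<theta> \<xi>))"
          by (intro integrable_norm test_funs_integrable[OF test_funs_partials(1)[OF \<theta>(1)]])
        show "integrable lborel (\<lambda>\<xi>. M * indicator K0 \<xi>)"
          using K0 emeasure_compact_finite[OF K0] by (intro integrable_mult_right integrable_real_indicator) (auto simp: borel_compact)
        show "cmod (partials js \<theta> \<xi>) \<le> M * indicator K0 \<xi>" for \<xi>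
        proof (cases "\<xi> \<in> fun_supp \<theta>")
          case False
          have "partials js \<theta> \<xi> = 0"
            by (rule partials_eq_0[OF _ test_fun_supp[OF \<theta>(1)] False]) (simp add: fun_supp_def)
          then show ?thesis using M(1) by simp
        next
          case True
          then show ?thesis using M(2)[of js \<xi>] js \<theta>(2) by (auto simp: n_def)
        qed
      qed
      also have "\<dots> = m * M" using K0 by (simp add: m_def borel_compact mult.commute)
      finally show ?thesis .
    qed
    have pt: "cmod (fourier \<theta> x) \<le> D * M * (1 / (1 + norm x) ^ n)" for x
    proof -
      have "(1 + norm (- x)) ^ n * cmod (inv_fourier \<theta> (- x)) \<le> (1 + real CARD('d)) ^ n * (m * M)"
        by (rule inv_fourier_decay[OF \<theta>(1) W])
      then have "cmod (fourier \<theta> x) * (1 + norm x) ^ n \<le> D * M"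
        by (simp add: fourier_eq_inv_fourier D_def mult_ac)
      moreover have "0 < (1 + norm x) ^ n" by (intro zero_less_power) (simp add: add_pos_nonneg)
      ultimately show ?thesis by (simp add: pos_le_divide_eq)
    qed
    have DM: "0 \<le> D * M" using D M by simp
    have c: "D * M * Z \<le> (D * (Z + 1) + 1) * M" "D * M \<le> (D * (Z + 1) + 1) * M"
      using DM Z M(1) mult_nonneg_nonneg[OF DM Z] by (auto simp: algebra_simps)
    have "(\<integral>\<^sup>+x. ennreal (cmod (fourier \<theta> x)) \<partial>lborel) \<le> (\<integral>\<^sup>+x. ennreal (D * M * (1 / (1 + norm (x :: real^'d)) ^ n)) \<partial>lborel)"
      by (intro nn_integral_mono ennreal_leI pt)
    also have "\<dots> = ennreal (D * M * Z)"
      unfolding Z_def integral_mult_right_zero[symmetric]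
    proof (rule nn_integral_eq_integral)
      show "integrable lborel (\<lambda>x :: real^'d. D * M * (1 / (1 + norm x) ^ n))"
        unfolding n_def by (rule integrable_mult_right[OF integrable_polynomial_decay])
    qed (use DM in auto)
    also have "\<dots> \<le> ennreal ((D * (Z + 1) + 1) * M)" by (rule ennreal_leI[OF c(1)])
    finally have 1: "(\<integral>\<^sup>+x. ennreal (cmod (fourier \<theta> x)) \<partial>lborel) \<le> ennreal ((D * (Z + 1) + 1) * M)" .
    have "cmod (fourier \<theta> x) \<le> (D * (Z + 1) + 1) * M" for x
    proof -
      have "1 / (1 + norm x) ^ n \<le> 1"
        using one_le_power[of "1 + norm x" n] frac_le[of 1 1 1 "(1 + norm x) ^ n"] by simp
      then have "D * M * (1 / (1 + norm x) ^ n) \<le> D * M" using mult_left_mono[OF _ DM] by fastforce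
      then show ?thesis using pt[of x] c(2) by linarith
    qed
    with 1 show ?thesis by blast
  qed
  then show ?thesis using that[of "D * (Z + 1) + 1"] D Z by (simp add: add_nonneg_pos)
qed

text \<open>Finitely many pieces determine \<open>\<Lambda>\<close> on \<open>K0\<close>, and each
  is paired with the transform of \<theta>. The order of the derivatives depends only on the
  dimension and c only on \<open>K0\<close>, not on f; this uniformity is what survives a limit of
  functionals.\<close>

lemma weak_bound:
  assumes K0: "compact K0" "K0 \<subseteq> \<Omega>"
  obtains c where "0 \<le> c" "\<And>f \<theta> M. f \<in> S_antidual \<Omega> \<Longrightarrow> \<theta> \<in> test_funs \<Omega> \<Longrightarrow> fun_supp \<theta> \<subseteq> K0 \<Longrightarrow> 0 < M \<Longrightarrow>
      (\<And>js \<xi>. length js \<le> 2 * CARD('d) \<Longrightarrow> cmod (partials js \<theta> \<xi>) \<le> M) \<Longrightarrow>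
      ennreal (cmod (antidual_hat f \<theta>)) \<le> ennreal (c * M) * decN (Gamma_map \<Omega> f)"
proof -
  obtain S where S: "finite S" "S \<subseteq> I" "\<And>i \<xi>. i \<in> I - S \<Longrightarrow> \<xi> \<in> K0 \<Longrightarrow> \<phi> i \<xi> = 0"
    by (rule frequency_localization_finite[OF K0]) blast
  obtain c where c: "0 < c" "\<And>\<theta> M. \<theta> \<in> test_funs \<Omega> \<Longrightarrow> fun_supp \<theta> \<subseteq> K0 \<Longrightarrow> 0 < M \<Longrightarrow>
      (\<And>js \<xi>. length js \<le> 2 * CARD('d) \<Longrightarrow> cmod (partials js \<theta> \<xi>) \<le> M) \<Longrightarrow>
      (\<integral>\<^sup>+x. ennreal (cmod (fourier \<theta> x)) \<partial>lborel) \<le> ennreal (c * M) \<and> (\<forall>x. cmod (fourier \<theta> x) \<le> c * M)"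
    by (rule fourier_uniform_bound[OF K0(1)]) blast
  have w: "0 < w i" if "i \<in> I" for i by (rule weight_discretization) (use that in blast)
  define R where "R = (\<Sum>i\<in>S. 1 / w i)"
  have R: "0 \<le> R" unfolding R_def using w S(2) by (intro sum_nonneg) (auto simp: less_imp_le subset_iff)
  have "ennreal (cmod (antidual_hat f \<theta>)) \<le> ennreal (c * R * M) * decN (Gamma_map \<Omega> f)"
    if f: "f \<in> S_antidual \<Omega>" and \<theta>: "\<theta> \<in> test_funs \<Omega>" "fun_supp \<theta> \<subseteq> K0" and M: "0 < M"
      "\<And>js \<xi>. length js \<le> 2 * CARD('d) \<Longrightarrow> cmod (partials js \<theta> \<xi>) \<le> M" for f \<theta> M
  proof -
    let ?N = "decN (Gamma_map \<Omega> f)"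
    have t: "(\<lambda>\<xi>. \<phi> i \<xi> * \<theta> \<xi>) \<in> test_funs \<Omega>" if "i \<in> I" for i
      by (rule test_funs_mult(1)[OF \<phi>[OF that] test_funsD(1)[OF \<theta>(1)]])
    have local: "ennreal (cmod (antidual_hat f (\<lambda>\<xi>. \<phi> i \<xi> * \<theta> \<xi>))) \<le> ennreal (c * M * (1 / w i)) * ?N" if i: "i \<in> I" for i
    proof -
      have "ennreal (w i) * distr_Lp_norm p (T f i) \<le> ?N"
        unfolding dec_norm_def by (rule Lp_norm_count_space_ge[OF q i])
      then have "ennreal (1 / w i) * (ennreal (w i) * distr_Lp_norm p (T f i)) \<le> ennreal (1 / w i) * ?N" by (rule mult_left_mono) simp
      moreover have "ennreal (1 / w i) * (ennreal (w i) * distr_Lp_norm p (T f i)) = distr_Lp_norm p (T f i)"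
        using w[OF i] by (simp flip: mult.assoc ennreal_mult)
      ultimately have d: "distr_Lp_norm p (T f i) \<le> ennreal (1 / w i) * ?N" by simp
      have "antidual_hat f (\<lambda>\<xi>. \<phi> i \<xi> * \<theta> \<xi>) = T f i (fourier \<theta>)"
        using T_eq[OF f, of i "fourier \<theta>"] t[OF i] unfolding inv_fourier_fourier[OF \<theta>(1)] by simp
      moreover have "ennreal (cmod (T f i (fourier \<theta>))) \<le> ennreal (c * M) * distr_Lp_norm p (T f i)"
        using c(2)[OF \<theta> M] c(1) M(1) fourier_integrable[OF \<theta>(1)]
        by (intro distr_Lp_norm_pairing[OF p schwartz_fourier[OF \<theta>(1)]]) auto
      moreover have "ennreal (c * M) * distr_Lp_norm p (T f i) \<le> ennreal (c * M) * (ennreal (1 / w i) * ?N)"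
        by (rule mult_left_mono[OF d]) simp
      moreover have "ennreal (c * M) * (ennreal (1 / w i) * ?N) = ennreal (c * M * (1 / w i)) * ?N"
        using c(1) M(1) w[OF i] by (subst ennreal_mult[of "c * M" "1 / w i"]) (auto simp: mult.assoc)
      ultimately show ?thesis by simp
    qed
    have "\<theta> \<xi> = (\<Sum>i\<in>S. 1 * (\<phi> i \<xi> * \<theta> \<xi>))" for \<xi>
    proof (cases "\<theta> \<xi> = 0")
      case False
      then have \<xi>: "\<xi> \<in> fun_supp \<theta>" using test_fun_supp[OF \<theta>(1)] by blast
      then have "\<xi> \<in> K0" using \<theta>(2) by blast
      then have "(\<Sum>i\<in>S. \<phi> i \<xi>) = 1"
        using K0(2) by (intro \<phi>_sum S) auto
      then show ?thesis by (simp flip: sum_distrib_right)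
    qed simp
    then have "antidual_hat f \<theta> = antidual_hat f (\<lambda>\<xi>. \<Sum>i\<in>S. 1 * (\<phi> i \<xi> * \<theta> \<xi>))" by presburger
    also have "\<dots> = (\<Sum>i\<in>S. 1 * antidual_hat f (\<lambda>\<xi>. \<phi> i \<xi> * \<theta> \<xi>))"
      using S(2) by (intro distribution_sum[OF \<Lambda>[OF f] S(1)] t) blast
    finally have "cmod (antidual_hat f \<theta>) \<le> (\<Sum>i\<in>S. cmod (antidual_hat f (\<lambda>\<xi>. \<phi> i \<xi> * \<theta> \<xi>)))"
      by (simp add: norm_sum)
    then have "ennreal (cmod (antidual_hat f \<theta>)) \<le> (\<Sum>i\<in>S. ennreal (cmod (antidual_hat f (\<lambda>\<xi>. \<phi> i \<xi> * \<theta> \<xi>))))"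
      by (simp add: sum_ennreal ennreal_leI)
    also have "\<dots> \<le> (\<Sum>i\<in>S. ennreal (c * M * (1 / w i)) * ?N)"
      using S(2) by (intro sum_mono local) blast
    also have "\<dots> = (\<Sum>i\<in>S. ennreal (c * M * (1 / w i))) * ?N" by (simp add: sum_distrib_right)
    also have "(\<Sum>i\<in>S. ennreal (c * M * (1 / w i))) = ennreal (\<Sum>i\<in>S. c * M * (1 / w i))"
      using c(1) M(1) w S(2) by (intro sum_ennreal) (auto simp: less_imp_le subset_iff)
    also have "(\<Sum>i\<in>S. c * M * (1 / w i)) = c * R * M" by (simp add: R_def sum_distrib_left mult_ac)
    finally show ?thesis .
  qed
  then show ?thesis using that[of "c * R"] c(1) R by simp
qed

lemma pointwise_bound: "\<exists>c\<ge>0. \<forall>f\<in>S_antidual \<Omega>. ennreal (cmod (f t)) \<le> ennreal c * decN (Gamma_map \<Omega> f)"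
proof (cases "t \<in> S_space \<Omega>")
  case False
  then show ?thesis by (intro exI[of _ 0]) (auto simp: S_antidual_def)
next
  case True
  then obtain b where b: "b \<in> test_funs \<Omega>" "t = inv_fourier b" by (auto simp: S_space_def)
  let ?\<theta> = "\<lambda>\<xi>. cnj (b \<xi>)"
  have \<theta>: "?\<theta> \<in> test_funs \<Omega>" by (rule test_funs_cnj(1)[OF b(1)])
  obtain c where c: "0 \<le> c" "\<And>f \<theta> M. f \<in> S_antidual \<Omega> \<Longrightarrow> \<theta> \<in> test_funs \<Omega> \<Longrightarrow> fun_supp \<theta> \<subseteq> fun_supp ?\<theta> \<Longrightarrow> 0 < M \<Longrightarrow>
      (\<And>js \<xi>. length js \<le> 2 * CARD('d) \<Longrightarrow> cmod (partials js \<theta> \<xi>) \<le> M) \<Longrightarrow>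
      ennreal (cmod (antidual_hat f \<theta>)) \<le> ennreal (c * M) * decN (Gamma_map \<Omega> f)"
    by (rule weak_bound[OF test_funsD(2,3)[OF \<theta>]]) blast
  have "\<forall>js. \<exists>B. \<forall>\<xi>. cmod (partials js ?\<theta> \<xi>) \<le> B"
    using test_funs_bounded[OF test_funs_partials(1)[OF \<theta>]] unfolding bounded_iff by auto
  then obtain B where B: "\<And>js \<xi>. cmod (partials js ?\<theta> \<xi>) \<le> B js" by metis
  let ?L = "{js :: 'd list. length js \<le> 2 * CARD('d)}"
  define M where "M = (\<Sum>js\<in>?L. B js) + 1"
  have B0: "0 \<le> B js" for js using B[of js 0] norm_ge_zero order_trans by blast
  have fin: "finite ?L" using finite_lists_length_le[of "UNIV :: 'd set"] by simp
  have M: "0 < M" unfolding M_def using sum_nonneg[of ?L B] B0 by (simp add: add_nonneg_pos)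
  have "cmod (partials js ?\<theta> \<xi>) \<le> M" if "length js \<le> 2 * CARD('d)" for js \<xi>
    using member_le_sum[of js ?L B] that B0 fin B[of js \<xi>] by (simp add: M_def)
  then have "ennreal (cmod (antidual_hat f ?\<theta>)) \<le> ennreal (c * M) * decN (Gamma_map \<Omega> f)" if "f \<in> S_antidual \<Omega>" for f
    using c(2)[OF that \<theta> order_refl M] by blast
  moreover have "antidual_hat f ?\<theta> = f t" for f by (simp add: antidual_hat_def b(2))
  ultimately show ?thesis using c(1) M by (intro exI[of _ "c * M"]) simp
qed

text \<open>A pointwise limit of continuous functionals need not be bounded by one seminorm for an
  evident reason; here the norm bound supplies the same order and constant for all members, and the
  estimate passes to the limit.\<close>

lemma antidual_limit:
  assumes F: "\<And>n. F n \<in> S_antidual \<Omega>" and lim: "\<And>t. (\<lambda>n. F n t) \<longlonglongrightarrow> f t"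
    and B: "0 \<le> B" "\<And>n. decN (Gamma_map \<Omega> (F n)) \<le> ennreal B"
  shows "f \<in> S_antidual \<Omega>"
  unfolding S_antidual_iff
proof (intro conjI ballI allI impI)
  have "test_bounded \<Omega> (antidual_hat f)"
    unfolding test_bounded_def
  proof (intro allI impI)
    fix K0 assume "compact K0 \<and> K0 \<subseteq> \<Omega>"
    then obtain c where c: "0 \<le> c" "\<And>f \<theta> M. f \<in> S_antidual \<Omega> \<Longrightarrow> \<theta> \<in> test_funs \<Omega> \<Longrightarrow> fun_supp \<theta> \<subseteq> K0 \<Longrightarrow> 0 < M \<Longrightarrow>
      (\<And>js \<xi>. length js \<le> 2 * CARD('d) \<Longrightarrow> cmod (partials js \<theta> \<xi>) \<le> M) \<Longrightarrow>
      ennreal (cmod (antidual_hat f \<theta>)) \<le> ennreal (c * M) * decN (Gamma_map \<Omega> f)"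
      using weak_bound by metis
    have "cmod (antidual_hat f \<theta>) \<le> c * B * M"
      if \<theta>: "\<theta> \<in> test_funs \<Omega>" "fun_supp \<theta> \<subseteq> K0" and M: "\<And>js \<xi>. length js \<le> 2 * CARD('d) \<Longrightarrow> cmod (partials js \<theta> \<xi>) \<le> M" for \<theta> M
    proof -
      have "cmod (antidual_hat (F n) \<theta>) \<le> c * B * M" for n
      proof (cases "0 < M")
        case True
        have "ennreal (cmod (antidual_hat (F n) \<theta>)) \<le> ennreal (c * M) * decN (Gamma_map \<Omega> (F n))" by (rule c(2)[OF F \<theta> True M])
        also have "\<dots> \<le> ennreal (c * M) * ennreal B" by (rule mult_left_mono[OF B(2)]) simp
        also have "\<dots> = ennreal (c * B * M)" using c(1) B(1) True by (simp add: mult_ac flip: ennreal_mult)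
        finally show ?thesis using c(1) B(1) True by (subst (asm) ennreal_le_iff) auto
      next
        \<comment> \<open>\<open>weak_bound\<close> needs M > 0. Otherwise M is 0, which forces
          \<theta> to vanish.\<close>
        case False
        have le: "cmod (\<theta> \<xi>) \<le> M" for \<xi> using M[of "[]" \<xi>] by simp
        have M0: "M = 0" using le[of 0] norm_ge_zero[of "\<theta> 0"] False by linarith
        then have z: "\<theta> = (\<lambda>\<xi>. 0)" using le by (simp add: fun_eq_iff)
        have "antidual_hat (F n) (\<lambda>\<xi>. 0 * \<theta> \<xi>) = 0 * antidual_hat (F n) \<theta>" by (rule distribution_cmult[OF \<Lambda>[OF F] \<theta>(1)])
        then show ?thesis by (simp add: z M0)
      qed
      moreover have "(\<lambda>n. cmod (antidual_hat (F n) \<theta>)) \<longlonglongrightarrow> cmod (antidual_hat f \<theta>)"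
        unfolding antidual_hat_def by (intro tendsto_norm lim)
      ultimately show ?thesis by (intro LIMSEQ_le_const2) auto
    qed
    then show "\<exists>n C. 0 \<le> C \<and> (\<forall>\<theta>\<in>test_funs \<Omega>. \<forall>B. fun_supp \<theta> \<subseteq> K0 \<longrightarrow>
       (\<forall>js. length js \<le> n \<longrightarrow> (\<forall>x. cmod (partials js \<theta> x) \<le> B)) \<longrightarrow> cmod (antidual_hat f \<theta>) \<le> C * B)"
      using c(1) B(1) by (intro exI[of _ "2 * CARD('d)"] exI[of _ "c * B"]) auto
  qed
  from test_bounded_cnj[OF this] show "test_bounded \<Omega> (\<lambda>\<theta>. f (inv_fourier \<theta>))"
    by (simp add: antidual_hat_def)
next
  fix s t :: "real^'d \<Rightarrow> complex" and a b :: complex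
  assume "s \<in> S_space \<Omega>" "t \<in> S_space \<Omega>"
  then have "F n (\<lambda>x. a * s x + b * t x) = cnj a * F n s + cnj b * F n t" for n
    using F[of n] unfolding S_antidual_def by blast
  then have "(\<lambda>n. F n (\<lambda>x. a * s x + b * t x)) \<longlonglongrightarrow> cnj a * f s + cnj b * f t"
    by (auto intro!: tendsto_intros lim)
  then show "f (\<lambda>x. a * s x + b * t x) = cnj a * f s + cnj b * f t"
    using lim LIMSEQ_unique by blast
next
  fix t assume "t \<notin> S_space \<Omega>"
  then have "F n t = 0" for n using F[of n] by (simp add: S_antidual_def)
  then show "f t = 0" using lim[of t] by (simp add: LIMSEQ_const_iff)
qed

text \<open>Fatou's lemma twice, in x for fixed h and then in h. The wavelet transforms converge
  pointwise because each value is an evaluation of the functional at one vector.\<close>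

lemma Co_norm_limit:
  assumes F: "\<And>n. F n \<in> S_antidual \<Omega>" and f: "f \<in> S_antidual \<Omega>" and lim: "\<And>t. (\<lambda>n. F n t) \<longlonglongrightarrow> f t"
    and B: "\<And>n. coN (F n) \<le> B"
  shows "coN f \<le> B"
proof -
  have WF_lim: "WF f h \<le> liminf (\<lambda>n. WF (F n) h)" if h: "h \<in> H" for h
  proof -
    let ?W = "\<lambda>f x. ennreal (cmod (of_real (v h) * wavelet (inv_fourier \<eta>) f (x, h)))"
    have "(\<lambda>n. ?W (F n) x) \<longlonglongrightarrow> ?W f x" for x
      unfolding wavelet_def by (intro tendsto_ennrealI tendsto_norm tendsto_mult tendsto_const lim)
    then have "?W f x = liminf (\<lambda>n. ?W (F n) x)" for x by (intro lim_imp_Liminf[symmetric]) auto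
    then have "WF f h = Lp_norm lborel p (\<lambda>x. liminf (\<lambda>n. ?W (F n) x))" unfolding WF_def[OF f] by presburger
    also have "\<dots> \<le> liminf (\<lambda>n. Lp_norm lborel p (?W (F n)))"
      using wavelet_section_measurable[OF F h] by (intro Lp_norm_Fatou[OF p]) measurable
    finally show ?thesis by (simp add: WF_def[OF F])
  qed
  have "coN f \<le> Lp_norm haar_det q (\<lambda>h. liminf (\<lambda>n. WF (F n) h))"
    unfolding Co_norm_eq[OF f] using WF_measurable[OF f] WF_lim by (intro Lp_norm_mono[OF q]) (auto simp: space_mu)
  also have "\<dots> \<le> liminf (\<lambda>n. Lp_norm haar_det q (WF (F n)))"
    using WF_measurable[OF F] by (intro Lp_norm_Fatou[OF q]) simp
  also have "\<dots> \<le> liminf (\<lambda>n :: nat. B)"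
    using B by (intro Liminf_mono always_eventually allI) (simp add: Co_norm_eq[OF F])
  finally show ?thesis by (simp add: Liminf_const)
qed

lemma Co_norm_add:
  assumes f: "f \<in> S_antidual \<Omega>" and f': "f' \<in> S_antidual \<Omega>"
  shows "coN (\<lambda>t. f t + f' t) \<le> coN f + coN f'"
proof -
  have s: "(\<lambda>t. f t + f' t) \<in> S_antidual \<Omega>" using S_antidual_linear[OF f f', of 1 1] by simp
  have le: "WF (\<lambda>t. f t + f' t) h \<le> WF f h + WF f' h" if h: "h \<in> H" for h
  proof -
    let ?W = "\<lambda>f x. of_real (v h) * wavelet (inv_fourier \<eta>) f (x, h)"
    note [measurable] = wavelet_section_measurable[OF f h] wavelet_section_measurable[OF f' h] wavelet_section_measurable[OF s h]
    have "ennreal (cmod (?W (\<lambda>t. f t + f' t) x)) \<le> ennreal (cmod (?W f x)) + ennreal (cmod (?W f' x))" for x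
      using norm_triangle_ineq[of "?W f x" "?W f' x"]
      by (simp add: wavelet_def distrib_left ennreal_leI flip: ennreal_plus)
    then have "WF (\<lambda>t. f t + f' t) h \<le> Lp_norm lborel p (\<lambda>x. ennreal (cmod (?W f x)) + ennreal (cmod (?W f' x)))"
      unfolding WF_def[OF s] by (intro Lp_norm_mono[OF p]) auto
    also have "\<dots> \<le> WF f h + WF f' h"
      unfolding WF_def[OF f] WF_def[OF f'] by (rule Lp_norm_add[OF sigma_finite_lborel p]) measurable
    finally show ?thesis .
  qed
  note [measurable] = WF_measurable[OF f] WF_measurable[OF f'] WF_measurable[OF s]
  interpret D: sigma_finite_measure haar_det
    by (subst sigma_finite_iff_density_finite) auto
  have "coN (\<lambda>t. f t + f' t) \<le> Lp_norm haar_det q (\<lambda>h. WF f h + WF f' h)"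
    unfolding Co_norm_eq[OF s] using le by (intro Lp_norm_mono[OF q]) (auto simp: space_mu)
  also have "\<dots> \<le> coN f + coN f'"
    unfolding Co_norm_eq[OF f] Co_norm_eq[OF f'] by (rule Lp_norm_add[OF D.sigma_finite_measure_axioms q]) auto
  finally show ?thesis .
qed

lemma Co_norm_cmult:
  assumes f: "f \<in> S_antidual \<Omega>"
  shows "coN (\<lambda>t. a * f t) = ennreal (cmod a) * coN f"
proof -
  have s: "(\<lambda>t. a * f t) \<in> S_antidual \<Omega>" using S_antidual_linear[OF f f, of a 0] by simp
  have WF: "WF (\<lambda>t. a * f t) h = ennreal (cmod a) * WF f h" if h: "h \<in> H" for h
  proof -
    note [measurable] = wavelet_section_measurable[OF f h]
    have "ennreal (cmod (of_real (v h) * wavelet (inv_fourier \<eta>) (\<lambda>t. a * f t) (x, h)))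
        = ennreal (cmod a) * ennreal (cmod (of_real (v h) * wavelet (inv_fourier \<eta>) f (x, h)))" for x
      by (simp add: wavelet_def norm_mult mult_ac flip: ennreal_mult)
    then show ?thesis
      unfolding WF_def[OF s] WF_def[OF f] by (simp add: Lp_norm_cmult[OF p])
  qed
  note [measurable] = WF_measurable[OF f] WF_measurable[OF s]
  have "coN (\<lambda>t. a * f t) = Lp_norm haar_det q (\<lambda>h. ennreal (cmod a) * WF f h)"
    unfolding Co_norm_eq[OF s] using WF
    by (intro antisym Lp_norm_mono[OF q]) (auto simp: space_mu)
  also have "\<dots> = ennreal (cmod a) * coN f"
    unfolding Co_norm_eq[OF f] by (rule Lp_norm_cmult[OF q]) auto
  finally show ?thesis .
qed

lemma Co_norm_neg: "coN (\<lambda>t. - f t) = coN f"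
  by (simp add: Co_norm_def Lpq_norm_def wavelet_def)

lemma Co_space_iff: "f \<in> CoV \<longleftrightarrow> f \<in> S_antidual \<Omega> \<and> coN f < \<infinity>"
  unfolding Co_space_def using wavelet_measurable by auto

lemma norm_equivalence:
  obtains A B where "0 < A" "0 < B" "\<And>f. f \<in> S_antidual \<Omega> \<Longrightarrow> coN f \<le> ennreal A * decN (Gamma_map \<Omega> f)"
    "\<And>f. f \<in> S_antidual \<Omega> \<Longrightarrow> decN (Gamma_map \<Omega> f) \<le> ennreal B * coN f"
proof -
  obtain A where A: "0 \<le> A" "\<And>f. f \<in> S_antidual \<Omega> \<Longrightarrow> coN f \<le> ennreal A * decN (Gamma_map \<Omega> f)"
    by (rule Co_norm_le) blast
  obtain B where B: "0 \<le> B" "\<And>f. f \<in> S_antidual \<Omega> \<Longrightarrow> decN (Gamma_map \<Omega> f) \<le> ennreal B * coN f"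
    by (rule dec_norm_le) blast
  \<comment> \<open>The constants obtained so far may be 0, while an equivalence of norms asks for
    positive ones.\<close>
  have "ennreal A * x \<le> ennreal (A + 1) * x" "ennreal B * x \<le> ennreal (B + 1) * x" for x
    by (intro mult_right_mono ennreal_leI; simp)+
  then show ?thesis using that[of "A + 1" "B + 1"] A B by (meson add_nonneg_pos order_trans zero_less_one)
qed

lemma complex_banach_Co: "complex_banach CoV coN"
proof -
  obtain A B where AB: "0 < A" "0 < B" "\<And>f. f \<in> S_antidual \<Omega> \<Longrightarrow> coN f \<le> ennreal A * decN (Gamma_map \<Omega> f)"
    "\<And>f. f \<in> S_antidual \<Omega> \<Longrightarrow> decN (Gamma_map \<Omega> f) \<le> ennreal B * coN f"
    by (rule norm_equivalence) blast
  show ?thesis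
  proof (rule complex_banachI)
    show "(\<lambda>_. 0) \<in> CoV"
      using Co_norm_cmult[OF S_antidual_0, of 0] S_antidual_0 by (simp add: Co_space_iff)
    show "(\<lambda>t. a * f t + b * g t) \<in> CoV" if "f \<in> CoV" "g \<in> CoV" for f g a b
    proof -
      have f: "f \<in> S_antidual \<Omega>" "coN f < \<infinity>" and g: "g \<in> S_antidual \<Omega>" "coN g < \<infinity>"
        using that by (auto simp: Co_space_iff)
      have "(\<lambda>t. a * f t) \<in> S_antidual \<Omega>" "(\<lambda>t. b * g t) \<in> S_antidual \<Omega>"
        using S_antidual_linear[OF f(1) f(1), of a 0] S_antidual_linear[OF g(1) g(1), of b 0] by simp_all
      from linear_combination_finite[of coN, OF Co_norm_add[OF this] Co_norm_cmult[OF f(1)] Co_norm_cmult[OF g(1)] f(2) g(2)]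
      show ?thesis using S_antidual_linear[OF f(1) g(1)] by (simp add: Co_space_iff)
    qed
    show "coN f < \<infinity>" if "f \<in> CoV" for f using that by (simp add: Co_space_iff)
    show "coN (\<lambda>t. a * f t) = ennreal (cmod a) * coN f" if "f \<in> CoV" for f a
      using that by (intro Co_norm_cmult) (simp add: Co_space_iff)
    show "coN (\<lambda>t. - f t) = coN f" for f by (rule Co_norm_neg)
    show "coN (\<lambda>t. f t + g t) \<le> coN f + coN g" if "f \<in> CoV" "g \<in> CoV" for f g
      using that by (intro Co_norm_add) (simp_all add: Co_space_iff)
    show "\<exists>c\<ge>0. \<forall>f\<in>CoV. ennreal (cmod (f t)) \<le> ennreal c * coN f" for t
    proof -
      obtain c where c: "0 \<le> c" "\<forall>f\<in>S_antidual \<Omega>. ennreal (cmod (f t)) \<le> ennreal c * decN (Gamma_map \<Omega> f)"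
        using pointwise_bound by blast
      have "ennreal (cmod (f t)) \<le> ennreal (c * B) * coN f" if "f \<in> CoV" for f
      proof -
        have f: "f \<in> S_antidual \<Omega>" using that by (simp add: Co_space_iff)
        have "ennreal (cmod (f t)) \<le> ennreal c * decN (Gamma_map \<Omega> f)" using c(2) f by blast
        also have "\<dots> \<le> ennreal c * (ennreal B * coN f)" by (rule mult_left_mono[OF AB(4)[OF f]]) simp
        also have "\<dots> = ennreal (c * B) * coN f" using c(1) AB(2) by (simp add: ennreal_mult mult.assoc)
        finally show ?thesis .
      qed
      then show ?thesis using c(1) AB(2) by (intro exI[of _ "c * B"]) simp
    qed
    show "0 \<le> (1 :: real)" by simp
    fix F f R assume F: "\<And>n. F n \<in> CoV" and lim: "\<And>t. (\<lambda>n. F n t) \<longlonglongrightarrow> f t" and R: "0 \<le> R" "\<And>n. coN (F n) \<le> ennreal R"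
    have FS: "F n \<in> S_antidual \<Omega>" for n using F by (simp add: Co_space_iff)
    have "decN (Gamma_map \<Omega> (F n)) \<le> ennreal (B * R)" for n
    proof -
      have "decN (Gamma_map \<Omega> (F n)) \<le> ennreal B * coN (F n)" by (rule AB(4)[OF FS])
      also have "\<dots> \<le> ennreal B * ennreal R" by (rule mult_left_mono[OF R(2)]) simp
      finally show ?thesis using AB(2) R(1) by (simp add: ennreal_mult)
    qed
    then have f: "f \<in> S_antidual \<Omega>" using AB(2) R(1) by (intro antidual_limit[OF FS lim, of "B * R"]) auto
    have "coN f \<le> ennreal R" by (rule Co_norm_limit[OF FS f lim R(2)])
    moreover from this have "coN f < \<infinity>" by (rule le_less_trans) simp
    ultimately show "f \<in> CoV \<and> coN f \<le> ennreal (1 * R)" using f by (simp add: Co_space_iff)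
  qed
qed

abbreviation DecV :: "((real^'d \<Rightarrow> complex) \<Rightarrow> complex) set" where
  "DecV \<equiv> dec_space \<Omega> I \<phi> p q w"

lemma bij_betw_Co_dec: "bij_betw (Gamma_map \<Omega>) CoV DecV"
proof (rule bij_betw_subset[OF bij_betw_Gamma_map[of \<Omega>]])
  obtain A B where AB: "0 < A" "0 < B" "\<And>f. f \<in> S_antidual \<Omega> \<Longrightarrow> coN f \<le> ennreal A * decN (Gamma_map \<Omega> f)"
    "\<And>f. f \<in> S_antidual \<Omega> \<Longrightarrow> decN (Gamma_map \<Omega> f) \<le> ennreal B * coN f"
    by (rule norm_equivalence) blast
  show "CoV \<subseteq> S_antidual \<Omega>" by (auto simp: Co_space_iff)
  have iff: "decN (Gamma_map \<Omega> f) < \<infinity> \<longleftrightarrow> coN f < \<infinity>" if "f \<in> S_antidual \<Omega>" for f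
    using le_less_trans[OF AB(3)[OF that], of \<infinity>] le_less_trans[OF AB(4)[OF that], of \<infinity>]
    by (auto simp: ennreal_mult_less_top)
  show "Gamma_map \<Omega> ` CoV = DecV"
  proof (intro equalityI subsetI)
    fix z assume "z \<in> Gamma_map \<Omega> ` CoV"
    then show "z \<in> DecV" using iff Gamma_map_in_Z_dual by (auto simp: Co_space_iff dec_space_def)
  next
    fix z assume "z \<in> DecV"
    then have z: "z \<in> Z_dual \<Omega>" "decN z < \<infinity>" by (auto simp: dec_space_def)
    then obtain f where "f \<in> S_antidual \<Omega>" "z = Gamma_map \<Omega> f"
      using bij_betw_imp_surj_on[OF bij_betw_Gamma_map[of \<Omega>]] by blast
    then show "z \<in> Gamma_map \<Omega> ` CoV" using z(2) iff by (auto simp: Co_space_iff)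
  qed
qed

text \<open>Limits are pulled back through \<Gamma>, where \<open>antidual_limit\<close> and
  \<open>Co_norm_limit\<close> apply. Going to the coorbit norm and back costs the constant
  \<open>B * A\<close>.\<close>

lemma complex_banach_dec: "complex_banach DecV decN"
proof -
  obtain A B where AB: "0 < A" "0 < B" "\<And>f. f \<in> S_antidual \<Omega> \<Longrightarrow> coN f \<le> ennreal A * decN (Gamma_map \<Omega> f)"
    "\<And>f. f \<in> S_antidual \<Omega> \<Longrightarrow> decN (Gamma_map \<Omega> f) \<le> ennreal B * coN f"
    by (rule norm_equivalence) blast
  have image: "Gamma_map \<Omega> ` CoV = DecV" by (rule bij_betw_imp_surj_on[OF bij_betw_Co_dec])
  have Co: "(\<lambda>_. 0) \<in> CoV" "\<And>f g a b. f \<in> CoV \<Longrightarrow> g \<in> CoV \<Longrightarrow> (\<lambda>t. a * f t + b * g t) \<in> CoV"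
    using complex_banach_Co unfolding complex_banach_def by blast+
  have CoS: "f \<in> S_antidual \<Omega>" if "f \<in> CoV" for f using that by (simp add: Co_space_iff)
  show ?thesis
  proof (rule complex_banachI)
    have "Gamma_map \<Omega> (\<lambda>_. 0) = (\<lambda>_. 0)" by (auto simp: Gamma_map_def)
    then show "(\<lambda>_. 0) \<in> DecV" using Co(1) image by (metis imageI)
    show "(\<lambda>t. a * f t + b * g t) \<in> DecV" if fg: "f \<in> DecV" "g \<in> DecV" for f g a b
    proof -
      obtain f' g' where "f' \<in> CoV" "f = Gamma_map \<Omega> f'" "g' \<in> CoV" "g = Gamma_map \<Omega> g'"
        using fg unfolding image[symmetric] by blast
      then show ?thesis
        using Co(2)[of f' g' a b] unfolding image[symmetric] by (simp add: Gamma_map_linear[symmetric])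
    qed
    show "decN f < \<infinity>" if "f \<in> DecV" for f using that by (simp add: dec_space_def)
    show "decN (\<lambda>t. a * f t) = ennreal (cmod a) * decN f" for f a by (rule dec_norm_cmult[OF p q])
    show "decN (\<lambda>t. - f t) = decN f" for f using dec_norm_cmult[OF p q, of I \<phi> w "-1" f] by simp
    show "decN (\<lambda>t. f t + g t) \<le> decN f + decN g" for f g by (rule dec_norm_add[OF p q countable_I])
    show "\<exists>c\<ge>0. \<forall>f\<in>DecV. ennreal (cmod (f t)) \<le> ennreal c * decN f" for t
    proof -
      obtain c where c: "0 \<le> c" "\<forall>f\<in>S_antidual \<Omega>. ennreal (cmod (f (\<lambda>x. cnj (t x)))) \<le> ennreal c * decN (Gamma_map \<Omega> f)"
        using pointwise_bound by blast
      have "ennreal (cmod (f t)) \<le> ennreal c * decN f" if f: "f \<in> DecV" for f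
      proof -
        obtain f' where "f' \<in> CoV" "f = Gamma_map \<Omega> f'" using f unfolding image[symmetric] by blast
        then show ?thesis using c(2) CoS by (simp add: Gamma_map_def)
      qed
      then show ?thesis using c(1) by blast
    qed
    show "0 \<le> B * A" using AB by simp
    fix F f R assume F: "\<And>n. F n \<in> DecV" and lim: "\<And>t. (\<lambda>n. F n t) \<longlonglongrightarrow> f t" and R: "0 \<le> R" "\<And>n. decN (F n) \<le> ennreal R"
    have "\<forall>n. \<exists>G. G \<in> CoV \<and> F n = Gamma_map \<Omega> G" using F unfolding image[symmetric] by blast
    then obtain G where G: "\<And>n. G n \<in> CoV" "\<And>n. F n = Gamma_map \<Omega> (G n)" by metis
    have GS: "G n \<in> S_antidual \<Omega>" for n using G(1) CoS by blast
    \<comment> \<open>The preimage of f under \<Gamma>, written out explicitly because f is not yet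
      known to lie in the dual space.\<close>
    define f' where "f' t = (if t \<in> S_space \<Omega> then f (\<lambda>x. cnj (t x)) else 0)" for t
    have lim': "(\<lambda>n. G n t) \<longlonglongrightarrow> f' t" for t
    proof (cases "t \<in> S_space \<Omega>")
      case True
      then have "(\<lambda>x. cnj (t x)) \<in> Z_space \<Omega>" using S_space_cnj_iff[of "\<lambda>x. cnj (t x)" \<Omega>] by simp
      then have "F n (\<lambda>x. cnj (t x)) = G n t" for n by (simp add: G(2) Gamma_map_def)
      then show ?thesis using lim[of "\<lambda>x. cnj (t x)"] True by (simp add: f'_def)
    next
      case False
      then have "G n t = 0" for n using GS[of n] by (simp add: S_antidual_def)
      then show ?thesis using False by (simp add: f'_def)
    qed
    have f': "f' \<in> S_antidual \<Omega>" using R G(2) by (intro antidual_limit[OF GS lim', of R]) auto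
    have "coN (G n) \<le> ennreal (A * R)" for n
    proof -
      have "coN (G n) \<le> ennreal A * decN (F n)" unfolding G(2) by (rule AB(3)[OF GS])
      also have "\<dots> \<le> ennreal A * ennreal R" by (rule mult_left_mono[OF R(2)]) simp
      finally show ?thesis using AB(1) R(1) by (simp add: ennreal_mult)
    qed
    then have le: "coN f' \<le> ennreal (A * R)" by (rule Co_norm_limit[OF GS f' lim'])
    then have "coN f' < \<infinity>" by (rule le_less_trans) simp
    then have "f' \<in> CoV" using f' by (simp add: Co_space_iff)
    moreover have "f = Gamma_map \<Omega> f'"
    proof
      fix t
      show "f t = Gamma_map \<Omega> f' t"
      proof (cases "t \<in> Z_space \<Omega>")
        case True
        then show ?thesis by (simp add: Gamma_map_def f'_def S_space_cnj_iff)
      next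
        case False
        then have "F n t = 0" for n by (simp add: G(2) Gamma_map_def)
        then show ?thesis using lim[of t] False by (simp add: LIMSEQ_const_iff Gamma_map_def)
      qed
    qed
    moreover have "decN (Gamma_map \<Omega> f') \<le> ennreal (B * A * R)"
    proof -
      have "decN (Gamma_map \<Omega> f') \<le> ennreal B * coN f'" by (rule AB(4)[OF f'])
      also have "\<dots> \<le> ennreal B * ennreal (A * R)" by (rule mult_left_mono[OF le]) simp
      finally show ?thesis using AB R(1) by (simp add: mult.assoc flip: ennreal_mult)
    qed
    ultimately show "f \<in> DecV \<and> decN f \<le> ennreal (B * A * R)" using image by blast
  qed
qed

lemma coorbit_decomposition:
  "(\<exists>A>0. \<exists>B>0. \<forall>f\<in>S_antidual \<Omega>. ennreal A * decN (Gamma_map \<Omega> f) \<le> coN f \<and> coN f \<le> ennreal B * decN (Gamma_map \<Omega> f)) \<and>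
   banach_isomorphism (Gamma_map \<Omega>) CoV coN DecV decN"
proof -
  obtain A B where AB: "0 < A" "0 < B" "\<And>f. f \<in> S_antidual \<Omega> \<Longrightarrow> coN f \<le> ennreal A * decN (Gamma_map \<Omega> f)"
    "\<And>f. f \<in> S_antidual \<Omega> \<Longrightarrow> decN (Gamma_map \<Omega> f) \<le> ennreal B * coN f"
    by (rule norm_equivalence) blast
  have 1: "\<exists>A>0. \<exists>B>0. \<forall>f\<in>S_antidual \<Omega>. ennreal A * decN (Gamma_map \<Omega> f) \<le> coN f \<and> coN f \<le> ennreal B * decN (Gamma_map \<Omega> f)"
    using AB by (intro exI[of _ "1 / B"] exI[of _ A] conjI ballI ennreal_le_swap[OF AB(2)]) auto
  have "\<exists>A>0. \<exists>B>0. \<forall>f\<in>CoV. ennreal A * coN f \<le> decN (Gamma_map \<Omega> f) \<and> decN (Gamma_map \<Omega> f) \<le> ennreal B * coN f"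
    using AB by (intro exI[of _ "1 / A"] exI[of _ B] conjI ballI ennreal_le_swap[OF AB(1)]) (auto simp: Co_space_iff)
  then have "banach_isomorphism (Gamma_map \<Omega>) CoV coN DecV decN"
    unfolding banach_isomorphism_def using complex_banach_Co complex_banach_dec bij_betw_Co_dec Gamma_map_linear by blast
  with 1 show ?thesis by blast
qed

end

theorem theorem5p5:
  fixes H :: "(real^'d^'d) set" and \<mu> :: "(real^'d^'d) measure"
    and \<Omega> C Q :: "(real^'d) set"
    and I :: "'i set" and h :: "'i \<Rightarrow> real^'d^'d" and \<phi> :: "'i \<Rightarrow> real^'d \<Rightarrow> complex"
    and p q :: ennreal
    and v :: "real^'d^'d \<Rightarrow> real" and u :: "real^'d \<Rightarrow> real" and w :: "'i \<Rightarrow> real"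
    and \<psi> :: "real^'d \<Rightarrow> complex"
  assumes "closed_subgroup_GL H"
    and "left_haar_measure H \<mu>"
    and "integrably_admissible H \<Omega>"
    and "compact_generator H \<Omega> C"
    and "induced_cover H \<Omega> I h Q"
    and "BAPU \<Omega> I (cover_set h Q) \<phi>"
    and "1 \<le> p" and "1 \<le> q"
    and "admissible_weight H (\<lambda>(x, h). v h)"
    and "pull_back H \<Omega> C (\<lambda>h. \<bar>det h\<bar> powr (1 / 2 - enn2real (1 / q)) * v h) u"
    and "discretization I (cover_set h Q) u w"
    and "\<psi> \<in> S_space \<Omega>" and "admissible_vector \<mu> \<psi>"
  shows "(\<exists>A>0. \<exists>B>0. \<forall>f\<in>S_antidual \<Omega>.
            ennreal A * dec_norm I \<phi> p q w (Gamma_map \<Omega> f)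
              \<le> Co_norm \<mu> \<psi> p q (\<lambda>(x, h). v h) f \<and>
            Co_norm \<mu> \<psi> p q (\<lambda>(x, h). v h) f
              \<le> ennreal B * dec_norm I \<phi> p q w (Gamma_map \<Omega> f)) \<and>
         banach_isomorphism (Gamma_map \<Omega>)
           (Co_space \<Omega> \<mu> \<psi> p q (\<lambda>(x, h). v h)) (Co_norm \<mu> \<psi> p q (\<lambda>(x, h). v h))
           (dec_space \<Omega> I \<phi> p q w) (dec_norm I \<phi> p q w)"
proof -
  obtain b where b: "b \<in> test_funs \<Omega>" "\<psi> = inv_fourier b"
    using assms(12) by (auto simp: S_space_def)
  interpret coorbit_setup H \<mu> \<Omega> C Q I h \<phi> p q v u w b
    by unfold_locales (use assms b in blast)+
  show ?thesis unfolding b(2) by (rule coorbit_decomposition)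
qed

end
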